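(* Let $n\ge 3$. Any Hamiltonian stationary Lagrangian submanifold of $\mathbb{R}^{2n}\simeq\mathbb{C}^n$ foliated by round $(n-1)$-spheres must be centered.
   Context: All objects are smooth. $\mathbb{C}^n\simeq\mathbb{R}^{2n}$ has coordinates $z_j=x_j+iy_j$, the Euclidean metric and the symplectic form $\omega=\sum_{j=1}^n dx_j\wedge dy_j$. A submanifold is Lagrangian if it has real dimension $n$ and $\omega$ vanishes on its tangent spaces. $\mathbb{R}^n=\{y_1=\dots=y_n=0\}\subset\mathbb{C}^n$, and $\mathbb{S}^{n-1}$ is the unit sphere of this $\mathbb{R}^n$. An $n$-dimensional submanifold of $\mathbb{R}^{2n}$ is foliated by round $(n-1)$-spheres if it can be locally parametrized by immersions $(s,x)\in I\times\mathbb{S}^{n-1}\mapsto r(s)M(s)x+V(s)$, with $I$ an interval, $r(s)>0$, $M(s)\in SO(2n)$, $V(s)\in\mathbb{C}^n$ depending smoothly on $s$. The Lagrangian angle $\beta$ of a Lagrangian submanifold is the (locally defined up to an additive constant) $\mathbb{R}/2\pi\mathbb{Z}$-valued function given by $e^{i\beta}=\det_{\mathbb{C}}(e_1,\dots,e_n)$ for an orthonormal basis $(e_1,\dots,e_n)$ of the tangent space. A Lagrangian submanifold is Hamiltonian stationary if it is critical for volume under Hamiltonian deformations, equivalently if $\Delta\beta=0$, where $\Delta$ is the Laplacian of the induced metric. Centered means: up to a congruence $z\mapsto Uz+c$ with $U\in U(n)$, $c\in\mathbb{C}^n$, the submanifold is locally an open subset of the image of an immersion $(s,x)\in I\times\mathbb{S}^{n-1}\mapsto\gamma(s)x$,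 where $\gamma:I\to\mathbb{C}\setminus\{0\}$ is a planar curve (such a full image is invariant under the standard action $z\mapsto Az$, $A\in SO(n)\subset U(n)$); the totally geodesic case (open subsets of affine Lagrangian $n$-planes) is regarded as centered. *)

theory Defs
  imports "HOL-Analysis.Analysis"
begin

text \<open>
  Throughout, \<open>\<complex>\<^sup>n\<close> is \<^typ>\<open>complex^'n\<close> with \<open>n = CARD('n)\<close>; its library inner product is the
  Euclidean one of \<open>\<real>\<^sup>2\<^sup>n\<close>, and \<^const>\<open>span\<close>, \<^const>\<open>subspace\<close>, \<^const>\<open>dim\<close> and
  derivatives are the real ones.
\<close>


subsection \<open>Smooth maps and embedded submanifolds\<close>

text \<open>Both notions are meant for open domains only.\<close>

primrec Ck_on :: "nat \<Rightarrow> 'a::euclidean_space set \<Rightarrow> ('a \<Rightarrow> 'b::real_normed_vector) \<Rightarrow> bool" where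
  "Ck_on 0 S f \<longleftrightarrow> continuous_on S f"
| "Ck_on (Suc k) S f \<longleftrightarrow> (\<forall>x\<in>S. f differentiable (at x)) \<and>
     (\<forall>v. Ck_on k S (\<lambda>x. frechet_derivative f (at x) v))"

definition smooth_on :: "'a::euclidean_space set \<Rightarrow> ('a \<Rightarrow> 'b::real_normed_vector) \<Rightarrow> bool" where
  "smooth_on S f \<longleftrightarrow> (\<forall>k. Ck_on k S f)"

definition local_parametrization ::
    "(complex^'n) set \<Rightarrow> (real^'n) set \<Rightarrow> (real^'n \<Rightarrow> complex^'n) \<Rightarrow> bool" where
  "local_parametrization M D X \<longleftrightarrow>
     open D \<and> smooth_on D X \<and> (\<forall>u\<in>D. inj (frechet_derivative X (at u))) \<and>
     openin (top_of_set M) (X ` D) \<and> (\<exists>Y. homeomorphism D (X ` D) X Y)"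

text \<open>Submanifolds are embedded, without boundary, and of real dimension \<open>n\<close>.\<close>

definition submanifold :: "(complex^'n) set \<Rightarrow> bool" where
  "submanifold M \<longleftrightarrow> (\<forall>p\<in>M. \<exists>D X. local_parametrization M D X \<and> p \<in> X ` D)"

text \<open>All local parametrizations around \<open>p\<close> contribute the same \<open>n\<close>-dimensional subspace.\<close>

definition tangent_space :: "(complex^'n) set \<Rightarrow> complex^'n \<Rightarrow> (complex^'n) set" where
  "tangent_space M p =
     {frechet_derivative X (at u) v | D X u v. local_parametrization M D X \<and> u \<in> D \<and> X u = p}"


subsection \<open>Lagrangian submanifolds\<close>

definition symplectic_form :: "complex^'n \<Rightarrow> complex^'n \<Rightarrow> real" where
  "symplectic_form v w = (\<Sum>j\<in>UNIV. Re (v $ j) * Im (w $ j) - Re (w $ j) * Im (v $ j))"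

definition lagrangian :: "(complex^'n) set \<Rightarrow> bool" where
  "lagrangian M \<longleftrightarrow> submanifold M \<and>
     (\<forall>p\<in>M. \<forall>v\<in>tangent_space M p. \<forall>w\<in>tangent_space M p. symplectic_form v w = 0)"

definition orthonormal_basis_of :: "(complex^'n) set \<Rightarrow> ('n \<Rightarrow> complex^'n) \<Rightarrow> bool" where
  "orthonormal_basis_of T e \<longleftrightarrow>
     (\<forall>i j. e i \<bullet> e j = (if i = j then 1 else 0)) \<and> span (range e) = T"

text \<open>
  A real-valued determination of the Lagrangian angle on the part \<open>N\<close> of \<open>M\<close>. The determinant
  depends on the orthonormal basis up to sign; for continuous \<open>\<beta>\<close> this leaves only a locally
  constant ambiguity in \<open>\<pi>\<int>\<close>.
\<close>

definition lagrangian_angle_on ::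
    "(complex^'n) set \<Rightarrow> (complex^'n) set \<Rightarrow> (complex^'n \<Rightarrow> real) \<Rightarrow> bool" where
  "lagrangian_angle_on M N \<beta> \<longleftrightarrow>
     (\<forall>p\<in>N. \<exists>e. orthonormal_basis_of (tangent_space M p) e \<and>
        exp (\<i> * complex_of_real (\<beta> p)) = det (\<chi> i j. e j $ i))"


subsection \<open>Hamiltonian stationary submanifolds\<close>

definition partial_derivative :: "'n \<Rightarrow> (real^'n \<Rightarrow> 'b::real_normed_vector) \<Rightarrow> real^'n \<Rightarrow> 'b" where
  "partial_derivative i f u = frechet_derivative f (at u) (axis i 1)"

definition induced_metric :: "(real^'n \<Rightarrow> complex^'n) \<Rightarrow> real^'n \<Rightarrow> real^'n^'n" where
  "induced_metric X u = (\<chi> i j. partial_derivative i X u \<bullet> partial_derivative j X u)"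

definition laplace_beltrami ::
    "(real^'n \<Rightarrow> real^'n^'n) \<Rightarrow> (real^'n \<Rightarrow> real) \<Rightarrow> real^'n \<Rightarrow> real" where
  "laplace_beltrami g f u = (1 / sqrt (det (g u))) *
     (\<Sum>i\<in>UNIV. partial_derivative i
        (\<lambda>u'. \<Sum>j\<in>UNIV. sqrt (det (g u')) * matrix_inv (g u') $ i $ j * partial_derivative j f u') u)"

text \<open>
  Harmonicity of the Lagrangian angle. It is independent of the local parametrization and of the
  determination \<open>\<beta>\<close>, and a smooth \<open>\<beta>\<close> exists near every point of a Lagrangian submanifold.
\<close>

definition hamiltonian_stationary :: "(complex^'n) set \<Rightarrow> bool" where
  "hamiltonian_stationary M \<longleftrightarrow> lagrangian M \<and>
     (\<forall>p\<in>M. \<exists>D X \<beta>. local_parametrization M D X \<and> p \<in> X ` D \<and>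
        lagrangian_angle_on M (X ` D) \<beta> \<and> smooth_on D (\<beta> \<circ> X) \<and>
        (\<forall>u\<in>D. laplace_beltrami (induced_metric X) (\<beta> \<circ> X) u = 0))"


subsection \<open>Foliations by round spheres\<close>

definition real_vec :: "real^'n \<Rightarrow> complex^'n" where
  "real_vec x = (\<chi> j. complex_of_real (x $ j))"

definition to_R2n :: "complex^'n \<Rightarrow> real^('n + 'n)" where
  "to_R2n z = (\<chi> k. case k of Inl j \<Rightarrow> Re (z $ j) | Inr j \<Rightarrow> Im (z $ j))"

definition of_R2n :: "real^('n + 'n) \<Rightarrow> complex^'n" where
  "of_R2n v = (\<chi> j. Complex (v $ Inl j) (v $ Inr j))"

text \<open>
  The differential of a map on \<open>I \<times> S\<^sup>n\<^sup>-\<^sup>1\<close> is that of its extension to \<open>I \<times> \<real>\<^sup>n\<close>, restricted to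
  the tangent space \<open>\<real> \<times> x\<^sup>\<bottom>\<close>. The maps \<open>F\<close> below are linear or affine in \<open>x\<close>, with smooth
  coefficients.
\<close>

definition immersion_on_cylinder ::
    "real set \<Rightarrow> (real \<times> (real^'n) \<Rightarrow> complex^'n) \<Rightarrow> bool" where
  "immersion_on_cylinder I F \<longleftrightarrow>
     (\<forall>s\<in>I. \<forall>x\<in>sphere 0 1. inj_on (frechet_derivative F (at (s, x))) {(t, v). x \<bullet> v = 0})"

definition sphere_family ::
    "(real \<Rightarrow> real) \<Rightarrow> (real \<Rightarrow> real^('n + 'n)^('n + 'n)) \<Rightarrow> (real \<Rightarrow> complex^'n) \<Rightarrow>
     real \<times> (real^'n) \<Rightarrow> complex^'n" where
  "sphere_family r R V = (\<lambda>(s, x). r s *\<^sub>R of_R2n (R s *v to_R2n (real_vec x)) + V s)"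

text \<open>
  The set \<open>A\<close> is the part of \<open>I \<times> S\<^sup>n\<^sup>-\<^sup>1\<close> mapped into the neighbourhood of \<open>p\<close>, so the submanifold
  need not contain entire spheres.
\<close>

definition foliated_by_round_spheres :: "(complex^'n) set \<Rightarrow> bool" where
  "foliated_by_round_spheres M \<longleftrightarrow>
     (\<forall>p\<in>M. \<exists>I r R V W A.
        open I \<and> is_interval I \<and> smooth_on I r \<and> smooth_on I R \<and> smooth_on I V \<and>
        (\<forall>s\<in>I. r s > 0 \<and> rotation_matrix (R s)) \<and>
        immersion_on_cylinder I (sphere_family r R V) \<and>
        open W \<and> p \<in> W \<and> openin (top_of_set (I \<times> sphere 0 1)) A \<and>
        sphere_family r R V ` A = M \<inter> W)"


subsection \<open>Centered submanifolds\<close>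

definition unitary_matrix :: "complex^'n^'n \<Rightarrow> bool" where
  "unitary_matrix U \<longleftrightarrow>
     map_matrix cnj (transpose U) ** U = mat 1 \<and> U ** map_matrix cnj (transpose U) = mat 1"

definition centered_family :: "(real \<Rightarrow> complex) \<Rightarrow> real \<times> (real^'n) \<Rightarrow> complex^'n" where
  "centered_family \<gamma> = (\<lambda>(s, x). \<gamma> s *s real_vec x)"

definition locally_centered_at_origin :: "(complex^'n) set \<Rightarrow> bool" where
  "locally_centered_at_origin M \<longleftrightarrow>
     (\<forall>p\<in>M. \<exists>I \<gamma> W.
        open I \<and> is_interval I \<and> smooth_on I \<gamma> \<and> (\<forall>s\<in>I. \<gamma> s \<noteq> 0) \<and>
        immersion_on_cylinder I (centered_family \<gamma> :: real \<times> (real^'n) \<Rightarrow> complex^'n) \<and>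
        open W \<and> p \<in> W \<and>
        openin (top_of_set (centered_family \<gamma> ` (I \<times> sphere 0 1))) (M \<inter> W))"

definition affine_lagrangian_plane :: "(complex^'n) set \<Rightarrow> bool" where
  "affine_lagrangian_plane P \<longleftrightarrow>
     (\<exists>L a. subspace L \<and> dim L = CARD('n) \<and> (\<forall>v\<in>L. \<forall>w\<in>L. symplectic_form v w = 0) \<and>
        P = (\<lambda>v. a + v) ` L)"

definition centered :: "(complex^'n) set \<Rightarrow> bool" where
  "centered M \<longleftrightarrow>
     (\<exists>U c. unitary_matrix U \<and> locally_centered_at_origin ((\<lambda>z. U *v z + c) ` M)) \<or>
     (\<exists>P. affine_lagrangian_plane P \<and> openin (top_of_set P) M)"

end

theory Submission
  imports Defs
begin

text \<open>
  For \<open>n \<ge> 3\<close> the spheres of the foliation are isotropic, hence lie in Lagrangian \<open>n\<close>-planes, and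
  these planes turn only by phases: locally the submanifold is
  \<open>F s x = r e\<^sup>i\<^sup>\<theta> U x + V\<close> with \<open>U\<close> a constant unitary matrix, \<open>x\<close> in the real unit sphere and
  \<open>V' = e\<^sup>i\<^sup>\<theta> U a\<close> for a curve \<open>a\<close> in \<open>\<real>\<^sup>n\<close>. Its Lagrangian angle is \<open>n \<theta> + arg (p + i q)\<close> up to a
  constant, where \<open>p = r' + a \<bullet> x\<close> and \<open>q = r \<theta>'\<close>.

  Harmonicity of this angle, written in the orthogonal frame of the normal form, is polynomial in
  the linear forms \<open>a \<bullet> x\<close>, \<open>a' \<bullet> x\<close>, \<open>a'' \<bullet> x\<close>. On great circles its highest Fourier mode is
  \<open>n (n - 2) q \<bar>a\<bar>\<^sup>5\<close> up to a factor, so \<open>a = 0\<close> wherever \<open>\<theta>' \<noteq> 0\<close>. Conserved quantities of the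
  remaining ordinary differential equation show that on an interval either \<open>\<theta>'\<close> vanishes
  identically, and the piece is an open part of an affine Lagrangian plane, or \<open>\<theta>' \<noteq> 0\<close> on a
  dense set, and \<open>a = 0\<close> makes the piece centered. A centered piece that is not flat determines
  its centre, and its real form \<open>U \<real>\<^sup>n\<close> up to a phase, and it never meets a flat piece; so both
  alternatives, with their data, propagate over connected components.
\<close>

subsection \<open>Smooth maps\<close>

text \<open>The hypothesis n >= 3 enters twice. The radial direction of a leaf becomes tangent only
  after the base point is turned towards a third direction, and this is what makes the whole turned
  copy of the real subspace isotropic; and the factor n - 2 of the leading Fourier mode is zero for
  n = 2. The Laplacian is given in a parametrization that has nothing to do with the foliation. It
  is therefore rewritten through curves in the submanifold. Their lifts to the parameter domain are
  known only to be continuous; their velocities and accelerations are recovered from the injectivity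
  of the differential. The Fourier argument is pointwise: at each parameter either \<open>a\<close>
  or the derivative of the phase vanishes. A curve might still alternate between both kinds of
  behaviour on different subintervals, smoothly glued at points where everything vanishes to
  infinite order. Excluding this is the purpose of the conserved quantities, whose exponents are
  those that make their derivatives multiples of the stationary equation.\<close>

definition dderiv :: "('a::euclidean_space \<Rightarrow> 'b::real_normed_vector) \<Rightarrow> 'a \<Rightarrow> 'a \<Rightarrow> 'b" where
  "dderiv f v x = frechet_derivative f (at x) v"

lemma smooth_on_differentiable:
  assumes "smooth_on S f" "x \<in> S"
  shows "f differentiable (at x)"
proof -
  have "Ck_on (Suc 0) S f"
    using assms(1) by (simp only: smooth_on_def)
  then show ?thesis
    using assms(2) by simp
qed

lemma smooth_on_has_derivative:
  assumes "smooth_on S f" "x \<in> S"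
  shows "(f has_derivative (\<lambda>v. dderiv f v x)) (at x)"
  using smooth_on_differentiable[OF assms] frechet_derivative_works
  unfolding dderiv_def by blast

lemma smooth_on_dderiv:
  assumes "smooth_on S f"
  shows "smooth_on S (dderiv f v)"
  unfolding smooth_on_def
proof
  fix k
  have "Ck_on (Suc k) S f"
    using assms by (simp only: smooth_on_def)
  then show "Ck_on k S (dderiv f v)"
    by (simp add: dderiv_def[abs_def])
qed

lemma smooth_on_continuous_on:
  assumes "smooth_on S f"
  shows "continuous_on S f"
  using assms Ck_on.simps(1) unfolding smooth_on_def by blast

lemma dderiv_unique:
  assumes "(f has_derivative f') (at x)"
  shows "dderiv f v x = f' v"
  using frechet_derivative_at[OF assms] by (simp add: dderiv_def)

lemma linear_dderiv:
  assumes "smooth_on S f" "x \<in> S"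
  shows "linear (\<lambda>v. dderiv f v x)"
  using has_derivative_linear[OF smooth_on_has_derivative[OF assms]] .

lemma partial_derivative_dderiv: "partial_derivative i f u = dderiv f (axis i 1) u"
  by (simp add: partial_derivative_def dderiv_def)

lemma has_derivative_along_line:
  assumes "(f has_derivative f') (at (u + t *\<^sub>R v))"
  shows "((\<lambda>t. f (u + t *\<^sub>R v)) has_derivative (\<lambda>h. f' (h *\<^sub>R v))) (at t within T)"
proof -
  have "((\<lambda>t. u + t *\<^sub>R v) has_derivative (\<lambda>h. h *\<^sub>R v)) (at t within T)"
    by (auto intro!: derivative_eq_intros)
  from has_derivative_compose[OF this assms] show ?thesis .
qed

text \<open>The mean value theorem is applied twice, to a difference of \<open>f\<close> in
  direction \<open>w\<close> and then to its derivative in direction \<open>v\<close>. Pairing with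
  \<open>b\<close> makes the functions real-valued, where the theorem is an equality.\<close>

lemma second_difference_mean_value:
  fixes f :: "'a::euclidean_space \<Rightarrow> 'b::euclidean_space"
  assumes f: "smooth_on S f" and s: "s > 0"
    and inS: "\<And>\<xi> \<eta>. 0 \<le> \<xi> \<Longrightarrow> \<xi> \<le> s \<Longrightarrow> 0 \<le> \<eta> \<Longrightarrow> \<eta> \<le> s \<Longrightarrow> u + \<xi> *\<^sub>R v + \<eta> *\<^sub>R w \<in> S"
  obtains \<xi> \<eta> where "0 \<le> \<xi>" "\<xi> \<le> s" "0 \<le> \<eta>" "\<eta> \<le> s"
    "(f (u + s *\<^sub>R v + s *\<^sub>R w) - f (u + s *\<^sub>R v) - f (u + s *\<^sub>R w) + f u) \<bullet> b =
      s\<^sup>2 * (dderiv (dderiv f v) w (u + \<xi> *\<^sub>R v + \<eta> *\<^sub>R w) \<bullet> b)"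
proof -
  define \<phi> where "\<phi> t = (f ((u + s *\<^sub>R w) + t *\<^sub>R v) - f (u + t *\<^sub>R v)) \<bullet> b" for t
  have eq: "u + t *\<^sub>R v + t' *\<^sub>R w = (u + t' *\<^sub>R w) + t *\<^sub>R v" for t t'
    by simp
  have d: "(\<phi> has_derivative (\<lambda>h. (dderiv f (h *\<^sub>R v) ((u + s *\<^sub>R w) + t *\<^sub>R v)
        - dderiv f (h *\<^sub>R v) (u + t *\<^sub>R v)) \<bullet> b)) (at t within {0..s})"
    if "0 \<le> t" "t \<le> s" for t
  proof -
    have "(f has_derivative (\<lambda>h. dderiv f h ((u + s *\<^sub>R w) + t *\<^sub>R v))) (at ((u + s *\<^sub>R w) + t *\<^sub>R v))"
      using inS[of t s] that s by (intro smooth_on_has_derivative[OF f]) (simp add: eq)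
    moreover have "(f has_derivative (\<lambda>h. dderiv f h (u + t *\<^sub>R v))) (at (u + t *\<^sub>R v))"
      using inS[of t 0] that s by (intro smooth_on_has_derivative[OF f]) simp
    ultimately show ?thesis
      unfolding \<phi>_def
      by (intro has_derivative_inner_left has_derivative_diff has_derivative_along_line)
  qed
  obtain \<xi> where \<xi>: "\<xi> \<in> {0<..<s}" and \<phi>s: "\<phi> s - \<phi> 0 =
      (dderiv f ((s - 0) *\<^sub>R v) ((u + s *\<^sub>R w) + \<xi> *\<^sub>R v) - dderiv f ((s - 0) *\<^sub>R v) (u + \<xi> *\<^sub>R v)) \<bullet> b"
    using mvt_simple[OF s, of \<phi> "\<lambda>t h. (dderiv f (h *\<^sub>R v) ((u + s *\<^sub>R w) + t *\<^sub>R v)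
        - dderiv f (h *\<^sub>R v) (u + t *\<^sub>R v)) \<bullet> b"] d by blast
  have lin: "dderiv f (s *\<^sub>R v) x = s *\<^sub>R dderiv f v x" if "x \<in> S" for x
    using linear_dderiv[OF f that] by (rule linear_cmul)
  have \<xi>S: "u + s *\<^sub>R w + \<xi> *\<^sub>R v \<in> S" "u + \<xi> *\<^sub>R v \<in> S"
    using inS[of \<xi> s] inS[of \<xi> 0] \<xi> s by (simp_all add: eq)
  define \<psi> where "\<psi> t = dderiv f v ((u + \<xi> *\<^sub>R v) + t *\<^sub>R w) \<bullet> b" for t
  have "(\<psi> has_derivative (\<lambda>h. dderiv (dderiv f v) (h *\<^sub>R w) ((u + \<xi> *\<^sub>R v) + t *\<^sub>R w) \<bullet> b)) (at t within {0..s})"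
    if "0 \<le> t" "t \<le> s" for t
  proof -
    have "(dderiv f v has_derivative (\<lambda>h. dderiv (dderiv f v) h ((u + \<xi> *\<^sub>R v) + t *\<^sub>R w))) (at ((u + \<xi> *\<^sub>R v) + t *\<^sub>R w))"
      using inS[of \<xi> t] that s \<xi> by (intro smooth_on_has_derivative[OF smooth_on_dderiv[OF f]]) simp
    then show ?thesis
      unfolding \<psi>_def by (intro has_derivative_inner_left has_derivative_along_line)
  qed
  then obtain \<eta> where \<eta>: "\<eta> \<in> {0<..<s}" and \<psi>s: "\<psi> s - \<psi> 0 =
      dderiv (dderiv f v) ((s - 0) *\<^sub>R w) ((u + \<xi> *\<^sub>R v) + \<eta> *\<^sub>R w) \<bullet> b"
    using mvt_simple[OF s, of \<psi> "\<lambda>t h. dderiv (dderiv f v) (h *\<^sub>R w) ((u + \<xi> *\<^sub>R v) + t *\<^sub>R w) \<bullet> b"]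
    by blast
  have lin2: "dderiv (dderiv f v) (s *\<^sub>R w) x = s *\<^sub>R dderiv (dderiv f v) w x" if "x \<in> S" for x
    using linear_dderiv[OF smooth_on_dderiv[OF f] that] by (rule linear_cmul)
  have \<eta>S: "u + \<xi> *\<^sub>R v + \<eta> *\<^sub>R w \<in> S"
    using inS[of \<xi> \<eta>] \<xi> \<eta> by simp
  have "(f (u + s *\<^sub>R v + s *\<^sub>R w) - f (u + s *\<^sub>R v) - f (u + s *\<^sub>R w) + f u) \<bullet> b = \<phi> s - \<phi> 0"
    unfolding \<phi>_def by (simp add: algebra_simps)
  also have "\<dots> = s * (\<psi> s - \<psi> 0)"
    using \<phi>s lin \<xi>S unfolding \<psi>_def by (simp add: algebra_simps)
  also have "\<dots> = s\<^sup>2 * (dderiv (dderiv f v) w (u + \<xi> *\<^sub>R v + \<eta> *\<^sub>R w) \<bullet> b)"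
    using \<psi>s lin2[OF \<eta>S] by (simp add: power2_eq_square)
  finally show ?thesis
    using that[of \<xi> \<eta>] \<xi> \<eta> by simp
qed

text \<open>The second difference is symmetric in \<open>v\<close> and \<open>w\<close>, so both
  mixed derivatives represent it at points close to \<open>u\<close>; their continuity does the
  rest.\<close>

lemma dderiv_commute:
  fixes f :: "'a::euclidean_space \<Rightarrow> 'b::euclidean_space"
  assumes S: "open S" and f: "smooth_on S f" and u: "u \<in> S"
  shows "dderiv (dderiv f v) w u = dderiv (dderiv f w) v u"
proof (rule vector_eq_rdot[THEN iffD1], rule allI)
  fix b
  let ?A = "dderiv (dderiv f v) w" and ?B = "dderiv (dderiv f w) v"
  have "isCont ?A u" "isCont ?B u"
    using smooth_on_continuous_on[OF smooth_on_dderiv[OF smooth_on_dderiv[OF f]]] S u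
    by (auto simp: continuous_on_eq_continuous_at)
  then have cA: "isCont (\<lambda>x. ?A x \<bullet> b) u" and cB: "isCont (\<lambda>x. ?B x \<bullet> b) u"
    by (auto intro!: continuous_intros)
  have "\<bar>?A u \<bullet> b - ?B u \<bullet> b\<bar> \<le> e" if e: "e > 0" for e
  proof -
    obtain d1 where d1: "d1 > 0" "\<And>x. dist x u < d1 \<Longrightarrow> \<bar>?A x \<bullet> b - ?A u \<bullet> b\<bar> < e/2"
      using cA e unfolding continuous_at_eps_delta dist_real_def by (meson half_gt_zero)
    obtain d2 where d2: "d2 > 0" "\<And>x. dist x u < d2 \<Longrightarrow> \<bar>?B x \<bullet> b - ?B u \<bullet> b\<bar> < e/2"
      using cB e unfolding continuous_at_eps_delta dist_real_def by (meson half_gt_zero)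
    obtain d3 where d3: "d3 > 0" "\<And>x. dist x u < d3 \<Longrightarrow> x \<in> S"
      using S u unfolding open_dist by blast
    define d where "d = min d1 (min d2 d3)"
    \<comment> \<open>The summand 1 keeps \<open>K\<close> positive when \<open>v\<close> and
      \<open>w\<close> both vanish.\<close>
    define K where "K = norm v + norm w + 1"
    have K: "K > 0" and d: "d > 0"
      using d1 d2 d3 unfolding K_def d_def by (auto intro: add_nonneg_pos)
    define s where "s = d / (2 * K)"
    have s: "s > 0" "s * K < d"
      using K d by (auto simp: s_def)
    have near: "dist (u + \<xi> *\<^sub>R v + \<eta> *\<^sub>R w) u < d"
      if "0 \<le> \<xi>" "\<xi> \<le> s" "0 \<le> \<eta>" "\<eta> \<le> s" for \<xi> \<eta>
    proof -
      have "dist (u + \<xi> *\<^sub>R v + \<eta> *\<^sub>R w) u = norm (\<xi> *\<^sub>R v + \<eta> *\<^sub>R w)"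
        by (simp add: dist_norm)
      also have "\<dots> \<le> \<xi> * norm v + \<eta> * norm w"
        using norm_triangle_ineq[of "\<xi> *\<^sub>R v" "\<eta> *\<^sub>R w"] that by simp
      also have "\<dots> \<le> s * norm v + s * norm w"
        using that by (intro add_mono mult_right_mono) auto
      also have "\<dots> \<le> s * K"
        using s by (simp add: K_def algebra_simps)
      finally show ?thesis using s by simp
    qed
    have inS: "u + \<xi> *\<^sub>R v + \<eta> *\<^sub>R w \<in> S"
      if "0 \<le> \<xi>" "\<xi> \<le> s" "0 \<le> \<eta>" "\<eta> \<le> s" for \<xi> \<eta>
      using near[OF that] d3 by (simp add: d_def)
    obtain \<xi> \<eta> where x1: "0 \<le> \<xi>" "\<xi> \<le> s" "0 \<le> \<eta>" "\<eta> \<le> s" and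
      e1: "(f (u + s *\<^sub>R v + s *\<^sub>R w) - f (u + s *\<^sub>R v) - f (u + s *\<^sub>R w) + f u) \<bullet> b =
      s\<^sup>2 * (?A (u + \<xi> *\<^sub>R v + \<eta> *\<^sub>R w) \<bullet> b)"
      by (rule second_difference_mean_value[OF f s(1), where u=u and v=v and w=w and b=b]) (use inS in auto)
    have inS': "u + \<xi> *\<^sub>R w + \<eta> *\<^sub>R v \<in> S"
      if "0 \<le> \<xi>" "\<xi> \<le> s" "0 \<le> \<eta>" "\<eta> \<le> s" for \<xi> \<eta>
      using inS[of \<eta> \<xi>] that by (simp add: algebra_simps)
    obtain \<xi>' \<eta>' where x2: "0 \<le> \<xi>'" "\<xi>' \<le> s" "0 \<le> \<eta>'" "\<eta>' \<le> s" and
      e2: "(f (u + s *\<^sub>R w + s *\<^sub>R v) - f (u + s *\<^sub>R w) - f (u + s *\<^sub>R v) + f u) \<bullet> b =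
      s\<^sup>2 * (?B (u + \<xi>' *\<^sub>R w + \<eta>' *\<^sub>R v) \<bullet> b)"
      by (rule second_difference_mean_value[OF f s(1), where u=u and v=w and w=v and b=b]) (use inS' in auto)
    have "s\<^sup>2 * (?A (u + \<xi> *\<^sub>R v + \<eta> *\<^sub>R w) \<bullet> b) = s\<^sup>2 * (?B (u + \<eta>' *\<^sub>R v + \<xi>' *\<^sub>R w) \<bullet> b)"
      using e1 e2 by (simp add: algebra_simps)
    then have "?A (u + \<xi> *\<^sub>R v + \<eta> *\<^sub>R w) \<bullet> b = ?B (u + \<eta>' *\<^sub>R v + \<xi>' *\<^sub>R w) \<bullet> b"
      using s by simp
    moreover have "\<bar>?A (u + \<xi> *\<^sub>R v + \<eta> *\<^sub>R w) \<bullet> b - ?A u \<bullet> b\<bar> < e/2"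
      using near[OF x1] by (intro d1) (simp add: d_def)
    moreover have "\<bar>?B (u + \<eta>' *\<^sub>R v + \<xi>' *\<^sub>R w) \<bullet> b - ?B u \<bullet> b\<bar> < e/2"
      using near[of \<eta>' \<xi>'] x2 by (intro d2) (simp add: d_def)
    ultimately show ?thesis by linarith
  qed
  then have "\<bar>?A u \<bullet> b - ?B u \<bullet> b\<bar> \<le> 0"
    by (rule field_le_epsilon) simp
  then show "?A u \<bullet> b = ?B u \<bullet> b" by simp
qed

subsection \<open>Derivatives of determinants and inverse matrices\<close>

text \<open>Leibniz expansion and the product rule, valid at singular matrices as well. It serves
  the determinant itself and, through Cramer's rule, the entries of the inverse.\<close>

lemma has_derivative_det_rows:
  fixes A :: "'a::real_normed_vector \<Rightarrow> real^'n^'n"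
  assumes "\<And>i j. ((\<lambda>u. A u $ i $ j) has_derivative A' i j) (at x)"
  shows "((\<lambda>u. det (A u)) has_derivative
    (\<lambda>h. \<Sum>i\<in>UNIV. det (\<chi> k l. if k = i then A' k l h else A x $ k $ l))) (at x)"
proof -
  have "((\<lambda>u. det (A u)) has_derivative
    (\<lambda>h. \<Sum>p | p permutes UNIV. of_int (sign p) *
      (\<Sum>i\<in>UNIV. A' i (p i) h * (\<Prod>j\<in>UNIV - {i}. A x $ j $ p j)))) (at x)"
    unfolding det_def
    by (intro has_derivative_sum has_derivative_mult_right has_derivative_prod assms)
  also have "(\<lambda>h. \<Sum>p | p permutes UNIV. of_int (sign p) *
      (\<Sum>i\<in>UNIV. A' i (p i) h * (\<Prod>j\<in>UNIV - {i}. A x $ j $ p j))) =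
    (\<lambda>h. \<Sum>i\<in>UNIV. det (\<chi> k l. if k = i then A' k l h else A x $ k $ l))"
  proof
    fix h
    have "(\<Prod>k\<in>UNIV. if k = i then A' k (p k) h else A x $ k $ p k) =
        A' i (p i) h * (\<Prod>j\<in>UNIV - {i}. A x $ j $ p j)" for i p
      by (subst prod.remove[of _ i]) (auto intro!: prod.cong)
    then show "(\<Sum>p | p permutes UNIV. of_int (sign p) *
      (\<Sum>i\<in>UNIV. A' i (p i) h * (\<Prod>j\<in>UNIV - {i}. A x $ j $ p j))) =
      (\<Sum>i\<in>UNIV. det (\<chi> k l. if k = i then A' k l h else A x $ k $ l))"
      unfolding det_def by (simp add: sum_distrib_left) (rule sum.swap)
  qed
  finally show ?thesis .
qed

lemma matrix_inv_mult:
  fixes A :: "real^'n^'n"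
  assumes "det A \<noteq> 0"
  shows "A ** matrix_inv A = mat 1" "matrix_inv A ** A = mat 1"
  using assms invertible_det_nz[of A] matrix_inv_def[of A] someI_ex[of "\<lambda>B. A ** B = mat 1 \<and> B ** A = mat 1"]
  unfolding invertible_def by simp_all

text \<open>Cramer's rule for the transpose: the cofactors of row \<open>i\<close> are the
  determinant times column \<open>i\<close> of the inverse.\<close>

lemma det_replace_row:
  fixes A :: "real^'n^'n"
  assumes "det A \<noteq> 0"
  shows "det (\<chi> k l. if k = i then b l else A $ k $ l) = det A * (\<Sum>l\<in>UNIV. b l * matrix_inv A $ l $ i)"
proof -
  let ?M = "transpose A" and ?x = "transpose (matrix_inv A) *v (\<chi> l. b l)"
  have "?M ** transpose (matrix_inv A) = mat 1"
    using matrix_inv_mult[OF assms] by (metis matrix_transpose_mul transpose_mat)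
  then have Mx: "?M *v ?x = (\<chi> l. b l)"
    by (simp only: matrix_vector_mul_assoc matrix_vector_mul_lid)
  have "det (\<chi> k l. if k = i then b l else A $ k $ l) =
      det (transpose (\<chi> k l. if k = i then b l else A $ k $ l))"
    by simp
  also have "transpose (\<chi> k l. if k = i then b l else A $ k $ l) =
      (\<chi> k l. if l = i then (?M *v ?x) $ k else ?M $ k $ l)"
    unfolding Mx by (simp add: transpose_def vec_eq_iff)
  also have "det \<dots> = ?x $ i * det ?M"
    by (rule cramer_lemma)
  finally show ?thesis
    by (simp add: matrix_vector_mult_def mult.commute) (simp add: transpose_def mult.commute)
qed

text \<open>Jacobi's formula: the logarithmic derivative of the determinant is the trace of the
  derivative times the inverse.\<close>

lemma has_derivative_det:
  fixes A :: "'a::real_normed_vector \<Rightarrow> real^'n^'n"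
  assumes "\<And>i j. ((\<lambda>u. A u $ i $ j) has_derivative A' i j) (at x)" "det (A x) \<noteq> 0"
  shows "((\<lambda>u. det (A u)) has_derivative
    (\<lambda>h. det (A x) * (\<Sum>i\<in>UNIV. \<Sum>j\<in>UNIV. A' i j h * matrix_inv (A x) $ j $ i))) (at x)"
proof -
  have "det (\<chi> k l. if k = i then A' k l h else A x $ k $ l) =
      det (A x) * (\<Sum>j\<in>UNIV. A' i j h * matrix_inv (A x) $ j $ i)" for i h
    by (subst det_replace_row[OF assms(2), symmetric]) (auto intro!: arg_cong[where f=det] simp: vec_eq_iff)
  with has_derivative_det_rows[of A A' x] assms(1) show ?thesis
    by (simp add: sum_distrib_left)
qed


lemma matrix_inv_entry:
  fixes A :: "real^'n^'n"
  assumes "det A \<noteq> 0"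
  shows "matrix_inv A $ k $ l =
    det (\<chi> i j. if j = k then (if i = l then 1 else 0) else A $ i $ j) / det A"
proof -
  have "A *v (matrix_inv A *v axis l 1) = axis l 1"
    using matrix_inv_mult(1)[OF assms] by (simp only: matrix_vector_mul_assoc matrix_vector_mul_lid)
  then have "matrix_inv A *v axis l 1 =
      (\<chi> k. det (\<chi> i j. if j = k then axis l 1 $ i else A $ i $ j) / det A)"
    using cramer[OF assms] by blast
  then have "(matrix_inv A *v axis l 1) $ k =
      det (\<chi> i j. if j = k then axis l 1 $ i else A $ i $ j) / det A"
    by simp
  moreover have "(matrix_inv A *v axis l 1) $ k = matrix_inv A $ k $ l"
    by (simp add: matrix_vector_mult_basis column_def)
  ultimately show ?thesis
    by (simp add: axis_def cong: if_cong)
qed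

text \<open>Cramer's rule shows only that the entries are differentiable. The value of the
  derivative then comes from differentiating the product of \<open>A\<close> and its inverse, which
  is constant on \<open>S\<close>.\<close>

lemma has_derivative_matrix_inv:
  fixes A :: "'a::real_normed_vector \<Rightarrow> real^'n^'n"
  assumes S: "open S" "x \<in> S" "\<And>u. u \<in> S \<Longrightarrow> det (A u) \<noteq> 0"
    and A': "\<And>i j. ((\<lambda>u. A u $ i $ j) has_derivative A' i j) (at x)"
  shows "((\<lambda>u. matrix_inv (A u) $ k $ l) has_derivative
    (\<lambda>h. - (\<Sum>a\<in>UNIV. \<Sum>b\<in>UNIV. matrix_inv (A x) $ k $ a * A' a b h * matrix_inv (A x) $ b $ l))) (at x)"
proof -
  have "\<exists>G'. ((\<lambda>u. matrix_inv (A u) $ k $ l) has_derivative G') (at x)" for k l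
  proof -
    define B where "B u = (\<chi> i j. if j = k then (if i = l then 1 else 0) else A u $ i $ j)" for u
    define B' where "B' i j = (if j = k then (\<lambda>h. 0) else A' i j)" for i j
    have "((\<lambda>u. B u $ i $ j) has_derivative B' i j) (at x)" for i j
      unfolding B_def B'_def using A'[of i j] by (cases "j = k") auto
    note dB = has_derivative_det_rows[of B B', OF this]
    have dA: "((\<lambda>u. det (A u)) has_derivative (\<lambda>h. \<Sum>i\<in>UNIV. det (\<chi> k l. if k = i then A' k l h else A x $ k $ l))) (at x)"
      by (rule has_derivative_det_rows[OF A'])
    from has_derivative_divide[OF dB dA] S
    have "((\<lambda>u. det (B u) / det (A u)) has_derivative (\<lambda>h. - det (B x) * (inverse (det (A x)) * (\<Sum>i\<in>UNIV. det (\<chi> k l. if k = i then A' k l h else A x $ k $ l)) * inverse (det (A x))) + (\<Sum>i\<in>UNIV. det (\<chi> k l. if k = i then B' k l h else B x $ k $ l)) / det (A x))) (at x)"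
      by blast
    then have "((\<lambda>u. matrix_inv (A u) $ k $ l) has_derivative (\<lambda>h. - det (B x) * (inverse (det (A x)) * (\<Sum>i\<in>UNIV. det (\<chi> k l. if k = i then A' k l h else A x $ k $ l)) * inverse (det (A x))) + (\<Sum>i\<in>UNIV. det (\<chi> k l. if k = i then B' k l h else B x $ k $ l)) / det (A x))) (at x)"
      by (rule has_derivative_transform_within_open[OF _ S(1,2)])
        (use S(3) in \<open>simp add: matrix_inv_entry B_def\<close>)
    then show ?thesis by blast
  qed
  then obtain G' where G': "\<And>k l. ((\<lambda>u. matrix_inv (A u) $ k $ l) has_derivative G' k l) (at x)"
    by metis
  let ?G = "matrix_inv (A x)"
  have 1: "(\<Sum>j\<in>UNIV. A u $ a $ j * matrix_inv (A u) $ j $ l) = (if a = l then 1 else 0)" if "u \<in> S" for u a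
    using arg_cong[OF matrix_inv_mult(1)[OF S(3)[OF that]], of "\<lambda>M. M $ a $ l"]
    by (simp add: matrix_matrix_mult_def mat_def)
  have 2: "(\<Sum>a\<in>UNIV. ?G $ k $ a * A x $ a $ j) = (if k = j then 1 else 0)" for j
    using arg_cong[OF matrix_inv_mult(2)[OF S(3)[OF S(2)]], of "\<lambda>M. M $ k $ j"]
    by (simp add: matrix_matrix_mult_def mat_def)
  have 3: "(\<Sum>j\<in>UNIV. A x $ a $ j * G' j l h) = - (\<Sum>j\<in>UNIV. A' a j h * ?G $ j $ l)" for a h
  proof -
    have "((\<lambda>u. \<Sum>j\<in>UNIV. A u $ a $ j * matrix_inv (A u) $ j $ l) has_derivative
        (\<lambda>h. \<Sum>j\<in>UNIV. A x $ a $ j * G' j l h + A' a j h * ?G $ j $ l)) (at x)"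
      by (intro has_derivative_sum has_derivative_mult A' G')
    moreover have "((\<lambda>u. \<Sum>j\<in>UNIV. A u $ a $ j * matrix_inv (A u) $ j $ l) has_derivative (\<lambda>h. 0)) (at x)"
      by (rule has_derivative_transform_within_open[OF has_derivative_const S(1,2)]) (simp add: 1)
    ultimately have "(\<lambda>h. \<Sum>j\<in>UNIV. A x $ a $ j * G' j l h + A' a j h * ?G $ j $ l) = (\<lambda>h. 0)"
      by (rule has_derivative_unique)
    from fun_cong[OF this, of h] show ?thesis
      by (simp add: sum.distrib)
  qed
  have "G' k l h = - (\<Sum>a\<in>UNIV. \<Sum>b\<in>UNIV. ?G $ k $ a * A' a b h * ?G $ b $ l)" for h
  proof -
    have "G' k l h = (\<Sum>j\<in>UNIV. (\<Sum>a\<in>UNIV. ?G $ k $ a * A x $ a $ j) * G' j l h)"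
      unfolding 2 by (simp add: if_distrib[where f="\<lambda>x. x * _"] cong: if_cong)
    also have "\<dots> = (\<Sum>a\<in>UNIV. ?G $ k $ a * (\<Sum>j\<in>UNIV. A x $ a $ j * G' j l h))"
      by (simp add: sum_distrib_left sum_distrib_right mult.assoc) (rule sum.swap)
    also have "\<dots> = - (\<Sum>a\<in>UNIV. \<Sum>b\<in>UNIV. ?G $ k $ a * A' a b h * ?G $ b $ l)"
      unfolding 3 by (simp add: sum_distrib_left sum_negf mult.assoc)
    finally show ?thesis .
  qed
  then show ?thesis
    using G'[of k l] by presburger
qed

subsection \<open>The Laplace--Beltrami operator of an immersion\<close>

lemma dderiv_basis_expansion:
  fixes f :: "real^'n \<Rightarrow> 'b::real_normed_vector"
  assumes "smooth_on S f" "x \<in> S"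
  shows "dderiv f v x = (\<Sum>i\<in>UNIV. v $ i *\<^sub>R dderiv f (axis i 1) x)"
proof -
  have "dderiv f v x = dderiv f (\<Sum>i\<in>UNIV. v $ i *\<^sub>R axis i 1) x"
    by (simp add: basis_expansion flip: scalar_mult_eq_scaleR)
  then show ?thesis
    by (simp only: linear_sum[OF linear_dderiv[OF assms]] linear_cmul[OF linear_dderiv[OF assms]])
qed

lemma induced_metric_nth:
  "induced_metric X u $ i $ j = dderiv X (axis i 1) u \<bullet> dderiv X (axis j 1) u"
  by (simp add: induced_metric_def partial_derivative_dderiv)

text \<open>A kernel vector \<open>v\<close> of the Gram matrix has an image
  \<open>dderiv X v u\<close> of length zero.\<close>

lemma induced_metric_det_nonzero:
  fixes X :: "real^'n \<Rightarrow> complex^'n"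
  assumes X: "smooth_on D X" "u \<in> D" "inj (frechet_derivative X (at u))"
  shows "det (induced_metric X u) \<noteq> 0"
proof -
  have "v = 0" if "induced_metric X u *v v = 0" for v
  proof -
    have "(norm (dderiv X v u))\<^sup>2 = (\<Sum>i\<in>UNIV. \<Sum>j\<in>UNIV. v $ i * (v $ j * induced_metric X u $ j $ i))"
      unfolding power2_norm_eq_inner dderiv_basis_expansion[OF X(1,2), of v] induced_metric_nth
      by (simp add: inner_sum_left inner_sum_right sum_distrib_left mult.left_commute)
    also have "\<dots> = (\<Sum>j\<in>UNIV. v $ j * (induced_metric X u *v v) $ j)"
      by (subst sum.swap) (simp add: matrix_vector_mult_def sum_distrib_left algebra_simps)
    also have "\<dots> = 0" using that by simp
    finally have "dderiv X v u = dderiv X 0 u"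
      using linear_0[OF linear_dderiv[OF X(1,2)]] by simp
    then show ?thesis
      using X(3) unfolding dderiv_def inj_def by blast
  qed
  then show ?thesis
    by (metis invertible_det_nz invertible_left_inverse matrix_left_invertible_ker)
qed

text \<open>The library root is odd, hence differentiable at negative numbers too; the form
  \<open>sqrt y / (2 * y)\<close> of its derivative covers both signs.\<close>

lemma has_derivative_sqrt_nonzero:
  fixes f :: "'a::real_normed_vector \<Rightarrow> real"
  assumes "(f has_derivative f') (at x)" "f x \<noteq> 0"
  shows "((\<lambda>x. sqrt (f x)) has_derivative (\<lambda>h. f' h * (sqrt (f x) / (2 * f x)))) (at x)"
proof -
  have "DERIV sqrt (f x) :> sqrt (f x) / (2 * f x)"
  proof (rule DERIV_real_sqrt_generic[OF assms(2)])
    assume "f x > 0"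
    then show "sqrt (f x) / (2 * f x) = inverse (sqrt (f x)) / 2"
      by (simp add: field_simps flip: power2_eq_square)
  next
    assume "f x < 0"
    then have "sqrt (f x) * sqrt (f x) = - f x"
      by (metis abs_of_neg real_sqrt_abs2 real_sqrt_mult)
    with \<open>f x < 0\<close> show "sqrt (f x) / (2 * f x) = - inverse (sqrt (f x)) / 2"
      by (simp add: field_simps)
  qed
  then show ?thesis
    using has_derivative_compose[OF assms(1), of sqrt "(*) (sqrt (f x) / (2 * f x))"]
    unfolding has_field_derivative_def by (simp only: mult.commute)
qed


text \<open>The divergence form becomes the trace of the Hessian. The Christoffel symbols appear
  extrinsically, as products of second and first derivatives of \<open>X\<close>, because the metric
  is induced from a flat space.\<close>

lemma laplace_beltrami_eq:
  fixes X :: "real^'n \<Rightarrow> complex^'n" and f :: "real^'n \<Rightarrow> real"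
  assumes D: "open D" "u \<in> D" and X: "smooth_on D X" and f: "smooth_on D f"
    and inj: "\<And>u. u \<in> D \<Longrightarrow> inj (frechet_derivative X (at u))"
  defines "G \<equiv> matrix_inv (induced_metric X u)"
    and "e \<equiv> \<lambda>i. axis i 1 :: real^'n"
  shows "laplace_beltrami (induced_metric X) f u =
    (\<Sum>i\<in>UNIV. \<Sum>j\<in>UNIV. G $ i $ j * (dderiv (dderiv f (e j)) (e i) u -
      (\<Sum>k\<in>UNIV. \<Sum>l\<in>UNIV. (dderiv (dderiv X (e j)) (e i) u \<bullet> dderiv X (e l) u) * G $ l $ k * dderiv f (e k) u)))"
proof -
  let ?g = "induced_metric X"
  have e: "axis i 1 = e i" for i
    by (simp add: e_def)
  define d where "d = det (?g u)"
  have det: "det (?g v) \<noteq> 0" if "v \<in> D" for v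
    using induced_metric_det_nonzero[OF X that inj[OF that]] .
  then have d: "d \<noteq> 0" using D d_def by simp
  \<comment> \<open>Christoffel symbols of the first kind, symmetric in the first two indices since
    second derivatives commute.\<close>
  define C where "C i a b = dderiv (dderiv X (e a)) (e i) u \<bullet> dderiv X (e b) u" for i a b
  define g' where "g' a b h = dderiv X (e a) u \<bullet> dderiv (dderiv X (e b)) h u + dderiv (dderiv X (e a)) h u \<bullet> dderiv X (e b) u" for a b h
  have C_sym: "C i a b = C a i b" for i a b
    unfolding C_def using dderiv_commute[OF D(1) X D(2)] by simp
  have g'_C: "g' a b (e i) = C i b a + C i a b" for i a b
    unfolding g'_def C_def by (simp add: inner_commute)
  have dX: "(dderiv X (e a) has_derivative (\<lambda>h. dderiv (dderiv X (e a)) h u)) (at u)" for a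
    by (rule smooth_on_has_derivative[OF smooth_on_dderiv[OF X] D(2)])
  have df: "(dderiv f (e a) has_derivative (\<lambda>h. dderiv (dderiv f (e a)) h u)) (at u)" for a
    by (rule smooth_on_has_derivative[OF smooth_on_dderiv[OF f] D(2)])
  have dg: "((\<lambda>u. ?g u $ a $ b) has_derivative g' a b) (at u)" for a b
    unfolding induced_metric_nth g'_def e by (rule has_derivative_inner[OF dX dX])
  have dG: "((\<lambda>u. matrix_inv (?g u) $ k $ l) has_derivative
      (\<lambda>h. - (\<Sum>a\<in>UNIV. \<Sum>b\<in>UNIV. G $ k $ a * g' a b h * G $ b $ l))) (at u)" for k l
    unfolding G_def by (rule has_derivative_matrix_inv[OF D det dg])
  have dd: "((\<lambda>u. sqrt (det (?g u))) has_derivative (\<lambda>h. (d * (\<Sum>a\<in>UNIV. \<Sum>b\<in>UNIV. g' a b h * G $ b $ a)) * (sqrt d / (2 * d)))) (at u)"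
    unfolding d_def G_def using d
    by (intro has_derivative_sqrt_nonzero has_derivative_det dg) (simp_all add: d_def)
  let ?F = "\<lambda>i u'. \<Sum>j\<in>UNIV. sqrt (det (?g u')) * matrix_inv (?g u') $ i $ j * dderiv f (e j) u'"
  have dF: "(?F i has_derivative (\<lambda>h. \<Sum>j\<in>UNIV.
      (sqrt d * G $ i $ j) * dderiv (dderiv f (e j)) h u +
      (sqrt d * - (\<Sum>a\<in>UNIV. \<Sum>b\<in>UNIV. G $ i $ a * g' a b h * G $ b $ j) +
       (d * (\<Sum>a\<in>UNIV. \<Sum>b\<in>UNIV. g' a b h * G $ b $ a)) * (sqrt d / (2 * d)) * G $ i $ j) * dderiv f (e j) u)) (at u)" for i
    unfolding d_def G_def
    by (intro has_derivative_sum has_derivative_mult dd[unfolded d_def G_def] dG[unfolded G_def] df)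
  have pF: "partial_derivative i (?F i) u = sqrt d * (\<Sum>j\<in>UNIV.
      G $ i $ j * dderiv (dderiv f (e j)) (e i) u -
      (\<Sum>a\<in>UNIV. \<Sum>b\<in>UNIV. G $ i $ a * g' a b (e i) * G $ b $ j) * dderiv f (e j) u +
      (\<Sum>a\<in>UNIV. \<Sum>b\<in>UNIV. g' a b (e i) * G $ b $ a) / 2 * G $ i $ j * dderiv f (e j) u)" for i
    unfolding partial_derivative_dderiv e dderiv_unique[OF dF[of i]]
    by (subst sum_distrib_left, intro sum.cong refl) (use d in \<open>simp add: algebra_simps\<close>)
  have "sqrt d \<noteq> 0" using d by simp
  then have "laplace_beltrami ?g f u = (\<Sum>i\<in>UNIV. \<Sum>j\<in>UNIV.
      G $ i $ j * dderiv (dderiv f (e j)) (e i) u -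
      (\<Sum>a\<in>UNIV. \<Sum>b\<in>UNIV. G $ i $ a * g' a b (e i) * G $ b $ j) * dderiv f (e j) u +
      (\<Sum>a\<in>UNIV. \<Sum>b\<in>UNIV. g' a b (e i) * G $ b $ a) / 2 * G $ i $ j * dderiv f (e j) u)"
    unfolding laplace_beltrami_def partial_derivative_dderiv[of _ f] e pF d_def[symmetric]
    by (simp flip: sum_distrib_left)
  also have "\<dots> = (\<Sum>i\<in>UNIV. \<Sum>j\<in>UNIV. G $ i $ j * dderiv (dderiv f (e j)) (e i) u)
      - (\<Sum>i\<in>UNIV. \<Sum>j\<in>UNIV. \<Sum>a\<in>UNIV. \<Sum>b\<in>UNIV. G $ i $ a * C i a b * G $ b $ j * dderiv f (e j) u)"
  proof -
    let ?f = "\<lambda>j. dderiv f (e j) u"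
    have GS: "G $ i $ j = G $ j $ i" for i j
    proof -
      have "transpose (?g u) = ?g u"
        by (simp add: transpose_def vec_eq_iff induced_metric_nth inner_commute)
      then have "transpose G ** ?g u = mat 1"
        using matrix_inv_mult(1)[OF det[OF D(2)]] unfolding G_def
        by (metis matrix_transpose_mul transpose_mat)
      then have "transpose G = G"
        using matrix_inv_mult(1)[OF det[OF D(2)]] unfolding G_def
        by (metis matrix_mul_assoc matrix_mul_lid matrix_mul_rid)
      then show ?thesis by (metis transpose_def vec_lambda_beta)
    qed
    \<comment> \<open>\<open>T\<close> arises with opposite signs from the derivative of the inverse
      metric and from that of the volume density, and cancels.\<close>
    define T where "T = (\<Sum>j\<in>UNIV. \<Sum>i\<in>UNIV. \<Sum>a\<in>UNIV. \<Sum>b\<in>UNIV. G $ b $ a * C i a b * G $ i $ j * ?f j)"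
    have T1: "(\<Sum>j\<in>UNIV. \<Sum>i\<in>UNIV. \<Sum>a\<in>UNIV. \<Sum>b\<in>UNIV. G $ b $ a * C i b a * G $ i $ j * ?f j) = T"
    proof -
      have "(\<Sum>a\<in>UNIV. \<Sum>b\<in>UNIV. G $ b $ a * C i b a * x * y) = (\<Sum>a\<in>UNIV. \<Sum>b\<in>UNIV. G $ b $ a * C i a b * x * y)" for i x y
        by (subst sum.swap) (simp add: GS)
      then show ?thesis unfolding T_def by simp
    qed
    have rot: "(\<Sum>i\<in>UNIV. \<Sum>a\<in>UNIV. \<Sum>b\<in>UNIV. \<phi> b i a) = (\<Sum>b\<in>UNIV. \<Sum>i\<in>UNIV. \<Sum>a\<in>UNIV. \<phi> b i a)"
      for \<phi> :: "'n \<Rightarrow> 'n \<Rightarrow> 'n \<Rightarrow> real"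
    proof -
      have "(\<Sum>i\<in>UNIV. \<Sum>a\<in>UNIV. \<Sum>b\<in>UNIV. \<phi> b i a) = (\<Sum>i\<in>UNIV. \<Sum>b\<in>UNIV. \<Sum>a\<in>UNIV. \<phi> b i a)"
        by (intro sum.cong refl sum.swap)
      also have "\<dots> = (\<Sum>b\<in>UNIV. \<Sum>i\<in>UNIV. \<Sum>a\<in>UNIV. \<phi> b i a)"
        by (rule sum.swap)
      finally show ?thesis .
    qed
    have T2: "(\<Sum>j\<in>UNIV. \<Sum>i\<in>UNIV. \<Sum>a\<in>UNIV. \<Sum>b\<in>UNIV. G $ i $ a * C i b a * G $ b $ j * ?f j) = T"
    proof -
      have "(\<Sum>i\<in>UNIV. \<Sum>a\<in>UNIV. \<Sum>b\<in>UNIV. G $ i $ a * C i b a * G $ b $ j * ?f j) =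
        (\<Sum>i\<in>UNIV. \<Sum>a\<in>UNIV. \<Sum>b\<in>UNIV. G $ a $ i * C b i a * G $ b $ j * ?f j)" for j
        by (simp add: GS C_sym)
      also have "\<dots> j = (\<Sum>b\<in>UNIV. \<Sum>i\<in>UNIV. \<Sum>a\<in>UNIV. G $ a $ i * C b i a * G $ b $ j * ?f j)" for j
        by (rule rot[of "\<lambda>b i a. G $ a $ i * C b i a * G $ b $ j * ?f j"])
      finally show ?thesis
        unfolding T_def by simp
    qed
    have "(\<Sum>i\<in>UNIV. \<Sum>j\<in>UNIV. \<Sum>a\<in>UNIV. \<Sum>b\<in>UNIV. G $ i $ a * g' a b (e i) * G $ b $ j * ?f j) =
        T + (\<Sum>i\<in>UNIV. \<Sum>j\<in>UNIV. \<Sum>a\<in>UNIV. \<Sum>b\<in>UNIV. G $ i $ a * C i a b * G $ b $ j * ?f j)"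
    proof -
      have "(\<Sum>i\<in>UNIV. \<Sum>j\<in>UNIV. \<Sum>a\<in>UNIV. \<Sum>b\<in>UNIV. G $ i $ a * C i b a * G $ b $ j * ?f j) = T"
        unfolding T2[symmetric] by (rule sum.swap)
      then show ?thesis
        unfolding g'_C by (simp add: distrib_left distrib_right sum.distrib)
    qed
    moreover have "(\<Sum>i\<in>UNIV. \<Sum>j\<in>UNIV. (\<Sum>a\<in>UNIV. \<Sum>b\<in>UNIV. g' a b (e i) * G $ b $ a) / 2 * G $ i $ j * ?f j) = T"
    proof -
      have "(\<Sum>i\<in>UNIV. \<Sum>j\<in>UNIV. (\<Sum>a\<in>UNIV. \<Sum>b\<in>UNIV. g' a b (e i) * G $ b $ a) / 2 * G $ i $ j * ?f j) =
        (\<Sum>j\<in>UNIV. \<Sum>i\<in>UNIV. \<Sum>a\<in>UNIV. \<Sum>b\<in>UNIV. (G $ b $ a * C i b a * G $ i $ j * ?f j + G $ b $ a * C i a b * G $ i $ j * ?f j) / 2)"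
        unfolding g'_C
        by (subst sum.swap) (simp add: algebra_simps sum.distrib sum_distrib_left sum_distrib_right sum_divide_distrib add_divide_distrib)
      also have "\<dots> = ((\<Sum>j\<in>UNIV. \<Sum>i\<in>UNIV. \<Sum>a\<in>UNIV. \<Sum>b\<in>UNIV. G $ b $ a * C i b a * G $ i $ j * ?f j) + T) / 2"
        unfolding T_def by (simp only: sum.distrib flip: sum_divide_distrib)
      finally show ?thesis
        unfolding T1 by simp
    qed
    ultimately show ?thesis
      by (simp add: sum.distrib sum_subtractf sum_distrib_right)
  qed
  also have "\<dots> = (\<Sum>i\<in>UNIV. \<Sum>j\<in>UNIV. G $ i $ j * (dderiv (dderiv f (e j)) (e i) u -
      (\<Sum>k\<in>UNIV. \<Sum>l\<in>UNIV. (dderiv (dderiv X (e j)) (e i) u \<bullet> dderiv X (e l) u) * G $ l $ k * dderiv f (e k) u)))"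
  proof -
    have "(\<Sum>j\<in>UNIV. \<Sum>a\<in>UNIV. \<Sum>b\<in>UNIV. G $ i $ a * C i a b * G $ b $ j * dderiv f (e j) u) =
        (\<Sum>j\<in>UNIV. G $ i $ j * (\<Sum>k\<in>UNIV. \<Sum>l\<in>UNIV. C i j l * G $ l $ k * dderiv f (e k) u))" for i
      by (subst sum.swap) (simp add: sum_distrib_left mult.assoc)
    then show ?thesis
      unfolding C_def[symmetric] by (simp add: right_diff_distrib sum_subtractf)
  qed
  finally show ?thesis .
qed

subsection \<open>Lifting maps through an immersion\<close>

text \<open>A linear left inverse \<open>L\<close> of \<open>X'\<close> transfers differentiability
  from \<open>L\<close> after \<open>c\<close> to the lift: near \<open>\<eta> z\<close> the map
  \<open>L\<close> after \<open>X\<close> differs from the identity by a small relative error. The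
  lift is only continuous beforehand, as it comes from the inverse homeomorphism of a
  parametrization.\<close>

lemma lift_has_derivative:
  fixes X :: "'a::euclidean_space \<Rightarrow> 'b::euclidean_space" and \<eta> :: "'c::real_normed_vector \<Rightarrow> 'a"
  assumes dX: "(X has_derivative X') (at (\<eta> z))" and inj: "inj X'"
    and cont: "isCont \<eta> z"
    and S: "open S" "z \<in> S" "\<And>y. y \<in> S \<Longrightarrow> X (\<eta> y) = c y"
    and dc: "(c has_derivative c') (at z)"
  shows "\<exists>\<eta>'. (\<eta> has_derivative \<eta>') (at z) \<and> (\<forall>h. X' (\<eta>' h) = c' h)"
proof -
  obtain L where L: "linear L" "L \<circ> X' = id"
    using linear_injective_left_inverse[OF has_derivative_linear[OF dX] inj] by blast
  then have bL: "bounded_linear L"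
    by (simp add: linear_conv_bounded_linear)
  have dLX: "((\<lambda>u. L (X u)) has_derivative (\<lambda>h. h)) (at (\<eta> z))"
    using bounded_linear.has_derivative[OF bL dX] L(2) by (simp add: fun_eq_iff)
  have dLc: "((\<lambda>y. L (c y)) has_derivative (\<lambda>h. L (c' h))) (at z)"
    using bounded_linear.has_derivative[OF bL dc] .
  then have blc: "bounded_linear (\<lambda>h. L (c' h))"
    by (rule has_derivative_bounded_linear)
  obtain K where K: "K > 0" "\<And>h. norm (L (c' h)) \<le> norm h * K"
    using bounded_linear.pos_bounded[OF blc] by blast
  have "(\<eta> has_derivative (\<lambda>h. L (c' h))) (at z)"
    unfolding has_derivative_at_alt
  proof (intro conjI allI impI blc)
    fix e :: real assume e: "e > 0"
    define e2 where "e2 = min (e/2) 1"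
    \<comment> \<open>The bound \<open>1/2\<close> allows the error in \<open>\<eta>\<close> to be
      absorbed, giving \<open>?E \<le> 2 * (K + 1) * ?n\<close>; the other bound then makes
      \<open>e1 * ?E\<close> at most half of \<open>e * ?n\<close>.\<close>
    define e1 where "e1 = min (1/2) (e / (4 * (K + 1)))"
    have "e1 > 0" "e2 > 0"
      using e K by (simp_all add: e1_def e2_def)
    moreover have "e2 \<le> 1" "e1 \<le> 1/2" "e2 \<le> e/2"
      unfolding e1_def e2_def by (rule min.cobounded1 min.cobounded2)+
    ultimately have pos: "e1 > 0" "e2 > 0" "e2 \<le> 1" "e1 \<le> 1/2" "e2 \<le> e/2"
      by blast+
    have e1K: "2 * e1 * (K + 1) \<le> e/2"
    proof -
      have "e1 \<le> e / (4 * (K + 1))" by (simp add: e1_def)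
      then show ?thesis using K by (simp add: field_simps)
    qed
    obtain d1 where d1: "d1 > 0" "\<And>u. norm (u - \<eta> z) < d1 \<Longrightarrow>
        norm (L (X u) - L (X (\<eta> z)) - (u - \<eta> z)) \<le> e1 * norm (u - \<eta> z)"
      using dLX pos unfolding has_derivative_at_alt by blast
    obtain d2 where d2: "d2 > 0" "\<And>y. norm (y - z) < d2 \<Longrightarrow>
        norm (L (c y) - L (c z) - L (c' (y - z))) \<le> e2 * norm (y - z)"
      using dLc pos unfolding has_derivative_at_alt by blast
    obtain d3 where d3: "d3 > 0" "\<And>y. norm (y - z) < d3 \<Longrightarrow> norm (\<eta> y - \<eta> z) < d1"
      using cont d1(1) unfolding continuous_at_eps_delta dist_norm by blast
    obtain d4 where d4: "d4 > 0" "\<And>y. norm (y - z) < d4 \<Longrightarrow> y \<in> S"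
      using S(1,2) unfolding open_dist dist_norm by blast
    show "\<exists>d>0. \<forall>y. norm (y - z) < d \<longrightarrow> norm (\<eta> y - \<eta> z - L (c' (y - z))) \<le> e * norm (y - z)"
    proof (intro exI[of _ "min d2 (min d3 d4)"] conjI allI impI)
      fix y assume y: "norm (y - z) < min d2 (min d3 d4)"
      let ?n = "norm (y - z)" and ?E = "norm (\<eta> y - \<eta> z)"
      have 1: "norm (L (c y) - L (c z) - (\<eta> y - \<eta> z)) \<le> e1 * ?E"
        using d1(2)[of "\<eta> y"] d3(2)[of y] S(3)[of y] S(3)[OF S(2)] d4(2)[of y] y by simp
      have 2: "norm (L (c y) - L (c z) - L (c' (y - z))) \<le> e2 * ?n"
        using d2(2)[of y] y by simp
      have "norm (\<eta> y - \<eta> z - L (c' (y - z))) =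
          norm ((L (c y) - L (c z) - L (c' (y - z))) - (L (c y) - L (c z) - (\<eta> y - \<eta> z)))"
        by (simp add: algebra_simps)
      also have "\<dots> \<le> e2 * ?n + e1 * ?E"
        using 1 2 norm_triangle_ineq4 by (smt (verit))
      finally have 3: "norm (\<eta> y - \<eta> z - L (c' (y - z))) \<le> e2 * ?n + e1 * ?E" .
      have "?E \<le> norm (\<eta> y - \<eta> z - L (c' (y - z))) + norm (L (c' (y - z)))"
        by (metis diff_add_cancel norm_triangle_ineq)
      then have "?E \<le> (e2 * ?n + e1 * ?E) + ?n * K"
        using 3 K(2)[of "y - z"] by linarith
      moreover have "e1 * ?E \<le> 1/2 * ?E" "e2 * ?n \<le> 1 * ?n"
        using pos by (intro mult_right_mono; simp)+
      ultimately have "?E \<le> 2 * (K + 1) * ?n"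
        by (simp add: algebra_simps)
      then have "e1 * ?E \<le> e1 * (2 * (K + 1) * ?n)"
        using pos by (intro mult_left_mono) auto
      also have "\<dots> = (2 * e1 * (K + 1)) * ?n"
        by simp
      also have "\<dots> \<le> e/2 * ?n"
        by (rule mult_right_mono[OF e1K]) simp
      finally have "e1 * ?E \<le> e/2 * ?n" .
      moreover have "e2 * ?n \<le> e/2 * ?n"
        using pos by (intro mult_right_mono) auto
      ultimately show "norm (\<eta> y - \<eta> z - L (c' (y - z))) \<le> e * ?n"
        using 3 by (simp add: field_simps)
    qed (use d2 d3 d4 in auto)
  qed
  note d\<eta> = this
  \<comment> \<open>Uniqueness of the derivative of \<open>c\<close> shows that \<open>c'\<close>
    takes its values in the range of \<open>X'\<close>.\<close>
  have "((\<lambda>y. X (\<eta> y)) has_derivative (\<lambda>h. X' (L (c' h)))) (at z)"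
    using has_derivative_compose[OF d\<eta> dX] .
  then have "(c has_derivative (\<lambda>h. X' (L (c' h)))) (at z)"
    by (rule has_derivative_transform_within_open[OF _ S(1,2)]) (use S(3) in simp)
  then have "(\<lambda>h. X' (L (c' h))) = c'"
    using dc by (rule has_derivative_unique)
  then show ?thesis
    using d\<eta> by (auto simp: fun_eq_iff)
qed

lemma has_derivative_imp_has_vector_derivative:
  assumes "(f has_derivative f') (at t)"
  shows "(f has_vector_derivative f' 1) (at t)"
proof -
  have "f' = (\<lambda>h. h *\<^sub>R f' 1)"
  proof
    fix h show "f' h = h *\<^sub>R f' 1"
      using linear_cmul[OF has_derivative_linear[OF assms], of h 1] by simp
  qed
  then show ?thesis
    using assms unfolding has_vector_derivative_def by metis
qed

lemma has_vector_derivative_compose_dderiv: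
  assumes "smooth_on D f" "\<eta> t \<in> D" "(\<eta> has_vector_derivative v) (at t)"
  shows "((\<lambda>t. f (\<eta> t)) has_vector_derivative dderiv f v (\<eta> t)) (at t)"
  using has_derivative_compose[OF assms(3)[unfolded has_vector_derivative_def] smooth_on_has_derivative[OF assms(1,2)]]
  by (simp add: has_vector_derivative_def linear_cmul[OF linear_dderiv[OF assms(1,2)]])

text \<open>The parameter occurs twice, in the base point and in the direction. Expanding the
  direction in the standard basis separates the two: the first yields the Hessian, the second the
  derivative along the acceleration.\<close>

lemma has_vector_derivative_dderiv_along:
  fixes f :: "real^'n \<Rightarrow> 'b::real_normed_vector"
  assumes D: "open D" and f: "smooth_on D f"
    and T: "open T" "s \<in> T" "\<And>t. t \<in> T \<Longrightarrow> \<eta> t \<in> D"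
    and \<eta>: "(\<eta> has_vector_derivative v s) (at s)"
    and v: "(v has_vector_derivative w) (at s)"
  shows "((\<lambda>t. dderiv f (v t) (\<eta> t)) has_vector_derivative
    dderiv (dderiv f (v s)) (v s) (\<eta> s) + dderiv f w (\<eta> s)) (at s)"
proof -
  let ?e = "\<lambda>i. axis i 1 :: real^'n"
  have vi: "((\<lambda>t. v t $ i) has_vector_derivative w $ i) (at s)" for i
    using bounded_linear.has_vector_derivative[OF bounded_linear_vec_nth v] .
  have dfi: "((\<lambda>t. dderiv f (?e i) (\<eta> t)) has_vector_derivative dderiv (dderiv f (?e i)) (v s) (\<eta> s)) (at s)" for i
    by (rule has_vector_derivative_compose_dderiv[where D=D, OF smooth_on_dderiv[OF f] T(3)[OF T(2)] \<eta>])
  have "((\<lambda>t. \<Sum>i\<in>UNIV. v t $ i *\<^sub>R dderiv f (?e i) (\<eta> t)) has_vector_derivative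
     (\<Sum>i\<in>UNIV. v s $ i *\<^sub>R dderiv (dderiv f (?e i)) (v s) (\<eta> s) + w $ i *\<^sub>R dderiv f (?e i) (\<eta> s))) (at s)"
    using vi dfi
    by (intro has_vector_derivative_sum bounded_bilinear.has_vector_derivative[OF bounded_bilinear_scaleR])
  moreover have "(\<Sum>i\<in>UNIV. w $ i *\<^sub>R dderiv f (?e i) (\<eta> s)) = dderiv f w (\<eta> s)"
    using dderiv_basis_expansion[OF f T(3)[OF T(2)]] by metis
  moreover have "(\<Sum>i\<in>UNIV. v s $ i *\<^sub>R dderiv (dderiv f (?e i)) (v s) (\<eta> s)) = dderiv (dderiv f (v s)) (v s) (\<eta> s)"
  proof -
    have "((\<lambda>x. \<Sum>i\<in>UNIV. v s $ i *\<^sub>R dderiv f (?e i) x) has_derivative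
        (\<lambda>h. \<Sum>i\<in>UNIV. v s $ i *\<^sub>R dderiv (dderiv f (?e i)) h (\<eta> s))) (at (\<eta> s))"
      by (intro has_derivative_sum has_derivative_scaleR_right
          smooth_on_has_derivative[where S=D, OF smooth_on_dderiv[OF f] T(3)[OF T(2)]])
    then have "(dderiv f (v s) has_derivative
        (\<lambda>h. \<Sum>i\<in>UNIV. v s $ i *\<^sub>R dderiv (dderiv f (?e i)) h (\<eta> s))) (at (\<eta> s))"
      by (rule has_derivative_transform_within_open[OF _ D T(3)[OF T(2)]])
        (simp add: dderiv_basis_expansion[OF f, of _ "v s"])
    from dderiv_unique[OF this] show ?thesis by simp
  qed
  ultimately have "((\<lambda>t. \<Sum>i\<in>UNIV. v t $ i *\<^sub>R dderiv f (?e i) (\<eta> t)) has_vector_derivative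
    dderiv (dderiv f (v s)) (v s) (\<eta> s) + dderiv f w (\<eta> s)) (at s)"
    by (simp add: sum.distrib)
  then show ?thesis
    by (rule has_vector_derivative_transform_within_open[OF _ T(1,2)])
      (simp add: dderiv_basis_expansion[OF f T(3)])
qed

lemma second_dderiv_expansion:
  fixes f :: "real^'n \<Rightarrow> 'b::real_normed_vector"
  assumes D: "open D" "u \<in> D" and f: "smooth_on D f"
  shows "dderiv (dderiv f v) w u =
    (\<Sum>i\<in>UNIV. \<Sum>j\<in>UNIV. (w $ i * v $ j) *\<^sub>R dderiv (dderiv f (axis j 1)) (axis i 1) u)"
proof -
  let ?e = "\<lambda>i. axis i 1 :: real^'n"
  have "((\<lambda>x. \<Sum>j\<in>UNIV. v $ j *\<^sub>R dderiv f (?e j) x) has_derivative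
      (\<lambda>h. \<Sum>j\<in>UNIV. v $ j *\<^sub>R dderiv (dderiv f (?e j)) h u)) (at u)"
    by (intro has_derivative_sum has_derivative_scaleR_right smooth_on_has_derivative[where S=D, OF smooth_on_dderiv[OF f] D(2)])
  then have "(dderiv f v has_derivative (\<lambda>h. \<Sum>j\<in>UNIV. v $ j *\<^sub>R dderiv (dderiv f (?e j)) h u)) (at u)"
    by (rule has_derivative_transform_within_open[OF _ D]) (simp add: dderiv_basis_expansion[OF f, of _ v])
  from dderiv_unique[OF this] have "dderiv (dderiv f v) w u = (\<Sum>j\<in>UNIV. v $ j *\<^sub>R dderiv (dderiv f (?e j)) w u)" .
  also have "\<dots> = (\<Sum>j\<in>UNIV. \<Sum>i\<in>UNIV. (w $ i * v $ j) *\<^sub>R dderiv (dderiv f (?e j)) (?e i) u)"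
    unfolding dderiv_basis_expansion[OF smooth_on_dderiv[OF f] D(2), of _ w]
    by (simp add: scaleR_sum_right mult.commute)
  finally show ?thesis
    by (subst sum.swap)
qed

text \<open>The lifted velocity solves the normal equations: it is the inverse Gram matrix applied
  to the products of \<open>c'\<close> with the coordinate vectors. Each factor is differentiable
  along the lift, so the lift has an acceleration.\<close>

lemma lift_second_derivative:
  fixes X :: "real^'n \<Rightarrow> complex^'n"
  assumes D: "open D" and X: "smooth_on D X"
    and inj: "\<And>u. u \<in> D \<Longrightarrow> inj (frechet_derivative X (at u))"
    and T: "open T" "s \<in> T" "\<And>t. t \<in> T \<Longrightarrow> \<eta> t \<in> D" "\<And>t. t \<in> T \<Longrightarrow> X (\<eta> t) = c t"
    and \<eta>: "continuous_on T \<eta>"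
    and c': "\<And>t. t \<in> T \<Longrightarrow> (c has_vector_derivative c' t) (at t)"
    and c2: "(c' has_vector_derivative c2) (at s)"
  shows "\<exists>\<eta>' \<eta>2. (\<forall>t\<in>T. (\<eta> has_vector_derivative \<eta>' t) (at t)) \<and>
    (\<eta>' has_vector_derivative \<eta>2) (at s) \<and>
    (\<forall>t\<in>T. dderiv X (\<eta>' t) (\<eta> t) = c' t) \<and>
    c2 = dderiv (dderiv X (\<eta>' s)) (\<eta>' s) (\<eta> s) + dderiv X \<eta>2 (\<eta> s)"
proof -
  have "\<exists>v. (\<eta> has_vector_derivative v) (at t) \<and> dderiv X v (\<eta> t) = c' t" if t: "t \<in> T" for t
  proof -
    have "inj (\<lambda>v. dderiv X v (\<eta> t))"
      using inj[OF T(3)[OF t]] by (simp add: dderiv_def[abs_def])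
    moreover have "isCont \<eta> t"
      using \<eta> T(1) t by (simp add: continuous_on_eq_continuous_at)
    ultimately have "\<exists>k. (\<eta> has_derivative k) (at t) \<and> (\<forall>h. dderiv X (k h) (\<eta> t) = h *\<^sub>R c' t)"
      by (rule lift_has_derivative[OF smooth_on_has_derivative[OF X T(3)[OF t]] _ _ T(1) t T(4) c'[OF t, unfolded has_vector_derivative_def]])
    then obtain k where k: "(\<eta> has_derivative k) (at t)" "\<And>h. dderiv X (k h) (\<eta> t) = h *\<^sub>R c' t"
      by blast
    from has_derivative_imp_has_vector_derivative[OF k(1)] show ?thesis
      using k(2)[of 1] by auto
  qed
  then obtain \<eta>' where \<eta>': "\<And>t. t \<in> T \<Longrightarrow> (\<eta> has_vector_derivative \<eta>' t) (at t)"
    "\<And>t. t \<in> T \<Longrightarrow> dderiv X (\<eta>' t) (\<eta> t) = c' t"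
    by metis
  let ?g = "induced_metric X" and ?e = "\<lambda>i. axis i 1 :: real^'n"
  have det: "det (?g u) \<noteq> 0" if "u \<in> D" for u
    using induced_metric_det_nonzero[OF X that inj[OF that]] .
  have \<eta>'_eq: "\<eta>' t $ k = (\<Sum>l\<in>UNIV. matrix_inv (?g (\<eta> t)) $ k $ l * (dderiv X (?e l) (\<eta> t) \<bullet> c' t))" if t: "t \<in> T" for t k
  proof -
    have "(?g (\<eta> t) *v \<eta>' t) $ l = dderiv X (?e l) (\<eta> t) \<bullet> c' t" for l
      unfolding \<eta>'(2)[OF t, symmetric] dderiv_basis_expansion[OF X T(3)[OF t], of "\<eta>' t"]
      by (simp add: matrix_vector_mult_def induced_metric_nth inner_sum_right mult.commute)
    moreover have "\<eta>' t = matrix_inv (?g (\<eta> t)) *v (?g (\<eta> t) *v \<eta>' t)"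
      using matrix_inv_mult(2)[OF det[OF T(3)[OF t]]] by (simp add: matrix_vector_mul_assoc)
    ultimately show ?thesis
      by (metis (no_types, lifting) matrix_vector_mult_def sum.cong vec_lambda_beta)
  qed
  have d\<eta>: "\<eta> differentiable (at s)"
    using \<eta>'(1)[OF T(2)] by (auto simp: has_vector_derivative_def differentiable_def)
  have dc': "c' differentiable (at s)"
    using c2 by (auto simp: has_vector_derivative_def differentiable_def)
  have us: "\<eta> s \<in> D" using T by simp
  have dX: "(\<lambda>t. dderiv X v (\<eta> t)) differentiable (at s)" for v
    using differentiable_chain_at[OF d\<eta> smooth_on_differentiable[OF smooth_on_dderiv[OF X] us]]
    by (simp add: o_def)
  have dg: "((\<lambda>u. ?g u $ a $ b) has_derivative (\<lambda>h. dderiv X (?e a) (\<eta> s) \<bullet> dderiv (dderiv X (?e b)) h (\<eta> s) + dderiv (dderiv X (?e a)) h (\<eta> s) \<bullet> dderiv X (?e b) (\<eta> s))) (at (\<eta> s))" for a b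
    unfolding induced_metric_nth
    by (intro has_derivative_inner smooth_on_has_derivative[where S=D] smooth_on_dderiv X us)
  have dG: "(\<lambda>t. matrix_inv (?g (\<eta> t)) $ k $ l) differentiable (at s)" for k l
    using differentiable_chain_at[OF d\<eta>, of "\<lambda>u. matrix_inv (?g u) $ k $ l"]
      has_derivative_matrix_inv[OF D us det dg] by (auto simp: o_def differentiable_def)
  have "(\<lambda>t. \<Sum>k\<in>UNIV. (\<Sum>l\<in>UNIV. matrix_inv (?g (\<eta> t)) $ k $ l * (dderiv X (?e l) (\<eta> t) \<bullet> c' t)) *\<^sub>R ?e k) differentiable (at s)"
    using dG dX dc' by (intro differentiable_sum differentiable_scaleR differentiable_mult differentiable_inner) auto
  then obtain F' where F': "((\<lambda>t. \<Sum>k\<in>UNIV. (\<Sum>l\<in>UNIV. matrix_inv (?g (\<eta> t)) $ k $ l * (dderiv X (?e l) (\<eta> t) \<bullet> c' t)) *\<^sub>R ?e k) has_derivative F') (at s)"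
    unfolding differentiable_def by blast
  have "(\<eta>' has_derivative F') (at s)"
  proof (rule has_derivative_transform_within_open[OF F' T(1,2)])
    fix t assume "t \<in> T"
    have "\<eta>' t = (\<Sum>k\<in>UNIV. \<eta>' t $ k *\<^sub>R ?e k)"
      by (simp add: basis_expansion flip: scalar_mult_eq_scaleR)
    then show "(\<Sum>k\<in>UNIV. (\<Sum>l\<in>UNIV. matrix_inv (?g (\<eta> t)) $ k $ l * (dderiv X (?e l) (\<eta> t) \<bullet> c' t)) *\<^sub>R ?e k) = \<eta>' t"
      using \<eta>'_eq[OF \<open>t \<in> T\<close>] by simp
  qed
  then have \<eta>2: "(\<eta>' has_vector_derivative F' 1) (at s)"
    by (rule has_derivative_imp_has_vector_derivative)
  have "((\<lambda>t. dderiv X (\<eta>' t) (\<eta> t)) has_vector_derivative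
    dderiv (dderiv X (\<eta>' s)) (\<eta>' s) (\<eta> s) + dderiv X (F' 1) (\<eta> s)) (at s)"
    by (rule has_vector_derivative_dderiv_along[OF D X T(1,2,3) \<eta>'(1)[OF T(2)] \<eta>2])
  then have "(c' has_vector_derivative dderiv (dderiv X (\<eta>' s)) (\<eta>' s) (\<eta> s) + dderiv X (F' 1) (\<eta> s)) (at s)"
    by (rule has_vector_derivative_transform_within_open[OF _ T(1,2)]) (use \<eta>'(2) in simp)
  then have "c2 = dderiv (dderiv X (\<eta>' s)) (\<eta>' s) (\<eta> s) + dderiv X (F' 1) (\<eta> s)"
    using c2 vector_derivative_unique_at by blast
  with \<eta>' \<eta>2 show ?thesis by blast
qed


lemma sum_mult_swap:
  fixes a :: "'a \<Rightarrow> 'c::comm_semiring_0"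
  shows "(\<Sum>m\<in>A. a m * (\<Sum>k\<in>B. b m k * c k)) = (\<Sum>k\<in>B. (\<Sum>m\<in>A. a m * b m k) * c k)"
  unfolding sum_distrib_left sum_distrib_right by (subst sum.swap) (simp add: mult_ac)

text \<open>
  The Laplacian is the trace of the intrinsic Hessian, computed here on the velocities of curves:
  along a curve with unit velocity \<open>\<tau>\<close>, the Hessian is the second derivative of the function
  minus its derivative in the direction of the tangential acceleration.
\<close>

lemma laplace_beltrami_frame:
  fixes X :: "real^'n \<Rightarrow> complex^'n" and f :: "real^'n \<Rightarrow> real" and \<eta> :: "'n \<Rightarrow> real \<Rightarrow> real^'n"
  assumes D: "open D" "u \<in> D" and X: "smooth_on D X" and f: "smooth_on D f"
    and inj: "\<And>u. u \<in> D \<Longrightarrow> inj (frechet_derivative X (at u))"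
    and T: "open T" "s \<in> T" "\<And>k t. t \<in> T \<Longrightarrow> \<eta> k t \<in> D" "\<And>k t. t \<in> T \<Longrightarrow> X (\<eta> k t) = c k t"
    and \<eta>: "\<And>k. continuous_on T (\<eta> k)" "\<And>k. \<eta> k s = u"
    and c': "\<And>k t. t \<in> T \<Longrightarrow> (c k has_vector_derivative c' k t) (at t)"
    and c2: "\<And>k. (c' k has_vector_derivative c2 k) (at s)"
    and orth: "\<And>k l. k \<noteq> l \<Longrightarrow> c' k s \<bullet> c' l s = 0" "\<And>k. c' k s \<noteq> 0"
    and \<phi>: "\<And>k t. t \<in> T \<Longrightarrow> ((\<lambda>t. f (\<eta> k t)) has_real_derivative \<phi>' k t) (at t)"
      "\<And>k. (\<phi>' k has_real_derivative \<phi>2 k) (at s)"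
  shows "laplace_beltrami (induced_metric X) f u =
    (\<Sum>k\<in>UNIV. (\<phi>2 k - (\<Sum>j\<in>UNIV. (c2 k \<bullet> c' j s) / (c' j s \<bullet> c' j s) * \<phi>' j s)) / (c' k s \<bullet> c' k s))"
proof -
  let ?g = "induced_metric X u" and ?e = "\<lambda>i. axis i 1 :: real^'n"
  have "\<exists>\<eta>' \<eta>2. (\<forall>t\<in>T. (\<eta> k has_vector_derivative \<eta>' t) (at t)) \<and>
    (\<eta>' has_vector_derivative \<eta>2) (at s) \<and>
    (\<forall>t\<in>T. dderiv X (\<eta>' t) (\<eta> k t) = c' k t) \<and>
    c2 k = dderiv (dderiv X (\<eta>' s)) (\<eta>' s) (\<eta> k s) + dderiv X \<eta>2 (\<eta> k s)" for k
    by (rule lift_second_derivative[OF D(1) X inj T \<eta>(1) c' c2])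
  then obtain \<eta>' \<eta>2 where \<eta>': "\<And>k t. t \<in> T \<Longrightarrow> (\<eta> k has_vector_derivative \<eta>' k t) (at t)"
    "\<And>k. (\<eta>' k has_vector_derivative \<eta>2 k) (at s)"
    "\<And>k t. t \<in> T \<Longrightarrow> dderiv X (\<eta>' k t) (\<eta> k t) = c' k t"
    "\<And>k. c2 k = dderiv (dderiv X (\<eta>' k s)) (\<eta>' k s) (\<eta> k s) + dderiv X (\<eta>2 k) (\<eta> k s)"
    by metis
  define v where "v k = \<eta>' k s" for k
  define \<tau> where "\<tau> k = c' k s" for k
  define n where "n k = \<tau> k \<bullet> \<tau> k" for k
  have n: "n k \<noteq> 0" for k
    using orth(2)[of k] by (simp add: n_def \<tau>_def)
  have \<tau>: "dderiv X (v k) u = \<tau> k" for k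
    using \<eta>'(3)[OF T(2), of k] \<eta>(2)[of k] by (simp add: v_def \<tau>_def)
  have c2_eq: "c2 k = dderiv (dderiv X (v k)) (v k) u + dderiv X (\<eta>2 k) u" for k
    using \<eta>'(4)[of k] \<eta>(2)[of k] by (simp add: v_def)
  have \<phi>'_eq: "\<phi>' k t = dderiv f (\<eta>' k t) (\<eta> k t)" if t: "t \<in> T" for k t
    by (rule vector_derivative_unique_at[OF
          \<phi>(1)[OF t, unfolded has_real_derivative_iff_has_vector_derivative]
          has_vector_derivative_compose_dderiv[where t=t, OF f T(3)[OF t] \<eta>'(1)[OF t]]])
  then have \<phi>'_s: "\<phi>' k s = dderiv f (v k) u" for k
    using T(2) \<eta>(2) by (simp add: v_def)
  have \<phi>2_eq: "\<phi>2 k = dderiv (dderiv f (v k)) (v k) u + dderiv f (\<eta>2 k) u" for k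
  proof -
    have "((\<lambda>t. dderiv f (\<eta>' k t) (\<eta> k t)) has_vector_derivative
        dderiv (dderiv f (\<eta>' k s)) (\<eta>' k s) (\<eta> k s) + dderiv f (\<eta>2 k) (\<eta> k s)) (at s)"
      by (rule has_vector_derivative_dderiv_along[OF D(1) f T(1,2,3) \<eta>'(1)[OF T(2)] \<eta>'(2)])
    then have "(\<phi>' k has_vector_derivative
        dderiv (dderiv f (\<eta>' k s)) (\<eta>' k s) (\<eta> k s) + dderiv f (\<eta>2 k) (\<eta> k s)) (at s)"
      by (rule has_vector_derivative_transform_within_open[OF _ T(1,2)]) (use \<phi>'_eq in simp)
    from vector_derivative_unique_at[OF \<phi>(2)[unfolded has_real_derivative_iff_has_vector_derivative] this]
    show ?thesis
      unfolding v_def \<eta>(2) .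
  qed
  have det: "det ?g \<noteq> 0"
    using induced_metric_det_nonzero[OF X D(2) inj[OF D(2)]] .
  \<comment> \<open>The inverse metric of an orthogonal frame is the sum of the dyads of the
    \<open>v k\<close> divided by the squared lengths. This is verified after multiplication from
    the left by \<open>E\<close>, whose Gram matrix is diagonal with nonzero entries.\<close>
  define Gm :: "real^'n^'n" where "Gm = (\<chi> i j. \<Sum>k\<in>UNIV. v k $ i * v k $ j / n k)"
  define E :: "real^'n^'n" where "E = (\<chi> k i. v k $ i)"
  have gv: "(\<Sum>l\<in>UNIV. ?g $ i $ l * v k $ l) = dderiv X (?e i) u \<bullet> \<tau> k" for i k
    unfolding \<tau>[symmetric] dderiv_basis_expansion[OF X D(2), of "v k"]
    by (simp add: induced_metric_nth inner_sum_right mult.commute)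
  have vgv: "(\<Sum>i\<in>UNIV. v l $ i * (\<Sum>m\<in>UNIV. ?g $ i $ m * v k $ m)) = (if k = l then n k else 0)" for k l
  proof -
    have "(\<Sum>i\<in>UNIV. v l $ i * (dderiv X (?e i) u \<bullet> \<tau> k)) = \<tau> l \<bullet> \<tau> k"
      unfolding \<tau>[of l, symmetric] dderiv_basis_expansion[OF X D(2), of "v l"]
      by (simp add: inner_sum_left)
    then show ?thesis
      unfolding gv using orth(1)[of k l] by (auto simp: n_def \<tau>_def inner_commute)
  qed
  have EgGm: "E ** (?g ** Gm) = E"
  proof -
    have "(E ** (?g ** Gm)) $ l $ j = v l $ j" for l j
    proof -
      have "(E ** (?g ** Gm)) $ l $ j =
        (\<Sum>i\<in>UNIV. v l $ i * (\<Sum>m\<in>UNIV. ?g $ i $ m * (\<Sum>k\<in>UNIV. v k $ m * v k $ j / n k)))"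
        by (simp add: matrix_matrix_mult_def E_def Gm_def)
      also have "\<dots> = (\<Sum>i\<in>UNIV. v l $ i * (\<Sum>k\<in>UNIV. (\<Sum>m\<in>UNIV. ?g $ i $ m * v k $ m) * (v k $ j / n k)))"
        by (simp only: sum_mult_swap flip: times_divide_eq_right)
      also have "\<dots> = (\<Sum>k\<in>UNIV. (\<Sum>i\<in>UNIV. v l $ i * (\<Sum>m\<in>UNIV. ?g $ i $ m * v k $ m)) * (v k $ j / n k))"
        by (rule sum_mult_swap)
      also have "\<dots> = v l $ j"
      proof -
        have "(if k = l then n k else 0) * (v k $ j / n k) = (if k = l then v k $ j else 0)" for k
          using n[of l] by simp
        then show ?thesis
          unfolding vgv by simp
      qed
      finally show ?thesis .
    qed
    then show ?thesis by (simp add: vec_eq_iff E_def)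
  qed
  have "invertible E"
  proof -
    have entry: "(E ** (?g ** transpose E)) $ l $ k = (if k = l then n k else 0)" for k l
      using vgv[where k=k and l=l] by (simp add: matrix_matrix_mult_def E_def transpose_def)
    have "det (E ** (?g ** transpose E)) = (\<Prod>i\<in>UNIV. (E ** (?g ** transpose E)) $ i $ i)"
      by (rule det_diagonal) (simp only: entry, simp)
    then have "det E * (det ?g * det (transpose E)) \<noteq> 0"
      using n by (simp add: entry det_mul)
    then show ?thesis
      by (simp add: invertible_det_nz)
  qed
  then have "?g ** Gm = mat 1"
    using EgGm by (metis invertible_def matrix_mul_assoc matrix_mul_lid)
  then have G: "matrix_inv ?g = Gm"
    using matrix_inv_mult(2)[OF det] by (metis matrix_mul_assoc matrix_mul_lid matrix_mul_rid)

  let ?D2f = "\<lambda>i j. dderiv (dderiv f (?e j)) (?e i) u" and ?D2X = "\<lambda>i j. dderiv (dderiv X (?e j)) (?e i) u"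
  \<comment> \<open>\<open>S w\<close> differentiates \<open>f\<close> in the direction of the
    tangential part of \<open>w\<close>; on tangent vectors it is the differential of
    \<open>f\<close>.\<close>
  define S where "S w = (\<Sum>p\<in>UNIV. (w \<bullet> \<tau> p) / n p * dderiv f (v p) u)" for w
  have S: "(\<Sum>k\<in>UNIV. \<Sum>l\<in>UNIV. (w \<bullet> dderiv X (?e l) u) * Gm $ l $ k * dderiv f (?e k) u) = S w" for w
  proof -
    have "S w = (\<Sum>p\<in>UNIV. (\<Sum>l\<in>UNIV. v p $ l * (w \<bullet> dderiv X (?e l) u)) / n p * (\<Sum>k\<in>UNIV. v p $ k * dderiv f (?e k) u))"
      unfolding S_def \<tau>[symmetric] dderiv_basis_expansion[OF X D(2), of "v _"] dderiv_basis_expansion[OF f D(2), of "v _"]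
      by (simp add: inner_sum_right)
    also have "\<dots> = (\<Sum>p\<in>UNIV. \<Sum>l\<in>UNIV. \<Sum>k\<in>UNIV. (w \<bullet> dderiv X (?e l) u) * (v p $ l * v p $ k / n p) * dderiv f (?e k) u)"
      by (simp add: sum_distrib_left sum_distrib_right sum_divide_distrib mult_ac)
    also have "\<dots> = (\<Sum>p\<in>UNIV. \<Sum>k\<in>UNIV. \<Sum>l\<in>UNIV. (w \<bullet> dderiv X (?e l) u) * (v p $ l * v p $ k / n p) * dderiv f (?e k) u)"
      by (intro sum.cong refl sum.swap)
    also have "\<dots> = (\<Sum>k\<in>UNIV. \<Sum>p\<in>UNIV. \<Sum>l\<in>UNIV. (w \<bullet> dderiv X (?e l) u) * (v p $ l * v p $ k / n p) * dderiv f (?e k) u)"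
      by (rule sum.swap)
    also have "\<dots> = (\<Sum>k\<in>UNIV. \<Sum>l\<in>UNIV. \<Sum>p\<in>UNIV. (w \<bullet> dderiv X (?e l) u) * (v p $ l * v p $ k / n p) * dderiv f (?e k) u)"
      by (intro sum.cong refl sum.swap)
    finally show ?thesis
      by (simp add: Gm_def sum_distrib_left sum_distrib_right)
  qed
  have S_add: "S (w + w') = S w + S w'" for w w'
    by (simp add: S_def inner_add_left add_divide_distrib distrib_right sum.distrib)
  interpret S: linear S
    by (rule linearI) (simp_all add: S_add, simp add: S_def sum_distrib_left mult.assoc)
  have S_DX: "S (dderiv X w u) = dderiv f w u" for w
  proof -
    have gGm: "(\<Sum>l\<in>UNIV. ?g $ a $ l * Gm $ l $ k) = (if a = k then 1 else 0)" for a k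
      using arg_cong[OF \<open>?g ** Gm = mat 1\<close>, of "\<lambda>M. M $ a $ k"] by (simp add: matrix_matrix_mult_def mat_def)
    have Se: "S (dderiv X (?e a) u) = dderiv f (?e a) u" for a
      unfolding S[symmetric] induced_metric_nth[symmetric]
      by (simp add: gGm if_distrib[where f="\<lambda>x. x * _"] flip: sum_distrib_right cong: if_cong)
    have "S (dderiv X w u) = (\<Sum>a\<in>UNIV. w $ a * S (dderiv X (?e a) u))"
      unfolding dderiv_basis_expansion[OF X D(2), of w] by (simp add: S.sum S.scale)
    then show ?thesis
      unfolding dderiv_basis_expansion[OF f D(2), of w] Se by simp
  qed
  have "laplace_beltrami (induced_metric X) f u =
      (\<Sum>i\<in>UNIV. \<Sum>j\<in>UNIV. Gm $ i $ j * (?D2f i j - S (?D2X i j)))"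
    using laplace_beltrami_eq[OF D X f inj] by (simp only: G S)
  also have "\<dots> = (\<Sum>i\<in>UNIV. \<Sum>j\<in>UNIV. \<Sum>m\<in>UNIV. (v m $ i * v m $ j) * (?D2f i j - S (?D2X i j)) / n m)"
    by (simp add: Gm_def sum_distrib_right)
  also have "\<dots> = (\<Sum>i\<in>UNIV. \<Sum>m\<in>UNIV. \<Sum>j\<in>UNIV. (v m $ i * v m $ j) * (?D2f i j - S (?D2X i j)) / n m)"
    by (intro sum.cong refl sum.swap)
  also have "\<dots> = (\<Sum>m\<in>UNIV. \<Sum>i\<in>UNIV. \<Sum>j\<in>UNIV. (v m $ i * v m $ j) * (?D2f i j - S (?D2X i j)) / n m)"
    by (rule sum.swap)
  also have "\<dots> = (\<Sum>m\<in>UNIV. (dderiv (dderiv f (v m)) (v m) u - S (dderiv (dderiv X (v m)) (v m) u)) / n m)"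
  proof (rule sum.cong[OF refl])
    fix m
    show "(\<Sum>i\<in>UNIV. \<Sum>j\<in>UNIV. (v m $ i * v m $ j) * (?D2f i j - S (?D2X i j)) / n m) =
        (dderiv (dderiv f (v m)) (v m) u - S (dderiv (dderiv X (v m)) (v m) u)) / n m"
      unfolding second_dderiv_expansion[OF D X, of "v m" "v m"] second_dderiv_expansion[OF D f, of "v m" "v m"] S.sum S.scale
      by (simp add: sum_subtractf right_diff_distrib diff_divide_distrib sum_divide_distrib)
  qed
  also have "\<dots> = (\<Sum>m\<in>UNIV. (\<phi>2 m - S (c2 m)) / n m)"
    unfolding \<phi>2_eq c2_eq S.add S_DX by simp
  finally show ?thesis
    unfolding S_def n_def \<tau>_def \<phi>'_s .
qed

subsection \<open>Hermitian product and unitary matrices\<close>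

definition herm :: "complex^'n \<Rightarrow> complex^'n \<Rightarrow> complex" where
  "herm z w = (\<Sum>i\<in>UNIV. z $ i * cnj (w $ i))"

text \<open>For unitary \<open>U\<close> and fixed nonzero \<open>c\<close> the image is a
  Lagrangian plane, turned by the phase of \<open>c\<close>. With \<open>c\<close> and
  \<open>y\<close> as separate arguments the map is real bilinear, so the product rule applies to
  moving phases.\<close>

definition uembed :: "complex^'n^'n \<Rightarrow> complex \<Rightarrow> real^'n \<Rightarrow> complex^'n" where
  "uembed U c y = c *s (U *v real_vec y)"

lemma inner_herm: "z \<bullet> w = Re (herm z w)" for z w :: "complex^'n"
  by (simp add: herm_def inner_vec_def inner_complex_def)

lemma symplectic_form_herm: "symplectic_form z w = - Im (herm z w)"
  by (simp add: symplectic_form_def herm_def sum_negf[symmetric] algebra_simps)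

lemma herm_smult: "herm (c *s z) (d *s w) = c * cnj d * herm z w"
  by (simp add: herm_def sum_distrib_left mult_ac)

lemma herm_real_vec: "herm (real_vec y) (real_vec z) = complex_of_real (y \<bullet> z)"
  by (simp add: herm_def real_vec_def inner_vec_def)

lemma map_matrix_nth [simp]: "map_matrix f A $ i $ j = f (A $ i $ j)"
  by (simp add: map_matrix_def)

lemma unitary_columns:
  assumes "unitary_matrix U"
  shows "(\<Sum>i\<in>UNIV. cnj (U $ i $ j) * U $ i $ k) = (if j = k then 1 else 0)"
proof -
  have "(map_matrix cnj (transpose U) ** U) $ j $ k = mat 1 $ j $ k"
    using assms unfolding unitary_matrix_def by simp
  then show ?thesis
    by (simp add: matrix_matrix_mult_def mat_def transpose_def)
qed

lemma unitary_rows: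
  assumes "unitary_matrix U"
  shows "(\<Sum>i\<in>UNIV. U $ j $ i * cnj (U $ k $ i)) = (if j = k then 1 else 0)"
proof -
  have "(U ** map_matrix cnj (transpose U)) $ j $ k = mat 1 $ j $ k"
    using assms unfolding unitary_matrix_def by simp
  then show ?thesis
    by (simp add: matrix_matrix_mult_def mat_def transpose_def)
qed

lemma herm_unitary:
  assumes "unitary_matrix U"
  shows "herm (U *v z) (U *v w) = herm z w"
proof -
  have "herm (U *v z) (U *v w) = (\<Sum>i\<in>UNIV. \<Sum>k\<in>UNIV. \<Sum>j\<in>UNIV. (z $ k * cnj (w $ j)) * (cnj (U $ i $ j) * U $ i $ k))"
    unfolding herm_def matrix_vector_mult_def vec_lambda_beta cnj_sum sum_product by (simp add: mult_ac)
  also have "\<dots> = (\<Sum>k\<in>UNIV. \<Sum>i\<in>UNIV. \<Sum>j\<in>UNIV. (z $ k * cnj (w $ j)) * (cnj (U $ i $ j) * U $ i $ k))"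
    by (rule sum.swap)
  also have "\<dots> = (\<Sum>k\<in>UNIV. \<Sum>j\<in>UNIV. \<Sum>i\<in>UNIV. (z $ k * cnj (w $ j)) * (cnj (U $ i $ j) * U $ i $ k))"
    by (intro sum.cong refl sum.swap)
  also have "\<dots> = (\<Sum>k\<in>UNIV. \<Sum>j\<in>UNIV. (z $ k * cnj (w $ j)) * (if j = k then 1 else 0))"
    by (simp add: unitary_columns[OF assms] flip: sum_distrib_left)
  also have "\<dots> = herm z w"
    by (simp add: herm_def if_distrib[where f="\<lambda>x. _ * x"] cong: if_cong)
  finally show ?thesis .
qed

lemma herm_uembed:
  assumes "unitary_matrix U"
  shows "herm (uembed U c y) (uembed U d z) = c * cnj d * complex_of_real (y \<bullet> z)"
  by (simp add: uembed_def herm_smult herm_unitary[OF assms] herm_real_vec)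

lemma inner_uembed:
  assumes "unitary_matrix U"
  shows "uembed U c y \<bullet> uembed U d z = (c \<bullet> d) * (y \<bullet> z)"
  by (simp add: inner_herm herm_uembed[OF assms] inner_complex_def)

lemma real_vec_linear: "real_vec (x + y) = real_vec x + real_vec y" "real_vec (c *\<^sub>R x) = c *\<^sub>R real_vec x"
  by (simp_all add: real_vec_def vec_eq_iff scaleR_conv_of_real[where 'a=complex])

lemma bounded_bilinear_uembed:
  assumes U: "unitary_matrix U"
  shows "bounded_bilinear (uembed U)"
proof -
  have "norm (uembed U c y) = norm c * norm y" for c y
    by (simp add: norm_eq_sqrt_inner inner_uembed[OF U] real_sqrt_mult)
  moreover have "uembed U c (y + z) = uembed U c y + uembed U c z" "uembed U c (t *\<^sub>R y) = t *\<^sub>R uembed U c y" for c y z t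
    by (simp_all add: uembed_def real_vec_linear matrix_vector_right_distrib vec_eq_iff distrib_left)
      (simp add: matrix_vector_mult_def flip: scaleR_sum_right)
  moreover have "uembed U (c + d) y = uembed U c y + uembed U d y" "uembed U (t *\<^sub>R c) y = t *\<^sub>R uembed U c y" for c d y t
    by (simp_all add: uembed_def vec_eq_iff distrib_right)
  ultimately show ?thesis
    by (intro bounded_bilinear.intro exI[of _ 1]) auto
qed

lemma det_unitary_nonzero:
  assumes "unitary_matrix U"
  shows "det U \<noteq> 0"
  using assms unfolding unitary_matrix_def invertible_det_nz[symmetric] invertible_def by blast

subsection \<open>Tangent spaces\<close>

lemma local_parametrizationD:
  assumes "local_parametrization M D X"
  shows "open D" "smooth_on D X" "\<And>u. u \<in> D \<Longrightarrow> inj (frechet_derivative X (at u))"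
    "openin (top_of_set M) (X ` D)" "X ` D \<subseteq> M" "\<exists>Y. homeomorphism D (X ` D) X Y"
  using assms
  by (simp_all add: local_parametrization_def) (use openin_imp_subset in blast)

text \<open>The image of the parametrization is open in \<open>M\<close>, so the curve stays in it
  for times near \<open>s\<close> and can be lifted there.\<close>

lemma submanifold_velocity:
  fixes X :: "real^'n \<Rightarrow> complex^'n" and c :: "real \<Rightarrow> complex^'n"
  assumes X: "local_parametrization M D X"
    and T: "open T" "s \<in> T" "\<And>t. t \<in> T \<Longrightarrow> c t \<in> M" "continuous_on T c"
    and u: "u \<in> D" "X u = c s"
    and c: "(c has_vector_derivative c') (at s)"
  shows "\<exists>w. c' = dderiv X w u"
proof -
  have D: "open D" "smooth_on D X" "\<And>u. u \<in> D \<Longrightarrow> inj (frechet_derivative X (at u))"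
    and op: "openin (top_of_set M) (X ` D)"
    using local_parametrizationD[OF X] by blast+
  obtain Y where Y: "homeomorphism D (X ` D) X Y"
    using local_parametrizationD(6)[OF X] by blast
  obtain W where W: "open W" "X ` D = M \<inter> W"
    using op unfolding openin_open by blast
  have "X u \<in> X ` D" using u(1) by blast
  then have "c s \<in> W" unfolding W(2) u(2) by blast
  define T' where "T' = T \<inter> c -` W"
  have T': "open T'" "s \<in> T'" "T' \<subseteq> T"
    unfolding T'_def using T(2) \<open>c s \<in> W\<close> continuous_open_preimage[OF T(4,1) W(1)] by auto
  have inXD: "c t \<in> X ` D" if "t \<in> T'" for t
    unfolding W(2) using that T(3) by (simp add: T'_def)
  define \<eta> where "\<eta> t = Y (c t)" for t
  have \<eta>: "X (\<eta> t) = c t" "\<eta> t \<in> D" if "t \<in> T'" for t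
    using Y inXD[OF that] unfolding homeomorphism_def \<eta>_def by auto
  have "\<eta> s = u"
    using Y u unfolding homeomorphism_def \<eta>_def by auto
  have "continuous_on T' \<eta>"
    unfolding \<eta>_def
  proof (rule continuous_on_compose2[of "X ` D" Y _ c])
    show "continuous_on (X ` D) Y"
      using Y unfolding homeomorphism_def by blast
    show "continuous_on T' c"
      by (rule continuous_on_subset[OF T(4) T'(3)])
    show "c ` T' \<subseteq> X ` D"
      using inXD by blast
  qed
  then have "isCont \<eta> s"
    using T' by (simp add: continuous_on_eq_continuous_at)
  moreover have "inj (\<lambda>v. dderiv X v (\<eta> s))"
    using D(3)[OF \<eta>(2)[OF T'(2)]] by (simp add: dderiv_def[abs_def])
  ultimately have "\<exists>\<eta>'. (\<eta> has_derivative \<eta>') (at s) \<and> (\<forall>h. dderiv X (\<eta>' h) (\<eta> s) = h *\<^sub>R c')"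
    by (intro lift_has_derivative[OF smooth_on_has_derivative[OF D(2) \<eta>(2)[OF T'(2)]] _ _ T'(1,2) \<eta>(1) c[unfolded has_vector_derivative_def]])
  then obtain \<eta>' where "\<And>h. dderiv X (\<eta>' h) u = h *\<^sub>R c'"
    unfolding \<open>\<eta> s = u\<close> by blast
  from this[of 1] show ?thesis
    by (metis scaleR_one)
qed

text \<open>Each vector in the union over all parametrizations is the velocity of a curve in
  \<open>M\<close>, and a single parametrization already captures all such velocities.\<close>

lemma tangent_space_eq:
  assumes X: "local_parametrization M D X" "u \<in> D" "X u = p"
  shows "tangent_space M p = range (\<lambda>w. dderiv X w u)"
proof
  show "range (\<lambda>w. dderiv X w u) \<subseteq> tangent_space M p"
    unfolding tangent_space_def dderiv_def using X by blast
  show "tangent_space M p \<subseteq> range (\<lambda>w. dderiv X w u)"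
  proof
    fix y assume "y \<in> tangent_space M p"
    then obtain D' X' u' v where X': "local_parametrization M D' X'" "u' \<in> D'" "X' u' = p"
      and y: "y = frechet_derivative X' (at u') v"
      unfolding tangent_space_def mem_Collect_eq by (elim exE conjE, intro that)
    have D': "open D'" "smooth_on D' X'" "X' ` D' \<subseteq> M"
      using local_parametrizationD[OF X'(1)] by blast+
    define T where "T = (\<lambda>t::real. u' + t *\<^sub>R v) -` D'"
    have T: "open T" "0 \<in> T"
      using open_vimage[OF D'(1), of "\<lambda>t::real. u' + t *\<^sub>R v"] X'(2)
      by (simp_all add: T_def continuous_intros)
    have "continuous_on T (\<lambda>t. X' (u' + t *\<^sub>R v))"
      using smooth_on_continuous_on[OF D'(2)]
      by (rule continuous_on_compose2) (auto intro!: continuous_intros simp: T_def)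
    moreover have "((\<lambda>t. X' (u' + t *\<^sub>R v)) has_vector_derivative dderiv X' v (u' + 0 *\<^sub>R v)) (at 0)"
      by (rule has_vector_derivative_compose_dderiv[OF D'(2)])
        (use X'(2) in \<open>auto intro!: derivative_eq_intros\<close>)
    moreover from this have "((\<lambda>t. X' (u' + t *\<^sub>R v)) has_vector_derivative y) (at 0)"
      by (simp add: y dderiv_def)
    moreover have "X' (u' + t *\<^sub>R v) \<in> M" if "t \<in> T" for t
      using that D'(3) by (auto simp: T_def)
    moreover have "X u = X' (u' + 0 *\<^sub>R v)"
      using X(3) X'(3) by simp
    ultimately have "\<exists>w. y = dderiv X w u"
      by (intro submanifold_velocity[OF X(1) T _ _ X(2)])
    then show "y \<in> range (\<lambda>w. dderiv X w u)"
      by blast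
  qed
qed

lemma velocity_in_tangent_space:
  assumes M: "submanifold M"
    and T: "open T" "s \<in> T" "\<And>t. t \<in> T \<Longrightarrow> c t \<in> M" "continuous_on T c"
    and c: "(c has_vector_derivative c') (at s)"
  shows "c' \<in> tangent_space M (c s)"
proof -
  obtain D X where X: "local_parametrization M D X" "c s \<in> X ` D"
    using M T(2,3) unfolding submanifold_def by blast
  then obtain u where u: "u \<in> D" "X u = c s" by auto
  show ?thesis
    unfolding tangent_space_eq[OF X(1) u]
    using submanifold_velocity[OF X(1) T u c] by blast
qed

lemma tangent_space_subspace_dim:
  fixes M :: "(complex^'n) set"
  assumes M: "submanifold M" and p: "p \<in> M"
  shows "subspace (tangent_space M p)" "dim (tangent_space M p) = CARD('n)"
proof -
  obtain D X where X: "local_parametrization M D X" and "p \<in> X ` D"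
    using M p unfolding submanifold_def by blast
  then obtain u where u: "u \<in> D" "X u = p" by blast
  have D: "smooth_on D X" "inj (\<lambda>w. dderiv X w u)"
    using local_parametrizationD(2,3)[OF X] u(1) by (simp_all add: dderiv_def[abs_def])
  have lin: "linear (\<lambda>w. dderiv X w u)"
    by (rule linear_dderiv[OF D(1) u(1)])
  show "subspace (tangent_space M p)"
    unfolding tangent_space_eq[OF X u] by (rule linear_subspace_image[OF lin subspace_UNIV])
  show "dim (tangent_space M p) = CARD('n)"
    unfolding tangent_space_eq[OF X u] using dim_image_eq[OF lin, of UNIV] D(2) by simp
qed

subsection \<open>The Lagrangian angle\<close>

lemma orthonormal_basis_of_tangent_space:
  fixes E :: "'n \<Rightarrow> complex^'n"
  assumes T: "subspace T" "dim T = CARD('n)"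
    and E: "\<And>i. E i \<in> T" "\<And>i j. E i \<bullet> E j = (if i = j then 1 else 0)"
  shows "orthonormal_basis_of T E"
proof -
  have inj: "inj E"
  proof (rule injI, rule ccontr)
    fix i j assume "E i = E j" "i \<noteq> j"
    then show False
      using E(2)[of i j] E(2)[of j j] by simp
  qed
  have "pairwise orthogonal (range E)"
    using E(2) by (auto simp: pairwise_def orthogonal_def)
  moreover have "0 \<notin> range E"
  proof
    assume "0 \<in> range E"
    then obtain i where "E i = 0" by auto
    then show False
      using E(2)[of i i] by simp
  qed
  ultimately have "independent (range E)"
    by (rule pairwise_orthogonal_independent)
  moreover have "card (range E) = CARD('n)"
    using inj by (rule card_image)
  moreover have "range E \<subseteq> T" using E(1) by auto
  ultimately have "T \<subseteq> span (range E)" "range E \<subseteq> T"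
    using T(2) card_eq_dim[of "range E" T] by auto
  then have "span (range E) = T"
    using span_minimal[OF _ T(1)] by blast
  then show ?thesis
    using E(2) by (simp add: orthonormal_basis_of_def)
qed

text \<open>Orthonormal bases of the same real space differ by a real orthogonal matrix, whose
  determinant is 1 or -1. Squaring removes this ambiguity of the Lagrangian angle.\<close>

lemma det_square_orthonormal_bases:
  fixes e E :: "'n \<Rightarrow> complex^'n"
  assumes e: "orthonormal_basis_of T e" and E: "orthonormal_basis_of T E"
  shows "(det (\<chi> i j. e j $ i))\<^sup>2 = (det (\<chi> i j. E j $ i))\<^sup>2"
proof -
  have e': "\<And>i j. e i \<bullet> e j = (if i = j then 1 else 0)" "span (range e) = T"
    and E': "\<And>i j. E i \<bullet> E j = (if i = j then 1 else 0)" "span (range E) = T"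
    using e E unfolding orthonormal_basis_of_def by auto
  have expand: "E k = (\<Sum>j\<in>UNIV. (e j \<bullet> E k) *\<^sub>R e j)" for k
  proof -
    \<comment> \<open>The remainder of the expansion lies in the span of the \<open>e j\<close> and
      is orthogonal to it.\<close>
    define y where "y = E k - (\<Sum>j\<in>UNIV. (e j \<bullet> E k) *\<^sub>R e j)"
    have "y \<in> span (range e)"
      unfolding y_def using e'(2) E'(2)
      by (intro span_diff span_sum span_scale) (auto intro: span_base)
    moreover have "orthogonal y (e j)" for j
    proof -
      have "e j \<bullet> (\<Sum>i\<in>UNIV. (e i \<bullet> E k) *\<^sub>R e i) = (\<Sum>i\<in>UNIV. (e i \<bullet> E k) * (if j = i then 1 else 0))"
        by (simp add: inner_sum_right e'(1))
      then have "e j \<bullet> y = 0"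
        by (simp add: y_def inner_diff_right if_distrib[where f="\<lambda>x. _ * x"] cong: if_cong)
      then show ?thesis
        by (simp add: orthogonal_def inner_commute)
    qed
    ultimately have "orthogonal y y"
      using orthogonal_to_span[of y "range e" y] by auto
    then show ?thesis
      by (simp add: orthogonal_def y_def)
  qed
  define Q :: "complex^'n^'n" where "Q = (\<chi> j k. complex_of_real (e j \<bullet> E k))"
  have "(\<chi> i j. E j $ i) = (\<chi> i j. e j $ i) ** Q"
  proof -
    have "E j $ i = (\<Sum>k\<in>UNIV. e k $ i * complex_of_real (e k \<bullet> E j))" for i j
      by (subst expand) (simp add: scaleR_conv_of_real[where 'a=complex] mult.commute)
    then show ?thesis
      by (simp add: vec_eq_iff matrix_matrix_mult_def Q_def)
  qed
  moreover have "transpose Q ** Q = mat 1"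
  proof -
    have "(\<Sum>j\<in>UNIV. (e j \<bullet> E i) * (e j \<bullet> E k)) = (if i = k then 1 else 0)" for i k
    proof -
      have "E i \<bullet> E k = (\<Sum>j\<in>UNIV. (e j \<bullet> E i) *\<^sub>R e j) \<bullet> E k"
        by (rule arg_cong[OF expand[of i], of "\<lambda>z. z \<bullet> E k"])
      then show ?thesis
        using E'(1) by (simp add: inner_sum_left)
    qed
    from arg_cong[OF this, of complex_of_real] show ?thesis
      by (simp add: vec_eq_iff matrix_matrix_mult_def Q_def transpose_def mat_def cong: if_cong)
  qed
  from arg_cong[OF this, of det] have "(det Q)\<^sup>2 = 1"
    by (simp add: det_mul power2_eq_square)
  ultimately show ?thesis
    by (simp add: det_mul power_mult_distrib)
qed

subsection \<open>Charts by spheres in a turning Lagrangian plane\<close>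

lemma smooth_on_has_vector_derivative:
  assumes "smooth_on I f" "s \<in> I"
  shows "(f has_vector_derivative dderiv f 1 s) (at s)"
  using has_derivative_imp_has_vector_derivative[OF smooth_on_has_derivative[OF assms]] .

lemma smooth_on_has_real_derivative:
  assumes "smooth_on I f" "s \<in> I"
  shows "(f has_real_derivative dderiv f 1 s) (at s)"
  using smooth_on_has_vector_derivative[OF assms]
  by (simp add: has_real_derivative_iff_has_vector_derivative)

section \<open>Great circles and orthonormal frames on the unit sphere\<close>

definition great_circle :: "real \<Rightarrow> real^'n \<Rightarrow> real^'n \<Rightarrow> real \<Rightarrow> real^'n" where
  "great_circle \<kappa> x e t = cos (\<kappa> * t) *\<^sub>R x + sin (\<kappa> * t) *\<^sub>R e"

definition great_circle' :: "real \<Rightarrow> real^'n \<Rightarrow> real^'n \<Rightarrow> real \<Rightarrow> real^'n" where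
  "great_circle' \<kappa> x e t = (- \<kappa> * sin (\<kappa> * t)) *\<^sub>R x + (\<kappa> * cos (\<kappa> * t)) *\<^sub>R e"

lemma great_circle_0 [simp]: "great_circle \<kappa> x e 0 = x" "great_circle' \<kappa> x e 0 = \<kappa> *\<^sub>R e"
  by (simp_all add: great_circle_def great_circle'_def)

lemma has_vector_derivative_great_circle:
  "(great_circle \<kappa> x e has_vector_derivative great_circle' \<kappa> x e t) (at t)"
  "(great_circle' \<kappa> x e has_vector_derivative - (\<kappa>\<^sup>2) *\<^sub>R great_circle \<kappa> x e t) (at t)"
  unfolding great_circle_def[abs_def] great_circle'_def[abs_def]
  by (auto intro!: derivative_eq_intros simp: power2_eq_square algebra_simps)

lemma great_circle_in_sphere:
  assumes "x \<in> sphere 0 1" "e \<in> sphere 0 1" "x \<bullet> e = 0"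
  shows "great_circle \<kappa> x e t \<in> sphere 0 1"
proof -
  have "great_circle \<kappa> x e t \<bullet> great_circle \<kappa> x e t = (cos (\<kappa> * t))\<^sup>2 * (x \<bullet> x) + (sin (\<kappa> * t))\<^sup>2 * (e \<bullet> e)"
    using assms(3) by (simp add: great_circle_def inner_add_left inner_add_right inner_commute power2_eq_square)
  also have "\<dots> = 1"
    using assms by (simp add: norm_eq_1 dist_norm)
  finally show ?thesis
    by (simp add: norm_eq_1)
qed

text \<open>The frame is indexed by the coordinate type itself, so that it can form the columns of a
  square matrix. Parseval's identity is included for the sums over the leaf directions.\<close>

lemma orthonormal_frame:
  fixes x :: "real^'n"
  assumes "x \<in> sphere 0 1"
  obtains e :: "'n \<Rightarrow> real^'n" where "e k0 = x" "\<And>i j. e i \<bullet> e j = (if i = j then 1 else 0)"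
    "\<And>v w. (\<Sum>k\<in>UNIV. (v \<bullet> e k) * (w \<bullet> e k)) = v \<bullet> w"
proof -
  obtain B :: "real^'n^'n" where B: "orthogonal_matrix B" "B *v axis k0 1 = x"
    using orthogonal_matrix_exists_basis[of x k0] assms by auto
  have ot: "orthogonal_transformation ((*v) B)" "orthogonal_transformation ((*v) (transpose B))"
    using B(1) orthogonal_transformation_matrix[of "(*v) B"] orthogonal_transformation_matrix[of "(*v) (transpose B)"]
    by (simp_all add: orthogonal_matrix_transpose)
  have "(B *v axis i 1) \<bullet> (B *v axis j 1) = (if i = j then 1 else 0)" for i j
    using ot(1) unfolding orthogonal_transformation_def by (simp add: inner_axis_axis)
  moreover have "(\<Sum>k\<in>UNIV. (v \<bullet> (B *v axis k 1)) * (w \<bullet> (B *v axis k 1))) = v \<bullet> w" for v w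
  proof -
    have "v \<bullet> (B *v axis k 1) = (transpose B *v v) $ k" for v k
      by (simp add: inner_axis flip: dot_lmul_matrix)
    then have "(\<Sum>k\<in>UNIV. (v \<bullet> (B *v axis k 1)) * (w \<bullet> (B *v axis k 1))) = (transpose B *v v) \<bullet> (transpose B *v w)"
      by (simp add: inner_vec_def)
    then show ?thesis
      using ot(2) unfolding orthogonal_transformation_def by simp
  qed
  ultimately show thesis
    using that[of "\<lambda>k. B *v axis k 1"] B(2) by blast
qed

text \<open>For \<open>w = 0\<close> any unit vector orthogonal to \<open>x\<close> serves, with
  speed 0; a second dimension provides one.\<close>

lemma unit_direction:
  fixes x w :: "real^'n"
  assumes n: "CARD('n) \<ge> 2" and x: "x \<in> sphere 0 1" and w: "x \<bullet> w = 0"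
  obtains \<kappa> e where "e \<in> sphere 0 1" "x \<bullet> e = 0" "w = \<kappa> *\<^sub>R e"
proof (cases "w = 0")
  case True
  obtain k0 k1 :: 'n where k: "k0 \<noteq> k1"
    using n card_le_Suc0_iff_eq[of "UNIV :: 'n set"] by auto
  obtain f where f: "f k0 = x" "\<And>i j. f i \<bullet> f j = (if i = j then 1 else 0)"
    using orthonormal_frame[OF x] by metis
  then show thesis
    using that[of "f k1" 0] True k f(2)[of k0 k1] f(2)[of k1 k1] by (simp add: norm_eq_1)
next
  case False
  then show thesis
    using that[of "w /\<^sub>R norm w" "norm w"] w by simp
qed

text \<open>
  With \<open>p\<close> and \<open>q\<close> defined below, \<open>\<partial>\<^sub>s F = e\<^sup>i\<^sup>\<theta> U ((p + i q) x + v)\<close> where \<open>v\<close> is the part of \<open>a\<close>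
  orthogonal to \<open>x\<close>; so \<open>P = p\<^sup>2 + q\<^sup>2 \<noteq> 0\<close> says that \<open>F\<close> is an immersion.
\<close>

locale sphere_chart =
  fixes M :: "(complex^'n) set" and U :: "complex^'n^'n" and I :: "real set"
    and r \<theta> :: "real \<Rightarrow> real" and a :: "real \<Rightarrow> real^'n" and V :: "real \<Rightarrow> complex^'n"
    and A :: "(real \<times> (real^'n)) set"
  assumes submanifold: "submanifold M"
    and U: "unitary_matrix U"
    and I: "open I"
    and smooth: "smooth_on I r" "smooth_on I \<theta>" "smooth_on I a"
    and r_pos: "s \<in> I \<Longrightarrow> r s > 0"
    and dV: "s \<in> I \<Longrightarrow> (V has_vector_derivative uembed U (cis (\<theta> s)) (a s)) (at s)"
    and A: "openin (top_of_set (I \<times> sphere 0 1)) A"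
    and immersed: "s \<in> I \<Longrightarrow> x \<in> sphere 0 1 \<Longrightarrow>
      (dderiv r 1 s + a s \<bullet> x)\<^sup>2 + (dderiv \<theta> 1 s * r s)\<^sup>2 \<noteq> 0"
    and A_M: "(s, x) \<in> A \<Longrightarrow> uembed U (r s * cis (\<theta> s)) x + V s \<in> M"
begin

definition F :: "real \<Rightarrow> real^'n \<Rightarrow> complex^'n" where
  "F s x = uembed U (r s * cis (\<theta> s)) x + V s"

abbreviation "r1 \<equiv> dderiv r 1"
abbreviation "r2 \<equiv> dderiv r1 1"
abbreviation "r3 \<equiv> dderiv r2 1"
abbreviation "lam \<equiv> dderiv \<theta> 1"
abbreviation "lam1 \<equiv> dderiv lam 1"
abbreviation "lam2 \<equiv> dderiv lam1 1"
abbreviation "a1 \<equiv> dderiv a 1"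
abbreviation "a2 \<equiv> dderiv a1 1"

definition "q s = lam s * r s"
definition "q1 s = lam1 s * r s + lam s * r1 s"
definition "q2 s = lam2 s * r s + 2 * lam1 s * r1 s + lam s * r2 s"
definition "p s x = r1 s + a s \<bullet> x"
definition "P s x = (p s x)\<^sup>2 + (q s)\<^sup>2"

lemmas real_derivs =
  smooth_on_has_real_derivative[OF smooth(1)]
  smooth_on_has_real_derivative[OF smooth_on_dderiv[OF smooth(1)]]
  smooth_on_has_real_derivative[OF smooth_on_dderiv[OF smooth_on_dderiv[OF smooth(1)]]]
  smooth_on_has_real_derivative[OF smooth(2)]
  smooth_on_has_real_derivative[OF smooth_on_dderiv[OF smooth(2)]]
  smooth_on_has_real_derivative[OF smooth_on_dderiv[OF smooth_on_dderiv[OF smooth(2)]]]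

lemmas vector_derivs =
  smooth_on_has_vector_derivative[OF smooth(3)]
  smooth_on_has_vector_derivative[OF smooth_on_dderiv[OF smooth(3)]]

lemma P_pos:
  assumes "s \<in> I" "x \<in> sphere 0 1"
  shows "P s x > 0"
  using immersed[OF assms] sum_power2_gt_zero_iff[of "p s x" "q s"]
  by (simp add: P_def p_def q_def)

lemma A_subset: "(s, x) \<in> A \<Longrightarrow> s \<in> I" "(s, x) \<in> A \<Longrightarrow> x \<in> sphere 0 1"
  using openin_imp_subset[OF A] by blast+

lemma uembed_linear:
  "uembed U c (x + y) = uembed U c x + uembed U c y" "uembed U (c + d) x = uembed U c x + uembed U d x"
  "uembed U c (t *\<^sub>R x) = t *\<^sub>R uembed U c x" "uembed U (t *\<^sub>R c) x = t *\<^sub>R uembed U c x"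
  "uembed U c (x - y) = uembed U c x - uembed U c y"
proof -
  interpret bounded_bilinear "uembed U" by (rule bounded_bilinear_uembed[OF U])
  show "uembed U c (x + y) = uembed U c x + uembed U c y" "uembed U (c + d) x = uembed U c x + uembed U d x"
    "uembed U c (t *\<^sub>R x) = t *\<^sub>R uembed U c x" "uembed U (t *\<^sub>R c) x = t *\<^sub>R uembed U c x"
    "uembed U c (x - y) = uembed U c x - uembed U c y"
    by (simp_all add: add_right add_left scaleR_right scaleR_left diff_right)
qed

text \<open>Test curves: the leaf parameter moves with speed \<open>\<sigma>\<close> while the point
  of the sphere runs along a great circle with speed \<open>\<kappa>\<close>. With
  \<open>\<sigma> = 0\<close> the curve stays in a leaf, with \<open>\<sigma> = 1\<close> it crosses
  the leaves.\<close>

definition curve where "curve s x \<sigma> \<kappa> e t = F (s + \<sigma> * t) (great_circle \<kappa> x e t)"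

definition curve' where
  "curve' s x \<sigma> \<kappa> e t = (let s' = s + \<sigma> * t in
    \<sigma> *\<^sub>R uembed U (Complex (r1 s') (q s') * cis (\<theta> s')) (great_circle \<kappa> x e t)
    + uembed U (r s' * cis (\<theta> s')) (great_circle' \<kappa> x e t)
    + \<sigma> *\<^sub>R uembed U (cis (\<theta> s')) (a s'))"

lemma has_vector_derivative_cis:
  "s \<in> I \<Longrightarrow> ((\<lambda>s. cis (\<theta> s)) has_vector_derivative \<i> * lam s * cis (\<theta> s)) (at s)"
  using field_vector_diff_chain_at[OF has_vector_derivative_mult_right[OF has_vector_derivative_of_real[OF real_derivs(4)]] DERIV_exp, of s \<i>]
  by (simp add: o_def cis_conv_exp)

lemma has_vector_derivative_frame:
  "s \<in> I \<Longrightarrow> ((\<lambda>s. of_real (r s) * cis (\<theta> s)) has_vector_derivative Complex (r1 s) (q s) * cis (\<theta> s)) (at s)"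
  "s \<in> I \<Longrightarrow> ((\<lambda>s. Complex (r1 s) (q s) * cis (\<theta> s)) has_vector_derivative
    (Complex (r2 s) (q1 s) + \<i> * lam s * Complex (r1 s) (q s)) * cis (\<theta> s)) (at s)"
proof -
  assume s: "s \<in> I"
  have dr: "((\<lambda>s. complex_of_real (r s)) has_vector_derivative complex_of_real (r1 s)) (at s)"
    using has_vector_derivative_of_real[OF real_derivs(1)[OF s]] .
  have dr1: "((\<lambda>s. complex_of_real (r1 s)) has_vector_derivative complex_of_real (r2 s)) (at s)"
    using has_vector_derivative_of_real[OF real_derivs(2)[OF s]] .
  have "(q has_real_derivative q1 s) (at s)"
    unfolding q_def[abs_def] q1_def using real_derivs(1)[OF s] real_derivs(5)[OF s]
    by (auto intro!: derivative_eq_intros)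
  then have dq: "((\<lambda>s. complex_of_real (q s)) has_vector_derivative complex_of_real (q1 s)) (at s)"
    by (rule has_vector_derivative_of_real)
  show "((\<lambda>s. of_real (r s) * cis (\<theta> s)) has_vector_derivative Complex (r1 s) (q s) * cis (\<theta> s)) (at s)"
    by (rule has_vector_derivative_eq_rhs[OF has_vector_derivative_mult[OF dr has_vector_derivative_cis[OF s]]])
      (simp add: Complex_eq q_def algebra_simps)
  have C: "Complex (f s) (g s) = complex_of_real (f s) + \<i> * complex_of_real (g s)" for f g s
    by (simp add: Complex_eq)
  have "((\<lambda>s. (complex_of_real (r1 s) + \<i> * complex_of_real (q s)) * cis (\<theta> s)) has_vector_derivative
    (complex_of_real (r1 s) + \<i> * complex_of_real (q s)) * (\<i> * lam s * cis (\<theta> s)) + (complex_of_real (r2 s) + \<i> * complex_of_real (q1 s)) * cis (\<theta> s)) (at s)"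
    by (intro has_vector_derivative_mult has_vector_derivative_cis[OF s] has_vector_derivative_add dr1 has_vector_derivative_mult_right dq)
  then show "((\<lambda>s. Complex (r1 s) (q s) * cis (\<theta> s)) has_vector_derivative
    (Complex (r2 s) (q1 s) + \<i> * lam s * Complex (r1 s) (q s)) * cis (\<theta> s)) (at s)"
    by (simp add: C algebra_simps)
qed

lemma has_vector_derivative_shift:
  assumes "(f has_vector_derivative f') (at (s + \<sigma> * t))"
  shows "((\<lambda>t. f (s + \<sigma> * t)) has_vector_derivative \<sigma> *\<^sub>R f') (at t)"
proof -
  have "((\<lambda>t. s + \<sigma> * t) has_vector_derivative \<sigma>) (at t)"
    by (auto intro!: derivative_eq_intros)
  from vector_diff_chain_at[OF this assms] show ?thesis
    by (simp add: o_def)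
qed

lemma has_vector_derivative_curve:
  assumes "s + \<sigma> * t \<in> I"
  shows "(curve s x \<sigma> \<kappa> e has_vector_derivative curve' s x \<sigma> \<kappa> e t) (at t)"
proof -
  interpret bounded_bilinear "uembed U" by (rule bounded_bilinear_uembed[OF U])
  show ?thesis
    unfolding curve_def[abs_def] F_def
    by (rule has_vector_derivative_eq_rhs[OF has_vector_derivative_add[OF
        has_vector_derivative[OF has_vector_derivative_shift[OF has_vector_derivative_frame(1)[OF assms]]
          has_vector_derivative_great_circle(1)]
        has_vector_derivative_shift[OF dV[OF assms]]]])
      (simp add: curve'_def Let_def scaleR_left)
qed

lemma has_vector_derivative_curve':
  assumes s: "s \<in> I"
  shows "(curve' s x \<sigma> \<kappa> e has_vector_derivative
    (\<sigma>\<^sup>2) *\<^sub>R uembed U ((Complex (r2 s) (q1 s) + \<i> * lam s * Complex (r1 s) (q s)) * cis (\<theta> s)) x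
    + ((\<sigma> * \<kappa>) *\<^sub>R uembed U (Complex (r1 s) (q s) * cis (\<theta> s)) e
      + (\<sigma> * \<kappa>) *\<^sub>R uembed U (Complex (r1 s) (q s) * cis (\<theta> s)) e)
    - (\<kappa>\<^sup>2) *\<^sub>R uembed U (r s * cis (\<theta> s)) x
    + (\<sigma>\<^sup>2) *\<^sub>R (uembed U (\<i> * lam s * cis (\<theta> s)) (a s) + uembed U (cis (\<theta> s)) (a1 s))) (at 0)"
proof -
  interpret bounded_bilinear "uembed U" by (rule bounded_bilinear_uembed[OF U])
  have s0: "s + \<sigma> * 0 \<in> I" using s by simp
  show ?thesis
    unfolding curve'_def[abs_def] Let_def
    by (rule has_vector_derivative_eq_rhs[OF has_vector_derivative_add[OF has_vector_derivative_add[OF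
        bounded_linear.has_vector_derivative[OF bounded_linear_scaleR_right
          has_vector_derivative[OF has_vector_derivative_shift[OF has_vector_derivative_frame(2)[OF s0]] has_vector_derivative_great_circle(1)]]
        has_vector_derivative[OF has_vector_derivative_shift[OF has_vector_derivative_frame(1)[OF s0]] has_vector_derivative_great_circle(2)]]
        bounded_linear.has_vector_derivative[OF bounded_linear_scaleR_right
          has_vector_derivative[OF has_vector_derivative_shift[OF has_vector_derivative_cis[OF s0]] has_vector_derivative_shift[OF vector_derivs(1)[OF s0]]]]]])
      (simp add: scaleR_left scaleR_right add_left algebra_simps power2_eq_square minus_right)
qed

lemma curve'_0:
  "curve' s x \<sigma> \<kappa> e 0 = \<sigma> *\<^sub>R uembed U (Complex (r1 s) (q s) * cis (\<theta> s)) x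
    + \<kappa> *\<^sub>R uembed U (r s * cis (\<theta> s)) e + \<sigma> *\<^sub>R uembed U (cis (\<theta> s)) (a s)"
  by (simp add: curve'_def uembed_linear)

definition times where "times s x \<sigma> \<kappa> e = {t. (s + \<sigma> * t, great_circle \<kappa> x e t) \<in> A}"

lemma open_times:
  assumes "x \<in> sphere 0 1" "e \<in> sphere 0 1" "x \<bullet> e = 0"
  shows "open (times s x \<sigma> \<kappa> e)"
proof -
  obtain B where "open B" "A = (I \<times> sphere 0 1) \<inter> B"
    using A unfolding openin_open by blast
  then have B: "open B" "\<And>z. z \<in> A \<longleftrightarrow> z \<in> I \<times> sphere 0 1 \<and> z \<in> B"
    by auto
  have "continuous_on UNIV (\<lambda>t. (s + \<sigma> * t, great_circle \<kappa> x e t))"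
    unfolding great_circle_def by (intro continuous_intros)
  then have "open ((\<lambda>t. (s + \<sigma> * t, great_circle \<kappa> x e t)) -` ((I \<times> UNIV) \<inter> B))"
    using B(1) I by (intro open_vimage open_Int open_Times) auto
  also have "(\<lambda>t. (s + \<sigma> * t, great_circle \<kappa> x e t)) -` ((I \<times> UNIV) \<inter> B) = times s x \<sigma> \<kappa> e"
    using great_circle_in_sphere[OF assms] by (auto simp: times_def B(2) simp del: mem_sphere)
  finally show ?thesis .
qed

lemma curve_in_M: "t \<in> times s x \<sigma> \<kappa> e \<Longrightarrow> curve s x \<sigma> \<kappa> e t \<in> M"
  by (simp add: times_def curve_def F_def A_M)

lemma times_I: "t \<in> times s x \<sigma> \<kappa> e \<Longrightarrow> s + \<sigma> * t \<in> I"
  by (simp add: times_def A_subset)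

lemma continuous_on_curve: "continuous_on (times s x \<sigma> \<kappa> e) (curve s x \<sigma> \<kappa> e)"
proof (intro continuous_at_imp_continuous_on ballI)
  fix t assume "t \<in> times s x \<sigma> \<kappa> e"
  from has_vector_derivative_continuous[OF has_vector_derivative_curve[OF times_I[OF this]]]
  show "isCont (curve s x \<sigma> \<kappa> e) t" .
qed

lemma curve'_tangent:
  assumes "(s, x) \<in> A" "e \<in> sphere 0 1" "x \<bullet> e = 0"
  shows "curve' s x \<sigma> \<kappa> e 0 \<in> tangent_space M (F s x)"
proof -
  have "0 \<in> times s x \<sigma> \<kappa> e" using assms(1) by (simp add: times_def)
  from velocity_in_tangent_space[OF submanifold open_times this curve_in_M continuous_on_curve
      has_vector_derivative_curve[OF times_I[OF this]]] assms A_subset[OF assms(1)]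
  show ?thesis by (simp add: curve_def)
qed


lemma leaf_tangent:
  assumes sx: "(s, x) \<in> A" and e: "e \<in> sphere 0 1" "x \<bullet> e = 0"
  shows "uembed U (cis (\<theta> s)) e \<in> tangent_space M (F s x)"
proof -
  have s: "s \<in> I" and "F s x \<in> M"
    using A_subset[OF sx] A_M[OF sx] by (auto simp: F_def)
  then have "subspace (tangent_space M (F s x))"
    using tangent_space_subspace_dim[OF submanifold] by blast
  from subspace_scale[OF this curve'_tangent[OF sx e, of 0 1], of "1 / r s"]
  show ?thesis
    using r_pos[OF s] by (simp add: curve'_0 uembed_linear flip: scaleR_conv_of_real)
qed

text \<open>The great circle is chosen so that its motion cancels the part of \<open>a s\<close>
  orthogonal to \<open>x\<close>. What remains is orthogonal to the leaf.\<close>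

lemma radial_velocity:
  assumes s: "s \<in> I" and x: "x \<in> sphere 0 1" and w: "- (a s - (a s \<bullet> x) *\<^sub>R x) = (r s * \<kappa>) *\<^sub>R e"
  shows "curve' s x 1 \<kappa> e 0 = uembed U (Complex (p s x) (q s) * cis (\<theta> s)) x"
proof -
  have "a s = (a s \<bullet> x) *\<^sub>R x - (r s * \<kappa>) *\<^sub>R e"
    using w by (simp add: algebra_simps)
  then have "curve' s x 1 \<kappa> e 0 = uembed U (Complex (r1 s) (q s) * cis (\<theta> s)) x
    + \<kappa> *\<^sub>R uembed U (r s * cis (\<theta> s)) e + uembed U (cis (\<theta> s)) ((a s \<bullet> x) *\<^sub>R x + (- r s * \<kappa>) *\<^sub>R e)"
    by (simp add: curve'_0)
  also have "\<dots> = uembed U (Complex (r1 s) (q s) * cis (\<theta> s)) x + uembed U ((a s \<bullet> x) *\<^sub>R cis (\<theta> s)) x"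
    by (simp add: uembed_linear flip: scaleR_conv_of_real)
  also have "\<dots> = uembed U (Complex (p s x) (q s) * cis (\<theta> s)) x"
    by (simp add: p_def Complex_eq scaleR_conv_of_real algebra_simps flip: uembed_linear(2))
  finally show ?thesis .
qed

text \<open>An orthonormal tangent basis is formed by the normalized velocity orthogonal to the leaf
  and a real frame of the leaf, all turned by \<open>U\<close> and \<open>\<theta>\<close>. Its
  determinant splits into that of \<open>U\<close>, the phases, and that of a real orthogonal
  matrix. Squares appear because the determinant of an orthonormal basis is defined only up to
  sign.\<close>

lemma angle_formula:
  assumes n: "CARD('n) \<ge> 2" and sx: "(s, x) \<in> A" and N: "F s x \<in> N" and \<beta>: "lagrangian_angle_on M N \<beta>"
  shows "exp (2 * \<i> * \<beta> (F s x)) * P s x = (det U)\<^sup>2 * cis (\<theta> s) ^ (2 * CARD('n)) * (Complex (p s x) (q s))\<^sup>2"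
proof -
  have s: "s \<in> I" and x: "x \<in> sphere 0 1"
    using A_subset[OF sx] by auto
  let ?T = "tangent_space M (F s x)"
  have "F s x \<in> M" using A_M[OF sx] by (simp add: F_def)
  note T = tangent_space_subspace_dim[OF submanifold this]
  obtain k0 :: 'n where True by blast
  obtain e where e0: "e k0 = x" and e: "\<And>i j. e i \<bullet> e j = (if i = j then 1 else 0)"
    using orthonormal_frame[OF x] by metis
  \<comment> \<open>The phase \<open>z\<close> differs from 1 only in the direction orthogonal to
    the leaf, where it is \<open>p + i q\<close> normalized.\<close>
  define z where "z k = (if k = k0 then Complex (p s x) (q s) / sqrt (P s x) else 1)" for k
  define E where "E k = uembed U (cis (\<theta> s) * z k) (e k)" for k
  have P: "P s x > 0" using P_pos[OF s x] .
  have zz: "z k * cnj (z k) = 1" for k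
  proof (cases "k = k0")
    case True
    have "Complex (p s x) (q s) * cnj (Complex (p s x) (q s)) = of_real (P s x)"
      by (simp add: complex_eq_iff P_def power2_eq_square)
    moreover have "complex_of_real (sqrt (P s x)) * complex_of_real (sqrt (P s x)) = of_real (P s x)"
      using P by (simp flip: of_real_mult)
    ultimately show ?thesis
      using P True by (simp add: z_def field_simps)
  qed (simp add: z_def)
  have "E i \<bullet> E j = (if i = j then 1 else 0)" for i j
  proof -
    have 1: "cis (\<theta> s) * z i * cnj (cis (\<theta> s) * z i) = (cis (\<theta> s) * cnj (cis (\<theta> s))) * (z i * cnj (z i))"
      by (simp add: mult_ac)
    have 2: "\<dots> = 1"
      by (simp add: zz cis_cnj cis_mult)
    show ?thesis
    proof (cases "i = j")
      case True
      show ?thesis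
        unfolding E_def inner_herm herm_uembed[OF U] e True[symmetric] trans[OF 1 2] by simp
    next
      case False
      then show ?thesis
        unfolding E_def inner_herm herm_uembed[OF U] e by simp
    qed
  qed
  moreover have "E k \<in> ?T" for k
  proof (cases "k = k0")
    case True
    have "x \<bullet> (- (a s - (a s \<bullet> x) *\<^sub>R x) /\<^sub>R r s) = 0"
      using x by (simp add: inner_diff_right inner_commute norm_eq_1)
    then obtain \<kappa> d where d: "d \<in> sphere 0 1" "x \<bullet> d = 0" "- (a s - (a s \<bullet> x) *\<^sub>R x) /\<^sub>R r s = \<kappa> *\<^sub>R d"
      using unit_direction[OF n x] by blast
    have "r s *\<^sub>R (- (a s - (a s \<bullet> x) *\<^sub>R x) /\<^sub>R r s) = r s *\<^sub>R (\<kappa> *\<^sub>R d)"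
      unfolding d(3) ..
    then have "- (a s - (a s \<bullet> x) *\<^sub>R x) = (r s * \<kappa>) *\<^sub>R d"
      using r_pos[OF s] by simp
    then have "uembed U (Complex (p s x) (q s) * cis (\<theta> s)) x \<in> ?T"
      using curve'_tangent[OF sx d(1,2), of 1 \<kappa>] radial_velocity[OF s x] by simp
    moreover have "E k = uembed U ((1 / sqrt (P s x)) *\<^sub>R (Complex (p s x) (q s) * cis (\<theta> s))) x"
      by (simp add: E_def z_def True e0 scaleR_conv_of_real[where 'a=complex] mult_ac)
    ultimately show ?thesis
      by (simp only: uembed_linear(4) subspace_scale[OF T(1)])
  next
    case False
    then have "uembed U (cis (\<theta> s)) (e k) \<in> ?T"
      using e[of k k] e[of k0 k] by (intro leaf_tangent[OF sx]) (simp_all add: e0 norm_eq_1)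
    then show ?thesis
      using False by (simp add: E_def z_def)
  qed
  ultimately have obE: "orthonormal_basis_of ?T E"
    by (intro orthonormal_basis_of_tangent_space[OF T])
  from bspec[OF \<beta>[unfolded lagrangian_angle_on_def] N]
  obtain f where f: "orthonormal_basis_of ?T f" "exp (\<i> * complex_of_real (\<beta> (F s x))) = det (\<chi> i j. f j $ i)"
    by (elim exE conjE)
  have "exp (2 * \<i> * \<beta> (F s x)) = (exp (\<i> * complex_of_real (\<beta> (F s x))))\<^sup>2"
    by (simp add: mult.assoc flip: exp_double)
  also have "\<dots> = (det (\<chi> i j. E j $ i))\<^sup>2"
    unfolding f(2) by (rule det_square_orthonormal_bases[OF f(1) obE])
  also have "(\<chi> i j. E j $ i) = U ** (\<chi> i j. (cis (\<theta> s) * z j) * complex_of_real (e j $ i))"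
    by (simp add: E_def vec_eq_iff matrix_matrix_mult_def uembed_def matrix_vector_mult_def real_vec_def sum_distrib_left mult_ac)
  also have "(det (U ** (\<chi> i j. (cis (\<theta> s) * z j) * complex_of_real (e j $ i))))\<^sup>2 =
      (det U)\<^sup>2 * cis (\<theta> s) ^ (2 * CARD('n)) * ((Complex (p s x) (q s))\<^sup>2 / P s x)"
  proof -
    let ?Q = "\<chi> j i. complex_of_real (e j $ i)"
    have "det (\<chi> i j. (cis (\<theta> s) * z j) * complex_of_real (e j $ i)) =
        det (transpose (\<chi> i j. (cis (\<theta> s) * z j) * complex_of_real (e j $ i)))"
      by simp
    also have "transpose (\<chi> i j. (cis (\<theta> s) * z j) * complex_of_real (e j $ i)) =
        (\<chi> j. (cis (\<theta> s) * z j) *s (?Q $ j))"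
      by (simp add: vec_eq_iff transpose_def)
    also have "det \<dots> = (\<Prod>j\<in>UNIV. cis (\<theta> s) * z j) * det ?Q"
      by (subst det_rows_mul) (simp add: vec_lambda_eta)
    also have "(\<Prod>j\<in>UNIV. cis (\<theta> s) * z j) = cis (\<theta> s) ^ CARD('n) * z k0"
      by (simp add: prod.distrib z_def)
    finally have 1: "det (\<chi> i j. (cis (\<theta> s) * z j) * complex_of_real (e j $ i)) = cis (\<theta> s) ^ CARD('n) * z k0 * det ?Q" .
    have "?Q ** transpose ?Q = mat 1"
    proof -
      have "(\<Sum>k\<in>UNIV. complex_of_real (e i $ k) * complex_of_real (e j $ k)) = complex_of_real (e i \<bullet> e j)" for i j
        by (simp add: inner_vec_def)
      then show ?thesis
        by (simp add: vec_eq_iff matrix_matrix_mult_def transpose_def mat_def e)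
    qed
    from arg_cong[OF this, of det] have 2: "(det ?Q)\<^sup>2 = 1"
      by (simp add: det_mul power2_eq_square)
    have "complex_of_real (sqrt (P s x)) ^ 2 = of_real (P s x)"
      using P by (simp flip: of_real_power)
    then have "z k0 ^ 2 = (Complex (p s x) (q s))\<^sup>2 / P s x"
      by (simp add: z_def power_divide)
    then show ?thesis
      unfolding det_mul 1 power_mult_distrib 2 by (simp add: power_mult[symmetric] mult.commute)
  qed
  finally show ?thesis
    using P by simp
qed

end

subsection \<open>The stationary equation\<close>

text \<open>With \<open>d = b - n * \<theta>\<close> and \<open>G = p + i q\<close> the hypothesis
  becomes \<open>exp (2 i d) * cnj G = K * G\<close>. Differentiating this identity and taking
  imaginary parts gives the derivative of the argument of \<open>G\<close> without choosing a
  logarithm.\<close>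

lemma argument_derivative:
  fixes b \<theta> p q :: "real \<Rightarrow> real" and K :: complex
  assumes T: "open T" "t \<in> T"
    and eq: "\<And>t. t \<in> T \<Longrightarrow> exp (2 * \<i> * b t) * ((p t)\<^sup>2 + (q t)\<^sup>2) = K * cis (\<theta> t) ^ (2 * n) * (Complex (p t) (q t))\<^sup>2"
    and K: "K \<noteq> 0" and P: "\<And>t. t \<in> T \<Longrightarrow> (p t)\<^sup>2 + (q t)\<^sup>2 > 0"
    and b: "(b has_real_derivative b') (at t)" and \<theta>: "(\<theta> has_real_derivative \<theta>') (at t)"
    and p: "(p has_real_derivative p') (at t)" and q: "(q has_real_derivative q') (at t)"
  shows "b' = n * \<theta>' + (p t * q' - q t * p') / ((p t)\<^sup>2 + (q t)\<^sup>2)"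
proof -
  define G where "G t = Complex (p t) (q t)" for t
  define d where "d t = b t - n * \<theta> t" for t
  define d' where "d' = b' - n * \<theta>'"
  have GP: "G t * cnj (G t) = (p t)\<^sup>2 + (q t)\<^sup>2" for t
    by (simp add: G_def complex_eq_iff power2_eq_square)
  have G0: "G t \<noteq> 0" if "t \<in> T" for t
    using GP[of t] P[OF that] by (metis mult_zero_left of_real_eq_0_iff less_irrefl)
  have key: "exp (2 * \<i> * d t) * cnj (G t) = K * G t" if t: "t \<in> T" for t
  proof -
    have e: "exp (2 * \<i> * b t) = exp (2 * \<i> * d t) * cis (\<theta> t) ^ (2 * n)"
      by (simp add: d_def cis_conv_exp algebra_simps flip: exp_of_nat_mult exp_add)
    have "exp (2 * \<i> * d t) * cis (\<theta> t) ^ (2 * n) * (G t * cnj (G t)) = K * cis (\<theta> t) ^ (2 * n) * (G t)\<^sup>2"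
      using eq[OF t] unfolding GP e G_def[symmetric] by (simp flip: of_real_power)
    then have "(cis (\<theta> t) ^ (2 * n) * G t) * (exp (2 * \<i> * d t) * cnj (G t)) = (cis (\<theta> t) ^ (2 * n) * G t) * (K * G t)"
      by (simp only: power2_eq_square mult_ac)
    then show ?thesis
      using G0[OF t] by simp
  qed
  have dG: "(G has_vector_derivative Complex p' q') (at t)"
  proof -
    have "((\<lambda>t. complex_of_real (p t) + \<i> * complex_of_real (q t)) has_vector_derivative complex_of_real p' + \<i> * complex_of_real q') (at t)"
      using p q by (intro has_vector_derivative_add has_vector_derivative_mult_right has_vector_derivative_of_real)
    then show ?thesis
      by (simp add: G_def[abs_def] Complex_eq)
  qed
  have dd: "(d has_real_derivative d') (at t)"
    unfolding d_def[abs_def] d'_def using b \<theta> by (auto intro!: derivative_eq_intros)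
  have de: "((\<lambda>t. exp (2 * \<i> * d t)) has_vector_derivative 2 * \<i> * d' * exp (2 * \<i> * d t)) (at t)"
    using field_vector_diff_chain_at[OF has_vector_derivative_mult_right[OF has_vector_derivative_of_real[OF dd]] DERIV_exp, of "2 * \<i>"]
    by (simp add: o_def)
  have dcG: "((\<lambda>t. cnj (G t)) has_vector_derivative cnj (Complex p' q')) (at t)"
    using bounded_linear.has_vector_derivative[OF bounded_linear_cnj dG] .
  have "((\<lambda>t. exp (2 * \<i> * d t) * cnj (G t)) has_vector_derivative
      exp (2 * \<i> * d t) * cnj (Complex p' q') + 2 * \<i> * d' * exp (2 * \<i> * d t) * cnj (G t)) (at t)"
    by (rule has_vector_derivative_mult[OF de dcG])
  then have "((\<lambda>t. K * G t) has_vector_derivative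
      exp (2 * \<i> * d t) * cnj (Complex p' q') + 2 * \<i> * d' * exp (2 * \<i> * d t) * cnj (G t)) (at t)"
    by (rule has_vector_derivative_transform_within_open[OF _ T]) (rule key)
  then have "K * Complex p' q' = exp (2 * \<i> * d t) * cnj (Complex p' q') + 2 * \<i> * d' * exp (2 * \<i> * d t) * cnj (G t)"
    using vector_derivative_unique_at has_vector_derivative_mult_right[OF dG, of K] by blast
  then have "K * Complex p' q' * cnj (G t) = (exp (2 * \<i> * d t) * cnj (G t)) * cnj (Complex p' q') + 2 * \<i> * d' * (exp (2 * \<i> * d t) * cnj (G t)) * cnj (G t)"
    by (simp add: algebra_simps)
  then have "K * (Complex p' q' * cnj (G t)) = K * (G t * cnj (Complex p' q') + 2 * \<i> * d' * (G t * cnj (G t)))"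
    unfolding key[OF T(2)] by (simp add: algebra_simps)
  then have "Complex p' q' * cnj (G t) = G t * cnj (Complex p' q') + 2 * \<i> * d' * (G t * cnj (G t))"
    using K by simp
  from arg_cong[OF this, of Im] have "q' * p t - p' * q t = d' * ((p t)\<^sup>2 + (q t)\<^sup>2)"
    unfolding GP by (simp add: G_def algebra_simps flip: of_real_power)
  then have "p t * q' - q t * p' = d' * ((p t)\<^sup>2 + (q t)\<^sup>2)"
    by (simp only: mult.commute)
  moreover have "(p t)\<^sup>2 + (q t)\<^sup>2 \<noteq> 0"
    using P[OF T(2)] by linarith
  ultimately have "(p t * q' - q t * p') / ((p t)\<^sup>2 + (q t)\<^sup>2) = d'"
    by (metis nonzero_mult_div_cancel_right)
  then show ?thesis
    by (simp add: d'_def)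
qed

lemma inner_cis_mult: "(w * cis t) \<bullet> (z * cis t) = w \<bullet> z"
proof -
  have "(w * cis t) \<bullet> (z * cis t) = ((cos t)\<^sup>2 + (sin t)\<^sup>2) * (w \<bullet> z)"
    unfolding inner_complex_def times_complex.sel cis.sel by algebra
  then show ?thesis by simp
qed

context sphere_chart
begin

section \<open>First and second derivatives of the Lagrangian angle along test curves\<close>

lemma has_real_derivative_q: "s \<in> I \<Longrightarrow> (q has_real_derivative q1 s) (at s)"
  unfolding q_def[abs_def] q1_def using real_derivs(1)[of s] real_derivs(5)[of s]
  by (auto intro!: derivative_eq_intros)

lemma has_real_derivative_q1: "s \<in> I \<Longrightarrow> (q1 has_real_derivative q2 s) (at s)"
  unfolding q1_def[abs_def] q2_def using real_derivs(1)[of s] real_derivs(2)[of s] real_derivs(5)[of s] real_derivs(6)[of s]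
  by (auto intro!: derivative_eq_intros)

lemma has_real_derivative_shift:
  assumes "(f has_real_derivative f') (at (s + \<sigma> * t))"
  shows "((\<lambda>t. f (s + \<sigma> * t)) has_real_derivative \<sigma> * f') (at t)"
  using has_vector_derivative_shift[of f f' s \<sigma> t] assms
  by (simp add: has_real_derivative_iff_has_vector_derivative)

definition p' where
  "p' s x \<sigma> \<kappa> e t = \<sigma> * r2 (s + \<sigma> * t) + (\<sigma> * (a1 (s + \<sigma> * t) \<bullet> great_circle \<kappa> x e t) +
    a (s + \<sigma> * t) \<bullet> great_circle' \<kappa> x e t)"

lemma has_real_derivative_inner:
  assumes "(f has_vector_derivative f') (at t)" "(g has_vector_derivative g') (at t)"
  shows "((\<lambda>t. f t \<bullet> g t) has_real_derivative f t \<bullet> g' + f' \<bullet> g t) (at t)"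
  using bounded_bilinear.has_vector_derivative[OF bounded_bilinear_inner assms]
  by (simp add: has_real_derivative_iff_has_vector_derivative)

lemma has_real_derivative_p:
  assumes "s + \<sigma> * t \<in> I"
  shows "((\<lambda>t. p (s + \<sigma> * t) (great_circle \<kappa> x e t)) has_real_derivative p' s x \<sigma> \<kappa> e t) (at t)"
  unfolding p_def p'_def
  by (rule DERIV_cong[OF DERIV_add[OF has_real_derivative_shift[OF real_derivs(2)[OF assms]]
      has_real_derivative_inner[OF has_vector_derivative_shift[OF vector_derivs(1)[OF assms]] has_vector_derivative_great_circle(1)]]])
    simp

lemma has_real_derivative_p':
  assumes s: "s \<in> I"
  shows "(p' s x \<sigma> \<kappa> e has_real_derivative
    \<sigma>\<^sup>2 * r3 s + \<sigma>\<^sup>2 * (a2 s \<bullet> x) + 2 * (\<sigma> * \<kappa>) * (a1 s \<bullet> e) - \<kappa>\<^sup>2 * (a s \<bullet> x)) (at 0)"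
proof -
  have s0: "s + \<sigma> * 0 \<in> I" using s by simp
  show ?thesis
    unfolding p'_def[abs_def]
    by (rule DERIV_cong[OF DERIV_add[OF DERIV_cmult[OF has_real_derivative_shift[OF real_derivs(3)[OF s0]]]
        DERIV_add[OF DERIV_cmult[OF has_real_derivative_inner[OF has_vector_derivative_shift[OF vector_derivs(2)[OF s0]] has_vector_derivative_great_circle(1)]]
          has_real_derivative_inner[OF has_vector_derivative_shift[OF vector_derivs(1)[OF s0]] has_vector_derivative_great_circle(2)]]]])
      (simp add: algebra_simps power2_eq_square)
qed

text \<open>The derivative of any Lagrangian angle along a test curve as an explicit function; the
  chosen determination drops out. \<open>angle2\<close> is its derivative at time 0 by the quotient
  rule.\<close>

definition angle' where
  "angle' s x \<sigma> \<kappa> e t = (let s' = s + \<sigma> * t; y = great_circle \<kappa> x e t in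
    CARD('n) * (\<sigma> * lam s') + (p s' y * (\<sigma> * q1 s') - q s' * p' s x \<sigma> \<kappa> e t) / P s' y)"

definition angle2 where
  "angle2 s x \<sigma> \<kappa> e = CARD('n) * (\<sigma>\<^sup>2 * lam1 s) +
    ((p s x * (\<sigma>\<^sup>2 * q2 s) - q s * (\<sigma>\<^sup>2 * r3 s + \<sigma>\<^sup>2 * (a2 s \<bullet> x) + 2 * (\<sigma> * \<kappa>) * (a1 s \<bullet> e) - \<kappa>\<^sup>2 * (a s \<bullet> x))) * P s x
      - (p s x * (\<sigma> * q1 s) - q s * p' s x \<sigma> \<kappa> e 0) * (2 * (p s x * p' s x \<sigma> \<kappa> e 0 + q s * (\<sigma> * q1 s)))) / (P s x)\<^sup>2"

lemma has_real_derivative_angle':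
  assumes s: "s \<in> I" and x: "x \<in> sphere 0 1"
  shows "(angle' s x \<sigma> \<kappa> e has_real_derivative angle2 s x \<sigma> \<kappa> e) (at 0)"
proof -
  have s0: "s + \<sigma> * 0 \<in> I" using s by simp
  define pc where "pc t = p (s + \<sigma> * t) (great_circle \<kappa> x e t)" for t
  define qc where "qc t = q (s + \<sigma> * t)" for t
  define q1c where "q1c t = q1 (s + \<sigma> * t)" for t
  define lc where "lc t = lam (s + \<sigma> * t)" for t
  have 1: "(pc has_real_derivative p' s x \<sigma> \<kappa> e 0) (at 0)"
    unfolding pc_def by (rule has_real_derivative_p[OF s0])
  have 2: "(qc has_real_derivative \<sigma> * q1 s) (at 0)"
    unfolding qc_def using has_real_derivative_shift[OF has_real_derivative_q[OF s0]] by simp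
  have 3: "(q1c has_real_derivative \<sigma> * q2 s) (at 0)"
    unfolding q1c_def using has_real_derivative_shift[OF has_real_derivative_q1[OF s0]] by simp
  have 4: "(lc has_real_derivative \<sigma> * lam1 s) (at 0)"
    unfolding lc_def using has_real_derivative_shift[OF real_derivs(5)[OF s0]] by simp
  note 5 = has_real_derivative_p'[OF s, of x \<sigma> \<kappa> e]
  have v: "pc 0 = p s x" "qc 0 = q s" "q1c 0 = q1 s" "lc 0 = lam s" "P s x = (p s x)\<^sup>2 + (q s)\<^sup>2"
    by (simp_all add: pc_def qc_def q1c_def lc_def P_def)
  have nz: "(pc 0)\<^sup>2 + (qc 0)\<^sup>2 \<noteq> 0"
    using P_pos[OF s x] unfolding v by linarith
  have eq: "angle' s x \<sigma> \<kappa> e t = CARD('n) * (\<sigma> * lc t) + (pc t * (\<sigma> * q1c t) - qc t * p' s x \<sigma> \<kappa> e t) / ((pc t)\<^sup>2 + (qc t)\<^sup>2)" for t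
    by (simp add: angle'_def Let_def pc_def qc_def q1c_def lc_def P_def)
  have "((\<lambda>t. CARD('n) * (\<sigma> * lc t) + (pc t * (\<sigma> * q1c t) - qc t * p' s x \<sigma> \<kappa> e t) / ((pc t)\<^sup>2 + (qc t)\<^sup>2)) has_real_derivative angle2 s x \<sigma> \<kappa> e) (at 0)"
    by (rule DERIV_cong[OF DERIV_add[OF DERIV_cmult[OF DERIV_cmult[OF 4]] DERIV_divide[OF
          DERIV_diff[OF DERIV_mult[OF 1 DERIV_cmult[OF 3]] DERIV_mult[OF 2 5]]
          DERIV_add[OF DERIV_power[OF 1] DERIV_power[OF 2]] nz]]])
      (simp add: angle2_def v power2_eq_square algebra_simps)
  then show ?thesis
    unfolding eq[abs_def] .
qed


text \<open>The chain rule through the lift is used only for the existence of a derivative; its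
  value is read off from the formula for the angle.\<close>

lemma smooth_compose_differentiable:
  fixes X :: "real^'n \<Rightarrow> complex^'n" and f :: "real^'n \<Rightarrow> real"
  assumes X: "local_parametrization M D X" and f: "smooth_on D f"
    and t: "t \<in> T" "open T" "\<And>t. t \<in> T \<Longrightarrow> \<eta> t \<in> D" "\<And>t. t \<in> T \<Longrightarrow> X (\<eta> t) = c t" "continuous_on T \<eta>"
    and c: "(c has_vector_derivative c') (at t)"
  shows "\<exists>d. ((\<lambda>t. f (\<eta> t)) has_real_derivative d) (at t)"
proof -
  note D = local_parametrizationD[OF X]
  have "inj (\<lambda>v. dderiv X v (\<eta> t))"
    using D(3)[OF t(3)[OF t(1)]] by (simp add: dderiv_def[abs_def])
  moreover have "isCont \<eta> t"
    using t by (simp add: continuous_on_eq_continuous_at)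
  ultimately have "\<exists>k. (\<eta> has_derivative k) (at t) \<and> (\<forall>h. dderiv X (k h) (\<eta> t) = h *\<^sub>R c')"
    by (rule lift_has_derivative[OF smooth_on_has_derivative[OF D(2) t(3)[OF t(1)]] _ _ t(2,1,4) c[unfolded has_vector_derivative_def]])
  then obtain k where "(\<eta> has_derivative k) (at t)" by blast
  from has_vector_derivative_compose_dderiv[OF f t(3)[OF t(1)] has_derivative_imp_has_vector_derivative[OF this]]
  show ?thesis
    by (auto simp: has_real_derivative_iff_has_vector_derivative)
qed

lemma angle_along_curve:
  assumes n: "CARD('n) \<ge> 2" and x: "x \<in> sphere 0 1" and e: "e \<in> sphere 0 1" "x \<bullet> e = 0"
    and \<beta>: "lagrangian_angle_on M N \<beta>"
    and T: "open T" "t \<in> T" "T \<subseteq> times s x \<sigma> \<kappa> e" "\<And>t. t \<in> T \<Longrightarrow> curve s x \<sigma> \<kappa> e t \<in> N"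
    and d: "((\<lambda>t. \<beta> (curve s x \<sigma> \<kappa> e t)) has_real_derivative d) (at t)"
  shows "d = angle' s x \<sigma> \<kappa> e t"
proof -
  let ?s = "\<lambda>t. s + \<sigma> * t" and ?y = "great_circle \<kappa> x e"
  have A: "(?s t, ?y t) \<in> A" if "t \<in> T" for t
    using T(3) that by (auto simp: times_def)
  have I: "?s t \<in> I" if "t \<in> T" for t
    using A_subset(1)[OF A[OF that]] .
  have "d = CARD('n) * (\<sigma> * lam (?s t)) + (p (?s t) (?y t) * (\<sigma> * q1 (?s t)) - q (?s t) * p' s x \<sigma> \<kappa> e t) / ((p (?s t) (?y t))\<^sup>2 + (q (?s t))\<^sup>2)"
  proof (rule argument_derivative[where K = "(det U)\<^sup>2" and \<theta> = "\<lambda>t. \<theta> (?s t)" and T = T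
      and b = "\<lambda>t. \<beta> (curve s x \<sigma> \<kappa> e t)" and p = "\<lambda>t. p (?s t) (?y t)" and q = "\<lambda>t. q (?s t)" and t = t])
    show "exp (2 * \<i> * \<beta> (curve s x \<sigma> \<kappa> e t)) * ((p (?s t) (?y t))\<^sup>2 + (q (?s t))\<^sup>2) =
        (det U)\<^sup>2 * cis (\<theta> (?s t)) ^ (2 * CARD('n)) * (Complex (p (?s t) (?y t)) (q (?s t)))\<^sup>2" if "t \<in> T" for t
      using angle_formula[OF n A[OF that] _ \<beta>] T(4)[OF that] by (simp add: curve_def P_def)
    show "(p (?s t) (?y t))\<^sup>2 + (q (?s t))\<^sup>2 > 0" if "t \<in> T" for t
      using P_pos[OF I[OF that] great_circle_in_sphere[OF x e]] by (simp add: P_def)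
    show "((\<lambda>t. \<theta> (?s t)) has_real_derivative \<sigma> * lam (?s t)) (at t)"
      by (rule has_real_derivative_shift[OF real_derivs(4)[OF I[OF T(2)]]])
    show "((\<lambda>t. q (?s t)) has_real_derivative \<sigma> * q1 (?s t)) (at t)"
      by (rule has_real_derivative_shift[OF has_real_derivative_q[OF I[OF T(2)]]])
  qed (use T(1,2) d det_unitary_nonzero[OF U] has_real_derivative_p[OF I[OF T(2)]] in simp_all)
  then show ?thesis
    by (simp add: angle'_def Let_def P_def)
qed


lemma open_curve_preimage:
  assumes "x \<in> sphere 0 1" "e \<in> sphere 0 1" "x \<bullet> e = 0" "open W"
  shows "open (times s x \<sigma> \<kappa> e \<inter> curve s x \<sigma> \<kappa> e -` W)"
  by (rule continuous_open_preimage[OF continuous_on_curve open_times[OF assms(1-3)] assms(4)])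

text \<open>Test curves with orthogonal velocities through the same point are lifted into the
  parametrization that stationarity supplies, and the trace formula for the Laplacian is applied to
  the lifts.\<close>

lemma stationary_frame_sum:
  fixes e :: "'n \<Rightarrow> real^'n" and \<sigma> \<kappa> :: "'n \<Rightarrow> real"
  assumes n: "CARD('n) \<ge> 2" and hs: "hamiltonian_stationary M" and sx: "(s, x) \<in> A"
    and e: "\<And>k. e k \<in> sphere 0 1" "\<And>k. x \<bullet> e k = 0"
    and c2: "\<And>k. (curve' s x (\<sigma> k) (\<kappa> k) (e k) has_vector_derivative c2 k) (at 0)"
    and \<tau>: "\<And>k. \<tau> k = curve' s x (\<sigma> k) (\<kappa> k) (e k) 0"
    and orth: "\<And>k l. k \<noteq> l \<Longrightarrow> \<tau> k \<bullet> \<tau> l = 0" "\<And>k. \<tau> k \<noteq> 0"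
  shows "(\<Sum>k\<in>UNIV. (angle2 s x (\<sigma> k) (\<kappa> k) (e k) -
    (\<Sum>j\<in>UNIV. (c2 k \<bullet> \<tau> j) / (\<tau> j \<bullet> \<tau> j) * angle' s x (\<sigma> j) (\<kappa> j) (e j) 0)) / (\<tau> k \<bullet> \<tau> k)) = 0"
proof -
  have s: "s \<in> I" and x: "x \<in> sphere 0 1" using A_subset[OF sx] by auto
  let ?c = "\<lambda>k. curve s x (\<sigma> k) (\<kappa> k) (e k)"
  have c0: "?c k 0 = F s x" for k by (simp add: curve_def)
  have "F s x \<in> M" using A_M[OF sx] by (simp add: F_def)
  with hs have "\<exists>D X \<beta>. local_parametrization M D X \<and> F s x \<in> X ` D \<and>
        lagrangian_angle_on M (X ` D) \<beta> \<and> smooth_on D (\<beta> \<circ> X) \<and>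
        (\<forall>u\<in>D. laplace_beltrami (induced_metric X) (\<beta> \<circ> X) u = 0)"
    unfolding hamiltonian_stationary_def by (elim conjE) (erule bspec)
  then obtain D X \<beta> where X: "local_parametrization M D X" and FX: "F s x \<in> X ` D"
    and \<beta>: "lagrangian_angle_on M (X ` D) \<beta>" and f: "smooth_on D (\<beta> \<circ> X)"
    and lap: "\<And>u. u \<in> D \<Longrightarrow> laplace_beltrami (induced_metric X) (\<beta> \<circ> X) u = 0"
    by (elim exE conjE) (rule that; assumption?; erule bspec)
  note D = local_parametrizationD[OF X]
  obtain Y where Y: "homeomorphism D (X ` D) X Y" using D(6) by blast
  obtain W where W: "open W" "X ` D = M \<inter> W"
    using D(4) unfolding openin_open by blast
  \<comment> \<open>A common open set of times during which all of the finitely many test curves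
    stay in the chart and in the parametrized part of \<open>M\<close>.\<close>
  define T where "T = (\<Inter>k. times s x (\<sigma> k) (\<kappa> k) (e k) \<inter> ?c k -` W)"
  have T: "open T" "0 \<in> T"
  proof -
    show "open T"
      unfolding T_def by (intro open_INT finite ballI open_curve_preimage x e W(1))
    have "F s x \<in> W" using FX W(2) by blast
    then show "0 \<in> T"
      unfolding T_def by (simp add: c0 times_def sx)
  qed
  have Tt: "t \<in> times s x (\<sigma> k) (\<kappa> k) (e k)" "?c k t \<in> W" if "t \<in> T" for t k
    using that by (auto simp: T_def)
  have cX: "?c k t \<in> X ` D" if "t \<in> T" for t k
    using curve_in_M[OF Tt(1)[OF that]] Tt(2)[OF that] W(2) by blast
  define \<eta> where "\<eta> k t = Y (?c k t)" for k t
  have \<eta>: "X (\<eta> k t) = ?c k t" "\<eta> k t \<in> D" if "t \<in> T" for k t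
    using homeomorphism_apply2[OF Y cX[OF that]] homeomorphism_image2[OF Y] cX[OF that, of k]
    by (auto simp: \<eta>_def)
  have cont: "continuous_on T (\<eta> k)" for k
    unfolding \<eta>_def
  proof (rule continuous_on_compose2[of "X ` D" Y _ "?c k"])
    show "continuous_on (X ` D) Y"
      using Y unfolding homeomorphism_def by blast
    show "continuous_on T (?c k)"
      by (rule continuous_on_subset[OF continuous_on_curve]) (use Tt(1) in blast)
    show "?c k ` T \<subseteq> X ` D"
      using cX by blast
  qed
  define u where "u = Y (F s x)"
  have u: "\<eta> k 0 = u" for k
    by (simp add: \<eta>_def u_def c0)
  have uD: "u \<in> D"
    using \<eta>(2)[OF T(2)] unfolding u .
  have dc: "(?c k has_vector_derivative curve' s x (\<sigma> k) (\<kappa> k) (e k) t) (at t)" if "t \<in> T" for k t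
    by (rule has_vector_derivative_curve[OF times_I[OF Tt(1)[OF that]]])
  have d\<phi>: "((\<lambda>t. (\<beta> \<circ> X) (\<eta> k t)) has_real_derivative angle' s x (\<sigma> k) (\<kappa> k) (e k) t) (at t)" if t: "t \<in> T" for k t
  proof -
    have "\<exists>d. ((\<lambda>t. (\<beta> \<circ> X) (\<eta> k t)) has_real_derivative d) (at t)"
      by (rule smooth_compose_differentiable[OF X f t T(1) \<eta>(2,1) cont dc[OF t]])
    then obtain d where d: "((\<lambda>t. (\<beta> \<circ> X) (\<eta> k t)) has_real_derivative d) (at t)" ..
    have "((\<lambda>t. \<beta> (?c k t)) has_real_derivative d) (at t)"
      by (rule has_field_derivative_transform_within_open[OF d T(1) t]) (simp add: \<eta>(1))
    then have "d = angle' s x (\<sigma> k) (\<kappa> k) (e k) t"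
      using cX Tt(1) by (intro angle_along_curve[OF n x e \<beta> T(1) t]) blast+
    with d show ?thesis by simp
  qed
  show ?thesis
    using laplace_beltrami_frame[where c' = "\<lambda>k. curve' s x (\<sigma> k) (\<kappa> k) (e k)" and \<eta> = \<eta>,
        OF D(1) uD D(2) f D(3) T \<eta>(2,1) cont u dc c2 orth[unfolded \<tau>] d\<phi> has_real_derivative_angle'[OF s x]]
      lap[OF uD]
    unfolding \<tau> by (simp add: o_def)
qed

text \<open>This is the frame sum for one curve orthogonal to the leaf and n - 1 great circles in
  the leaf, multiplied by \<open>(r s)\<^sup>2 * Pv ^ 3\<close>. \<open>SA\<close> is the squared
  length of the part of \<open>a s\<close> tangent to the sphere and \<open>SB\<close> its product
  with that of \<open>a1 s\<close>; \<open>Z\<close> and \<open>pp\<close> are the first and second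
  derivatives of \<open>p\<close> along the orthogonal curve.\<close>

lemma stationary_equation:
  assumes n: "CARD('n) \<ge> 2" and hs: "hamiltonian_stationary M" and sx: "(s, x) \<in> A"
  defines "u \<equiv> a s \<bullet> x" and "SA \<equiv> a s \<bullet> a s - (a s \<bullet> x)\<^sup>2" and "SB \<equiv> a s \<bullet> a1 s - (a1 s \<bullet> x) * (a s \<bullet> x)"
  defines "Z \<equiv> r2 s + a1 s \<bullet> x - SA / r s"
    and "pp \<equiv> r3 s + a2 s \<bullet> x - 2 * SB / r s - SA * u / (r s)\<^sup>2"
    and "pv \<equiv> p s x" and "qv \<equiv> q s" and "Pv \<equiv> P s x" and "N \<equiv> real CARD('n)"
  shows "(r s)\<^sup>2 * (Pv\<^sup>2 * N * lam1 s + (pv * q2 s - qv * pp) * Pv - 2 * (pv * q1 s - qv * Z) * (pv * Z + qv * q1 s)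
      - (pv * Z + qv * q1 s) * (N * lam s * Pv + pv * q1 s - qv * Z))
    + qv * Pv * (r s * SB - 2 * r1 s * SA) + (N - 1) * qv * u * Pv\<^sup>2 + 2 * pv * qv * SA * Pv
    + (N - 1) * r s * pv * Pv * (N * lam s * Pv + pv * q1 s - qv * Z) = 0"
proof -
  have s: "s \<in> I" and x: "x \<in> sphere 0 1" using A_subset[OF sx] by auto
  have xx: "x \<bullet> x = 1" using x by (simp add: norm_eq_1)
  have r0: "r s > 0" using r_pos[OF s] .
  have P0: "Pv > 0" unfolding Pv_def using P_pos[OF s x] .
  obtain k0 :: 'n where True by blast
  obtain f :: "'n \<Rightarrow> real^'n" where f0: "f k0 = x" and f: "\<And>i j. f i \<bullet> f j = (if i = j then 1 else 0)"
    and pars: "\<And>v w. (\<Sum>k\<in>UNIV. (v \<bullet> f k) * (w \<bullet> f k)) = v \<bullet> w"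
    by (rule orthonormal_frame[OF x, of k0]) (rule that)
  have "x \<bullet> (- (a s - u *\<^sub>R x) /\<^sub>R r s) = 0"
    using xx by (simp add: inner_diff_right inner_commute u_def)
  then obtain \<kappa>0 d where d: "d \<in> sphere 0 1" "x \<bullet> d = 0" and dw: "- (a s - u *\<^sub>R x) /\<^sub>R r s = \<kappa>0 *\<^sub>R d"
    using unit_direction[OF n x] by blast
  have "r s *\<^sub>R (- (a s - u *\<^sub>R x) /\<^sub>R r s) = r s *\<^sub>R (\<kappa>0 *\<^sub>R d)"
    unfolding dw ..
  then have dw': "- (a s - (a s \<bullet> x) *\<^sub>R x) = (r s * \<kappa>0) *\<^sub>R d"
    using r0 by (simp add: u_def)
  \<comment> \<open>Multiplied by \<open>\<kappa>0\<close>, inner products with \<open>d\<close>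
    become products with \<open>a s\<close> and \<open>x\<close>, which eliminates the auxiliary
    direction.\<close>
  have inner_d: "\<kappa>0 * (v \<bullet> d) = - (v \<bullet> a s - u * (v \<bullet> x)) / r s" for v
  proof -
    have "v \<bullet> (- (a s - (a s \<bullet> x) *\<^sub>R x)) = (r s * \<kappa>0) * (v \<bullet> d)"
      unfolding dw' by simp
    then show ?thesis
      using r0 by (simp add: inner_diff_right u_def field_simps)
  qed
  have \<kappa>2: "\<kappa>0\<^sup>2 = SA / (r s)\<^sup>2"
  proof -
    have "\<kappa>0\<^sup>2 = \<kappa>0 * (\<kappa>0 * (d \<bullet> d))"
      using d(1) by (simp add: norm_eq_1 power2_eq_square)
    also have "\<dots> = - (\<kappa>0 * (a s \<bullet> d)) / r s"
      unfolding inner_d[of d] using d(2) by (simp add: inner_commute)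
    also have "\<dots> = SA / (r s)\<^sup>2"
      unfolding inner_d[of "a s"] SA_def u_def by (simp add: power2_eq_square diff_divide_distrib)
    finally show ?thesis .
  qed
  \<comment> \<open>Index \<open>k0\<close> carries the curve orthogonal to the leaf, with great
    circle speed \<open>\<kappa>0\<close> in direction \<open>d\<close>; all other indices carry
    great circles of unit speed in the leaf.\<close>
  define \<sigma> where "\<sigma> k = (if k = k0 then 1 else 0 :: real)" for k
  define \<kappa> where "\<kappa> k = (if k = k0 then \<kappa>0 else 1)" for k
  define e where "e k = (if k = k0 then d else f k)" for k
  define h where "h = cis (\<theta> s)"
  define \<tau> where "\<tau> k = curve' s x (\<sigma> k) (\<kappa> k) (e k) 0" for k
  define c2 where "c2 k = (\<sigma> k)\<^sup>2 *\<^sub>R uembed U ((Complex (r2 s) (q1 s) + \<i> * lam s * Complex (r1 s) (q s)) * h) x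
    + ((\<sigma> k * \<kappa> k) *\<^sub>R uembed U (Complex (r1 s) (q s) * h) (e k)
      + (\<sigma> k * \<kappa> k) *\<^sub>R uembed U (Complex (r1 s) (q s) * h) (e k))
    - ((\<kappa> k)\<^sup>2) *\<^sub>R uembed U (r s * h) x
    + ((\<sigma> k)\<^sup>2) *\<^sub>R (uembed U (\<i> * lam s * h) (a s) + uembed U h (a1 s))" for k
  have e: "e k \<in> sphere 0 1" "x \<bullet> e k = 0" for k
    using d f[of k k] f[of k0 k] by (auto simp: e_def f0 norm_eq_1)
  have \<tau>0: "\<tau> k0 = uembed U (Complex pv qv * h) x"
    unfolding \<tau>_def \<sigma>_def \<kappa>_def e_def h_def pv_def qv_def using radial_velocity[OF s x dw'] by simp
  have \<tau>k: "\<tau> k = uembed U (r s * h) (f k)" if "k \<noteq> k0" for k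
    using that by (simp add: \<tau>_def \<sigma>_def \<kappa>_def e_def h_def curve'_0)
  have ie: "uembed U (w * h) y \<bullet> uembed U (z * h) y' = (w \<bullet> z) * (y \<bullet> y')" for w z y y'
    unfolding inner_uembed[OF U] h_def inner_cis_mult ..
  have n0: "\<tau> k0 \<bullet> \<tau> k0 = Pv"
    unfolding \<tau>0 ie by (simp add: xx inner_complex_def Pv_def P_def pv_def qv_def power2_eq_square)
  have nk: "\<tau> k \<bullet> \<tau> k = (r s)\<^sup>2" if "k \<noteq> k0" for k
    unfolding \<tau>k[OF that] ie by (simp add: f inner_complex_def power2_eq_square)
  have orth: "\<tau> k \<bullet> \<tau> l = 0" if "k \<noteq> l" for k l
    using that f[of k l] f[of k0 l] f[of k k0]
    by (cases "k = k0"; cases "l = k0") (simp_all add: \<tau>0 \<tau>k ie f0)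
  have nz: "\<tau> k \<noteq> 0" for k
    using n0 nk[of k] P0 r0 by (cases "k = k0") auto
  have dc2: "(curve' s x (\<sigma> k) (\<kappa> k) (e k) has_vector_derivative c2 k) (at 0)" for k
    unfolding c2_def h_def by (rule has_vector_derivative_curve'[OF s])
  let ?A = "\<lambda>k. angle' s x (\<sigma> k) (\<kappa> k) (e k) 0" and ?A2 = "\<lambda>k. angle2 s x (\<sigma> k) (\<kappa> k) (e k)"
  have sum0: "(\<Sum>k\<in>UNIV. (?A2 k - (\<Sum>j\<in>UNIV. (c2 k \<bullet> \<tau> j) / (\<tau> j \<bullet> \<tau> j) * ?A j)) / (\<tau> k \<bullet> \<tau> k)) = 0"
    by (rule stationary_frame_sum[OF n hs sx e dc2 \<tau>_def orth nz])
  have fk: "x \<bullet> f k = 0" "f k \<bullet> x = 0" if "k \<noteq> k0" for k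
    using f[of k0 k] f[of k k0] that by (auto simp: f0)
  have c2k: "c2 k = - uembed U (r s * h) x" if "k \<noteq> k0" for k
    using that by (simp add: c2_def \<sigma>_def \<kappa>_def)
  have ck_j: "c2 k \<bullet> \<tau> j = 0" if "k \<noteq> k0" "j \<noteq> k0" for k j
    unfolding c2k[OF that(1)] \<tau>k[OF that(2)] using fk[OF that(2)] by (simp add: ie)
  have ck_0: "c2 k \<bullet> \<tau> k0 = - r s * pv" if "k \<noteq> k0" for k
    unfolding c2k[OF that(1)] \<tau>0 by (simp add: ie xx inner_complex_def)
  have c20: "c2 k0 = uembed U ((Complex (r2 s) (q1 s) + \<i> * lam s * Complex (r1 s) (q s)) * h) x
    + (uembed U (Complex (r1 s) (q s) * h) (\<kappa>0 *\<^sub>R d) + uembed U (Complex (r1 s) (q s) * h) (\<kappa>0 *\<^sub>R d))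
    - \<kappa>0\<^sup>2 *\<^sub>R uembed U (r s * h) x + (uembed U ((\<i> * lam s) * h) (a s) + uembed U (1 * h) (a1 s))"
    by (simp add: c2_def \<sigma>_def \<kappa>_def e_def uembed_linear)
  have c0_j: "c2 k0 \<bullet> \<tau> j = a1 s \<bullet> f j * r s - 2 * r1 s * (a s \<bullet> f j)" if "j \<noteq> k0" for j
  proof -
    have "c2 k0 \<bullet> \<tau> j = 2 * (r1 s * r s * (\<kappa>0 * (f j \<bullet> d))) + r s * (a1 s \<bullet> f j)"
      unfolding c20 \<tau>k[OF that] inner_add_left inner_diff_left inner_scaleR_left ie
      using fk[OF that] by (simp add: inner_complex_def inner_commute)
    then show ?thesis
      unfolding inner_d using fk[OF that] r0 by (simp add: inner_commute)
  qed
  have c0_0: "c2 k0 \<bullet> \<tau> k0 = pv * Z + qv * q1 s"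
  proof -
    have "c2 k0 \<bullet> \<tau> k0 = (r2 s - lam s * q s) * pv + (q1 s + lam s * r1 s) * qv - \<kappa>0\<^sup>2 * (r s * pv) + lam s * qv * u + pv * (a1 s \<bullet> x)"
      unfolding c20 \<tau>0 inner_add_left inner_diff_left inner_scaleR_left ie
      using d(2) by (simp add: inner_complex_def inner_commute xx u_def algebra_simps)
    also have "\<dots> = pv * (r2 s + a1 s \<bullet> x - SA / r s) + qv * q1 s"
    proof -
      have "pv = r1 s + u" by (simp add: pv_def p_def u_def)
      moreover have "\<kappa>0\<^sup>2 * (r s * pv) = pv * (SA / r s)"
        unfolding \<kappa>2 using r0 by (simp add: power2_eq_square)
      ultimately show ?thesis
        by (simp add: qv_def algebra_simps)
    qed
    finally show ?thesis by (simp add: Z_def)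
  qed
  have p'0: "p' s x 1 \<kappa>0 d 0 = Z"
  proof -
    have "p' s x 1 \<kappa>0 d 0 = r2 s + a1 s \<bullet> x + \<kappa>0 * (a s \<bullet> d)"
      by (simp add: p'_def)
    then show ?thesis
      unfolding inner_d by (simp add: Z_def SA_def u_def power2_eq_square inner_commute diff_divide_distrib)
  qed
  have A0: "?A k0 = N * lam s + (pv * q1 s - qv * Z) / Pv"
    by (simp add: angle'_def Let_def \<sigma>_def \<kappa>_def e_def p'0 N_def pv_def qv_def Pv_def)
  have Aj: "?A j = - qv * (a s \<bullet> f j) / Pv" if "j \<noteq> k0" for j
    using that by (simp add: angle'_def Let_def \<sigma>_def \<kappa>_def e_def p'_def qv_def Pv_def)
  have A20: "?A2 k0 = N * lam1 s + ((pv * q2 s - qv * pp) * Pv - (pv * q1 s - qv * Z) * (2 * (pv * Z + qv * q1 s))) / Pv\<^sup>2"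
  proof -
    have "r3 s + a2 s \<bullet> x + 2 * \<kappa>0 * (a1 s \<bullet> d) - \<kappa>0\<^sup>2 * (a s \<bullet> x) = pp"
      unfolding \<kappa>2 mult.assoc inner_d pp_def SB_def u_def by (simp add: inner_commute algebra_simps diff_divide_distrib)
    then show ?thesis
      by (simp add: angle2_def \<sigma>_def \<kappa>_def e_def p'0 N_def pv_def qv_def Pv_def mult.assoc)
  qed
  have A2j: "?A2 j = qv * u / Pv + 2 * pv * qv * ((a s \<bullet> f j) * (a s \<bullet> f j)) / Pv\<^sup>2" if "j \<noteq> k0" for j
    using that P0 by (simp add: angle2_def \<sigma>_def \<kappa>_def e_def p'_def qv_def pv_def Pv_def u_def power2_eq_square add_divide_distrib)
  let ?R = "UNIV - {k0}"
  have split: "(\<Sum>k\<in>UNIV. g k) = g k0 + (\<Sum>k\<in>?R. g k)" for g :: "'n \<Rightarrow> real"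
    by (rule sum.remove) auto
  have cR: "real (card ?R) = N - 1"
    by (simp add: N_def)
  have SAs: "(\<Sum>k\<in>?R. (a s \<bullet> f k) * (a s \<bullet> f k)) = SA"
    using pars[of "a s" "a s"] unfolding split f0 SA_def by (simp add: power2_eq_square)
  have SBs: "(\<Sum>k\<in>?R. (a1 s \<bullet> f k) * (a s \<bullet> f k)) = SB"
    using pars[of "a1 s" "a s"] unfolding split f0 SB_def by (simp add: inner_commute)
  have inner0: "(\<Sum>j\<in>UNIV. (c2 k0 \<bullet> \<tau> j) / (\<tau> j \<bullet> \<tau> j) * ?A j) =
      (pv * Z + qv * q1 s) / Pv * ?A k0 - qv / ((r s)\<^sup>2 * Pv) * (r s * SB - 2 * r1 s * SA)"
  proof -
    have "(\<Sum>j\<in>?R. (c2 k0 \<bullet> \<tau> j) / (\<tau> j \<bullet> \<tau> j) * ?A j) =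
       (\<Sum>j\<in>?R. - (qv / ((r s)\<^sup>2 * Pv)) * (r s * ((a1 s \<bullet> f j) * (a s \<bullet> f j)) - 2 * r1 s * ((a s \<bullet> f j) * (a s \<bullet> f j))))"
    proof (rule sum.cong[OF refl])
      fix j assume "j \<in> ?R"
      then have j: "j \<noteq> k0" by simp
      show "(c2 k0 \<bullet> \<tau> j) / (\<tau> j \<bullet> \<tau> j) * ?A j =
        - (qv / ((r s)\<^sup>2 * Pv)) * (r s * ((a1 s \<bullet> f j) * (a s \<bullet> f j)) - 2 * r1 s * ((a s \<bullet> f j) * (a s \<bullet> f j)))"
        unfolding c0_j[OF j] nk[OF j] Aj[OF j] by (simp add: algebra_simps diff_divide_distrib)
    qed
    also have "\<dots> = - (qv / ((r s)\<^sup>2 * Pv)) * (r s * SB - 2 * r1 s * SA)"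
      by (simp only: sum_subtractf SAs SBs flip: sum_distrib_left)
    finally show ?thesis
      unfolding split c0_0 n0 by simp
  qed
  have innerk: "(\<Sum>j\<in>UNIV. (c2 k \<bullet> \<tau> j) / (\<tau> j \<bullet> \<tau> j) * ?A j) = - r s * pv / Pv * ?A k0" if k: "k \<noteq> k0" for k
    unfolding split ck_0[OF k] n0 using ck_j[OF k] by simp
  have "(\<Sum>k\<in>?R. (?A2 k - (\<Sum>j\<in>UNIV. (c2 k \<bullet> \<tau> j) / (\<tau> j \<bullet> \<tau> j) * ?A j)) / (\<tau> k \<bullet> \<tau> k)) =
    (\<Sum>k\<in>?R. (qv * u / Pv + r s * pv / Pv * ?A k0) / (r s)\<^sup>2 + 2 * pv * qv / (Pv\<^sup>2 * (r s)\<^sup>2) * ((a s \<bullet> f k) * (a s \<bullet> f k)))"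
  proof (rule sum.cong[OF refl])
    fix k assume "k \<in> ?R"
    then have k: "k \<noteq> k0" by simp
    show "(?A2 k - (\<Sum>j\<in>UNIV. (c2 k \<bullet> \<tau> j) / (\<tau> j \<bullet> \<tau> j) * ?A j)) / (\<tau> k \<bullet> \<tau> k) =
      (qv * u / Pv + r s * pv / Pv * ?A k0) / (r s)\<^sup>2 + 2 * pv * qv / (Pv\<^sup>2 * (r s)\<^sup>2) * ((a s \<bullet> f k) * (a s \<bullet> f k))"
      unfolding innerk[OF k] A2j[OF k] nk[OF k] by (simp add: add_divide_distrib)
  qed
  also have "\<dots> = (N - 1) * ((qv * u / Pv + r s * pv / Pv * ?A k0) / (r s)\<^sup>2) + 2 * pv * qv / (Pv\<^sup>2 * (r s)\<^sup>2) * SA"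
    by (simp only: sum.distrib sum_constant cR SAs flip: sum_distrib_left)
  finally have final: "(?A2 k0 - ((pv * Z + qv * q1 s) / Pv * ?A k0 - qv / ((r s)\<^sup>2 * Pv) * (r s * SB - 2 * r1 s * SA))) / Pv
      + ((N - 1) * ((qv * u / Pv + r s * pv / Pv * ?A k0) / (r s)\<^sup>2) + 2 * pv * qv / (Pv\<^sup>2 * (r s)\<^sup>2) * SA) = 0"
    using sum0 unfolding split[of "\<lambda>k. (?A2 k - (\<Sum>j\<in>UNIV. (c2 k \<bullet> \<tau> j) / (\<tau> j \<bullet> \<tau> j) * ?A j)) / (\<tau> k \<bullet> \<tau> k)"] inner0 n0 by simp
  \<comment> \<open>\<open>E / Pv\<close> and \<open>G / Pv\<^sup>2\<close> are the first and second
    derivatives of the angle along the orthogonal curve; only denominators remain to be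
    cleared.\<close>
  define E where "E = N * lam s * Pv + pv * q1 s - qv * Z"
  define G where "G = Pv\<^sup>2 * N * lam1 s + (pv * q2 s - qv * pp) * Pv - 2 * (pv * q1 s - qv * Z) * (pv * Z + qv * q1 s)"
  have AE: "?A k0 = E / Pv"
    unfolding A0 E_def using P0 by (simp add: field_simps)
  have AG: "?A2 k0 = G / Pv\<^sup>2"
    unfolding A20 G_def using P0 by (simp add: field_simps)
  have "(r s)\<^sup>2 * (G - (pv * Z + qv * q1 s) * E) + qv * Pv * (r s * SB - 2 * r1 s * SA) + (N - 1) * qv * u * Pv\<^sup>2
      + 2 * pv * qv * SA * Pv + (N - 1) * r s * pv * Pv * E =
    (r s)\<^sup>2 * Pv ^ 3 * ((G / Pv\<^sup>2 - ((pv * Z + qv * q1 s) / Pv * (E / Pv) - qv / ((r s)\<^sup>2 * Pv) * (r s * SB - 2 * r1 s * SA))) / Pv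
      + ((N - 1) * ((qv * u / Pv + r s * pv / Pv * (E / Pv)) / (r s)\<^sup>2) + 2 * pv * qv / (Pv\<^sup>2 * (r s)\<^sup>2) * SA))"
    using P0 r0 by (simp add: field_simps power2_eq_square power3_eq_cube)
  also have "\<dots> = 0"
    using final unfolding AE AG by simp
  finally show ?thesis
    unfolding G_def E_def by (simp add: algebra_simps)
qed

end

subsection \<open>Dichotomy for the turning speed\<close>

text \<open>
  Along a great circle the linear forms \<open>u\<close>, \<open>u1\<close>, \<open>u2\<close> are real parts of multiples of
  \<open>e\<^sup>i\<^sup>t\<close>. Multiplied by \<open>e\<^sup>-\<^sup>5\<^sup>i\<^sup>t\<close>, the stationary equation becomes a polynomial in
  \<open>\<epsilon> = e\<^sup>-\<^sup>i\<^sup>t\<close>, whose constant term comes only from the powers of \<open>u\<close> of total degree five.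
\<close>

lemma stationary_polynomial_leading_term:
  fixes r r1 r2 r3 q q1 q2 lam lam1 al nu N c0 d0 c1 d1 c2 d2 \<delta> :: real
  assumes \<delta>: "\<delta> > 0" and r: "r \<noteq> 0" and ql: "q = lam * r"
    and eq: "\<And>t u u1 u2 SA SB Z pp p P. \<bar>t\<bar> < \<delta> \<Longrightarrow> u = c0 * cos t + d0 * sin t \<Longrightarrow> u1 = c1 * cos t + d1 * sin t \<Longrightarrow>
      u2 = c2 * cos t + d2 * sin t \<Longrightarrow> SA = al - u\<^sup>2 \<Longrightarrow> SB = nu - u1 * u \<Longrightarrow> Z = r2 + u1 - SA / r \<Longrightarrow>
      pp = r3 + u2 - 2 * SB / r - SA * u / r\<^sup>2 \<Longrightarrow> p = r1 + u \<Longrightarrow> P = p\<^sup>2 + q\<^sup>2 \<Longrightarrow>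
      r\<^sup>2 * (P\<^sup>2 * N * lam1 + (p * q2 - q * pp) * P - 2 * (p * q1 - q * Z) * (p * Z + q * q1)
      - (p * Z + q * q1) * (N * lam * P + p * q1 - q * Z))
    + q * P * (r * SB - 2 * r1 * SA) + (N - 1) * q * u * P\<^sup>2 + 2 * p * q * SA * P
    + (N - 1) * r * p * P * (N * lam * P + p * q1 - q * Z) = 0"
  shows "q * (N * (N - 2)) * (c0\<^sup>2 + d0\<^sup>2) = 0"
proof -
  let ?C = complex_of_real
  define X :: "complex poly" where "X = [:0, 1:]"
  \<comment> \<open>At \<open>e = cis (- t)\<close> the value is \<open>e\<close> times
    \<open>c * cos t + d * sin t\<close>. Below, powers of \<open>X\<close> are inserted so that the
    value of each quantity at \<open>e\<close> is a fixed power of \<open>e\<close> times its real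
    counterpart: exponent one for \<open>u\<close> and \<open>p\<close>, two for \<open>SA\<close>,
    \<open>SB\<close>, \<open>Z\<close> and \<open>P\<close>, three for \<open>pp\<close>, five for
    \<open>H\<close>.\<close>
  define L where "L c d = [: Complex c (- d) / 2, 0, Complex c d / 2 :]" for c d
  define u u1 u2 where "u = L c0 d0" and "u1 = L c1 d1" and "u2 = L c2 d2"
  define K where "K k = [: ?C k :]" for k
  define SA where "SA = K al * X ^ 2 - u ^ 2"
  define SB where "SB = K nu * X ^ 2 - u1 * u"
  define Z where "Z = K r2 * X ^ 2 + u1 * X - K (1 / r) * SA"
  define pp where "pp = K r3 * X ^ 3 + u2 * X ^ 2 - K (2 / r) * SB * X - K (1 / r\<^sup>2) * SA * u"
  define p where "p = K r1 * X + u"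
  define P where "P = p ^ 2 + K (q\<^sup>2) * X ^ 2"
  define H where "H = K (r\<^sup>2) * (K (N * lam1) * P ^ 2 * X + (K q2 * p * X ^ 2 - K q * pp) * P
      - K 2 * (K q1 * p * X - K q * Z) * (p * Z + K (q * q1) * X ^ 3)
      - (p * Z + K (q * q1) * X ^ 3) * (K (N * lam) * P + K q1 * p * X - K q * Z))
    + K q * P * (K r * SB - K (2 * r1) * SA) * X + K ((N - 1) * q) * u * P ^ 2 + K (2 * q) * p * SA * P
    + K ((N - 1) * r) * p * P * (K (N * lam) * P + K q1 * p * X - K q * Z)"
  have root: "poly H (cis (- t)) = 0" if t: "\<bar>t\<bar> < \<delta>" for t
  proof -
    define e where "e = cis (- t)"
    have Lp: "poly (L c d) e = e * ?C (c * cos t + d * sin t)" for c d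
    proof -
      have "cis t * e = 1"
        by (simp add: e_def cis_mult)
      then have "poly (L c d) e = e * (Complex c (- d) / 2 * cis t + Complex c d / 2 * e)"
        by (simp add: L_def algebra_simps)
      also have "Complex c (- d) / 2 * cis t + Complex c d / 2 * e = ?C (c * cos t + d * sin t)"
        by (simp add: complex_eq_iff e_def diff_divide_distrib)
      finally show ?thesis .
    qed
    define u' u1' u2' where "u' = c0 * cos t + d0 * sin t" and "u1' = c1 * cos t + d1 * sin t" and "u2' = c2 * cos t + d2 * sin t"
    define SA' where "SA' = al - u'\<^sup>2"
    define SB' where "SB' = nu - u1' * u'"
    define Z' where "Z' = r2 + u1' - SA' / r"
    define pp' where "pp' = r3 + u2' - 2 * SB' / r - SA' * u' / r\<^sup>2"
    define p' where "p' = r1 + u'"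
    define P' where "P' = p'\<^sup>2 + q\<^sup>2"
    have [simp]: "poly (K k) e = ?C k" "poly X e = e" for k
      by (simp_all add: K_def X_def)
    have [simp]: "poly u e = e * ?C u'" "poly u1 e = e * ?C u1'" "poly u2 e = e * ?C u2'"
      by (simp_all only: u_def u1_def u2_def Lp u'_def u1'_def u2'_def)
    have [simp]: "poly SA e = e ^ 2 * ?C SA'"
      by (simp add: SA_def SA'_def algebra_simps)
    have [simp]: "poly SB e = e ^ 2 * ?C SB'"
      by (simp add: SB_def SB'_def algebra_simps power2_eq_square)
    have [simp]: "poly Z e = e ^ 2 * ?C Z'"
      by (simp add: Z_def Z'_def algebra_simps power2_eq_square)
    have [simp]: "poly pp e = e ^ 3 * ?C pp'"
      by (simp add: pp_def pp'_def algebra_simps power2_eq_square power3_eq_cube)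
    have [simp]: "poly p e = e * ?C p'"
      by (simp add: p_def p'_def algebra_simps)
    have [simp]: "poly P e = e ^ 2 * ?C P'"
      by (simp add: P_def P'_def algebra_simps)
    have "poly H e = e ^ 5 * ?C (r\<^sup>2 * (P'\<^sup>2 * N * lam1 + (p' * q2 - q * pp') * P' - 2 * (p' * q1 - q * Z') * (p' * Z' + q * q1)
      - (p' * Z' + q * q1) * (N * lam * P' + p' * q1 - q * Z'))
    + q * P' * (r * SB' - 2 * r1 * SA') + (N - 1) * q * u' * P'\<^sup>2 + 2 * p' * q * SA' * P'
    + (N - 1) * r * p' * P' * (N * lam * P' + p' * q1 - q * Z'))"
      unfolding H_def by simp algebra
    also have "\<dots> = 0"
      using eq[OF t u'_def u1'_def u2'_def SA'_def SB'_def Z'_def pp'_def p'_def P'_def] by simp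
    finally show ?thesis by (simp add: e_def)
  qed
  \<comment> \<open>A nonzero polynomial has finitely many roots, but a whole arc of the unit circle
    consists of roots of \<open>H\<close>.\<close>
  have "H = 0"
  proof (rule ccontr)
    assume "H \<noteq> 0"
    then have "finite {z. poly H z = 0}" by (rule poly_roots_finite)
    moreover have "(\<lambda>t. cis (- t)) ` {- min \<delta> 1 <..< min \<delta> 1} \<subseteq> {z. poly H z = 0}"
      using root by (auto simp: abs_less_iff)
    moreover have "inj_on (\<lambda>t. cis (- t)) {- min \<delta> 1 <..< min \<delta> 1}"
    proof (rule inj_onI)
      fix t t' assume t: "t \<in> {- min \<delta> 1 <..< min \<delta> 1}" "t' \<in> {- min \<delta> 1 <..< min \<delta> 1}" and "cis (- t) = cis (- t')"
      then have "sin t = sin t'"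
        by (simp add: complex_eq_iff)
      moreover have "\<bar>t\<bar> \<le> pi / 2" "\<bar>t'\<bar> \<le> pi / 2"
        using t pi_gt3 by (auto simp: abs_le_iff)
      ultimately show "t = t'"
        by (metis abs_le_iff minus_le_iff sin_inj_pi)
    qed
    ultimately have "finite {- min \<delta> 1 <..< min \<delta> 1}"
      using finite_imageD finite_subset by blast
    then show False
      using \<delta> infinite_Ioo[of "- min \<delta> 1" "min \<delta> 1"] by simp
  qed
  then have "poly H 0 = 0" by simp
  define w where "w = Complex c0 (- d0) / 2"
  have [simp]: "poly (K k) 0 = ?C k" "poly X 0 = 0" "poly u 0 = w" for k
    by (simp_all add: K_def X_def u_def L_def w_def)
  \<comment> \<open>The relation \<open>q = lam * r\<close> combines the surviving terms into the
    single coefficient \<open>q * (N * (N - 2))\<close>.\<close>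
  have "poly H 0 = ?C (q * (N * (N - 2))) * w ^ 5"
    unfolding H_def using r
    by (simp add: P_def p_def pp_def Z_def SA_def SB_def ql field_simps power2_eq_square power3_eq_cube)
      (simp add: eval_nat_numeral algebra_simps)
  with \<open>poly H 0 = 0\<close> have "?C (q * (N * (N - 2))) = 0 \<or> w ^ 5 = 0"
    by (metis mult_eq_0_iff)
  then have "q * (N * (N - 2)) = 0 \<or> w = 0"
    by (metis of_real_eq_0_iff power_eq_0_iff)
  then show ?thesis
    by (auto simp: w_def complex_eq_iff)
qed

context sphere_chart
begin

text \<open>The great circle leaves \<open>x\<close> in the direction of the tangential part of
  \<open>a s\<close>, so a nonzero \<open>a s\<close> restricts to a nonzero linear form on it. The
  vanishing of the leading coefficient then contradicts n >= 3.\<close>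

lemma turning_or_translating:
  assumes n: "CARD('n) \<ge> 3" and hs: "hamiltonian_stationary M"
    and sx: "(s, x) \<in> A" and lam: "lam s \<noteq> 0"
  shows "a s = 0"
proof (rule ccontr)
  assume a0: "a s \<noteq> 0"
  have s: "s \<in> I" and x: "x \<in> sphere 0 1" using A_subset[OF sx] by auto
  have r0: "r s > 0" using r_pos[OF s] .
  have xx: "x \<bullet> x = 1" using x by (simp add: norm_eq_1)
  have n2: "CARD('n) \<ge> 2" using n by simp
  have "x \<bullet> (a s - (a s \<bullet> x) *\<^sub>R x) = 0"
    by (simp add: inner_diff_right inner_commute xx)
  then obtain k e where e: "e \<in> sphere 0 1" "x \<bullet> e = 0" and ke: "a s - (a s \<bullet> x) *\<^sub>R x = k *\<^sub>R e"
    using unit_direction[OF n2 x] by blast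
  have ee: "e \<bullet> e = 1" using e(1) by (simp add: norm_eq_1)
  have nz: "(a s \<bullet> x)\<^sup>2 + (a s \<bullet> e)\<^sup>2 \<noteq> 0"
  proof
    assume "(a s \<bullet> x)\<^sup>2 + (a s \<bullet> e)\<^sup>2 = 0"
    then have 0: "a s \<bullet> x = 0" "a s \<bullet> e = 0"
      by (simp_all add: sum_power2_eq_zero_iff)
    with ke have "a s = k *\<^sub>R e" by simp
    with 0(2) ee a0 show False by simp
  qed
  have "open (times s x 0 1 e)" "0 \<in> times s x 0 1 e"
    using open_times[OF x e, of s 0 1] sx by (simp_all add: times_def)
  then obtain \<delta> where \<delta>: "\<delta> > 0" "ball 0 \<delta> \<subseteq> times s x 0 1 e"
    using openE by blast
  have inA: "(s, great_circle 1 x e t) \<in> A" if "\<bar>t\<bar> < \<delta>" for t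
    using subsetD[OF \<delta>(2), of t] that by (simp add: times_def dist_norm)
  have gc: "v \<bullet> great_circle 1 x e t = (v \<bullet> x) * cos t + (v \<bullet> e) * sin t" for v t
    by (simp add: great_circle_def inner_add_right mult.commute)
  have "q s * (real CARD('n) * (real CARD('n) - 2)) * ((a s \<bullet> x)\<^sup>2 + (a s \<bullet> e)\<^sup>2) = 0"
  proof (rule stationary_polynomial_leading_term[OF \<delta>(1), where r = "r s" and lam = "lam s" and ?r1.0 = "r1 s" and ?r2.0 = "r2 s" and ?r3.0 = "r3 s" and ?q1.0 = "q1 s" and ?q2.0 = "q2 s"
      and ?lam1.0 = "lam1 s" and al = "a s \<bullet> a s" and nu = "a s \<bullet> a1 s" and ?c1.0 = "a1 s \<bullet> x" and ?d1.0 = "a1 s \<bullet> e" and ?c2.0 = "a2 s \<bullet> x" and ?d2.0 = "a2 s \<bullet> e"])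
    fix t :: real and u u1 u2 SA SB Z pp pv Pv
    assume t: "\<bar>t\<bar> < \<delta>"
      and defs: "u = (a s \<bullet> x) * cos t + (a s \<bullet> e) * sin t" "u1 = (a1 s \<bullet> x) * cos t + (a1 s \<bullet> e) * sin t"
      "u2 = (a2 s \<bullet> x) * cos t + (a2 s \<bullet> e) * sin t" "SA = a s \<bullet> a s - u\<^sup>2" "SB = a s \<bullet> a1 s - u1 * u"
      "Z = r2 s + u1 - SA / r s" "pp = r3 s + u2 - 2 * SB / r s - SA * u / (r s)\<^sup>2"
      "pv = r1 s + u" "Pv = pv\<^sup>2 + (q s)\<^sup>2"
    have P': "P s (great_circle 1 x e t) = Pv" "p s (great_circle 1 x e t) = pv"
      by (simp_all add: P_def p_def gc defs(1,8,9))
    show "(r s)\<^sup>2 * (Pv\<^sup>2 * real CARD('n) * lam1 s + (pv * q2 s - q s * pp) * Pv - 2 * (pv * q1 s - q s * Z) * (pv * Z + q s * q1 s)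
      - (pv * Z + q s * q1 s) * (real CARD('n) * lam s * Pv + pv * q1 s - q s * Z))
    + q s * Pv * (r s * SB - 2 * r1 s * SA) + (real CARD('n) - 1) * q s * u * Pv\<^sup>2 + 2 * pv * q s * SA * Pv
    + (real CARD('n) - 1) * r s * pv * Pv * (real CARD('n) * lam s * Pv + pv * q1 s - q s * Z) = 0"
      using stationary_equation[OF n2 hs inA[OF t]]
      unfolding gc defs(1,2,3)[symmetric] defs(4,5)[symmetric] defs(6)[symmetric] defs(7)[symmetric] P' .
  qed (use r0 in \<open>simp_all add: q_def\<close>)
  moreover have "q s \<noteq> 0" using lam r0 by (simp add: q_def)
  moreover have "real CARD('n) * (real CARD('n) - 2) \<noteq> 0" using n by simp
  ultimately show False using nz by simp
qed


section \<open>The stationary equation of a chart with a fixed centre\<close>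

lemma dderiv_locally_zero:
  assumes J: "open J" "J \<subseteq> I" "\<And>s. s \<in> J \<Longrightarrow> f s = 0" and s: "s \<in> J"
  shows "dderiv f (1::real) s = 0"
proof -
  have "(f has_derivative (\<lambda>h. 0)) (at s)"
    by (rule has_derivative_transform_within_open[OF has_derivative_const J(1) s]) (simp add: J(3))
  then show ?thesis by (rule dderiv_unique)
qed

text \<open>Values for \<open>a = 0\<close>, where nothing depends on the point of the sphere:
  \<open>P0\<close> is the squared speed orthogonal to the leaf, \<open>2 * D0\<close> its
  derivative, \<open>E0 / P0\<close> the derivative of the angle, \<open>E1\<close> the derivative
  of \<open>E0\<close>, and \<open>R0\<close> the stationary equation divided by
  \<open>r\<close>.\<close>

definition "P0 s = (r1 s)\<^sup>2 + (q s)\<^sup>2"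
definition "D0 s = r1 s * r2 s + q s * q1 s"
definition "E0 s = CARD('n) * lam s * P0 s + r1 s * q1 s - q s * r2 s"
definition "E1 s = CARD('n) * lam1 s * P0 s + 2 * real CARD('n) * lam s * D0 s + r1 s * q2 s - q s * r3 s"
definition "R0 s = r s * (P0 s * E1 s - 3 * D0 s * E0 s) + (real CARD('n) - 1) * r1 s * P0 s * E0 s"

text \<open>This is the immersion condition at a point \<open>x\<close> orthogonal to
  \<open>a s\<close>, which exists in dimension at least two.\<close>

lemma P0_pos:
  assumes n: "CARD('n) \<ge> 2" and s: "s \<in> I"
  shows "P0 s > 0"
proof -
  obtain x :: "real^'n" where x: "x \<in> sphere 0 1" "a s \<bullet> x = 0"
  proof (cases "a s = 0")
    case True
    have "(axis undefined 1 :: real^'n) \<in> sphere 0 1" by simp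
    then show thesis using that True by fastforce
  next
    case False
    then have "a s /\<^sub>R norm (a s) \<in> sphere 0 1" by simp
    from unit_direction[OF n this, of 0] obtain e where "e \<in> sphere 0 1" "(a s /\<^sub>R norm (a s)) \<bullet> e = 0"
      by auto
    with False that show thesis by simp
  qed
  then show ?thesis
    using P_pos[OF s x(1)] by (simp add: P_def p_def P0_def)
qed

lemma has_real_derivative_P0_E0:
  assumes s: "s \<in> I"
  shows "(P0 has_real_derivative 2 * D0 s) (at s)" "(E0 has_real_derivative E1 s) (at s)"
proof -
  note d = real_derivs(2,3,5)[OF s] has_real_derivative_q[OF s] has_real_derivative_q1[OF s]
  show P: "(P0 has_real_derivative 2 * D0 s) (at s)"
    unfolding P0_def[abs_def] D0_def
    by (rule DERIV_cong[OF DERIV_add[OF DERIV_power[OF d(1)] DERIV_power[OF d(4)]]]) (simp add: algebra_simps)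
  show "(E0 has_real_derivative E1 s) (at s)"
    unfolding E0_def[abs_def]
    by (rule DERIV_cong[OF DERIV_diff[OF DERIV_add[OF DERIV_mult[OF DERIV_cmult[OF d(3)] P] DERIV_mult[OF d(1) d(5)]] DERIV_mult[OF d(4) d(2)]]])
      (simp add: E1_def algebra_simps)
qed

end

text \<open>The domain is a product over an interval: above every \<open>s\<close> in
  \<open>I\<close> there are points of the chart, and functions on \<open>I\<close> with zero
  derivative are constant.\<close>

locale sphere_box = sphere_chart M U I r \<theta> a V A
  for M :: "(complex^'n) set" and U :: "complex^'n^'n" and I :: "real set"
    and r \<theta> :: "real \<Rightarrow> real" and a :: "real \<Rightarrow> real^'n" and V :: "real \<Rightarrow> complex^'n"
    and A :: "(real \<times> (real^'n)) set" +
  fixes O0 :: "(real^'n) set"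
  assumes box: "A = I \<times> O0" and O0: "O0 \<noteq> {}" and interval: "is_interval I"
    and hs: "hamiltonian_stationary M" and card3: "CARD('n) \<ge> 3"
begin

lemma card2: "CARD('n) \<ge> 2"
  using card3 by simp

lemma lam_nonzero_imp: "s \<in> I \<Longrightarrow> lam s \<noteq> 0 \<Longrightarrow> a s = 0"
  using turning_or_translating[OF card3 hs] O0 box by blast

lemma continuous_data:
  "continuous_on I r" "continuous_on I r1" "continuous_on I r2" "continuous_on I r3"
  "continuous_on I lam" "continuous_on I lam1" "continuous_on I lam2" "continuous_on I a"
  using smooth by (simp_all add: smooth_on_continuous_on smooth_on_dderiv)

text \<open>Where \<open>lam\<close> is nonzero this is the stationary equation. A point with
  nonzero \<open>R0\<close> would have a neighbourhood on which \<open>lam\<close> vanishes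
  identically; there \<open>E0\<close> and \<open>E1\<close> vanish, and one of them is a factor of
  every term of \<open>R0\<close>.\<close>

lemma R0_zero:
  assumes s: "s \<in> I"
  shows "R0 s = 0"
proof -
  have nonzero: "R0 s = 0" if s: "s \<in> I" and l: "lam s \<noteq> 0" for s
  proof -
    \<comment> \<open>On this open set \<open>a\<close> vanishes identically, hence so do its
      derivatives.\<close>
    define J where "J = I \<inter> lam -` (- {0})"
    have J: "open J" "J \<subseteq> I" "s \<in> J"
      unfolding J_def using continuous_open_preimage[OF continuous_data(5) I, of "- {0}"] s l by auto
    have a0: "a s = 0" if "s \<in> J" for s
      using that lam_nonzero_imp by (auto simp: J_def)
    have a10: "a1 s = 0" if "s \<in> J" for s
      by (rule dderiv_locally_zero[OF J(1,2) a0 that])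
    have a20: "a2 s = 0" if "s \<in> J" for s
      by (rule dderiv_locally_zero[OF J(1,2) a10 that])
    obtain x where sx: "(s, x) \<in> A" using s O0 box by blast
    have px: "p s x = r1 s" "P s x = P0 s"
      using a0[OF J(3)] by (simp_all add: p_def P_def P0_def)
    have "r s * (r s * ((P0 s)\<^sup>2 * CARD('n) * lam1 s + (r1 s * q2 s - q s * r3 s) * P0 s - 2 * (r1 s * q1 s - q s * r2 s) * D0 s
       - D0 s * E0 s) + (real CARD('n) - 1) * r1 s * P0 s * E0 s) = 0"
      using stationary_equation[OF card2 hs sx] a0[OF J(3)] a10[OF J(3)] a20[OF J(3)]
      unfolding px by (simp add: E0_def D0_def algebra_simps power2_eq_square)
    then have "r s * ((P0 s)\<^sup>2 * CARD('n) * lam1 s + (r1 s * q2 s - q s * r3 s) * P0 s - 2 * (r1 s * q1 s - q s * r2 s) * D0 s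
       - D0 s * E0 s) + (real CARD('n) - 1) * r1 s * P0 s * E0 s = 0"
      using r_pos[OF s] by simp
    moreover have "R0 s = r s * ((P0 s)\<^sup>2 * CARD('n) * lam1 s + (r1 s * q2 s - q s * r3 s) * P0 s - 2 * (r1 s * q1 s - q s * r2 s) * D0 s
       - D0 s * E0 s) + (real CARD('n) - 1) * r1 s * P0 s * E0 s"
      unfolding R0_def E1_def E0_def by algebra
    ultimately show ?thesis by simp
  qed
  show ?thesis
  proof (rule ccontr)
    assume R: "R0 s \<noteq> 0"
    have cq: "continuous_on I q" "continuous_on I q1" "continuous_on I q2"
      unfolding q_def[abs_def] q1_def[abs_def] q2_def[abs_def] by (intro continuous_intros continuous_data)+
    have cP: "continuous_on I P0" "continuous_on I D0"
      unfolding P0_def[abs_def] D0_def[abs_def] by (intro continuous_intros continuous_data cq)+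
    have cE: "continuous_on I E0" "continuous_on I E1"
      unfolding E0_def[abs_def] E1_def[abs_def] by (intro continuous_intros continuous_data cq cP)+
    have cR: "continuous_on I R0"
      unfolding R0_def[abs_def] by (intro continuous_intros continuous_data cP cE)
    define J where "J = I \<inter> R0 -` (- {0})"
    have J: "open J" "J \<subseteq> I" "s \<in> J"
      unfolding J_def using continuous_open_preimage[OF cR I, of "- {0}"] s R by auto
    have l0: "lam s = 0" if "s \<in> J" for s
      using that nonzero by (auto simp: J_def)
    have l1: "lam1 s = 0" if "s \<in> J" for s
      by (rule dderiv_locally_zero[OF J(1,2) l0 that])
    have l2: "lam2 s = 0" if "s \<in> J" for s
      by (rule dderiv_locally_zero[OF J(1,2) l1 that])
    have "R0 s = 0"
      using l0[OF J(3)] l1[OF J(3)] l2[OF J(3)]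
      by (simp add: R0_def E0_def E1_def q_def q1_def q2_def)
    with R show False by simp
  qed
qed

text \<open>
  The equation \<open>R0 = 0\<close> makes \<open>r\<^sup>2\<^sup>(\<^sup>n\<^sup>-\<^sup>1\<^sup>) E0\<^sup>2 / P0\<^sup>3\<close> constant. If this constant is nonzero, the zeros
  of \<open>\<theta>'\<close> are simple; if it is zero, \<open>r\<^sup>2\<^sup>n q\<^sup>2 / P0\<close> is constant too.
\<close>

lemma turning_dichotomy:
  "(\<forall>s\<in>I. lam s = 0) \<or>
   ((\<forall>s\<in>I. a s = 0) \<and> (\<forall>J. open J \<longrightarrow> J \<subseteq> I \<longrightarrow> J \<noteq> {} \<longrightarrow> (\<exists>s\<in>J. lam s \<noteq> 0)))"
proof -
  let ?m = "2 * (CARD('n) - 1)"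
  have convex: "convex I"
    using interval by (rule is_interval_convex)
  have N: "real ?m = 2 * (real CARD('n) - 1)"
    using card3 by (simp add: of_nat_diff)
  have pw: "r s ^ m = r s * r s ^ (m - Suc 0)" if "m > 0" for s m
    using that by (metis Suc_diff_1 One_nat_def power_Suc)
  have "\<exists>c. \<forall>s\<in>I. r s ^ ?m * (E0 s)\<^sup>2 / P0 s ^ 3 = c"
  proof (rule has_field_derivative_zero_constant[OF convex])
    fix s assume s: "s \<in> I"
    note d = real_derivs(1)[OF s] has_real_derivative_P0_E0[OF s]
    have "P0 s > 0" by (rule P0_pos[OF card2 s])
    then have nz: "P0 s ^ 3 \<noteq> 0" by simp
    have "((\<lambda>s. r s ^ ?m * (E0 s)\<^sup>2 / P0 s ^ 3) has_real_derivative 0) (at s)"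
    proof (rule DERIV_cong[OF DERIV_divide[OF DERIV_mult[OF DERIV_power[OF d(1), of ?m] DERIV_power[OF d(3), of 2]] DERIV_power[OF d(2), of 3] nz]])
      have "(real ?m * (r1 s * r s ^ (?m - Suc 0)) * (E0 s)\<^sup>2 + real 2 * (E1 s * E0 s ^ (2 - Suc 0)) * r s ^ ?m) * P0 s ^ 3 -
          r s ^ ?m * (E0 s)\<^sup>2 * (real 3 * (2 * D0 s * P0 s ^ (3 - Suc 0))) = 2 * r s ^ (?m - Suc 0) * E0 s * (P0 s)\<^sup>2 * R0 s"
        unfolding N R0_def using pw[of ?m s] card3 by (simp add: power2_eq_square power3_eq_cube algebra_simps)
      then show "((real ?m * (r1 s * r s ^ (?m - Suc 0)) * (E0 s)\<^sup>2 + real 2 * (E1 s * E0 s ^ (2 - Suc 0)) * r s ^ ?m) * P0 s ^ 3 -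
          r s ^ ?m * (E0 s)\<^sup>2 * (real 3 * (2 * D0 s * P0 s ^ (3 - Suc 0)))) / (P0 s ^ 3 * P0 s ^ 3) = 0"
        by (simp add: R0_zero[OF s])
    qed
    then show "((\<lambda>s. r s ^ ?m * (E0 s)\<^sup>2 / P0 s ^ 3) has_field_derivative 0) (at s within I)"
      by (rule has_field_derivative_at_within)
  qed
  then obtain c where c: "\<And>s. s \<in> I \<Longrightarrow> r s ^ ?m * (E0 s)\<^sup>2 / P0 s ^ 3 = c" by blast
  show ?thesis
  proof (cases "c = 0")
    case False
    \<comment> \<open>At a double zero of \<open>lam\<close> the quantity \<open>E0\<close> would
      vanish, and with it the constant.\<close>
    have simple: "lam1 s \<noteq> 0" if s: "s \<in> I" and l: "lam s = 0" for s
    proof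
      assume "lam1 s = 0"
      then have "E0 s = 0" using l by (simp add: E0_def q_def q1_def)
      with c[OF s] False show False by simp
    qed
    have dense: "\<exists>s\<in>J. lam s \<noteq> 0" if J: "open J" "J \<subseteq> I" "J \<noteq> {}" for J
    proof (rule ccontr)
      assume "\<not> (\<exists>s\<in>J. lam s \<noteq> 0)"
      then have l0: "\<And>s. s \<in> J \<Longrightarrow> lam s = 0" by blast
      obtain s where s: "s \<in> J" using J(3) by blast
      have "lam1 s = 0" by (rule dderiv_locally_zero[OF J(1,2) l0 s])
      with simple l0 s J(2) show False by blast
    qed
    have "a s = 0" if s: "s \<in> I" for s
    proof (rule ccontr)
      assume "a s \<noteq> 0"
      define J where "J = I \<inter> a -` (- {0})"
      have J: "open J" "J \<subseteq> I" "J \<noteq> {}"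
        unfolding J_def using continuous_open_preimage[OF continuous_data(8) I, of "- {0}"] s \<open>a s \<noteq> 0\<close> by auto
      obtain s' where "s' \<in> J" "lam s' \<noteq> 0" using dense[OF J] by blast
      with lam_nonzero_imp show False by (auto simp: J_def)
    qed
    with dense show ?thesis by blast
  next
    case True
    have E: "E0 s = 0" if s: "s \<in> I" for s
      using c[OF s] True P0_pos[OF card2 s] r_pos[OF s] by simp
    let ?k = "2 * CARD('n)"
    have k: "real ?k = 2 * real CARD('n)" by simp
    have "\<exists>c. \<forall>s\<in>I. r s ^ ?k * (q s)\<^sup>2 / P0 s = c"
    proof (rule has_field_derivative_zero_constant[OF convex])
      fix s assume s: "s \<in> I"
      note d = real_derivs(1)[OF s] has_real_derivative_q[OF s] has_real_derivative_P0_E0(1)[OF s]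
      have nz: "P0 s \<noteq> 0" using P0_pos[OF card2 s] by simp
      have "((\<lambda>s. r s ^ ?k * (q s)\<^sup>2 / P0 s) has_real_derivative 0) (at s)"
      proof (rule DERIV_cong[OF DERIV_divide[OF DERIV_mult[OF DERIV_power[OF d(1), of ?k] DERIV_power[OF d(2), of 2]] d(3) nz]])
        \<comment> \<open>The derivative of the second conserved quantity is a multiple of this
          bracket, which equals \<open>r s * r1 s * E0 s\<close>.\<close>
        have key: "real CARD('n) * r1 s * q s * P0 s + r s * q1 s * P0 s - r s * q s * D0 s = 0"
        proof -
          have "real CARD('n) * r1 s * q s * P0 s + r s * q1 s * P0 s - r s * q s * D0 s = r s * r1 s * E0 s"
            unfolding E0_def P0_def D0_def q_def by algebra
          then show ?thesis using E[OF s] by simp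
        qed
        have "(real ?k * (r1 s * r s ^ (?k - Suc 0)) * (q s)\<^sup>2 + real 2 * (q1 s * q s ^ (2 - Suc 0)) * r s ^ ?k) * P0 s -
            r s ^ ?k * (q s)\<^sup>2 * (2 * D0 s) = 2 * r s ^ (?k - Suc 0) * q s *
            (real CARD('n) * r1 s * q s * P0 s + r s * q1 s * P0 s - r s * q s * D0 s)"
          unfolding k using pw[of ?k s] by (simp add: power2_eq_square algebra_simps)
        then show "((real ?k * (r1 s * r s ^ (?k - Suc 0)) * (q s)\<^sup>2 + real 2 * (q1 s * q s ^ (2 - Suc 0)) * r s ^ ?k) * P0 s -
            r s ^ ?k * (q s)\<^sup>2 * (2 * D0 s)) / (P0 s * P0 s) = 0"
          unfolding key by simp
      qed
      then show "((\<lambda>s. r s ^ ?k * (q s)\<^sup>2 / P0 s) has_field_derivative 0) (at s within I)"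
        by (rule has_field_derivative_at_within)
    qed
    then obtain c' where c': "\<And>s. s \<in> I \<Longrightarrow> r s ^ ?k * (q s)\<^sup>2 / P0 s = c'" by blast
    show ?thesis
    \<comment> \<open>Since \<open>r\<close> and \<open>P0\<close> are positive, the constant
      decides whether \<open>lam\<close> vanishes everywhere or nowhere on \<open>I\<close>.\<close>
    proof (cases "c' = 0")
      case True
      have "lam s = 0" if s: "s \<in> I" for s
        using c'[OF s] True P0_pos[OF card2 s] r_pos[OF s] by (simp add: q_def)
      then show ?thesis by blast
    next
      case False
      have "lam s \<noteq> 0" if s: "s \<in> I" for s
        using c'[OF s] False by (auto simp: q_def)
      then show ?thesis
        using lam_nonzero_imp by blast
    qed
  qed
qed

end

subsection \<open>Calculus of smooth maps\<close>

text \<open>On an open set the derivative at a point depends only on values in the set, so the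
  recursion through derivatives respects equality on it.\<close>

lemma Ck_on_cong:
  assumes "open S" "Ck_on k S f" "\<And>x. x \<in> S \<Longrightarrow> f x = g x"
  shows "Ck_on k S g"
  using assms(2,3)
proof (induction k arbitrary: f g)
  case 0
  then show ?case by (simp cong: continuous_on_cong)
next
  case (Suc k)
  have d: "(g has_derivative frechet_derivative f (at x)) (at x)" if "x \<in> S" for x
  proof (rule has_derivative_transform_within_open[OF _ assms(1) that])
    show "(f has_derivative frechet_derivative f (at x)) (at x)"
      using Suc.prems(1) that by (simp add: frechet_derivative_works[symmetric])
  qed (rule Suc.prems(2))
  then have "\<forall>x\<in>S. g differentiable (at x)"
    unfolding differentiable_def by blast
  moreover have "Ck_on k S (\<lambda>x. frechet_derivative g (at x) v)" for v
    by (rule Suc.IH[of "\<lambda>x. frechet_derivative f (at x) v"])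
      (use Suc.prems(1) frechet_derivative_at[OF d] in auto)
  ultimately show ?case by simp
qed

lemma Ck_on_SucD: "Ck_on (Suc k) S f \<Longrightarrow> Ck_on k S f"
proof (induction k arbitrary: f)
  case 0
  then show ?case
    by (auto intro!: continuous_at_imp_continuous_on differentiable_imp_continuous_within)
next
  case (Suc k)
  then show ?case by simp
qed

lemma Ck_on_SucI:
  assumes "open S" "\<And>x. x \<in> S \<Longrightarrow> (f has_derivative f' x) (at x)" "\<And>v. Ck_on k S (\<lambda>x. f' x v)"
  shows "Ck_on (Suc k) S f"
proof -
  have "Ck_on k S (\<lambda>x. frechet_derivative f (at x) v)" for v
    by (rule Ck_on_cong[OF assms(1) assms(3)[of v]]) (simp add: frechet_derivative_at[OF assms(2)])
  then show ?thesis
    using assms(2) by (auto simp: differentiable_def)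
qed

lemma Ck_on_Suc_has_derivative:
  assumes "Ck_on (Suc k) S f" "x \<in> S"
  shows "(f has_derivative frechet_derivative f (at x)) (at x)"
  using assms frechet_derivative_works by auto

lemma Ck_on_const: "Ck_on k S (\<lambda>x. c)"
  by (induction k arbitrary: c) auto

lemma Ck_on_add:
  assumes "open S" "Ck_on k S f" "Ck_on k S g"
  shows "Ck_on k S (\<lambda>x. f x + g x)"
  using assms(2,3)
proof (induction k arbitrary: f g)
  case 0
  then show ?case by (auto intro: continuous_intros)
next
  case (Suc k)
  show ?case
    by (rule Ck_on_SucI[OF assms(1) has_derivative_add[OF Ck_on_Suc_has_derivative[OF Suc.prems(1)] Ck_on_Suc_has_derivative[OF Suc.prems(2)]]])
      (use Suc in auto)
qed

lemma Ck_on_bounded_bilinear: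
  assumes "open S" "bounded_bilinear pr" "Ck_on k S f" "Ck_on k S g"
  shows "Ck_on k S (\<lambda>x. pr (f x) (g x))"
  using assms(3,4)
proof (induction k arbitrary: f g)
  case 0
  then show ?case by (auto intro: bounded_bilinear.continuous_on[OF assms(2)])
next
  case (Suc k)
  show ?case
    by (rule Ck_on_SucI[OF assms(1) bounded_bilinear.FDERIV[OF assms(2) Ck_on_Suc_has_derivative[OF Suc.prems(1)] Ck_on_Suc_has_derivative[OF Suc.prems(2)]]])
      (use Suc Suc.prems[THEN Ck_on_SucD] in \<open>auto intro!: Ck_on_add[OF assms(1)]\<close>)
qed

lemma Ck_on_bounded_linear:
  assumes "open S" "bounded_linear h" "Ck_on k S f"
  shows "Ck_on k S (\<lambda>x. h (f x))"
  using assms(3)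
proof (induction k arbitrary: f)
  case 0
  then show ?case by (auto intro: bounded_linear.continuous_on[OF assms(2)])
next
  case (Suc k)
  show ?case
    by (rule Ck_on_SucI[OF assms(1) bounded_linear.has_derivative[OF assms(2) Ck_on_Suc_has_derivative[OF Suc.prems]]])
      (use Suc in auto)
qed

lemma smooth_on_const: "smooth_on S (\<lambda>x. c)"
  by (simp add: smooth_on_def Ck_on_const)

lemma smooth_on_add: "open S \<Longrightarrow> smooth_on S f \<Longrightarrow> smooth_on S g \<Longrightarrow> smooth_on S (\<lambda>x. f x + g x)"
  by (simp add: smooth_on_def Ck_on_add)

lemma smooth_on_bounded_bilinear:
  "open S \<Longrightarrow> bounded_bilinear pr \<Longrightarrow> smooth_on S f \<Longrightarrow> smooth_on S g \<Longrightarrow> smooth_on S (\<lambda>x. pr (f x) (g x))"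
  by (simp add: smooth_on_def Ck_on_bounded_bilinear)

lemma smooth_on_bounded_linear:
  "open S \<Longrightarrow> bounded_linear h \<Longrightarrow> smooth_on S f \<Longrightarrow> smooth_on S (\<lambda>x. h (f x))"
  by (simp add: smooth_on_def Ck_on_bounded_linear)

lemma smooth_on_sum:
  assumes "finite J" "open S" "\<And>j. j \<in> J \<Longrightarrow> smooth_on S (f j)"
  shows "smooth_on S (\<lambda>x. \<Sum>j\<in>J. f j x)"
  using assms(1,3) by (induction J rule: finite_induct) (auto simp: smooth_on_const smooth_on_add assms(2))

lemma Ck_on_SucI_real:
  fixes f :: "real \<Rightarrow> 'b::real_normed_vector"
  assumes "open I" "\<And>s. s \<in> I \<Longrightarrow> (f has_vector_derivative f' s) (at s)" "Ck_on k I f'"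
  shows "Ck_on (Suc k) I f"
  by (rule Ck_on_SucI[where f'="\<lambda>s h. h *\<^sub>R f' s", OF assms(1) assms(2)[unfolded has_vector_derivative_def]], assumption,
    rule Ck_on_bounded_linear[OF assms(1) bounded_linear_scaleR_right assms(3)])

lemma smooth_on_antiderivative:
  fixes f :: "real \<Rightarrow> 'b::real_normed_vector"
  assumes "open I" "\<And>s. s \<in> I \<Longrightarrow> (f has_vector_derivative f' s) (at s)" "smooth_on I f'"
  shows "smooth_on I f"
  unfolding smooth_on_def
proof
  fix k show "Ck_on k I f"
    by (rule Ck_on_SucD[OF Ck_on_SucI_real[OF assms(1,2)]]) (use assms(3) in \<open>simp_all add: smooth_on_def\<close>)
qed

text \<open>Differentiation reproduces \<open>cis (\<theta> s)\<close> times a smooth factor, so the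
  induction on the order closes.\<close>

lemma smooth_on_cis:
  fixes \<theta> :: "real \<Rightarrow> real"
  assumes I: "open I" and \<theta>: "smooth_on I \<theta>"
  shows "smooth_on I (\<lambda>s. cis (\<theta> s))"
  unfolding smooth_on_def
proof
  fix k show "Ck_on k I (\<lambda>s. cis (\<theta> s))"
  proof (induction k)
    case 0
    show ?case
      using smooth_on_continuous_on[OF \<theta>] by (simp add: cis_conv_exp continuous_intros)
  next
    case (Suc k)
    have d: "((\<lambda>s. cis (\<theta> s)) has_vector_derivative \<i> * dderiv \<theta> 1 s * cis (\<theta> s)) (at s)" if "s \<in> I" for s
      using field_vector_diff_chain_at[OF has_vector_derivative_mult_right[OF
          has_vector_derivative_of_real[OF smooth_on_has_real_derivative[OF \<theta> that]]] DERIV_exp, of \<i>]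
      by (simp add: o_def cis_conv_exp)
    have l: "bounded_linear (\<lambda>x. \<i> * complex_of_real x)"
      by (intro bounded_linear_const_mult bounded_linear_of_real)
    show ?case
      by (rule Ck_on_SucI_real[OF I d], assumption, rule Ck_on_bounded_bilinear[OF I bounded_bilinear_mult
          Ck_on_bounded_linear[OF I l] Suc.IH])
        (use smooth_on_dderiv[OF \<theta>] in \<open>simp add: smooth_on_def\<close>)
  qed
qed

lemma smooth_on_subset:
  assumes "smooth_on S f" "T \<subseteq> S"
  shows "smooth_on T f"
proof -
  have "Ck_on k S f \<Longrightarrow> Ck_on k T f" for k and f :: "'a \<Rightarrow> 'b"
    by (induction k arbitrary: f) (use assms(2) continuous_on_subset in auto)
  then show ?thesis
    using assms(1) by (simp add: smooth_on_def)
qed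

text \<open>Evaluating the identity and its first three derivatives at 0 gives
  \<open>\<alpha> + \<gamma> = 0\<close>, \<open>2 * \<beta> + \<delta> = 0\<close>,
  \<open>4 * \<alpha> + \<gamma> = 0\<close> and \<open>8 * \<beta> + \<delta> = 0\<close>.\<close>

lemma second_harmonic_zero:
  fixes \<alpha> \<beta> \<gamma> \<delta> \<epsilon> :: real
  assumes \<epsilon>: "\<epsilon> > 0"
    and eq: "\<And>t. \<bar>t\<bar> < \<epsilon> \<Longrightarrow> \<alpha> * cos (2 * t) + \<beta> * sin (2 * t) + \<gamma> * cos t + \<delta> * sin t = 0"
  shows "\<alpha> = 0" "\<beta> = 0" "\<gamma> = 0" "\<delta> = 0"
proof -
  have step: "\<And>t. \<bar>t\<bar> < \<epsilon> \<Longrightarrow> (2 * \<beta>') * cos (2 * t) + (- 2 * \<alpha>') * sin (2 * t) + \<delta>' * cos t + (- \<gamma>') * sin t = 0"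
    if eq': "\<And>t. \<bar>t\<bar> < \<epsilon> \<Longrightarrow> \<alpha>' * cos (2 * t) + \<beta>' * sin (2 * t) + \<gamma>' * cos t + \<delta>' * sin t = 0" for \<alpha>' \<beta>' \<gamma>' \<delta>'
  proof -
    fix t :: real assume t: "\<bar>t\<bar> < \<epsilon>"
    let ?f = "\<lambda>t. \<alpha>' * cos (2 * t) + \<beta>' * sin (2 * t) + \<gamma>' * cos t + \<delta>' * sin t"
    have "(?f has_real_derivative (2 * \<beta>') * cos (2 * t) + (- 2 * \<alpha>') * sin (2 * t) + \<delta>' * cos t + (- \<gamma>') * sin t) (at t)"
      by (auto intro!: derivative_eq_intros)
    moreover have "(?f has_real_derivative 0) (at t)"
      by (rule has_field_derivative_transform_within_open[OF DERIV_const, of "{-\<epsilon><..<\<epsilon>}" _ 0])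
        (use t eq' in \<open>auto simp: abs_less_iff\<close>)
    ultimately show "(2 * \<beta>') * cos (2 * t) + (- 2 * \<alpha>') * sin (2 * t) + \<delta>' * cos t + (- \<gamma>') * sin t = 0"
      by (rule DERIV_unique)
  qed
  note s1 = step[OF eq]
  note s2 = step[OF s1]
  note s3 = step[OF s2]
  show "\<alpha> = 0" "\<beta> = 0" "\<gamma> = 0" "\<delta> = 0"
    using eq[of 0] s1[of 0] s2[of 0] s3[of 0] \<epsilon> by simp_all
qed

lemma herm_add: "herm (x + y) z = herm x z + herm y z" "herm z (x + y) = herm z x + herm z y"
  by (simp_all add: herm_def algebra_simps sum.distrib)

lemma herm_scaleR: "herm (c *\<^sub>R x) z = c *\<^sub>R herm x z" "herm z (c *\<^sub>R x) = c *\<^sub>R herm z x"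
  by (simp_all add: herm_def scaleR_sum_right)

lemma herm_commute: "herm y x = cnj (herm x y)"
  by (simp add: herm_def mult.commute)

lemma bounded_bilinear_herm: "bounded_bilinear (herm :: complex^'n \<Rightarrow> _)"
  unfolding bilinear_conv_bounded_bilinear[symmetric] bilinear_def
  by (auto intro!: linearI simp: herm_add herm_scaleR)

lemma orthonormal_expansion:
  fixes e :: "'n \<Rightarrow> real^'n"
  assumes "\<And>v w. (\<Sum>k\<in>UNIV. (v \<bullet> e k) * (w \<bullet> e k)) = v \<bullet> w"
  shows "v = (\<Sum>k\<in>UNIV. (v \<bullet> e k) *\<^sub>R e k)"
proof (rule vector_eq_rdot[THEN iffD1], rule allI)
  fix w
  show "v \<bullet> w = (\<Sum>k\<in>UNIV. (v \<bullet> e k) *\<^sub>R e k) \<bullet> w"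
    unfolding assms[of v w, symmetric] inner_sum_left inner_scaleR_left by (simp add: inner_commute)
qed

lemma openin_sphere_great_circle:
  assumes S: "openin (top_of_set (sphere 0 1)) S" "x \<in> S" and e: "e \<in> sphere 0 1" "x \<bullet> e = 0"
  obtains \<delta> where "\<delta> > 0" "\<And>t. \<bar>t\<bar> < \<delta> \<Longrightarrow> great_circle 1 x e t \<in> S"
proof -
  obtain B where B: "open B" "S = sphere 0 1 \<inter> B"
    using S(1) unfolding openin_open by blast
  have xs: "x \<in> sphere 0 1" using S(2) B(2) by blast
  have "open (great_circle 1 x e -` B)"
    unfolding great_circle_def[abs_def] by (intro open_vimage B(1) continuous_intros)
  moreover have "0 \<in> great_circle 1 x e -` B"
    using S(2) B(2) by simp
  ultimately obtain \<delta> where \<delta>: "\<delta> > 0" "ball 0 \<delta> \<subseteq> great_circle 1 x e -` B"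
    using openE by blast
  show thesis
  proof (rule that[OF \<delta>(1)])
    fix t :: real assume "\<bar>t\<bar> < \<delta>"
    then have "great_circle 1 x e t \<in> B"
      using subsetD[OF \<delta>(2), of t] by (simp add: dist_norm)
    then show "great_circle 1 x e t \<in> S"
      using great_circle_in_sphere[OF xs e] B(2) by blast
  qed
qed


subsection \<open>Reduction to a turning Lagrangian plane\<close>

text \<open>\<open>g s\<close> is the rotation of the foliation restricted to the real subspace. It
  is only known to preserve the real inner product; the imaginary part of \<open>herm\<close> has to
  be extracted from the Lagrangian condition. The last inequality is the immersion condition on a
  tangent vector with unit component along the parameter.\<close>

locale round_chart =
  fixes M :: "(complex^'n) set" and I :: "real set" and r :: "real \<Rightarrow> real"
    and g :: "real \<Rightarrow> real^'n \<Rightarrow> complex^'n" and V :: "real \<Rightarrow> complex^'n"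
    and O0 :: "(real^'n) set"
  assumes lag: "lagrangian M"
    and I: "open I"
    and smooth: "smooth_on I r" "smooth_on I V" "\<And>y. smooth_on I (\<lambda>s. g s y)"
    and lin: "linear (g s)"
    and iso: "s \<in> I \<Longrightarrow> g s y \<bullet> g s z = y \<bullet> z"
    and r_pos: "s \<in> I \<Longrightarrow> r s > 0"
    and O0: "openin (top_of_set (sphere 0 1)) O0" "O0 \<noteq> {}"
    and in_M: "s \<in> I \<Longrightarrow> x \<in> O0 \<Longrightarrow> r s *\<^sub>R g s x + V s \<in> M"
    and immersed: "s \<in> I \<Longrightarrow> x \<in> sphere 0 1 \<Longrightarrow> v \<bullet> x = 0 \<Longrightarrow>
      dderiv r 1 s *\<^sub>R g s x + r s *\<^sub>R (dderiv (\<lambda>s. g s x) 1 s + g s v) + dderiv V 1 s \<noteq> 0"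
    and card3: "CARD('n) \<ge> 3"
begin

abbreviation "r1 \<equiv> dderiv r 1"
abbreviation "V1 \<equiv> dderiv V 1"
abbreviation "g1 s y \<equiv> dderiv (\<lambda>s. g s y) 1 s"

lemma submanifold: "submanifold M"
  using lag by (simp add: lagrangian_def)

lemma isotropic: "p \<in> M \<Longrightarrow> v \<in> tangent_space M p \<Longrightarrow> w \<in> tangent_space M p \<Longrightarrow> Im (herm v w) = 0"
  using lag by (auto simp: lagrangian_def symplectic_form_herm)

lemma bounded_linear_g: "bounded_linear (g s)"
  using lin by (simp add: linear_conv_bounded_linear)

lemma dg: "s \<in> I \<Longrightarrow> ((\<lambda>s. g s y) has_vector_derivative g1 s y) (at s)"
  by (rule smooth_on_has_vector_derivative[OF smooth(3)])

lemma linear_g1: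
  assumes s: "s \<in> I"
  shows "linear (g1 s)"
proof (rule linearI)
  fix y z c
  have "((\<lambda>s. g s (y + z)) has_vector_derivative g1 s y + g1 s z) (at s)"
    using has_vector_derivative_add[OF dg[OF s, of y] dg[OF s, of z]] by (simp add: linear_add[OF lin])
  then show "g1 s (y + z) = g1 s y + g1 s z"
    using dg[OF s, of "y + z"] vector_derivative_unique_at by blast
  have "((\<lambda>s. g s (c *\<^sub>R y)) has_vector_derivative c *\<^sub>R g1 s y) (at s)"
    using bounded_linear.has_vector_derivative[OF bounded_linear_scaleR_right dg[OF s, of y]]
    by (simp add: linear_cmul[OF lin])
  then show "g1 s (c *\<^sub>R y) = c *\<^sub>R g1 s y"
    using dg[OF s, of "c *\<^sub>R y"] vector_derivative_unique_at by blast
qed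

lemma O0_sphere: "x \<in> O0 \<Longrightarrow> x \<in> sphere 0 1"
  using openin_imp_subset[OF O0(1)] by blast

lemma leaf_tangent:
  assumes s: "s \<in> I" and x: "x \<in> O0" and e: "e \<in> sphere 0 1" "x \<bullet> e = 0"
  shows "g s e \<in> tangent_space M (r s *\<^sub>R g s x + V s)"
proof -
  obtain \<delta> where \<delta>: "\<delta> > 0" "\<And>t. \<bar>t\<bar> < \<delta> \<Longrightarrow> great_circle 1 x e t \<in> O0"
    using openin_sphere_great_circle[OF O0(1) x e] by blast
  let ?c = "\<lambda>t. r s *\<^sub>R g s (great_circle 1 x e t) + V s"
  have d: "(?c has_vector_derivative r s *\<^sub>R g s (great_circle' 1 x e t) + 0) (at t)" for t
    by (intro has_vector_derivative_add has_vector_derivative_const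
        bounded_linear.has_vector_derivative[OF bounded_linear_scaleR_right]
        bounded_linear.has_vector_derivative[OF bounded_linear_g] has_vector_derivative_great_circle(1))
  have "continuous_on {-\<delta><..<\<delta>} ?c"
    by (intro continuous_at_imp_continuous_on ballI has_vector_derivative_continuous[OF d])
  then have "r s *\<^sub>R g s (great_circle' 1 x e 0) + 0 \<in> tangent_space M (?c 0)"
    by (intro velocity_in_tangent_space[OF submanifold _ _ _ _ d, of "{-\<delta><..<\<delta>}"])
      (use \<delta> in_M[OF s] in \<open>auto simp: abs_less_iff\<close>)
  then have "r s *\<^sub>R g s e \<in> tangent_space M (r s *\<^sub>R g s x + V s)"
    by simp
  from subspace_scale[OF tangent_space_subspace_dim(1)[OF submanifold in_M[OF s x]] this, of "1 / r s"]
  show ?thesis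
    using r_pos[OF s] by simp
qed

lemma transversal_tangent:
  assumes s: "s \<in> I" and x: "x \<in> O0"
  shows "r1 s *\<^sub>R g s x + r s *\<^sub>R g1 s x + V1 s \<in> tangent_space M (r s *\<^sub>R g s x + V s)"
proof -
  let ?c = "\<lambda>t. r t *\<^sub>R g t x + V t"
  have d: "(?c has_vector_derivative (r t *\<^sub>R g1 t x + r1 t *\<^sub>R g t x) + V1 t) (at t)" if "t \<in> I" for t
    using that by (intro has_vector_derivative_add smooth_on_has_vector_derivative[OF smooth(2)]
        bounded_bilinear.has_vector_derivative[OF bounded_bilinear_scaleR] dg smooth_on_has_vector_derivative[OF smooth(1)])
  have "continuous_on I ?c"
    by (intro continuous_at_imp_continuous_on ballI has_vector_derivative_continuous[OF d])
  from velocity_in_tangent_space[OF submanifold I s in_M[OF _ x] this d[OF s]]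
  show ?thesis by (simp add: add.commute)
qed

lemma great_circle'_conv: "great_circle' 1 x e t = great_circle 1 e (- x) t"
  by (simp add: great_circle'_def great_circle_def)

lemma great_circle'_props:
  assumes "x \<in> sphere 0 1" "e \<in> sphere 0 1" "x \<bullet> e = 0"
  shows "great_circle' 1 x e t \<in> sphere 0 1" "great_circle 1 x e t \<bullet> great_circle' 1 x e t = 0"
proof -
  show "great_circle' 1 x e t \<in> sphere 0 1"
    unfolding great_circle'_conv using assms by (intro great_circle_in_sphere) (auto simp: inner_commute)
  have "x \<bullet> x = 1" "e \<bullet> e = 1" using assms by (auto simp: norm_eq_1)
  then show "great_circle 1 x e t \<bullet> great_circle' 1 x e t = 0"
    using assms(3) by (simp add: great_circle_def great_circle'_def inner_add_left inner_diff_left inner_add_right inner_diff_right inner_commute)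
qed

text \<open>Leaf tangents at \<open>x\<close> are the images of vectors orthogonal to
  \<open>x\<close> and so are isotropic; the missing products involve \<open>x\<close> itself.
  Turning the base point towards another frame vector \<open>e l\<close> makes a combination of
  \<open>e l\<close> and \<open>x\<close> tangent while \<open>e j\<close> stays tangent, and
  isotropy at both base points isolates the product of \<open>x\<close> and
  \<open>e j\<close>.\<close>

lemma herm_g:
  assumes s: "s \<in> I"
  shows "herm (g s y) (g s z) = complex_of_real (y \<bullet> z)"
proof -
  obtain x where x: "x \<in> O0" using O0(2) by blast
  note xs = O0_sphere[OF x]
  obtain k0 :: 'n where True by blast
  obtain e :: "'n \<Rightarrow> real^'n" where e0: "e k0 = x" and e: "\<And>i j. e i \<bullet> e j = (if i = j then 1 else 0)"
    and pars: "\<And>v w. (\<Sum>k\<in>UNIV. (v \<bullet> e k) * (w \<bullet> e k)) = v \<bullet> w"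
    by (rule orthonormal_frame[OF xs, of k0]) (rule that)
  have es: "e k \<in> sphere 0 1" for k using e[of k k] by (simp add: norm_eq_1)
  let ?\<Omega> = "\<lambda>v w. Im (herm (g s v) (g s w))"
  have iso0: "?\<Omega> v w = 0" if "x \<in> O0" "v \<in> sphere 0 1" "x \<bullet> v = 0" "w \<in> sphere 0 1" "x \<bullet> w = 0" for x v w
    by (rule isotropic[OF in_M[OF s that(1)] leaf_tangent[OF s that(1,2,3)] leaf_tangent[OF s that(1,4,5)]])
  have off: "?\<Omega> x (e j) = 0" if j: "j \<noteq> k0" for j
  proof -
    \<comment> \<open>The third index exists because n >= 3.\<close>
    obtain l where l: "l \<noteq> k0" "l \<noteq> j"
    proof -
      have "UNIV \<noteq> {k0, j}"
      proof
        assume "UNIV = {k0, j}"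
        then have "CARD('n) = card {k0, j}" by simp
        with card3 j show False by simp
      qed
      with that show thesis by blast
    qed
    have xl: "x \<bullet> e l = 0" using e[of k0 l] l e0 by simp
    obtain \<delta> where \<delta>: "\<delta> > 0" "\<And>t. \<bar>t\<bar> < \<delta> \<Longrightarrow> great_circle 1 x (e l) t \<in> O0"
      using openin_sphere_great_circle[OF O0(1) x es xl] by blast
    define t where "t = min (\<delta> / 2) 1"
    have t: "\<bar>t\<bar> < \<delta>" "0 < t" "t < pi" using \<delta> pi_gt3 by (auto simp: t_def min_def)
    have "great_circle 1 x (e l) t \<bullet> e j = 0"
      using e[of k0 j] e[of l j] j l e0 by (simp add: great_circle_def inner_add_left)
    then have "?\<Omega> (great_circle' 1 x (e l) t) (e j) = 0"
      by (intro iso0[OF \<delta>(2)[OF t(1)]] great_circle'_props[OF xs es xl] es)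
    moreover have "?\<Omega> (e l) (e j) = 0"
      using e[of k0 j] j e0 by (intro iso0[OF x es xl es]) simp
    ultimately have "sin t * ?\<Omega> x (e j) = 0"
      by (simp add: great_circle'_def linear_diff[OF lin] linear_add[OF lin] linear_cmul[OF lin] herm_add herm_scaleR
          flip: scaleR_minus_left)
    then show ?thesis
      using sin_gt_zero[OF t(2,3)] by simp
  qed
  have "?\<Omega> (e i) (e j) = 0" for i j
  proof -
    consider "i = k0" "j = k0" | "i = k0" "j \<noteq> k0" | "i \<noteq> k0" "j = k0" | "i \<noteq> k0" "j \<noteq> k0" by blast
    then show ?thesis
    proof cases
      case 1
      then show ?thesis by (simp add: herm_def)
    next
      case 2
      then show ?thesis using off e0 by simp
    next
      case 3
      then show ?thesis using off[of i] e0 herm_commute[of "g s (e i)" "g s x"] by simp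
    next
      case 4
      then show ?thesis using e[of k0 i] e[of k0 j] e0 by (intro iso0[OF x es _ es]) auto
    qed
  qed
  moreover have "herm (g s y) (g s z) = (\<Sum>i\<in>UNIV. \<Sum>j\<in>UNIV. ((y \<bullet> e i) * (z \<bullet> e j)) *\<^sub>R herm (g s (e i)) (g s (e j)))"
  proof -
    interpret h: bounded_bilinear "herm :: complex^'n \<Rightarrow> _" by (rule bounded_bilinear_herm)
    have "g s v = (\<Sum>i\<in>UNIV. (v \<bullet> e i) *\<^sub>R g s (e i))" for v
      by (subst orthonormal_expansion[OF pars, of v]) (simp add: linear_sum[OF lin] linear_cmul[OF lin])
    then have "herm (g s y) (g s z) = herm (\<Sum>i\<in>UNIV. (y \<bullet> e i) *\<^sub>R g s (e i)) (\<Sum>j\<in>UNIV. (z \<bullet> e j) *\<^sub>R g s (e j))"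
      by metis
    then show ?thesis
      by (simp only: h.sum_left, simp only: h.sum_right herm_scaleR, simp add: mult_ac)
  qed
  ultimately have "Im (herm (g s y) (g s z)) = 0" by simp
  moreover have "Re (herm (g s y) (g s z)) = y \<bullet> z"
    using iso[OF s] by (simp add: inner_herm)
  ultimately show ?thesis by (simp add: complex_eq_iff)
qed

lemma herm_g1_skew:
  assumes s: "s \<in> I"
  shows "herm (g s y) (g1 s z) + herm (g1 s y) (g s z) = 0"
proof -
  have "((\<lambda>s. herm (g s y) (g s z)) has_vector_derivative herm (g s y) (g1 s z) + herm (g1 s y) (g s z)) (at s)"
    by (rule bounded_bilinear.has_vector_derivative[OF bounded_bilinear_herm dg[OF s] dg[OF s]])
  moreover have "((\<lambda>s. herm (g s y) (g s z)) has_vector_derivative 0) (at s)"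
    by (rule has_vector_derivative_transform_within_open[OF has_vector_derivative_const I s]) (simp add: herm_g)
  ultimately show ?thesis by (rule vector_derivative_unique_at)
qed

lemma Im_herm_g1_commute: "s \<in> I \<Longrightarrow> Im (herm (g1 s y) (g s z)) = Im (herm (g1 s z) (g s y))"
  using arg_cong[OF herm_g1_skew[of s y z], of Im] herm_commute[of "g1 s z" "g s y"] by simp

lemma Re_herm_g1_skew: "s \<in> I \<Longrightarrow> Re (herm (g1 s y) (g s z)) = - Re (herm (g1 s z) (g s y))"
  using arg_cong[OF herm_g1_skew[of s y z], of Re] herm_commute[of "g1 s z" "g s y"] by simp

text \<open>The choice of the unit vector is immaterial: the imaginary part of the turning proves to
  be the same multiple of the inner product in all directions.\<close>

definition "lam s = Im (herm (g1 s (axis undefined 1)) (g s (axis undefined 1)))"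

text \<open>That the transversal velocity at \<open>x\<close> is symplectically orthogonal to the
  leaf tangent \<open>v\<close> reads \<open>r s * ?B x v + ?b v = 0\<close>. Along a great circle
  the contribution of \<open>?B\<close> is a second harmonic and that of \<open>?b\<close> a first
  harmonic, so each vanishes. Hence \<open>?b\<close> is zero, and \<open>?B\<close> takes the same
  value on all unit vectors of an orthogonal pair.\<close>

lemma turning_scalar:
  assumes s: "s \<in> I"
  shows "Im (herm (g1 s y) (g s z)) = lam s * (y \<bullet> z)" "Im (herm (V1 s) (g s z)) = 0"
proof -
  obtain x where x: "x \<in> O0" using O0(2) by blast
  note xs = O0_sphere[OF x]
  obtain k0 :: 'n where True by blast
  obtain e :: "'n \<Rightarrow> real^'n" where e0: "e k0 = x" and e: "\<And>i j. e i \<bullet> e j = (if i = j then 1 else 0)"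
    and pars: "\<And>v w. (\<Sum>k\<in>UNIV. (v \<bullet> e k) * (w \<bullet> e k)) = v \<bullet> w"
    by (rule orthonormal_frame[OF xs, of k0]) (rule that)
  have es: "e k \<in> sphere 0 1" for k using e[of k k] by (simp add: norm_eq_1)
  let ?B = "\<lambda>y z. Im (herm (g1 s y) (g s z))" and ?b = "\<lambda>z. Im (herm (V1 s) (g s z))"
  note lins = linear_add[OF lin] linear_cmul[OF lin] linear_add[OF linear_g1[OF s]] linear_cmul[OF linear_g1[OF s]]
  have B_lin: "?B (c *\<^sub>R y + d *\<^sub>R z) (c' *\<^sub>R y' + d' *\<^sub>R z') =
      c * c' * ?B y y' + c * d' * ?B y z' + d * c' * ?B z y' + d * d' * ?B z z'" for c d c' d' y z y' z'
    by (simp only: lins(3,4), simp only: lins(1,2), simp add: herm_add herm_scaleR algebra_simps)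
  have b_lin: "?b (c *\<^sub>R y + d *\<^sub>R z) = c * ?b y + d * ?b z" for c d y z
    by (simp add: lins herm_add herm_scaleR)
  have base: "r s * ?B x v + ?b v = 0" if "x \<in> O0" "v \<in> sphere 0 1" "x \<bullet> v = 0" for x v
  proof -
    have "Im (herm (r1 s *\<^sub>R g s x + r s *\<^sub>R g1 s x + V1 s) (g s v)) = 0"
      by (rule isotropic[OF in_M[OF s that(1)] transversal_tangent[OF s that(1)] leaf_tangent[OF s that]])
    then show ?thesis
      using that(3) by (simp add: herm_add herm_scaleR herm_g[OF s])
  qed
  have harm: "?B x v = 0 \<and> ?B v v = ?B x x \<and> ?b v = 0 \<and> ?b x = 0" if v: "v \<in> sphere 0 1" "x \<bullet> v = 0" for v
  proof -
    obtain \<delta> where \<delta>: "\<delta> > 0" "\<And>t. \<bar>t\<bar> < \<delta> \<Longrightarrow> great_circle 1 x v t \<in> O0"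
      using openin_sphere_great_circle[OF O0(1) x v] by blast
    have "(r s * ?B x v) * cos (2 * t) + (r s * (?B v v - ?B x x) / 2) * sin (2 * t) + ?b v * cos t + (- ?b x) * sin t = 0"
      if t: "\<bar>t\<bar> < \<delta>" for t
    proof -
      have "r s * ?B (great_circle 1 x v t) (great_circle' 1 x v t) + ?b (great_circle' 1 x v t) = 0"
        by (rule base[OF \<delta>(2)[OF t] great_circle'_props[OF xs v]])
      then have "r s * (cos t * (- sin t) * ?B x x + cos t * cos t * ?B x v + sin t * (- sin t) * ?B v x + sin t * cos t * ?B v v)
          + ((- sin t) * ?b x + cos t * ?b v) = 0"
        unfolding great_circle_def great_circle'_def B_lin b_lin by simp
      then show ?thesis
        unfolding cos_double sin_double Im_herm_g1_commute[OF s, of v x]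
        by (simp add: power2_eq_square algebra_simps diff_divide_distrib)
    qed
    from second_harmonic_zero[OF \<delta>(1) this] r_pos[OF s] show ?thesis by simp
  qed
  define l where "l = ?B x x"
  have Bee: "?B (e i) (e j) = (if i = j then l else 0)" for i j
  proof -
    have *: "x \<bullet> e i = 0" if "i \<noteq> k0" for i using e[of k0 i] that e0 by simp
    consider "i = j" "i = k0" | "i = j" "i \<noteq> k0" | "i \<noteq> j" "i = k0" | "i \<noteq> j" "j = k0" | "i \<noteq> j" "i \<noteq> k0" "j \<noteq> k0" by blast
    then show ?thesis
    proof cases
      case 1
      then show ?thesis by (simp add: l_def flip: e0)
    next
      case 2
      then show ?thesis using harm[OF es *, of j] by (simp add: l_def)
    next
      case 3
      then show ?thesis using harm[OF es *, of j] e0 by simp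
    next
      case 4
      then show ?thesis using harm[OF es *, of i] e0 Im_herm_g1_commute[OF s, of "e i" x] by simp
    next
      case 5
      \<comment> \<open>The common diagonal value is also taken at the normalized sum, so
        polarization annihilates the mixed values.\<close>
      define v where "v = (1 / sqrt 2) *\<^sub>R e i + (1 / sqrt 2) *\<^sub>R e j"
      have "v \<bullet> v = 1"
        using 5 by (simp add: v_def inner_add_left inner_add_right e)
      then have "?B v v = l"
        using harm[of v] *[OF 5(2)] *[OF 5(3)] by (simp add: norm_eq_1 l_def) (simp add: v_def inner_add_right)
      moreover have "?B (e i) (e i) = l" "?B (e j) (e j) = l"
        using harm[OF es *[OF 5(2)]] harm[OF es *[OF 5(3)]] by (simp_all add: l_def)
      ultimately have "?B (e i) (e j) + ?B (e j) (e i) = 0"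
        unfolding v_def B_lin by (simp add: field_simps)
      then show ?thesis
        using 5 Im_herm_g1_commute[OF s, of "e j" "e i"] by simp
    qed
  qed
  interpret h: bounded_bilinear "herm :: complex^'n \<Rightarrow> _" by (rule bounded_bilinear_herm)
  have g_exp: "g s v = (\<Sum>i\<in>UNIV. (v \<bullet> e i) *\<^sub>R g s (e i))" for v
    by (subst orthonormal_expansion[OF pars, of v]) (simp add: linear_sum[OF lin] linear_cmul[OF lin])
  have g1_exp: "g1 s v = (\<Sum>i\<in>UNIV. (v \<bullet> e i) *\<^sub>R g1 s (e i))" for v
    by (subst orthonormal_expansion[OF pars, of v])
      (simp add: linear_sum[OF linear_g1[OF s]] linear_cmul[OF linear_g1[OF s]])
  have B_l: "?B y z = l * (y \<bullet> z)" for y z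
  proof -
    have "?B y z = Im (herm (\<Sum>i\<in>UNIV. (y \<bullet> e i) *\<^sub>R g1 s (e i)) (\<Sum>j\<in>UNIV. (z \<bullet> e j) *\<^sub>R g s (e j)))"
      using g_exp[of z] g1_exp[of y] by simp
    also have "\<dots> = (\<Sum>i\<in>UNIV. \<Sum>j\<in>UNIV. (y \<bullet> e i) * ((z \<bullet> e j) * ?B (e i) (e j)))"
      by (simp only: h.sum_left, simp only: h.sum_right herm_scaleR, simp add: mult_ac)
    also have "\<dots> = (\<Sum>i\<in>UNIV. l * ((y \<bullet> e i) * (z \<bullet> e i)))"
      unfolding Bee by (simp add: if_distrib[where f="\<lambda>x. _ * x"] mult_ac cong: if_cong)
    also have "\<dots> = l * (y \<bullet> z)"
      by (simp only: pars flip: sum_distrib_left)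
    finally show ?thesis .
  qed
  then have "l = lam s"
    by (simp add: lam_def)
  with B_l show "?B y z = lam s * (y \<bullet> z)" by simp
  have be: "?b (e j) = 0" for j
  proof (cases "j = k0")
    case True
    have "\<exists>i. i \<noteq> k0"
    proof (rule ccontr)
      assume "\<not> (\<exists>i. i \<noteq> k0)"
      then have "UNIV = {k0}" by blast
      then have "CARD('n) = card {k0}" by simp
      with card3 show False by simp
    qed
    then obtain i where "i \<noteq> k0" ..
    then show ?thesis
      using harm[OF es, of i] e[of k0 i] e0 True by simp
  next
    case False
    then show ?thesis
      using harm[OF es, of j] e[of k0 j] e0 by simp
  qed
  have "?b z = (\<Sum>j\<in>UNIV. (z \<bullet> e j) * ?b (e j))"
    using g_exp[of z] by (simp add: h.sum_right herm_scaleR)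
  then show "?b z = 0"
    by (simp add: be)
qed

end

lemma herm_unitary_expansion:
  assumes "unitary_matrix U"
  shows "herm z w = (\<Sum>l\<in>UNIV. herm z (column l U) * herm (column l U) w)"
    and "z = U *v (\<chi> l. herm z (column l U))"
proof -
  have "(\<Sum>l\<in>UNIV. herm z (column l U) * herm (column l U) w) =
      (\<Sum>l\<in>UNIV. \<Sum>i\<in>UNIV. \<Sum>j\<in>UNIV. (z $ i * cnj (w $ j)) * (U $ j $ l * cnj (U $ i $ l)))"
    by (simp add: herm_def column_def sum_product mult_ac)
  also have "\<dots> = (\<Sum>i\<in>UNIV. \<Sum>l\<in>UNIV. \<Sum>j\<in>UNIV. (z $ i * cnj (w $ j)) * (U $ j $ l * cnj (U $ i $ l)))"
    by (rule sum.swap)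
  also have "\<dots> = (\<Sum>i\<in>UNIV. \<Sum>j\<in>UNIV. \<Sum>l\<in>UNIV. (z $ i * cnj (w $ j)) * (U $ j $ l * cnj (U $ i $ l)))"
    by (intro sum.cong refl sum.swap)
  also have "\<dots> = (\<Sum>i\<in>UNIV. \<Sum>j\<in>UNIV. (z $ i * cnj (w $ j)) * (if j = i then 1 else 0))"
    by (simp only: unitary_rows[OF assms] flip: sum_distrib_left)
  also have "\<dots> = herm z w"
    by (simp add: herm_def if_distrib[where f="\<lambda>x. _ * x"] cong: if_cong)
  finally show "herm z w = (\<Sum>l\<in>UNIV. herm z (column l U) * herm (column l U) w)" ..
  have "(U *v (\<chi> l. herm z (column l U))) $ i = z $ i" for i
  proof -
    have "(U *v (\<chi> l. herm z (column l U))) $ i = (\<Sum>l\<in>UNIV. \<Sum>j\<in>UNIV. z $ j * (U $ i $ l * cnj (U $ j $ l)))"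
      by (simp add: matrix_vector_mult_def herm_def column_def sum_distrib_left mult_ac)
    also have "\<dots> = (\<Sum>j\<in>UNIV. \<Sum>l\<in>UNIV. z $ j * (U $ i $ l * cnj (U $ j $ l)))"
      by (rule sum.swap)
    also have "\<dots> = (\<Sum>j\<in>UNIV. z $ j * (if i = j then 1 else 0))"
      by (simp only: unitary_rows[OF assms] flip: sum_distrib_left)
    also have "\<dots> = z $ i"
      by (simp add: if_distrib[where f="\<lambda>x. _ * x"] cong: if_cong)
    finally show ?thesis .
  qed
  then show "z = U *v (\<chi> l. herm z (column l U))"
    by (simp add: vec_eq_iff)
qed

context round_chart
begin

section \<open>The moving frame as a unitary matrix and its rates of change\<close>

abbreviation "ax k \<equiv> axis k 1 :: real^'n"

definition frame_matrix :: "real \<Rightarrow> complex^'n^'n" where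
  "frame_matrix s = (\<chi> i k. g s (ax k) $ i)"

lemma column_frame [simp]: "column k (frame_matrix s) = g s (ax k)"
  by (simp add: column_def frame_matrix_def)

lemma frame_unitary:
  assumes "s \<in> I"
  shows "unitary_matrix (frame_matrix s)"
proof -
  have "(\<Sum>i\<in>UNIV. cnj (g s (ax j) $ i) * g s (ax k) $ i) = (if j = k then 1 else 0)" for j k
    using herm_g[OF assms, of "ax k" "ax j"] by (simp add: herm_def mult.commute inner_axis_axis)
  then have 1: "map_matrix cnj (transpose (frame_matrix s)) ** frame_matrix s = mat 1"
    by (simp add: vec_eq_iff matrix_matrix_mult_def frame_matrix_def transpose_def mat_def)
  then have "frame_matrix s ** map_matrix cnj (transpose (frame_matrix s)) = mat 1"
    using matrix_left_right_inverse by blast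
  with 1 show ?thesis by (simp add: unitary_matrix_def)
qed

lemma frame_matrix_real_vec: "frame_matrix s *v real_vec y = g s y"
proof -
  have "g s y = g s (\<Sum>k\<in>UNIV. y $ k *\<^sub>R ax k)"
    by (simp add: basis_expansion flip: scalar_mult_eq_scaleR)
  also have "\<dots> = (\<Sum>k\<in>UNIV. y $ k *\<^sub>R g s (ax k))"
    by (simp add: linear_sum[OF lin] linear_cmul[OF lin])
  finally show ?thesis
    by (simp add: vec_eq_iff matrix_vector_mult_def frame_matrix_def real_vec_def scaleR_conv_of_real[where 'a=complex] mult.commute)
qed

text \<open>Real components in the moving frame: \<open>rho s\<close> is the skew rate of rotation
  inside the plane, \<open>drift s\<close> the velocity of the centre.\<close>

definition "rho s y = (\<chi> l. Re (herm (g1 s y) (g s (ax l))))"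
definition "drift s = (\<chi> l. Re (herm (V1 s) (g s (ax l))))"

lemma real_combination:
  assumes s: "s \<in> I"
  shows "(\<Sum>l\<in>UNIV. (y $ l) *\<^sub>R g s (ax l)) = g s y"
  by (subst (2) basis_expansion[symmetric])
    (simp add: linear_sum[OF lin] linear_cmul[OF lin] scalar_mult_eq_scaleR)

lemma drift_eq:
  assumes s: "s \<in> I"
  shows "V1 s = g s (drift s)"
proof -
  have "V1 s = frame_matrix s *v (\<chi> l. herm (V1 s) (g s (ax l)))"
    using herm_unitary_expansion(2)[OF frame_unitary[OF s], of "V1 s"] by simp
  also have "(\<chi> l. herm (V1 s) (g s (ax l))) = real_vec (drift s)"
    using turning_scalar(2)[OF s] by (simp add: real_vec_def drift_def vec_eq_iff complex_eq_iff)
  finally show ?thesis by (simp only: frame_matrix_real_vec)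
qed

lemma g1_eq:
  assumes s: "s \<in> I"
  shows "g1 s y = (\<i> * lam s) *s g s y + g s (rho s y)"
proof -
  have "g1 s y = frame_matrix s *v (\<chi> l. herm (g1 s y) (g s (ax l)))"
    using herm_unitary_expansion(2)[OF frame_unitary[OF s], of "g1 s y"] by simp
  also have "(\<chi> l. herm (g1 s y) (g s (ax l))) = (\<i> * lam s) *s real_vec y + real_vec (rho s y)"
    using turning_scalar(1)[OF s]
    by (simp add: real_vec_def rho_def vec_eq_iff complex_eq_iff inner_axis)
  finally show ?thesis
    by (simp add: frame_matrix_real_vec matrix_vector_right_distrib vector_scalar_commute)
qed

lemma rho_perp:
  assumes s: "s \<in> I"
  shows "rho s x \<bullet> x = 0"
proof -
  have "herm (g1 s x) (g s x) = (\<Sum>l\<in>UNIV. (x $ l) *\<^sub>R herm (g1 s x) (g s (ax l)))"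
    by (subst real_combination[OF s, symmetric])
      (simp add: bounded_bilinear.sum_right[OF bounded_bilinear_herm] herm_scaleR)
  then have "Re (herm (g1 s x) (g s x)) = rho s x \<bullet> x"
    by (simp add: rho_def inner_vec_def mult.commute)
  then show ?thesis
    using Re_herm_g1_skew[OF s, of x x] by simp
qed

lemma smooth_herm: "smooth_on I f \<Longrightarrow> smooth_on I h \<Longrightarrow> smooth_on I (\<lambda>s. herm (f s) (h s))"
  by (rule smooth_on_bounded_bilinear[OF I bounded_bilinear_herm])

lemma smooth_lam: "smooth_on I lam"
  unfolding lam_def[abs_def]
  by (intro smooth_on_bounded_linear[OF I bounded_linear_Im] smooth_herm smooth_on_dderiv smooth)

section \<open>Separating the phase of the frame from its real rotation\<close>

context
  fixes \<alpha> \<beta> s0 :: real and \<theta> :: "real \<Rightarrow> real"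
  assumes J: "{\<alpha><..<\<beta>} \<subseteq> I" "s0 \<in> {\<alpha><..<\<beta>}"
    and \<theta>: "\<And>s. s \<in> {\<alpha><..<\<beta>} \<Longrightarrow> (\<theta> has_real_derivative lam s) (at s)" "\<theta> s0 = 0"
begin

abbreviation "J \<equiv> {\<alpha><..<\<beta>}"
abbreviation "U0 \<equiv> frame_matrix s0"

text \<open>Entries of the frame at \<open>s\<close> against the frame at \<open>s0\<close>, with
  the accumulated phase removed. They prove to be real, so that \<open>Q\<close> loses nothing by
  taking real parts.\<close>

definition "o' s k j = cis (- \<theta> s) * herm (g s (ax j)) (g s0 (ax k))"
definition Q :: "real \<Rightarrow> real^'n^'n" where "Q s = (\<chi> k j. Re (o' s k j))"

lemma s0_I: "s0 \<in> I" using J by blast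

lemma o'_deriv:
  assumes s: "s \<in> J"
  shows "((\<lambda>s. o' s k j) has_vector_derivative (\<Sum>l\<in>UNIV. rho s (ax j) $ l *\<^sub>R o' s k l)) (at s)"
proof -
  have sI: "s \<in> I" using s J by blast
  have dc: "((\<lambda>s. cis (- \<theta> s)) has_vector_derivative - \<i> * lam s * cis (- \<theta> s)) (at s)"
    using field_vector_diff_chain_at[OF has_vector_derivative_mult_right[OF
        has_vector_derivative_of_real[OF \<theta>(1)[OF s]]] DERIV_exp, of "- \<i>"]
    by (simp add: o_def cis_conv_exp)
  have dh: "((\<lambda>s. herm (g s (ax j)) (g s0 (ax k))) has_vector_derivative herm (g1 s (ax j)) (g s0 (ax k))) (at s)"
    using bounded_bilinear.has_vector_derivative[OF bounded_bilinear_herm dg[OF sI] has_vector_derivative_const]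
    by (simp add: herm_def)
  have h1: "herm (g1 s (ax j)) (g s0 (ax k)) = \<i> * lam s * herm (g s (ax j)) (g s0 (ax k)) + herm (g s (rho s (ax j))) (g s0 (ax k))"
    unfolding g1_eq[OF sI] herm_add using herm_smult[of "\<i> * lam s" "g s (ax j)" 1 "g s0 (ax k)"] by simp
  have h2: "herm (g s (rho s (ax j))) (g s0 (ax k)) = (\<Sum>l\<in>UNIV. rho s (ax j) $ l *\<^sub>R herm (g s (ax l)) (g s0 (ax k)))"
    by (subst real_combination[OF sI, symmetric])
      (simp add: bounded_bilinear.sum_left[OF bounded_bilinear_herm] herm_scaleR)
  show ?thesis
    unfolding o'_def
    by (rule has_vector_derivative_eq_rhs[OF has_vector_derivative_mult[OF dc dh]])
      (simp add: h1 h2 algebra_simps sum_distrib_left)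
qed

text \<open>The imaginary parts obey a linear system whose coefficients \<open>rho\<close> are skew,
  so the sum of their squares along a row is constant. It is zero at \<open>s0\<close>.\<close>

lemma o'_real:
  assumes s: "s \<in> J"
  shows "Im (o' s k j) = 0"
proof -
  have "\<exists>c. \<forall>s\<in>J. (\<Sum>j\<in>UNIV. (Im (o' s k j))\<^sup>2) = c"
  proof (rule has_field_derivative_zero_constant)
    show "convex J" by simp
    fix s assume s: "s \<in> J"
    then have sI: "s \<in> I" using J by blast
    have d: "((\<lambda>s. Im (o' s k j)) has_real_derivative (\<Sum>l\<in>UNIV. rho s (ax j) $ l * Im (o' s k l))) (at s)" for j
      using bounded_linear.has_vector_derivative[OF bounded_linear_Im o'_deriv[OF s]]
      by (simp add: has_real_derivative_iff_has_vector_derivative)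
    have "((\<lambda>s. \<Sum>j\<in>UNIV. (Im (o' s k j))\<^sup>2) has_real_derivative
        (\<Sum>j\<in>UNIV. 2 * ((\<Sum>l\<in>UNIV. rho s (ax j) $ l * Im (o' s k l)) * Im (o' s k j)))) (at s)"
      by (rule DERIV_cong[OF DERIV_sum[OF DERIV_power[OF d, where n=2]]]) simp
    moreover have "(\<Sum>j\<in>UNIV. 2 * ((\<Sum>l\<in>UNIV. rho s (ax j) $ l * Im (o' s k l)) * Im (o' s k j))) = 0"
    proof -
      let ?S = "\<Sum>j\<in>UNIV. \<Sum>l\<in>UNIV. rho s (ax j) $ l * (Im (o' s k l) * Im (o' s k j))"
      have skew: "rho s (ax j) $ l = - (rho s (ax l) $ j)" for j l
        unfolding rho_def using Re_herm_g1_skew[OF sI, of "ax j" "ax l"] by simp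
      have "?S = (\<Sum>j\<in>UNIV. \<Sum>l\<in>UNIV. - (rho s (ax l) $ j * (Im (o' s k j) * Im (o' s k l))))"
        by (intro sum.cong refl) (subst skew, simp)
      also have "\<dots> = - (\<Sum>j\<in>UNIV. \<Sum>l\<in>UNIV. rho s (ax l) $ j * (Im (o' s k j) * Im (o' s k l)))"
        by (simp add: sum_negf)
      also have "\<dots> = - ?S"
        by (subst sum.swap) simp
      finally have "?S = 0" by simp
      then show ?thesis
        by (simp add: sum_distrib_right mult.assoc flip: sum_distrib_left)
    qed
    ultimately have "((\<lambda>s. \<Sum>j\<in>UNIV. (Im (o' s k j))\<^sup>2) has_real_derivative 0) (at s)"
      by (simp only:)
    then show "((\<lambda>s. \<Sum>j\<in>UNIV. (Im (o' s k j))\<^sup>2) has_field_derivative 0) (at s within J)"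
      by (rule has_field_derivative_at_within)
  qed
  then obtain c where c: "\<And>s. s \<in> J \<Longrightarrow> (\<Sum>j\<in>UNIV. (Im (o' s k j))\<^sup>2) = c" by blast
  have "c = 0"
    using c[OF J(2)] by (simp add: o'_def \<theta>(2) herm_g[OF s0_I])
  then have "(\<Sum>j\<in>UNIV. (Im (o' s k j))\<^sup>2) = 0"
    using c[OF s] by simp
  then show ?thesis
    by (simp add: sum_nonneg_eq_0_iff)
qed

lemma g_Q:
  assumes s: "s \<in> J"
  shows "g s y = uembed U0 (cis (\<theta> s)) (Q s *v y)"
proof -
  have sI: "s \<in> I" using s J by blast
  have "herm (g s y) (g s0 (ax k)) = cis (\<theta> s) * complex_of_real ((Q s *v y) $ k)" for k
  proof -
    have "herm (g s y) (g s0 (ax k)) = (\<Sum>j\<in>UNIV. y $ j *\<^sub>R herm (g s (ax j)) (g s0 (ax k)))"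
      by (subst real_combination[OF sI, symmetric])
        (simp add: bounded_bilinear.sum_left[OF bounded_bilinear_herm] herm_scaleR)
    also have "herm (g s (ax j)) (g s0 (ax k)) = cis (\<theta> s) * complex_of_real (Q s $ k $ j)" for j
    proof -
      have "complex_of_real (Q s $ k $ j) = o' s k j"
        using o'_real[OF s] by (simp add: Q_def complex_eq_iff)
      then show ?thesis
        by (simp add: o'_def cis_mult flip: mult.assoc)
    qed
    then have "(\<Sum>j\<in>UNIV. y $ j *\<^sub>R herm (g s (ax j)) (g s0 (ax k))) = (\<Sum>j\<in>UNIV. y $ j *\<^sub>R (cis (\<theta> s) * complex_of_real (Q s $ k $ j)))"
      by simp
    finally show ?thesis
      by (simp add: matrix_vector_mult_def sum_distrib_left scaleR_conv_of_real mult_ac)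
  qed
  then have "(\<chi> k. herm (g s y) (g s0 (ax k))) = cis (\<theta> s) *s real_vec (Q s *v y)"
    by (simp add: vec_eq_iff real_vec_def)
  then show ?thesis
    using herm_unitary_expansion(2)[OF frame_unitary[OF s0_I], of "g s y"]
    by (simp add: uembed_def vector_scalar_commute)
qed

lemma Q_orthogonal:
  assumes s: "s \<in> J"
  shows "orthogonal_matrix (Q s)"
proof -
  have sI: "s \<in> I" using s J by blast
  have "(Q s *v y) \<bullet> (Q s *v z) = y \<bullet> z" for y z
    using iso[OF sI, of y z] unfolding g_Q[OF s] inner_uembed[OF frame_unitary[OF s0_I]]
    by (simp add: inner_complex_def flip: power2_eq_square)
  then have "orthogonal_transformation ((*v) (Q s))"
    by (simp add: orthogonal_transformation_def matrix_vector_mul_linear)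
  then show ?thesis
    by (simp add: orthogonal_transformation_matrix)
qed

lemma Q_s0: "Q s0 = mat 1"
  by (simp add: Q_def o'_def \<theta>(2) herm_g[OF s0_I] vec_eq_iff mat_def inner_axis_axis)

lemma smooth_\<theta>: "smooth_on J \<theta>"
  by (rule smooth_on_antiderivative[of _ _ lam])
    (use \<theta>(1) smooth_on_subset[OF smooth_lam J(1)] in \<open>auto simp: has_real_derivative_iff_has_vector_derivative\<close>)

lemma smooth_Q: "smooth_on J (\<lambda>s. Q s $ k $ j)"
proof -
  have J': "open J" by simp
  have "smooth_on J (\<lambda>s. - \<theta> s)"
    by (rule smooth_on_bounded_linear[OF J' bounded_linear_minus[OF bounded_linear_ident] smooth_\<theta>])
  moreover have "smooth_on J (\<lambda>s. herm (g s (ax j)) (g s0 (ax k)))"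
    by (rule smooth_on_subset[OF smooth_herm[OF smooth(3) smooth_on_const] J(1)])
  ultimately have "smooth_on J (\<lambda>s. o' s k j)"
    unfolding o'_def by (intro smooth_on_bounded_bilinear[OF J' bounded_bilinear_mult] smooth_on_cis[OF J'])
  then show ?thesis
    unfolding Q_def by (simp add: smooth_on_bounded_linear[OF J' bounded_linear_Re])
qed

definition "a' s = Q s *v drift s"

lemma smooth_a': "smooth_on J a'"
proof -
  have J': "open J" by simp
  have sd: "smooth_on J (\<lambda>s. drift s $ j)" for j
    unfolding drift_def vec_lambda_beta
    by (intro smooth_on_subset[OF _ J(1)] smooth_on_bounded_linear[OF I bounded_linear_Re] smooth_herm smooth_on_dderiv smooth)
  have "smooth_on J (\<lambda>s. \<Sum>k\<in>UNIV. (\<Sum>j\<in>UNIV. Q s $ k $ j * drift s $ j) *\<^sub>R ax k)"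
    by (intro smooth_on_sum J' finite smooth_on_bounded_linear[OF J' bounded_linear_scaleR_left]
        smooth_on_bounded_bilinear[OF J' bounded_bilinear_mult] smooth_Q sd)
  moreover have "(\<Sum>k\<in>UNIV. (\<Sum>j\<in>UNIV. Q s $ k $ j * drift s $ j) *\<^sub>R ax k) = a' s" for s
  proof -
    have "a' s = (\<Sum>k\<in>UNIV. (a' s $ k) *\<^sub>R ax k)"
      by (simp add: basis_expansion flip: scalar_mult_eq_scaleR)
    then show ?thesis by (simp add: a'_def matrix_vector_mult_def)
  qed
  ultimately show ?thesis by simp
qed

text \<open>In coordinates turned by \<open>Q s\<close> the piece \<open>O0\<close> moves with
  \<open>s\<close>. Continuity and the fact that \<open>Q s0\<close> is the identity leave a fixed
  piece around \<open>x0\<close> for all \<open>s\<close> near \<open>s0\<close>.\<close>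

lemma exists_box:
  assumes x0: "x0 \<in> O0"
  shows "\<exists>K O2. open K \<and> is_interval K \<and> K \<subseteq> J \<and> s0 \<in> K \<and> openin (top_of_set (sphere 0 1)) O2 \<and> x0 \<in> O2 \<and>
    (\<forall>s\<in>K. \<forall>y\<in>O2. transpose (Q s) *v y \<in> O0)"
proof -
  obtain B where B: "open B" "O0 = sphere 0 1 \<inter> B"
    using O0(1) unfolding openin_open by blast
  define f where "f = (\<lambda>(s, y). transpose (Q s) *v y)"
  have "continuous_on J (\<lambda>s. Q s $ k $ j)" for k j
    by (rule smooth_on_continuous_on[OF smooth_Q])
  then have cQ: "continuous_on (J \<times> UNIV) (\<lambda>z. Q (fst z) $ k $ j)" for k j
    by (rule continuous_on_compose2[OF _ continuous_on_fst]) (auto intro: continuous_on_id)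
  have "continuous_on (J \<times> UNIV) (\<lambda>z. \<chi> i. \<Sum>j\<in>UNIV. Q (fst z) $ j $ i * snd z $ j)"
    by (intro continuous_on_vec_lambda continuous_on_sum continuous_on_mult cQ) (intro continuous_intros)
  also have "(\<lambda>z. \<chi> i. \<Sum>j\<in>UNIV. Q (fst z) $ j $ i * snd z $ j) = f"
    by (simp add: f_def fun_eq_iff matrix_vector_mult_def vec_eq_iff del: transpose_matrix_vector) (simp add: transpose_def)
  finally have "continuous_on (J \<times> UNIV) f" .
  then have "open ((J \<times> UNIV) \<inter> f -` B)"
    by (rule continuous_open_preimage) (use B in \<open>auto intro: open_Times\<close>)
  moreover have "(s0, x0) \<in> (J \<times> UNIV) \<inter> f -` B"
    using J(2) x0 B(2) by (simp add: f_def Q_s0 transpose_mat)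
  ultimately obtain K' L where KL: "open K'" "open L" "s0 \<in> K'" "x0 \<in> L" "K' \<times> L \<subseteq> (J \<times> UNIV) \<inter> f -` B"
    by (rule open_prod_elim) (auto simp: mem_Times_iff)
  obtain d where d: "d > 0" "ball s0 d \<subseteq> K'"
    using KL(1,3) openE by blast
  have "transpose (Q s) *v y \<in> O0" if s: "s \<in> ball s0 d" and y: "y \<in> sphere 0 1 \<inter> L" for s y
  proof -
    have "(s, y) \<in> (J \<times> UNIV) \<inter> f -` B" using s y d KL(5) by blast
    then have sJ: "s \<in> J" and "transpose (Q s) *v y \<in> B" by (auto simp: f_def)
    moreover have "norm (transpose (Q s) *v y) = norm y"
      using Q_orthogonal[OF sJ] orthogonal_transformation_norm[of "(*v) (transpose (Q s))" y]
      by (simp add: orthogonal_transformation_matrix orthogonal_matrix_transpose)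
    ultimately show ?thesis
      using y B(2) by simp
  qed
  moreover have "ball s0 d \<subseteq> J" using d(2) KL(4,5) by blast
  ultimately show ?thesis
    using d(1) x0 O0_sphere KL
    by (intro exI[of _ "ball s0 d"] exI[of _ "sphere 0 1 \<inter> L"]) (auto simp: is_interval_convex_1 openin_open)
qed

text \<open>Replacing the point \<open>x\<close> of the sphere by \<open>Q s *v x\<close> absorbs
  the rotation inside the plane and leaves only the phase.\<close>

lemma exists_sphere_box_aux:
  assumes x0: "x0 \<in> O0" and hs: "hamiltonian_stationary M"
  shows "\<exists>U K \<theta> a A O2. sphere_box M U K r \<theta> a V A O2 \<and> s0 \<in> K \<and> x0 \<in> O2 \<and> K \<subseteq> I \<and>
    uembed U (r s0 * cis (\<theta> s0)) x0 = r s0 *\<^sub>R g s0 x0"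
proof -
  from exists_box[OF x0]
  obtain K O2 where K: "open K" "is_interval K" "K \<subseteq> J" "s0 \<in> K" and O2: "openin (top_of_set (sphere 0 1)) O2" "x0 \<in> O2"
    and KO': "\<forall>s\<in>K. \<forall>y\<in>O2. transpose (Q s) *v y \<in> O0"
    by (elim exE conjE)
  have KO: "transpose (Q s) *v y \<in> O0" if "s \<in> K" "y \<in> O2" for s y
    using bspec[OF bspec[OF KO' that(1)] that(2)] .
  have KI: "K \<subseteq> I" using K(3) J(1) by blast
  note U0 = frame_unitary[OF s0_I]
  have scale: "uembed U0 (of_real c * w) y = c *\<^sub>R uembed U0 w y" for c w y
    by (simp add: bounded_bilinear.scaleR_left[OF bounded_bilinear_uembed[OF U0]] flip: scaleR_conv_of_real)
  have dd\<theta>: "dderiv \<theta> 1 s = lam s" if "s \<in> J" for s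
    using dderiv_unique[OF \<theta>(1)[OF that, unfolded has_field_derivative_def], of 1] by simp
  have QQ: "Q s *v (transpose (Q s) *v y) = y" if "s \<in> J" for s y
  proof -
    have "Q s ** transpose (Q s) = mat 1"
      using Q_orthogonal[OF that] by (simp add: orthogonal_matrix_def)
    then show ?thesis
      by (simp only: matrix_vector_mul_assoc matrix_vector_mul_lid)
  qed
  have box: "sphere_box M U0 K r \<theta> a' V (K \<times> O2) O2"
  proof
    show "submanifold M" by (rule submanifold)
    show "unitary_matrix U0" by (rule U0)
    show "open K" "is_interval K" "hamiltonian_stationary M" "CARD('n) \<ge> 3" "K \<times> O2 = K \<times> O2"
      by (fact K hs card3 refl)+
    show "smooth_on K r" "smooth_on K \<theta>" "smooth_on K a'"
      by (rule smooth_on_subset[OF smooth(1) KI] smooth_on_subset[OF smooth_\<theta> K(3)] smooth_on_subset[OF smooth_a' K(3)])+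
    show "r s > 0" if "s \<in> K" for s using r_pos that KI by blast
    show "O2 \<noteq> {}" using O2(2) by blast
    show "openin (top_of_set (K \<times> sphere 0 1)) (K \<times> O2)"
      using O2(1) by (intro openin_Times) auto
    show "(V has_vector_derivative uembed U0 (cis (\<theta> s)) (a' s)) (at s)" if s: "s \<in> K" for s
    proof -
      have "V1 s = uembed U0 (cis (\<theta> s)) (a' s)"
        using drift_eq[of s] g_Q[of s "drift s"] s K(3) KI by (simp add: a'_def subset_iff)
      then show ?thesis
        using smooth_on_has_vector_derivative[OF smooth(2), of s] s KI by auto
    qed
    show "uembed U0 (r s * cis (\<theta> s)) x + V s \<in> M" if "(s, x) \<in> K \<times> O2" for s x
    proof -
      have s: "s \<in> J" "s \<in> I" and x: "x \<in> O2" "s \<in> K" using that K(3) KI by auto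
      have "r s *\<^sub>R g s (transpose (Q s) *v x) + V s \<in> M"
        by (rule in_M[OF s(2) KO[OF x(2,1)]])
      then show ?thesis
        by (simp add: g_Q[OF s(1)] QQ[OF s(1)] scale del: transpose_matrix_vector)
    qed
    show "(r1 s + a' s \<bullet> y)\<^sup>2 + (dderiv \<theta> 1 s * r s)\<^sup>2 \<noteq> 0" if sK: "s \<in> K" and y: "y \<in> sphere 0 1" for s y
    proof
      have s: "s \<in> J" "s \<in> I" using sK K(3) KI by auto
      assume "(r1 s + a' s \<bullet> y)\<^sup>2 + (dderiv \<theta> 1 s * r s)\<^sup>2 = 0"
      then have p0: "r1 s + a' s \<bullet> y = 0" and "dderiv \<theta> 1 s * r s = 0"
        by (simp_all add: sum_power2_eq_zero_iff)
      then have l0: "lam s = 0"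
        using dd\<theta>[OF s(1)] r_pos[OF s(2)] by simp
      define x where "x = transpose (Q s) *v y"
      have Qx: "Q s *v x = y" unfolding x_def by (rule QQ[OF s(1)])
      have ot: "orthogonal_transformation ((*v) (Q s))"
        using Q_orthogonal[OF s(1)] by (simp add: orthogonal_transformation_matrix)
      have xs: "x \<in> sphere 0 1"
        using orthogonal_transformation_norm[OF ot, of x] y Qx by simp
      have xx: "x \<bullet> x = 1" using xs by (simp add: norm_eq_1)
      have cx: "drift s \<bullet> x = a' s \<bullet> y"
        using ot Qx unfolding orthogonal_transformation_def a'_def by metis
      \<comment> \<open>This leaf direction cancels the rotation and the tangential drift. What
        remains is \<open>r1 s + drift s \<bullet> x\<close> times the radial direction, which is
        zero under the assumption to be refuted.\<close>
      define v where "v = - (rho s x + (1 / r s) *\<^sub>R (drift s - (drift s \<bullet> x) *\<^sub>R x))"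
      have "v \<bullet> x = 0"
        by (simp add: v_def inner_add_left inner_diff_left rho_perp[OF s(2)] xx)
      have "r1 s *\<^sub>R g s x + r s *\<^sub>R (g1 s x + g s v) + V1 s =
          g s (r1 s *\<^sub>R x + r s *\<^sub>R (rho s x + v) + drift s)"
        unfolding g1_eq[OF s(2)] drift_eq[OF s(2)] l0 by (simp add: linear_add[OF lin] linear_cmul[OF lin])
      also have "r1 s *\<^sub>R x + r s *\<^sub>R (rho s x + v) + drift s = (r1 s + drift s \<bullet> x) *\<^sub>R x"
        using r_pos[OF s(2)] by (simp add: v_def algebra_simps)
      also have "\<dots> = 0" unfolding cx p0 by simp
      finally show False
        using immersed[OF s(2) xs \<open>v \<bullet> x = 0\<close>] linear_0[OF lin] by simp
    qed
  qed
  have eq: "uembed U0 (r s0 * cis (\<theta> s0)) x0 = r s0 *\<^sub>R g s0 x0"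
    by (simp add: scale g_Q[OF J(2)] Q_s0)
  show ?thesis
    by (rule exI[of _ U0], rule exI[of _ K], rule exI[of _ \<theta>], rule exI[of _ a'], rule exI[of _ "K \<times> O2"], rule exI[of _ O2])
      (intro conjI box K(4) O2(2) KI eq)
qed

end

text \<open>The phase is an antiderivative of \<open>lam\<close> on a compact interval around
  \<open>s0\<close>, normalized to vanish at \<open>s0\<close>.\<close>

theorem exists_sphere_box:
  assumes s0: "s0 \<in> I" and x0: "x0 \<in> O0" and hs: "hamiltonian_stationary M"
  shows "\<exists>U K \<theta> a A O2. sphere_box M U K r \<theta> a V A O2 \<and> s0 \<in> K \<and> x0 \<in> O2 \<and> K \<subseteq> I \<and>
    uembed U (r s0 * cis (\<theta> s0)) x0 = r s0 *\<^sub>R g s0 x0"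
proof -
  obtain d where d: "d > 0" "cball s0 d \<subseteq> I"
    using I s0 open_contains_cball by blast
  have cl: "{s0 - d..s0 + d} \<subseteq> I"
    using d(2) by (simp add: cball_eq_atLeastAtMost)
  have "continuous_on {s0 - d..s0 + d} lam"
    using smooth_on_continuous_on[OF smooth_lam] cl continuous_on_subset by blast
  then obtain G where
    G: "\<And>s. s \<in> {s0 - d..s0 + d} \<Longrightarrow> (G has_vector_derivative lam s) (at s within {s0 - d..s0 + d})"
    by (rule antiderivative_continuous) (rule that)
  show ?thesis
  proof (rule exists_sphere_box_aux[OF _ _ _ _ x0 hs])
    show "{s0 - d<..<s0 + d} \<subseteq> I" using cl by auto
    show "s0 \<in> {s0 - d<..<s0 + d}" using d by simp
    show "((\<lambda>s. G s - G s0) has_real_derivative lam s) (at s)" if s: "s \<in> {s0 - d<..<s0 + d}" for s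
    proof -
      have "(G has_vector_derivative lam s) (at s within {s0 - d<..<s0 + d})"
        by (rule has_vector_derivative_within_subset[OF G]) (use s in auto)
      then have "(G has_real_derivative lam s) (at s)"
        using s by (simp add: has_vector_derivative_within_open[OF s] has_real_derivative_iff_has_vector_derivative)
      from DERIV_diff[OF this DERIV_const] show ?thesis by simp
    qed
  qed simp
qed

end

subsection \<open>From the foliation to a box\<close>

lemma sum_UNIV_Plus: "(\<Sum>k\<in>(UNIV :: ('n::finite + 'n) set). f k) = (\<Sum>j\<in>UNIV. f (Inl j)) + (\<Sum>j\<in>UNIV. f (Inr j))"
  using sum.Plus[of UNIV UNIV f] by (simp add: o_def)

lemma inner_of_R2n: "of_R2n v \<bullet> of_R2n w = v \<bullet> w"
  by (simp add: of_R2n_def inner_vec_def inner_complex_def sum_UNIV_Plus sum.distrib)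

lemma inner_to_R2n: "to_R2n z \<bullet> to_R2n w = z \<bullet> w"
  by (simp add: to_R2n_def inner_vec_def inner_complex_def sum_UNIV_Plus sum.distrib)

lemma inner_real_vec: "real_vec y \<bullet> real_vec z = y \<bullet> z"
  by (simp add: inner_herm herm_real_vec)

definition turned :: "real^('n + 'n)^('n + 'n) \<Rightarrow> real^'n \<Rightarrow> complex^'n" where
  "turned R y = of_R2n (R *v to_R2n (real_vec y))"

lemma bounded_bilinear_turned: "bounded_bilinear (turned :: real^('n + 'n)^('n + 'n) \<Rightarrow> real^'n \<Rightarrow> complex^'n)"
proof -
  have lo: "linear (of_R2n :: real^('n + 'n) \<Rightarrow> complex^'n)"
    by (auto intro!: linearI simp: of_R2n_def vec_eq_iff complex_eq_iff)
  have lt: "linear (to_R2n :: complex^'n \<Rightarrow> real^('n + 'n))"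
    by (auto intro!: linearI simp: to_R2n_def vec_eq_iff split: sum.split)
  show ?thesis
    unfolding bilinear_conv_bounded_bilinear[symmetric] bilinear_def turned_def
    by (auto intro!: linearI simp: real_vec_linear linear_add[OF lt] linear_cmul[OF lt] linear_add[OF lo, symmetric]
        linear_cmul[OF lo, symmetric] matrix_vector_right_distrib matrix_vector_mult_add_rdistrib matrix_vector_mult_scaleR scaleR_matrix_vector_assoc)
qed

lemma rotation_turned_inner:
  assumes "rotation_matrix R"
  shows "turned R y \<bullet> turned R z = y \<bullet> z"
proof -
  have "orthogonal_transformation ((*v) R)"
    using assms by (simp add: rotation_matrix_def orthogonal_transformation_matrix)
  then show ?thesis
    by (simp add: turned_def inner_of_R2n orthogonal_transformation_def inner_to_R2n inner_real_vec)
qed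

lemma sphere_family_turned: "sphere_family r R V = (\<lambda>(s, x). r s *\<^sub>R turned (R s) x + V s)"
  by (simp add: sphere_family_def turned_def)

lemma has_derivative_sphere_family:
  fixes x :: "real^'n"
  assumes "smooth_on I r" "smooth_on I R" "smooth_on I V" "s \<in> I"
  shows "(sphere_family r R V has_derivative (\<lambda>(t, v). r s *\<^sub>R (turned (R s) v + turned (t *\<^sub>R dderiv R 1 s) x) +
    (t *\<^sub>R dderiv r 1 s) *\<^sub>R turned (R s) x + t *\<^sub>R dderiv V 1 s)) (at (s, x))"
proof -
  have f: "((\<lambda>z. f (fst z)) has_derivative (\<lambda>h. fst h *\<^sub>R dderiv f 1 s)) (at (s, x))"
    if "smooth_on I f" for f :: "real \<Rightarrow> 'c::real_normed_vector"
    using has_derivative_compose[OF has_derivative_fst[OF has_derivative_ident], of f "\<lambda>h. h *\<^sub>R dderiv f 1 s" "(s, x)" UNIV]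
      smooth_on_has_vector_derivative[OF that assms(4)] by (simp add: has_vector_derivative_def)
  have "((\<lambda>z. r (fst z) *\<^sub>R turned (R (fst z)) (snd z) + V (fst z)) has_derivative
    (\<lambda>h. (r (fst (s, x)) *\<^sub>R (turned (R (fst (s, x))) (snd h) + turned (fst h *\<^sub>R dderiv R 1 s) (snd (s, x))) +
    (fst h *\<^sub>R dderiv r 1 s) *\<^sub>R turned (R (fst (s, x))) (snd (s, x))) + fst h *\<^sub>R dderiv V 1 s)) (at (s, x))"
    by (intro has_derivative_add has_derivative_scaleR bounded_bilinear.FDERIV[OF bounded_bilinear_turned]
        f assms has_derivative_snd has_derivative_ident)
  then show ?thesis
    unfolding sphere_family_turned split_def by simp
qed

text \<open>Around a preimage of \<open>p\<close> the set \<open>A\<close> contains the product of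
  an open set of parameters and a piece of the sphere, and the reduction applies to this
  product.\<close>

lemma foliated_sphere_box:
  fixes M :: "(complex^'n) set"
  assumes card3: "CARD('n) \<ge> 3" and lag: "lagrangian M" and hs: "hamiltonian_stationary M"
    and fol: "foliated_by_round_spheres M" and p: "p \<in> M"
  shows "\<exists>U K r \<theta> a V A O2 s0 x0. sphere_box M U K r \<theta> a V A O2 \<and> s0 \<in> K \<and> x0 \<in> O2 \<and>
    p = uembed U (r s0 * cis (\<theta> s0)) x0 + V s0"
proof -
  from fol p have "\<exists>I r R V W A.
        open I \<and> is_interval I \<and> smooth_on I r \<and> smooth_on I R \<and> smooth_on I V \<and>
        (\<forall>s\<in>I. r s > 0 \<and> rotation_matrix (R s)) \<and>
        immersion_on_cylinder I (sphere_family r R V) \<and>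
        open W \<and> p \<in> W \<and> openin (top_of_set (I \<times> sphere 0 1)) A \<and>
        sphere_family r R V ` A = M \<inter> W"
    unfolding foliated_by_round_spheres_def by (rule bspec)
  then obtain I r R V W A where I: "open I" and sm: "smooth_on I r" "smooth_on I R" "smooth_on I V"
    and rR: "\<forall>s\<in>I. r s > 0 \<and> rotation_matrix (R s)"
    and imm: "immersion_on_cylinder I (sphere_family r R V)"
    and W: "p \<in> W" and A: "openin (top_of_set (I \<times> sphere 0 1)) A" and im: "sphere_family r R V ` A = M \<inter> W"
    by (elim exE conjE)
  obtain B where B: "open B" "A = (I \<times> sphere 0 1) \<inter> B"
    using A unfolding openin_open by blast
  have "p \<in> sphere_family r R V ` A" using p W im by blast
  then obtain s0 x0 where sx: "(s0, x0) \<in> A" and p_eq: "p = r s0 *\<^sub>R turned (R s0) x0 + V s0"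
    by (auto simp: sphere_family_turned)
  have "open ((I \<times> UNIV) \<inter> B)" using I B by (intro open_Int open_Times) auto
  moreover have "(s0, x0) \<in> (I \<times> UNIV) \<inter> B" using sx B by auto
  ultimately obtain I1 L where IL: "open I1" "open L" "s0 \<in> I1" "x0 \<in> L" "I1 \<times> L \<subseteq> (I \<times> UNIV) \<inter> B"
    by (rule open_prod_elim) (auto simp: mem_Times_iff)
  have I1: "I1 \<subseteq> I" using IL by blast
  define O0 where "O0 = sphere 0 1 \<inter> L"
  have x0: "x0 \<in> O0" using IL(4) sx B(2) by (auto simp: O0_def)
  have box: "(s, x) \<in> A" if "s \<in> I1" "x \<in> O0" for s x
  proof -
    have "(s, x) \<in> (I \<times> UNIV) \<inter> B" using that IL(5) by (auto simp: O0_def)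
    then show ?thesis using that B(2) by (auto simp: O0_def)
  qed
  have bl: "bounded_linear (\<lambda>R. turned R y)" for y :: "real^'n"
    by (rule bounded_bilinear.bounded_linear_left[OF bounded_bilinear_turned])
  have dg: "dderiv (\<lambda>s. turned (R s) y) 1 s = turned (dderiv R 1 s) y" if "s \<in> I" for s and y :: "real^'n"
  proof -
    have "((\<lambda>s. turned (R s) y) has_derivative (\<lambda>h. turned (h *\<^sub>R dderiv R 1 s) y)) (at s)"
      using bounded_linear.has_derivative[OF bl smooth_on_has_vector_derivative[OF sm(2) that, unfolded has_vector_derivative_def]] .
    from dderiv_unique[OF this, of 1] show ?thesis by simp
  qed
  interpret rc: round_chart M I1 r "\<lambda>s. turned (R s)" V O0
  proof (rule round_chart.intro)
    show "lagrangian M" "open I1" "CARD('n) \<ge> 3" by (fact lag IL(1) card3)+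
    show "smooth_on I1 r" "smooth_on I1 V"
      by (rule smooth_on_subset[OF sm(1) I1] smooth_on_subset[OF sm(3) I1])+
    show "smooth_on I1 (\<lambda>s. turned (R s) y)" for y :: "real^'n"
      by (rule smooth_on_bounded_linear[OF IL(1) bl smooth_on_subset[OF sm(2) I1]])
    show "linear (turned (R s) :: real^'n \<Rightarrow> complex^'n)" for s
      using bounded_bilinear.bounded_linear_right[OF bounded_bilinear_turned] by (simp add: linear_conv_bounded_linear)
    show "turned (R s) y \<bullet> turned (R s) z = y \<bullet> z" if "s \<in> I1" for s and y z :: "real^'n"
      using rR I1 that by (intro rotation_turned_inner) blast
    show "r s > 0" if "s \<in> I1" for s using rR I1 that by blast
    show "openin (top_of_set (sphere 0 1)) O0"
      using IL(2) by (auto simp: O0_def openin_open)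
    show "O0 \<noteq> {}" using x0 by blast
    show "r s *\<^sub>R turned (R s) x + V s \<in> M" if "s \<in> I1" "x \<in> O0" for s x
    proof -
      have "sphere_family r R V (s, x) \<in> M"
        using imageI[OF box[OF that], of "sphere_family r R V"] im by blast
      then show ?thesis by (simp add: sphere_family_turned)
    qed
    show "dderiv r 1 s *\<^sub>R turned (R s) x + r s *\<^sub>R (dderiv (\<lambda>s. turned (R s) x) 1 s + turned (R s) v) + dderiv V 1 s \<noteq> 0"
      if s: "s \<in> I1" and x: "x \<in> sphere 0 1" and v: "v \<bullet> x = 0" for s and x v :: "real^'n"
    proof
      have sI: "s \<in> I" using s I1 by blast
      let ?D = "\<lambda>(t, v). r s *\<^sub>R (turned (R s) v + turned (t *\<^sub>R dderiv R 1 s) x) +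
          (t *\<^sub>R dderiv r 1 s) *\<^sub>R turned (R s) x + t *\<^sub>R dderiv V 1 s"
      assume "dderiv r 1 s *\<^sub>R turned (R s) x + r s *\<^sub>R (dderiv (\<lambda>s. turned (R s) x) 1 s + turned (R s) v) + dderiv V 1 s = 0"
      \<comment> \<open>A vanishing velocity gives \<open>(1, v)\<close> and \<open>(0, 0)\<close>
        the same image under the differential, against its injectivity.\<close>
      then have "?D (1, v) = 0"
        unfolding dg[OF sI] by (simp add: algebra_simps)
      moreover have "?D (0, 0) = 0"
        using bounded_bilinear.zero_left[OF bounded_bilinear_turned] bounded_bilinear.zero_right[OF bounded_bilinear_turned]
        by (simp add: bounded_bilinear.zero_left[OF bounded_bilinear_turned] bounded_bilinear.zero_right[OF bounded_bilinear_turned])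
      moreover have "inj_on ?D {(t, v). x \<bullet> v = 0}"
        using imm[unfolded immersion_on_cylinder_def, rule_format, OF sI x]
        by (simp only: frechet_derivative_at[OF has_derivative_sphere_family[OF sm sI, of x], symmetric])
      ultimately have "(1::real, v) = (0, 0)"
        using v by (intro inj_onD[of ?D "{(t, v). x \<bullet> v = 0}"]) (auto simp: inner_commute)
      then show False by simp
    qed
  qed
  from rc.exists_sphere_box[OF IL(3) x0 hs]
  obtain U K \<theta> a A2 O2 where "sphere_box M U K r \<theta> a V A2 O2" "s0 \<in> K" "x0 \<in> O2"
    "uembed U (r s0 * cis (\<theta> s0)) x0 = r s0 *\<^sub>R turned (R s0) x0"
    by (elim exE conjE)
  then show ?thesis
    unfolding p_eq by (intro exI conjI) auto
qed

subsection \<open>Openness of the sphere families\<close>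

lemma local_parametrization_open_image:
  assumes X: "local_parametrization M D X" and N: "open N" "N \<subseteq> D"
  shows "openin (top_of_set M) (X ` N)"
proof -
  obtain Y where Y: "homeomorphism D (X ` D) X Y"
    using local_parametrizationD(6)[OF X] by blast
  have "openin (top_of_set D) N"
    using N by (simp add: open_subset)
  then have "openin (top_of_set (X ` D)) (X ` N)"
    by (rule homeomorphism_imp_open_map[OF Y])
  then show ?thesis
    using openin_trans[OF _ local_parametrizationD(4)[OF X]] by blast
qed

context sphere_chart
begin

lemma continuous_on_F: "continuous_on (I \<times> UNIV) (\<lambda>(s, x). F s x)"
proof -
  have "continuous_on I V"
    by (intro continuous_at_imp_continuous_on ballI has_vector_derivative_continuous[OF dV])
  then have cV: "continuous_on (I \<times> UNIV) (\<lambda>z. V (fst z))"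
    by (rule continuous_on_compose2[OF _ continuous_on_fst]) (auto intro: continuous_on_id)
  have "continuous_on I (\<lambda>s. of_real (r s) * cis (\<theta> s))"
    by (intro continuous_at_imp_continuous_on ballI has_vector_derivative_continuous[OF has_vector_derivative_frame(1)])
  then have "continuous_on (I \<times> UNIV) (\<lambda>z. of_real (r (fst z)) * cis (\<theta> (fst z)))"
    by (rule continuous_on_compose2[OF _ continuous_on_fst]) (auto intro: continuous_on_id)
  then show ?thesis
    unfolding F_def case_prod_beta
    by (intro continuous_on_add cV bounded_bilinear.continuous_on[OF bounded_bilinear_uembed[OF U]])
      (auto intro: continuous_on_snd continuous_on_id)
qed

text \<open>
  Seen in a parametrization of \<open>M\<close>, the map \<open>z \<mapsto> F (s + \<bar>z\<bar> - 1) (z / \<bar>z\<bar>)\<close> goes between open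
  subsets of \<open>\<real>\<^sup>n\<close> and has an invertible derivative at \<open>x\<close>.
\<close>

lemma open_image:
  assumes B: "openin (top_of_set (I \<times> sphere 0 1)) B" "B \<subseteq> A"
  shows "openin (top_of_set M) ((\<lambda>(s, x). F s x) ` B)"
proof (subst openin_subopen, intro ballI)
  fix w assume "w \<in> (\<lambda>(s, x). F s x) ` B"
  then obtain s x where sx: "(s, x) \<in> B" and w: "w = F s x" by auto
  have sxA: "(s, x) \<in> A" using sx B(2) by blast
  have s: "s \<in> I" and x: "x \<in> sphere 0 1" using A_subset[OF sxA] by auto
  have nx: "norm x = 1" and xx: "x \<bullet> x = 1" and x0: "x \<noteq> 0" using x by (auto simp: norm_eq_1)
  have "F s x \<in> M" using A_M[OF sxA] by (simp add: F_def)
  then obtain D X where X: "local_parametrization M D X" and FX: "F s x \<in> X ` D"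
    using submanifold unfolding submanifold_def by blast
  note D = local_parametrizationD[OF X]
  obtain Y where Y: "homeomorphism D (X ` D) X Y" using D(6) by blast
  obtain W where W: "open W" "X ` D = M \<inter> W"
    using D(4) unfolding openin_open by blast
  obtain B' where B': "open B'" "\<And>z. z \<in> B \<longleftrightarrow> z \<in> I \<times> sphere 0 1 \<and> z \<in> B'"
    using B(1) unfolding openin_open by blast
  define polar where "polar z = (s + (norm z - 1), z /\<^sub>R norm z)" for z :: "real^'n"
  define k where "k z = F (fst (polar z)) (snd (polar z))" for z
  have polar_x: "polar x = (s, x)" by (simp add: polar_def nx)
  have cp: "continuous_on (- {0}) polar"
    unfolding polar_def by (intro continuous_intros) auto
  define Z1 where "Z1 = (- {0}) \<inter> polar -` ((I \<times> UNIV) \<inter> B')"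
  have Z1: "open Z1" "x \<in> Z1"
  proof -
    show "open Z1"
      unfolding Z1_def by (rule continuous_open_preimage[OF cp]) (auto intro!: open_Int open_Times I B')
    show "x \<in> Z1"
      using x0 polar_x s sx B'(2)[of "(s, x)"] by (simp add: Z1_def)
  qed
  have polar_B: "polar z \<in> B" if "z \<in> Z1" for z
    using that B'(2)[of "polar z"] by (auto simp: Z1_def polar_def)
  have ck: "continuous_on Z1 k"
    unfolding k_def
    by (rule continuous_on_compose2[OF continuous_on_F[unfolded case_prod_beta], of Z1 polar])
      (auto simp: Z1_def intro: continuous_on_subset[OF cp])
  define Z where "Z = Z1 \<inter> k -` W"
  have kx: "k x = F s x" by (simp add: k_def polar_x)
  have Z: "open Z" "x \<in> Z"
    unfolding Z_def using continuous_open_preimage[OF ck Z1(1) W(1)] Z1(2) kx FX W(2) by auto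
  have kB: "k z \<in> (\<lambda>(s, x). F s x) ` B" if "z \<in> Z" for z
    using polar_B[of z] that by (force simp: Z_def k_def case_prod_beta)
  have kX: "k z \<in> X ` D" if z: "z \<in> Z" for z
  proof -
    obtain s' x' where "(s', x') \<in> B" "k z = F s' x'" using kB[OF z] by auto
    then have "k z \<in> M" using A_M[of s' x'] B(2) by (auto simp: F_def)
    then show ?thesis using z W(2) by (auto simp: Z_def)
  qed
  define \<psi> where "\<psi> z = Y (k z)" for z
  have \<psi>: "X (\<psi> z) = k z" "\<psi> z \<in> D" if "z \<in> Z" for z
    using homeomorphism_apply2[OF Y kX[OF that]] homeomorphism_image2[OF Y] kX[OF that]
    by (auto simp: \<psi>_def)
  have c\<psi>: "continuous_on Z \<psi>"
    unfolding \<psi>_def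
  proof (rule continuous_on_compose2[of "X ` D" Y _ k])
    show "continuous_on (X ` D) Y"
      using Y unfolding homeomorphism_def by blast
    show "continuous_on Z k"
      by (rule continuous_on_subset[OF ck]) (auto simp: Z_def)
    show "k ` Z \<subseteq> X ` D"
      using kX by blast
  qed
  define k' where "k' h = (x \<bullet> h) *\<^sub>R uembed U (Complex (p s x) (q s) * cis (\<theta> s)) x +
      uembed U (1 * cis (\<theta> s)) (r s *\<^sub>R (h - (x \<bullet> h) *\<^sub>R x) + (x \<bullet> h) *\<^sub>R (a s - (a s \<bullet> x) *\<^sub>R x))" for h
  have dk: "(k has_derivative k') (at x)"
  proof -
    have dn: "(norm has_derivative (\<lambda>h. x \<bullet> h)) (at x)"
      using has_derivative_norm[OF x0] nx by (simp add: sgn_div_norm inner_commute)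
    have ds: "((\<lambda>z. s + (norm z - 1)) has_derivative (\<lambda>h. x \<bullet> h)) (at x)"
      using dn by (auto intro!: derivative_eq_intros)
    have di: "((\<lambda>z. inverse (norm z)) has_derivative (\<lambda>h. - (x \<bullet> h))) (at x)"
      using Deriv.has_derivative_inverse[OF _ dn] nx x0 by simp
    have dy: "((\<lambda>z. z /\<^sub>R norm z) has_derivative (\<lambda>h. h - (x \<bullet> h) *\<^sub>R x)) (at x)"
      using has_derivative_scaleR[OF di has_derivative_ident] nx by simp
    have dz: "((\<lambda>z. of_real (r (s + (norm z - 1))) * cis (\<theta> (s + (norm z - 1)))) has_derivative
        (\<lambda>h. (x \<bullet> h) *\<^sub>R (Complex (r1 s) (q s) * cis (\<theta> s)))) (at x)"
      using has_derivative_compose[OF ds, of "\<lambda>s. of_real (r s) * cis (\<theta> s)"] has_vector_derivative_frame(1)[OF s] nx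
      by (simp add: has_vector_derivative_def)
    have dV': "((\<lambda>z. V (s + (norm z - 1))) has_derivative (\<lambda>h. (x \<bullet> h) *\<^sub>R uembed U (cis (\<theta> s)) (a s))) (at x)"
      using has_derivative_compose[OF ds, of V] dV[OF s] nx by (simp add: has_vector_derivative_def)
    have "(k has_derivative (\<lambda>h. (uembed U (of_real (r s) * cis (\<theta> s)) (h - (x \<bullet> h) *\<^sub>R x) +
        uembed U ((x \<bullet> h) *\<^sub>R (Complex (r1 s) (q s) * cis (\<theta> s))) x) + (x \<bullet> h) *\<^sub>R uembed U (cis (\<theta> s)) (a s))) (at x)"
      using has_derivative_add[OF bounded_bilinear.FDERIV[OF bounded_bilinear_uembed[OF U] dz dy] dV'] nx
      unfolding k_def[abs_def] polar_def F_def by simp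
    moreover have "(uembed U (of_real (r s) * cis (\<theta> s)) (h - (x \<bullet> h) *\<^sub>R x) +
        uembed U ((x \<bullet> h) *\<^sub>R (Complex (r1 s) (q s) * cis (\<theta> s))) x) + (x \<bullet> h) *\<^sub>R uembed U (cis (\<theta> s)) (a s) = k' h" for h
    proof -
      have "Complex (p s x) (q s) * cis (\<theta> s) = Complex (r1 s) (q s) * cis (\<theta> s) + (a s \<bullet> x) *\<^sub>R cis (\<theta> s)"
        by (simp add: p_def Complex_eq scaleR_conv_of_real algebra_simps)
      moreover have "uembed U (cis (\<theta> s) * of_real (r s)) w = r s *\<^sub>R uembed U (cis (\<theta> s)) w" for w
        using uembed_linear(4)[of "r s" "cis (\<theta> s)" w] by (simp add: scaleR_conv_of_real[where 'a=complex] mult.commute)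
      ultimately show ?thesis
        by (simp add: k'_def uembed_linear scaleR_right_distrib scaleR_right_diff_distrib mult.commute flip: scaleR_conv_of_real)
    qed
    ultimately show ?thesis by simp
  qed
  \<comment> \<open>Pairing with the velocity orthogonal to the leaf isolates
    \<open>x \<bullet> h\<close>, which is zero because \<open>P\<close> is positive; pairing with
    the embedded \<open>h\<close> then gives \<open>h = 0\<close>.\<close>
  have k'_inj: "h = 0" if "k' h = 0" for h
  proof -
    define v where "v = r s *\<^sub>R (h - (x \<bullet> h) *\<^sub>R x) + (x \<bullet> h) *\<^sub>R (a s - (a s \<bullet> x) *\<^sub>R x)"
    have k'v: "k' h = (x \<bullet> h) *\<^sub>R uembed U (Complex (p s x) (q s) * cis (\<theta> s)) x + uembed U (1 * cis (\<theta> s)) v"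
      by (simp add: k'_def v_def)
    have vx: "v \<bullet> x = 0"
      by (simp add: v_def inner_add_left inner_diff_left xx inner_commute[of h x])
    have "k' h \<bullet> uembed U (Complex (p s x) (q s) * cis (\<theta> s)) x = (x \<bullet> h) * P s x"
      unfolding k'v inner_add_left inner_scaleR_left inner_uembed[OF U] inner_cis_mult vx
      by (simp add: xx P_def inner_complex_def power2_eq_square)
    then have t0: "x \<bullet> h = 0"
      using that P_pos[OF s x] by simp
    have "k' h \<bullet> uembed U (1 * cis (\<theta> s)) h = r s * (h \<bullet> h)"
      unfolding k'_def inner_add_left inner_scaleR_left inner_uembed[OF U] inner_cis_mult
      by (simp add: t0)
    then show ?thesis
      using that r_pos[OF s] by simp
  qed
  have "inj (\<lambda>v. dderiv X v (\<psi> x))"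
    using D(3)[OF \<psi>(2)[OF Z(2)]] by (simp add: dderiv_def[abs_def])
  moreover have "isCont \<psi> x"
    using c\<psi> Z by (simp add: continuous_on_eq_continuous_at)
  ultimately have "\<exists>\<psi>'. (\<psi> has_derivative \<psi>') (at x) \<and> (\<forall>h. dderiv X (\<psi>' h) (\<psi> x) = k' h)"
    by (rule lift_has_derivative[OF smooth_on_has_derivative[OF D(2) \<psi>(2)[OF Z(2)]] _ _ Z \<psi>(1) dk])
  then obtain \<psi>' where \<psi>': "(\<psi> has_derivative \<psi>') (at x)" "\<And>h. dderiv X (\<psi>' h) (\<psi> x) = k' h"
    by blast
  have lin: "linear \<psi>'" using has_derivative_linear[OF \<psi>'(1)] .
  have "h = 0" if "\<psi>' h = 0" for h
    using k'_inj[of h] \<psi>'(2)[of h] that linear_0[OF linear_dderiv[OF D(2) \<psi>(2)[OF Z(2)]]] by simp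
  then have "inj \<psi>'"
    using linear_injective_0[OF lin] by blast
  then have "surj \<psi>'"
    using linear_injective_imp_surjective[OF lin] by blast
  then obtain g' where g': "linear g'" "\<psi>' \<circ> g' = id"
    using linear_surjective_right_inverse[OF lin] by blast
  \<comment> \<open>This open mapping theorem works from continuity and a right inverse of the
    derivative at the single point \<open>x\<close>.\<close>
  have "\<psi> x \<in> interior (\<psi> ` Z)"
    by (rule sussmann_open_mapping[OF Z(1) c\<psi> Z(2) \<psi>'(1) _ g'(2) order_refl])
      (use g'(1) Z in \<open>auto simp: linear_conv_bounded_linear interior_open\<close>)
  then obtain N where N: "open N" "\<psi> x \<in> N" "N \<subseteq> \<psi> ` Z"
    by (rule interiorE)
  have "N \<subseteq> D" using N(3) \<psi>(2) by blast
  then have "openin (top_of_set M) (X ` N)"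
    by (rule local_parametrization_open_image[OF X N(1)])
  moreover have "w \<in> X ` N"
    using N(2) \<psi>(1)[OF Z(2)] kx w by force
  moreover have "X ` N \<subseteq> (\<lambda>(s, x). F s x) ` B"
  proof
    fix y assume "y \<in> X ` N"
    then obtain z where "z \<in> Z" "y = X (\<psi> z)" using N(3) by blast
    then show "y \<in> (\<lambda>(s, x). F s x) ` B" using kB \<psi>(1) by simp
  qed
  ultimately show "\<exists>T. openin (top_of_set M) T \<and> w \<in> T \<and> T \<subseteq> (\<lambda>(s, x). F s x) ` B"
    by blast
qed

end

subsection \<open>Centered and flat pieces\<close>

definition piece_image :: "complex^'n^'n \<Rightarrow> complex^'n \<Rightarrow> (real \<Rightarrow> complex) \<Rightarrow> real set \<Rightarrow> (real^'n) set \<Rightarrow> (complex^'n) set" where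
  "piece_image U c \<gamma> K S = (\<lambda>(s, x). uembed U (\<gamma> s) x + c) ` (K \<times> S)"

text \<open>
  The last condition says that \<open>\<gamma>\<close> runs along no line through the origin, which excludes flat
  pieces and makes \<open>U\<close> and \<open>c\<close> essentially unique.
\<close>

definition sphere_piece :: "(complex^'n) set \<Rightarrow> complex^'n^'n \<Rightarrow> complex^'n \<Rightarrow> real set \<Rightarrow> (real \<Rightarrow> complex) \<Rightarrow> (real^'n) set \<Rightarrow> bool" where
  "sphere_piece M U c K \<gamma> S \<longleftrightarrow> unitary_matrix U \<and> open K \<and> is_interval K \<and> smooth_on K \<gamma> \<and>
    (\<forall>s\<in>K. \<gamma> s \<noteq> 0 \<and> dderiv \<gamma> 1 s \<noteq> 0) \<and> openin (top_of_set (sphere 0 1)) S \<and>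
    (\<forall>K' S'. open K' \<longrightarrow> K' \<subseteq> K \<longrightarrow> openin (top_of_set (sphere 0 1)) S' \<longrightarrow> S' \<subseteq> S \<longrightarrow>
      openin (top_of_set M) (piece_image U c \<gamma> K' S')) \<and>
    (\<forall>J. open J \<longrightarrow> J \<subseteq> K \<longrightarrow> J \<noteq> {} \<longrightarrow> (\<exists>s\<in>J. Im (dderiv \<gamma> 1 s * cnj (\<gamma> s)) \<noteq> 0))"

lemma sphere_pieceD:
  assumes "sphere_piece M U c K \<gamma> S"
  shows "unitary_matrix U" "open K" "is_interval K" "smooth_on K \<gamma>"
    "\<And>s. s \<in> K \<Longrightarrow> \<gamma> s \<noteq> 0" "\<And>s. s \<in> K \<Longrightarrow> dderiv \<gamma> 1 s \<noteq> 0"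
    "openin (top_of_set (sphere 0 1)) S"
    "\<And>K' S'. open K' \<Longrightarrow> K' \<subseteq> K \<Longrightarrow> openin (top_of_set (sphere 0 1)) S' \<Longrightarrow> S' \<subseteq> S \<Longrightarrow>
      openin (top_of_set M) (piece_image U c \<gamma> K' S')"
    "\<And>J. open J \<Longrightarrow> J \<subseteq> K \<Longrightarrow> J \<noteq> {} \<Longrightarrow> \<exists>s\<in>J. Im (dderiv \<gamma> 1 s * cnj (\<gamma> s)) \<noteq> 0"
  using assms unfolding sphere_piece_def by blast+

definition flat_piece :: "(complex^'n) set \<Rightarrow> (complex^'n) set \<Rightarrow> (complex^'n) set \<Rightarrow> bool" where
  "flat_piece M P N \<longleftrightarrow> affine_lagrangian_plane P \<and> openin (top_of_set M) N \<and> openin (top_of_set P) N"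

text \<open>The plane is also shown to be a submanifold so that the openness of sphere families can
  be applied with the plane in place of \<open>M\<close>. The parametrization is inverted by inner
  products with the embedded standard basis.\<close>

lemma uembed_range_plane:
  assumes U: "unitary_matrix U" and h: "h \<noteq> 0"
  shows "affine_lagrangian_plane (range (\<lambda>y. b + uembed U h y))" "submanifold (range (\<lambda>y. b + uembed U h y))"
proof -
  interpret u: bounded_bilinear "uembed U" by (rule bounded_bilinear_uembed[OF U])
  have bl: "bounded_linear (uembed U h)" by (rule u.bounded_linear_right)
  then have lin: "linear (uembed U h)" by (simp add: linear_conv_bounded_linear)
  have hh: "h \<bullet> h > 0" using h by simp
  have "y = 0" if "uembed U h y = 0" for y
  proof -
    have "uembed U h y \<bullet> uembed U h y = (h \<bullet> h) * (y \<bullet> y)" by (rule inner_uembed[OF U])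
    then show ?thesis using that hh by simp
  qed
  then have inj: "inj (uembed U h)"
    using linear_injective_0[OF lin] by blast
  show "affine_lagrangian_plane (range (\<lambda>y. b + uembed U h y))"
    unfolding affine_lagrangian_plane_def
  proof (intro exI[of _ "range (uembed U h)"] exI[of _ b] conjI ballI)
    show "subspace (range (uembed U h))"
      by (rule linear_subspace_image[OF lin subspace_UNIV])
    show "dim (range (uembed U h)) = CARD('a)"
      using dim_image_eq[OF lin, of UNIV] inj by simp
    show "symplectic_form v w = 0" if "v \<in> range (uembed U h)" "w \<in> range (uembed U h)" for v w
      using that by (auto simp: symplectic_form_herm herm_uembed[OF U] complex_mult_cnj)
    show "range (\<lambda>y. b + uembed U h y) = (+) b ` range (uembed U h)"
      by auto
  qed
  let ?X = "\<lambda>y. b + uembed U h y"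
  define Y where "Y z = (\<chi> k. ((z - b) \<bullet> uembed U h (axis k 1)) / (h \<bullet> h))" for z
  have YX: "Y (?X y) = y" for y
    using hh by (simp add: Y_def inner_uembed[OF U] vec_eq_iff inner_axis)
  have "local_parametrization (range ?X) UNIV ?X"
    unfolding local_parametrization_def
  proof (intro conjI ballI)
    show "smooth_on UNIV ?X"
    proof (rule smooth_on_add[OF open_UNIV smooth_on_const])
      show "smooth_on UNIV (uembed U h)"
        unfolding smooth_on_def
      proof
        fix k
        show "Ck_on k UNIV (uembed U h)"
        proof (cases k)
          case 0
          then show ?thesis by (simp add: linear_continuous_on[OF bl])
        next
          case (Suc j)
          show ?thesis
            unfolding Suc by (rule Ck_on_SucI[OF open_UNIV bounded_linear_imp_has_derivative[OF bl] Ck_on_const])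
        qed
      qed
    qed
    have "(?X has_derivative uembed U h) (at u)" for u
      using has_derivative_add[OF has_derivative_const bounded_linear_imp_has_derivative[OF bl]] by fastforce
    then show "inj (frechet_derivative ?X (at u))" for u
      using inj frechet_derivative_at by metis
    show "\<exists>Y. homeomorphism UNIV (range ?X) ?X Y"
    proof (intro exI[of _ Y] homeomorphismI)
      show "continuous_on UNIV ?X"
        by (intro continuous_intros linear_continuous_on bl)
      show "continuous_on (range ?X) Y"
        unfolding Y_def by (intro continuous_intros) (use h in simp)
    qed (use YX in auto)
  qed auto
  then show "submanifold (range ?X)"
    unfolding submanifold_def by blast
qed

context sphere_box
begin

lemma O0_open: "I \<noteq> {} \<Longrightarrow> openin (top_of_set (sphere 0 1)) O0"
  using A O0 unfolding box by (auto simp: openin_Times_eq)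

lemma dderiv_frame:
  assumes s: "s \<in> I"
  shows "dderiv (\<lambda>s. of_real (r s) * cis (\<theta> s)) 1 s = Complex (r1 s) (q s) * cis (\<theta> s)"
  using dderiv_unique[OF has_vector_derivative_frame(1)[OF s, unfolded has_vector_derivative_def], of 1] by simp

text \<open>With \<open>a = 0\<close> the centre \<open>V\<close> has zero derivative. The
  nonflatness condition of a piece reads \<open>q s * r s \<noteq> 0\<close> and holds where
  \<open>lam\<close> is nonzero.\<close>

lemma centered_case:
  assumes ne: "I \<noteq> {}" and a0: "\<And>s. s \<in> I \<Longrightarrow> a s = 0"
    and dense: "\<And>J. open J \<Longrightarrow> J \<subseteq> I \<Longrightarrow> J \<noteq> {} \<Longrightarrow> \<exists>s\<in>J. lam s \<noteq> 0"
  shows "\<exists>c. (\<forall>s\<in>I. V s = c) \<and> sphere_piece M U c I (\<lambda>s. of_real (r s) * cis (\<theta> s)) O0"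
proof -
  let ?\<gamma> = "\<lambda>s. of_real (r s) * cis (\<theta> s)"
  have "\<exists>c. \<forall>s\<in>I. V s = c"
  proof (rule has_derivative_zero_constant)
    show "convex I" using interval by (rule is_interval_convex)
    show "(V has_derivative (\<lambda>h. 0)) (at s within I)" if s: "s \<in> I" for s
      using has_derivative_at_withinI[OF dV[OF s, unfolded has_vector_derivative_def], of I] a0[OF s]
      by (simp add: bounded_bilinear.zero_right[OF bounded_bilinear_uembed[OF U]])
  qed
  then obtain c where c: "\<And>s. s \<in> I \<Longrightarrow> V s = c" by blast
  have bl: "bounded_linear complex_of_real" by (rule bounded_linear_of_real)
  have "sphere_piece M U c I ?\<gamma> O0"
    unfolding sphere_piece_def
  proof (intro conjI ballI allI impI)
    show "smooth_on I ?\<gamma>"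
      by (rule smooth_on_bounded_bilinear[OF I bounded_bilinear_mult smooth_on_bounded_linear[OF I bl smooth(1)] smooth_on_cis[OF I smooth(2)]])
    show "?\<gamma> s \<noteq> 0" if "s \<in> I" for s using r_pos[OF that] by simp
    show "dderiv ?\<gamma> 1 s \<noteq> 0" if "s \<in> I" for s
    proof -
      have "Complex (r1 s) (q s) \<noteq> 0"
        using P0_pos[OF card2 that] by (auto simp: complex_eq_iff P0_def)
      then show ?thesis by (simp add: dderiv_frame[OF that])
    qed
    show "openin (top_of_set (sphere 0 1)) O0" by (rule O0_open[OF ne])
    show "openin (top_of_set M) (piece_image U c ?\<gamma> K' S')"
      if "open K'" "K' \<subseteq> I" "openin (top_of_set (sphere 0 1)) S'" "S' \<subseteq> O0" for K' S'
    proof -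
      have "openin (top_of_set (I \<times> sphere 0 1)) (K' \<times> S')"
        using that by (intro openin_Times) (auto intro: open_subset)
      moreover have "K' \<times> S' \<subseteq> A" using that box by auto
      ultimately have "openin (top_of_set M) ((\<lambda>(s, x). F s x) ` (K' \<times> S'))"
        by (rule open_image)
      moreover have "(\<lambda>(s, x). F s x) ` (K' \<times> S') = piece_image U c ?\<gamma> K' S'"
        unfolding piece_image_def using that(2) c by (intro image_cong) (auto simp: F_def)
      ultimately show ?thesis by simp
    qed
    show "\<exists>s\<in>J. Im (dderiv ?\<gamma> 1 s * cnj (?\<gamma> s)) \<noteq> 0" if J: "open J" "J \<subseteq> I" "J \<noteq> {}" for J
    proof -
      obtain s where s: "s \<in> J" "lam s \<noteq> 0" using dense[OF J] by blast
      then have sI: "s \<in> I" using J by blast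
      have "dderiv ?\<gamma> 1 s * cnj (?\<gamma> s) = Complex (r1 s) (q s) * r s * (cis (\<theta> s) * cnj (cis (\<theta> s)))"
        unfolding dderiv_frame[OF sI] by simp
      also have "\<dots> = Complex (r1 s) (q s) * r s" by (simp add: cis_cnj cis_mult)
      finally have "Im (dderiv ?\<gamma> 1 s * cnj (?\<gamma> s)) = Im (Complex (r1 s) (q s) * r s)"
        by (rule arg_cong)
      also have "\<dots> = q s * r s" by simp
      finally have "Im (dderiv ?\<gamma> 1 s * cnj (?\<gamma> s)) = q s * r s" .
      moreover have "q s * r s \<noteq> 0" using s(2) r_pos[OF sI] by (simp add: q_def)
      ultimately have "Im (dderiv ?\<gamma> 1 s * cnj (?\<gamma> s)) \<noteq> 0" by (simp only: simp_thms)
      then show ?thesis by (rule bexI) (rule s(1))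
    qed
  qed (fact U I interval)+
  with c show ?thesis by blast
qed

text \<open>A constant phase keeps the velocity of \<open>V\<close> in one real form, so all leaves
  lie in a single affine plane. The chart is then a chart of that plane as well, and its image is
  open in \<open>M\<close> and in the plane by the same lemma.\<close>

lemma flat_case:
  assumes s0: "s0 \<in> I" and l0: "\<And>s. s \<in> I \<Longrightarrow> lam s = 0"
  shows "\<exists>P. flat_piece M P ((\<lambda>(s, x). F s x) ` A)"
proof -
  have convex: "convex I" using interval by (rule is_interval_convex)
  have "\<exists>c. \<forall>s\<in>I. \<theta> s = c"
  proof (rule has_field_derivative_zero_constant[OF convex])
    show "(\<theta> has_field_derivative 0) (at s within I)" if s: "s \<in> I" for s
      using has_field_derivative_at_within[OF real_derivs(4)[OF s]] l0[OF s] by simp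
  qed
  then obtain t0 where t0: "\<And>s. s \<in> I \<Longrightarrow> \<theta> s = t0" by blast
  define h where "h = cis t0"
  have hh: "h * cnj h = 1" by (simp add: h_def cis_cnj cis_mult)
  have h0: "h \<noteq> 0" by (simp add: h_def)
  define P where "P = range (\<lambda>y. V s0 + uembed U h y)"
  have VP: "\<exists>y. V s = V s0 + uembed U h y" if s: "s \<in> I" for s
  proof -
    \<comment> \<open>Components of the displacement of \<open>V\<close> transversal to the plane;
      their derivatives vanish.\<close>
    define m where "m k s = Im (cnj h * herm (V s - V s0) (column k U))" for k s
    have col: "column k U = uembed U 1 (axis k 1)" for k
      by (simp add: uembed_def matrix_vector_mult_def vec_eq_iff column_def real_vec_def axis_def if_distrib[where f=complex_of_real] if_distrib[where f="\<lambda>x. _ * x"] cong: if_cong)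
    have "\<exists>c. \<forall>s\<in>I. m k s = c" for k
    proof (rule has_field_derivative_zero_constant[OF convex])
      fix s assume s: "s \<in> I"
      have "((\<lambda>s. V s - V s0) has_vector_derivative uembed U h (a s)) (at s)"
        using has_vector_derivative_diff[OF dV[OF s] has_vector_derivative_const, of "V s0"] t0[OF s] by (simp add: h_def)
      from bounded_bilinear.has_vector_derivative[OF bounded_bilinear_herm this has_vector_derivative_const, of "column k U"]
      have "((\<lambda>s. herm (V s - V s0) (column k U)) has_vector_derivative herm (uembed U h (a s)) (column k U)) (at s)"
        by (simp add: herm_def)
      from bounded_linear.has_vector_derivative[OF bounded_linear_Im has_vector_derivative_mult_right[OF this, of "cnj h"]]
      have "(m k has_real_derivative Im (cnj h * herm (uembed U h (a s)) (column k U))) (at s)"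
        by (simp add: m_def[abs_def] has_real_derivative_iff_has_vector_derivative)
      moreover have "cnj h * herm (uembed U h (a s)) (column k U) = complex_of_real (a s \<bullet> axis k 1)"
        unfolding col herm_uembed[OF U] using hh by (simp add: mult_ac)
      ultimately show "(m k has_field_derivative 0) (at s within I)"
        by (simp add: has_field_derivative_at_within)
    qed
    then have "m k s = m k s0" for k using s s0 by metis
    then have m0: "m k s = 0" for k by (simp add: m_def herm_def)
    define y where "y = (\<chi> k. Re (cnj h * herm (V s - V s0) (column k U)))"
    have "herm (V s - V s0) (column k U) = h * complex_of_real (y $ k)" for k
    proof -
      have "complex_of_real (y $ k) = cnj h * herm (V s - V s0) (column k U)"
        using m0[of k] by (simp add: y_def m_def complex_eq_iff)
      then have "h * complex_of_real (y $ k) = (h * cnj h) * herm (V s - V s0) (column k U)"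
        by simp
      then show ?thesis by (simp add: hh)
    qed
    then have "(\<chi> k. herm (V s - V s0) (column k U)) = h *s real_vec y"
      by (simp add: vec_eq_iff real_vec_def)
    then have "V s - V s0 = uembed U h y"
      using herm_unitary_expansion(2)[OF U, of "V s - V s0"] by (simp add: uembed_def vector_scalar_commute)
    then show ?thesis by (metis add.commute diff_add_cancel)
  qed
  have FP: "F s x \<in> P" if "(s, x) \<in> A" for s x
  proof -
    have s: "s \<in> I" using A_subset(1)[OF that] .
    obtain y where y: "V s = V s0 + uembed U h y" using VP[OF s] by blast
    have "F s x = V s0 + uembed U h (r s *\<^sub>R x + y)"
      unfolding F_def y t0[OF s] h_def[symmetric] using uembed_linear(4)[of "r s" h x]
      by (simp add: uembed_linear scaleR_conv_of_real[where 'a=complex])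
    then show ?thesis by (auto simp: P_def)
  qed
  interpret p: sphere_chart P U I r \<theta> a V A
  proof (unfold_locales)
    show "submanifold P" unfolding P_def by (rule uembed_range_plane(2)[OF U h0])
    show "uembed U (of_real (r s) * cis (\<theta> s)) x + V s \<in> P" if "(s, x) \<in> A" for s x
      using FP[OF that] by (simp add: F_def)
  qed (fact U I smooth r_pos dV A immersed)+
  have AA: "openin (top_of_set (I \<times> sphere 0 1)) A" "A \<subseteq> A" using A by auto
  have "flat_piece M P ((\<lambda>(s, x). F s x) ` A)"
    unfolding flat_piece_def using open_image[OF AA] p.open_image[OF AA] uembed_range_plane(1)[OF U h0]
    by (simp add: P_def)
  then show ?thesis by blast
qed

end

lemma box_alternative:
  fixes M :: "(complex^'n) set"
  assumes "CARD('n) \<ge> 3" "lagrangian M" "hamiltonian_stationary M" "foliated_by_round_spheres M" "p \<in> M"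
  shows "(\<exists>U c K \<gamma> S. sphere_piece M U c K \<gamma> S \<and> p \<in> piece_image U c \<gamma> K S) \<or> (\<exists>P N. flat_piece M P N \<and> p \<in> N)"
proof -
  from foliated_sphere_box[OF assms] obtain U K r \<theta> a V A O2 s0 x0 where
    box: "sphere_box M U K r \<theta> a V A O2" and s0: "s0 \<in> K" and x0: "x0 \<in> O2"
    and p: "p = uembed U (r s0 * cis (\<theta> s0)) x0 + V s0"
    by (elim exE conjE)
  interpret sphere_box M U K r \<theta> a V A O2 by (rule box)
  from turning_dichotomy show ?thesis
  proof
    assume "\<forall>s\<in>K. lam s = 0"
    then obtain P where "flat_piece M P ((\<lambda>(s, x). F s x) ` A)"
      using flat_case[OF s0] by blast
    moreover have "p \<in> (\<lambda>(s, x). F s x) ` A"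
      unfolding p box using s0 x0 by (force simp: F_def)
    ultimately show ?thesis by blast
  next
    assume "(\<forall>s\<in>K. a s = 0) \<and> (\<forall>J. open J \<longrightarrow> J \<subseteq> K \<longrightarrow> J \<noteq> {} \<longrightarrow> (\<exists>s\<in>J. lam s \<noteq> 0))"
    then have "\<exists>c. (\<forall>s\<in>K. V s = c) \<and> sphere_piece M U c K (\<lambda>s. of_real (r s) * cis (\<theta> s)) O2"
      using s0 by (intro centered_case) auto
    then obtain c where c: "\<forall>s\<in>K. V s = c" and cb: "sphere_piece M U c K (\<lambda>s. of_real (r s) * cis (\<theta> s)) O2"
      by blast
    have "p \<in> piece_image U c (\<lambda>s. of_real (r s) * cis (\<theta> s)) K O2"
      unfolding p piece_image_def using s0 x0 c by (force simp: image_iff)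
    with cb show ?thesis by blast
  qed
qed


subsection \<open>Overlapping pieces\<close>

lemma piece_image_subset:
  assumes "sphere_piece M U c K \<gamma> S"
  shows "piece_image U c \<gamma> K S \<subseteq> M"
  using openin_imp_subset[OF sphere_pieceD(8)[OF assms sphere_pieceD(2)[OF assms] order_refl sphere_pieceD(7)[OF assms] order_refl]] .

lemma sphere_piece_shrink:
  assumes cb: "sphere_piece M U c K \<gamma> S" and N: "openin (top_of_set M) N" and z: "z \<in> piece_image U c \<gamma> K S" "z \<in> N"
  shows "\<exists>K' S' s x. open K' \<and> K' \<subseteq> K \<and> s \<in> K' \<and> openin (top_of_set (sphere 0 1)) S' \<and> S' \<subseteq> S \<and> x \<in> S' \<and>
    z = uembed U (\<gamma> s) x + c \<and> piece_image U c \<gamma> K' S' \<subseteq> N"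
proof -
  note D = sphere_pieceD[OF cb]
  obtain s x where sx: "s \<in> K" "x \<in> S" "z = uembed U (\<gamma> s) x + c"
    using z(1) by (auto simp: piece_image_def)
  obtain W where W: "open W" "N = M \<inter> W" using N unfolding openin_open by blast
  obtain B where B: "open B" "S = sphere 0 1 \<inter> B" using D(7) unfolding openin_open by blast
  let ?F = "\<lambda>z. uembed U (\<gamma> (fst z)) (snd z) + c"
  have "continuous_on (K \<times> UNIV) (\<lambda>z. \<gamma> (fst z))"
    by (rule continuous_on_compose2[OF smooth_on_continuous_on[OF D(4)] continuous_on_fst]) (auto intro: continuous_on_id)
  then have cF: "continuous_on (K \<times> UNIV) ?F"
    by (intro continuous_on_add continuous_on_const bounded_bilinear.continuous_on[OF bounded_bilinear_uembed[OF D(1)]])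
      (auto intro: continuous_on_snd continuous_on_id)
  have "open ((K \<times> UNIV) \<inter> ?F -` W)"
    by (rule continuous_open_preimage[OF cF _ W(1)]) (auto intro: open_Times D(2))
  moreover have "(s, x) \<in> (K \<times> UNIV) \<inter> ?F -` W"
    using sx z(2) W(2) by simp
  ultimately obtain K' L where KL: "open K'" "open L" "s \<in> K'" "x \<in> L" "K' \<times> L \<subseteq> (K \<times> UNIV) \<inter> ?F -` W"
    by (rule open_prod_elim) (auto simp: mem_Times_iff)
  have K'K: "K' \<subseteq> K" using KL by blast
  have "piece_image U c \<gamma> K' (S \<inter> L) \<subseteq> N"
  proof
    fix w assume "w \<in> piece_image U c \<gamma> K' (S \<inter> L)"
    then obtain s' x' where w: "s' \<in> K'" "x' \<in> S" "x' \<in> L" "w = uembed U (\<gamma> s') x' + c"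
      by (auto simp: piece_image_def)
    have "(s', x') \<in> (K \<times> UNIV) \<inter> ?F -` W" using w KL(5) by blast
    then have "w \<in> W" using w(4) by simp
    moreover have "w \<in> piece_image U c \<gamma> K S"
      unfolding piece_image_def w(4) using w(1,2) K'K by force
    ultimately show "w \<in> N" using piece_image_subset[OF cb] W(2) by blast
  qed
  moreover have "openin (top_of_set (sphere 0 1)) (S \<inter> L)"
    using D(7) KL(2) openin_Int_open by blast
  moreover have "S \<inter> L \<subseteq> S" "x \<in> S \<inter> L" using sx KL by auto
  ultimately show ?thesis
    using KL(1,3) K'K sx(3) by blast
qed

text \<open>If \<open>\<gamma> * w\<close> is real on an open set, so is its derivative, and hence
  the derivative times the conjugate of the value. Up to the factor \<open>(cmod w)\<^sup>2\<close>
  its imaginary part is the quantity that a piece requires to be nonzero somewhere.\<close>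

lemma sphere_piece_turning:
  assumes cb: "sphere_piece M U c K \<gamma> S" and K': "open K'" "K' \<subseteq> K" "K' \<noteq> {}"
    and w: "w \<noteq> 0" and zero: "\<And>s. s \<in> K' \<Longrightarrow> Im (\<gamma> s * w) = 0"
  shows False
proof -
  note D = sphere_pieceD[OF cb]
  have "Im (dderiv \<gamma> 1 s * cnj (\<gamma> s)) = 0" if s: "s \<in> K'" for s
  proof -
    have sK: "s \<in> K" using s K'(2) by blast
    have d: "((\<lambda>s. Im (\<gamma> s * w)) has_vector_derivative Im (dderiv \<gamma> 1 s * w)) (at s)"
      by (rule bounded_linear.has_vector_derivative[OF bounded_linear_Im
            has_vector_derivative_mult_left[OF smooth_on_has_vector_derivative[OF D(4) sK]]])
    have "((\<lambda>s. Im (\<gamma> s * w)) has_vector_derivative 0) (at s)"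
      by (rule has_vector_derivative_transform_within_open[OF has_vector_derivative_const K'(1) s]) (rule zero[symmetric])
    with d have "Im (dderiv \<gamma> 1 s * w) = 0"
      by (rule vector_derivative_unique_at)
    moreover have "Im (\<gamma> s * w) = 0" by (rule zero[OF s])
    ultimately have "Im ((dderiv \<gamma> 1 s * w) * cnj (\<gamma> s * w)) = 0"
      by simp
    moreover have "(dderiv \<gamma> 1 s * w) * cnj (\<gamma> s * w) = (dderiv \<gamma> 1 s * cnj (\<gamma> s)) * of_real ((cmod w)\<^sup>2)"
      by (simp add: mult_ac flip: complex_norm_square)
    ultimately have "Im (dderiv \<gamma> 1 s * cnj (\<gamma> s)) * (cmod w)\<^sup>2 = 0"
      by (simp only: Im_complex_of_real times_complex.sel Re_complex_of_real mult_zero_right add_0_left add_0_right)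
    then show ?thesis using w by simp
  qed
  then show False using D(9)[OF K'] by blast
qed

text \<open>The second difference of a leaf along a great circle is a multiple of the radial vector.
  If the leaves lie in an affine plane, its direction space contains
  \<open>uembed U (\<gamma> s) x\<close> for all nearby \<open>s\<close>; being Lagrangian, it
  forces the quotients of the values of \<open>\<gamma>\<close> to be real.\<close>

lemma sphere_piece_flat_disjoint:
  fixes M :: "(complex^'n) set"
  assumes n: "CARD('n) \<ge> 2" and cb: "sphere_piece M U c K \<gamma> S" and fl: "flat_piece M P N"
  shows "piece_image U c \<gamma> K S \<inter> N = {}"
proof (rule ccontr)
  assume "piece_image U c \<gamma> K S \<inter> N \<noteq> {}"
  then obtain z where z: "z \<in> piece_image U c \<gamma> K S" "z \<in> N" by blast
  have N: "openin (top_of_set M) N" "N \<subseteq> P" "affine_lagrangian_plane P"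
    using fl unfolding flat_piece_def by (auto dest: openin_imp_subset)
  obtain L b where L: "subspace L" "\<And>v w. v \<in> L \<Longrightarrow> w \<in> L \<Longrightarrow> symplectic_form v w = 0" "P = (\<lambda>v. b + v) ` L"
    using N(3) unfolding affine_lagrangian_plane_def by blast
  note D = sphere_pieceD[OF cb]
  interpret u: bounded_bilinear "uembed U" by (rule bounded_bilinear_uembed[OF D(1)])
  from sphere_piece_shrink[OF cb N(1) z] obtain K' S' s0 x where K': "open K'" "K' \<subseteq> K" "s0 \<in> K'"
    and S': "openin (top_of_set (sphere 0 1)) S'" "x \<in> S'" and sub: "piece_image U c \<gamma> K' S' \<subseteq> N"
    by (elim exE conjE)
  have xs: "x \<in> sphere 0 1" using S' openin_imp_subset by blast
  obtain k e where e: "e \<in> sphere 0 1" "x \<bullet> e = 0"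
    using unit_direction[OF n xs, of 0] by auto
  obtain \<delta> where \<delta>: "\<delta> > 0" "\<And>t. \<bar>t\<bar> < \<delta> \<Longrightarrow> great_circle 1 x e t \<in> S'"
    using openin_sphere_great_circle[OF S' e] by blast
  define t where "t = min (\<delta> / 2) 1"
  have t: "\<bar>t\<bar> < \<delta>" "\<bar>- t\<bar> < \<delta>" "0 < t" "t \<le> 1" using \<delta>(1) by (auto simp: t_def min_def)
  have "cos t < 1"
    using cos_monotone_0_pi[of 0 t] t pi_gt3 by simp
  have inL: "uembed U (\<gamma> s) x \<in> L" if s: "s \<in> K'" for s
  proof -
    have inP: "uembed U (\<gamma> s) y + c \<in> P" if "y \<in> S'" for y
      using sub N(2) s that unfolding piece_image_def by force
    have diff: "v - w \<in> L" if "v \<in> P" "w \<in> P" for v w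
      using that L(3) subspace_diff[OF L(1)] by auto
    let ?A = "uembed U (\<gamma> s) x" and ?B = "uembed U (\<gamma> s) e"
    have F: "(uembed U (\<gamma> s) (great_circle 1 x e t) + c) - (?A + c) = (cos t - 1) *\<^sub>R ?A + sin t *\<^sub>R ?B" for t
      by (simp add: great_circle_def u.add_right u.scaleR_right algebra_simps)
    have "(cos t - 1) *\<^sub>R ?A + sin t *\<^sub>R ?B \<in> L"
      unfolding F[symmetric] by (intro diff inP \<delta>(2) t S'(2))
    moreover have "(cos (- t) - 1) *\<^sub>R ?A + sin (- t) *\<^sub>R ?B \<in> L"
      unfolding F[symmetric] by (intro diff inP \<delta>(2) t S'(2))
    ultimately have "((cos t - 1) *\<^sub>R ?A + sin t *\<^sub>R ?B) + ((cos (- t) - 1) *\<^sub>R ?A + sin (- t) *\<^sub>R ?B) \<in> L"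
      by (rule subspace_add[OF L(1)])
    moreover have "((cos t - 1) *\<^sub>R ?A + sin t *\<^sub>R ?B) + ((cos (- t) - 1) *\<^sub>R ?A + sin (- t) *\<^sub>R ?B) = (2 * (cos t - 1)) *\<^sub>R ?A"
      unfolding cos_minus sin_minus mult_2 scaleR_add_left by simp
    ultimately have "(1 / (2 * (cos t - 1))) *\<^sub>R ((2 * (cos t - 1)) *\<^sub>R ?A) \<in> L"
      using subspace_scale[OF L(1)] by metis
    then show ?thesis using \<open>cos t < 1\<close> by simp
  qed
  have "Im (\<gamma> s * cnj (\<gamma> s0)) = 0" if "s \<in> K'" for s
    using L(2)[OF inL[OF that] inL[OF K'(3)]] xs
    by (auto simp: symplectic_form_herm herm_uembed[OF D(1)] norm_eq_1)
  then show False
    using sphere_piece_turning[OF cb K'(1,2), of "cnj (\<gamma> s0)"] K'(2,3) D(5)[of s0] by auto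
qed

section \<open>Quadrics containing a piece of the sphere\<close>

lemma second_harmonic_const:
  fixes \<alpha> \<beta> \<gamma> \<delta> k :: real
  assumes \<epsilon>: "\<epsilon> > 0"
    and eq: "\<And>t. \<bar>t\<bar> < \<epsilon> \<Longrightarrow> \<alpha> * cos (2 * t) + \<beta> * sin (2 * t) + \<gamma> * cos t + \<delta> * sin t + k = 0"
  shows "\<alpha> = 0 \<and> \<beta> = 0 \<and> \<gamma> = 0 \<and> \<delta> = 0 \<and> k = 0"
proof -
  have d: "(2 * \<beta>) * cos (2 * t) + (- 2 * \<alpha>) * sin (2 * t) + \<delta> * cos t + (- \<gamma>) * sin t = 0" if t: "\<bar>t\<bar> < \<epsilon>" for t
  proof -
    let ?f = "\<lambda>t. \<alpha> * cos (2 * t) + \<beta> * sin (2 * t) + \<gamma> * cos t + \<delta> * sin t + k"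
    have "(?f has_real_derivative (2 * \<beta>) * cos (2 * t) + (- 2 * \<alpha>) * sin (2 * t) + \<delta> * cos t + (- \<gamma>) * sin t) (at t)"
      by (auto intro!: derivative_eq_intros)
    moreover have "(?f has_real_derivative 0) (at t)"
      by (rule has_field_derivative_transform_within_open[where f = "\<lambda>_. 0" and S = "{- \<epsilon><..<\<epsilon>}"]) (use t eq in auto)
    ultimately show ?thesis by (rule DERIV_unique)
  qed
  have "2 * \<beta> = 0" "- 2 * \<alpha> = 0" "\<delta> = 0" "- \<gamma> = 0"
    using second_harmonic_zero[OF \<epsilon> d] by blast+
  then show ?thesis using eq[of 0] \<epsilon> by simp
qed

text \<open>Every point of the sphere is joined to \<open>x0\<close> by a great circle, along which
  the quadric is a trigonometric polynomial of degree two. Vanishing near \<open>x0\<close> makes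
  all its coefficients zero.\<close>

lemma quadratic_vanishing_on_sphere:
  fixes B :: "real^'n \<Rightarrow> real^'n \<Rightarrow> real"
  assumes n: "CARD('n) \<ge> 2" and B: "bilinear B" and l: "linear l"
    and S: "openin (top_of_set (sphere 0 1)) S" "x0 \<in> S"
    and zero: "\<And>x. x \<in> S \<Longrightarrow> B x x + l x + k = 0"
    and x: "x \<in> sphere 0 1"
  shows "B x x + l x + k = 0"
proof -
  have x0: "x0 \<in> sphere 0 1" using S openin_imp_subset by blast
  have x00: "x0 \<bullet> x0 = 1" and xx: "x \<bullet> x = 1" using x0 x by (auto simp: norm_eq_1)
  have "x0 \<bullet> (x - (x \<bullet> x0) *\<^sub>R x0) = 0"
    by (simp add: inner_diff_right x00 inner_commute)
  from unit_direction[OF n x0 this] obtain \<kappa> e where e: "e \<in> sphere 0 1" "x0 \<bullet> e = 0" "x - (x \<bullet> x0) *\<^sub>R x0 = \<kappa> *\<^sub>R e"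
    by blast
  have xe: "x = (x \<bullet> x0) *\<^sub>R x0 + \<kappa> *\<^sub>R e" using e(3) by (simp add: algebra_simps)
  have "x \<bullet> x = ((x \<bullet> x0) *\<^sub>R x0 + \<kappa> *\<^sub>R e) \<bullet> ((x \<bullet> x0) *\<^sub>R x0 + \<kappa> *\<^sub>R e)"
    using xe by (rule arg_cong)
  also have "\<dots> = (x \<bullet> x0)\<^sup>2 + \<kappa>\<^sup>2"
    using x00 e by (simp add: inner_add_left inner_add_right inner_commute norm_eq_1 power2_eq_square)
  finally have "(x \<bullet> x0)\<^sup>2 + \<kappa>\<^sup>2 = 1" using xx by simp
  then obtain t0 where t0: "x \<bullet> x0 = cos t0" "\<kappa> = sin t0" by (rule sincos_total_2pi)
  let ?Q = "\<lambda>x. B x x + l x + k"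
  let ?p = "B x0 x0" and ?r = "B e e" and ?m = "B x0 e + B e x0"
  have Q: "?Q (great_circle 1 x0 e t) = ((?p - ?r) / 2) * cos (2 * t) + (?m / 2) * sin (2 * t) + l x0 * cos t + l e * sin t + ((?p + ?r) / 2 + k)" for t
  proof -
    have "?Q (great_circle 1 x0 e t) = ?p * (cos t)\<^sup>2 + ?m * (cos t * sin t) + ?r * (sin t)\<^sup>2 + l x0 * cos t + l e * sin t + k"
      unfolding great_circle_def mult_1 using B l
      by (simp add: bilinear_ladd bilinear_radd bilinear_lmul bilinear_rmul linear_add linear_scale power2_eq_square algebra_simps)
    also have "(cos t)\<^sup>2 = (1 + cos (2 * t)) / 2" by (simp add: cos_double_cos)
    also have "(sin t)\<^sup>2 = (1 - cos (2 * t)) / 2" by (simp add: cos_double_sin)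
    also have "cos t * sin t = sin (2 * t) / 2" by (simp add: sin_double)
    finally show ?thesis by (simp add: field_simps)
  qed
  obtain \<delta> where \<delta>: "\<delta> > 0" "\<And>t. \<bar>t\<bar> < \<delta> \<Longrightarrow> great_circle 1 x0 e t \<in> S"
    using openin_sphere_great_circle[OF S e(1,2)] by blast
  have "?Q (great_circle 1 x0 e t0) = 0"
    using second_harmonic_const[OF \<delta>(1) zero[OF \<delta>(2), unfolded Q]] unfolding Q by (simp add: field_simps)
  moreover have "great_circle 1 x0 e t0 = x"
    unfolding great_circle_def mult_1 using xe t0 by simp
  ultimately show ?thesis by simp
qed

text \<open>The phase makes one nonzero entry of column \<open>k0\<close> positive. Tested against
  this entry, the condition makes the whole column real and the imaginary part of any other column
  proportional to it; orthogonality of the columns then makes the factor zero.\<close>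

lemma unitary_phase_real:
  fixes D :: "complex^'n^'n"
  assumes D: "unitary_matrix D"
    and im: "\<And>i j l m. Im (D $ i $ l * cnj (D $ j $ m) + D $ i $ m * cnj (D $ j $ l)) = 0"
  shows "\<exists>\<omega>. cmod \<omega> = 1 \<and> (\<forall>i l. Im (\<omega> * D $ i $ l) = 0)"
proof -
  fix k0 :: 'n
  note col = unitary_columns[OF D]
  have "(\<Sum>i\<in>UNIV. cnj (D $ i $ k0) * D $ i $ k0) \<noteq> 0" using col[of k0 k0] by simp
  then have "\<exists>i0. D $ i0 $ k0 \<noteq> 0" by (rule contrapos_np) simp
  then obtain i0 where i0: "D $ i0 $ k0 \<noteq> 0" ..
  define \<rho> where "\<rho> = cmod (D $ i0 $ k0)"
  define \<omega> where "\<omega> = cnj (D $ i0 $ k0) / of_real \<rho>"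
  have \<rho>: "\<rho> > 0" using i0 by (simp add: \<rho>_def)
  have \<omega>1: "cmod \<omega> = 1" using i0 by (simp add: \<omega>_def \<rho>_def norm_divide)
  then have \<omega>\<omega>: "\<omega> * cnj \<omega> = 1" by (simp add: complex_norm_square[symmetric])
  define E where "E i l = \<omega> * D $ i $ l" for i l
  have E0: "E i0 k0 = of_real \<rho>"
    using \<rho> complex_norm_square[of "D $ i0 $ k0"] by (simp add: E_def \<omega>_def \<rho>_def power2_eq_square nonzero_divide_eq_eq mult.commute)
  have imE: "Im (E i l * cnj (E j m) + E i m * cnj (E j l)) = 0" for i j l m
  proof -
    have "E i l * cnj (E j m) + E i m * cnj (E j l) = (\<omega> * cnj \<omega>) * (D $ i $ l * cnj (D $ j $ m) + D $ i $ m * cnj (D $ j $ l))"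
      by (simp add: E_def algebra_simps)
    then show ?thesis unfolding \<omega>\<omega> mult_1 using im by metis
  qed
  have colE: "(\<Sum>i\<in>UNIV. cnj (E i j) * E i k) = (if j = k then 1 else 0)" for j k
  proof -
    have "(\<Sum>i\<in>UNIV. cnj (E i j) * E i k) = (\<omega> * cnj \<omega>) * (\<Sum>i\<in>UNIV. cnj (D $ i $ j) * D $ i $ k)"
      unfolding sum_distrib_left by (intro sum.cong) (simp_all add: E_def mult_ac)
    then show ?thesis by (simp add: \<omega>\<omega> col)
  qed
  have re0: "Im (E i k0) = 0" for i
    using imE[of i k0 i0 k0] \<rho> by (simp add: E0)
  have "Im (E i l) = 0" for i l
  proof (cases "l = k0")
    case True
    then show ?thesis by (simp add: re0)
  next
    case False
    have t: "Im (E i l) = (Im (E i0 l) / \<rho>) * Re (E i k0)" for i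
      using imE[of i l i0 k0] \<rho> by (simp add: E0 re0 field_simps)
    have "0 = Im (\<Sum>i\<in>UNIV. cnj (E i k0) * E i l)"
      using colE[of k0 l] False by simp
    also have "\<dots> = (\<Sum>i\<in>UNIV. Re (E i k0) * Im (E i l))"
      by (simp add: re0)
    also have "\<dots> = (Im (E i0 l) / \<rho>) * (\<Sum>i\<in>UNIV. Re (E i k0) * Re (E i k0))"
      unfolding sum_distrib_left by (intro sum.cong refl, subst t) (simp add: mult_ac)
    also have "(\<Sum>i\<in>UNIV. Re (E i k0) * Re (E i k0)) = Re (\<Sum>i\<in>UNIV. cnj (E i k0) * E i k0)"
      by (simp add: re0)
    also have "\<dots> = 1" by (simp add: colE)
    finally have "Im (E i0 l) / \<rho> = 0" by simp
    then show ?thesis by (subst t) auto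
  qed
  then show ?thesis using \<omega>1 unfolding E_def by blast
qed

lemma sum_axis: "(\<Sum>l\<in>UNIV. of_real (axis k (1::real) $ l) * f l) = (f k :: complex)"
  by (simp add: axis_def if_distrib[where f=of_real] if_distrib[where f="\<lambda>x. x * _"] cong: if_cong)

lemma orthogonal_image_sphere:
  fixes R :: "real^'n^'n"
  assumes R: "transpose R ** R = mat 1" "R ** transpose R = mat 1"
    and S: "openin (top_of_set (sphere 0 1)) S"
  shows "openin (top_of_set (sphere 0 1)) ((*v) R ` S)"
proof -
  obtain B where B: "open B" "S = sphere 0 1 \<inter> B" using S unfolding openin_open by blast
  have inv: "transpose R *v (R *v x) = x" "R *v (transpose R *v x) = x" for x
    by (simp_all only: matrix_vector_mul_assoc R matrix_vector_mul_lid)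
  have "orthogonal_matrix R" "orthogonal_matrix (transpose R)"
    using R by (simp_all add: orthogonal_matrix_def)
  then have nm: "norm (R *v x) = norm x" "norm (transpose R *v x) = norm x" for x
    using orthogonal_transformation_matrix[of "(*v) R"] orthogonal_transformation_matrix[of "(*v) (transpose R)"]
    by (simp_all add: orthogonal_transformation del: transpose_matrix_vector)
  have "(*v) R ` S = sphere 0 1 \<inter> (*v) (transpose R) -` B"
  proof (intro set_eqI iffI)
    show "y \<in> sphere 0 1 \<inter> (*v) (transpose R) -` B" if "y \<in> (*v) R ` S" for y
      using that B(2) by (auto simp: inv nm simp del: transpose_matrix_vector)
    show "y \<in> (*v) R ` S" if "y \<in> sphere 0 1 \<inter> (*v) (transpose R) -` B" for y
      using that B(2) by (intro image_eqI[of _ _ "transpose R *v y"]) (auto simp: inv nm simp del: transpose_matrix_vector)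
  qed
  moreover have "open ((*v) (transpose R) -` B)"
    by (intro open_vimage B(1) matrix_vector_mult_linear_continuous_on)
  ultimately show ?thesis by (auto intro: openin_open_Int)
qed


section \<open>Changing the unitary matrix of a piece by a phase and a real orthogonal
  matrix\<close>

definition adjoint_matrix :: "complex^'n^'n \<Rightarrow> complex^'n^'n" where
  "adjoint_matrix A = map_matrix cnj (transpose A)"

lemma adjoint_matrix_nth: "adjoint_matrix A $ i $ j = cnj (A $ j $ i)"
  by (simp add: adjoint_matrix_def transpose_def)

lemma adjoint_matrix_mult: "adjoint_matrix (A ** B) = adjoint_matrix B ** adjoint_matrix A"
  by (simp add: vec_eq_iff adjoint_matrix_nth matrix_matrix_mult_def mult.commute)

lemma adjoint_adjoint_matrix: "adjoint_matrix (adjoint_matrix A) = A"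
  by (simp add: vec_eq_iff adjoint_matrix_nth)

lemma unitary_matrix_adjoint: "unitary_matrix U \<longleftrightarrow> adjoint_matrix U ** U = mat 1 \<and> U ** adjoint_matrix U = mat 1"
  by (simp add: unitary_matrix_def adjoint_matrix_def)

lemma unitary_adjoint_matrix: "unitary_matrix U \<Longrightarrow> unitary_matrix (adjoint_matrix U)"
  by (simp add: unitary_matrix_adjoint adjoint_adjoint_matrix)

lemma unitary_matrix_mult:
  assumes "unitary_matrix U" "unitary_matrix V"
  shows "unitary_matrix (U ** V)"
proof -
  have "adjoint_matrix V ** adjoint_matrix U ** (U ** V) = adjoint_matrix V ** (adjoint_matrix U ** U) ** V"
    "U ** V ** (adjoint_matrix V ** adjoint_matrix U) = U ** (V ** adjoint_matrix V) ** adjoint_matrix U"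
    by (simp_all only: matrix_mul_assoc)
  then show ?thesis
    using assms by (simp add: unitary_matrix_adjoint adjoint_matrix_mult)
qed

lemma piece_image_rotate:
  assumes "\<And>x. U1 *v real_vec x = U2 *v (cnj \<omega> *s real_vec (R *v x))"
  shows "piece_image U2 c (\<lambda>s. cnj \<omega> * \<gamma> s) K ((*v) R ` S) = piece_image U1 c \<gamma> K S"
proof -
  have "uembed U2 (cnj \<omega> * g) (R *v x) = uembed U1 g x" for g x
    unfolding uembed_def assms vector_scalar_commute[symmetric] by (simp add: mult.commute)
  then show ?thesis
    unfolding piece_image_def by (force simp: image_iff)
qed

text \<open>The phase is moved to the curve and the real orthogonal matrix to the sphere. This
  transports one description of a piece into the unitary frame of another.\<close>

lemma sphere_piece_rotate:
  fixes R :: "real^'n^'n"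
  assumes cb: "sphere_piece M U1 c K \<gamma> S" and U2: "unitary_matrix U2"
    and R: "transpose R ** R = mat 1" "R ** transpose R = mat 1" and \<omega>: "cmod \<omega> = 1"
    and U: "\<And>x. U1 *v real_vec x = U2 *v (cnj \<omega> *s real_vec (R *v x))"
  shows "sphere_piece M U2 c K (\<lambda>s. cnj \<omega> * \<gamma> s) ((*v) R ` S)"
proof -
  note D = sphere_pieceD[OF cb]
  have \<omega>0: "\<omega> \<noteq> 0" and \<omega>\<omega>: "cnj \<omega> * \<omega> = 1"
    using \<omega> by (auto simp: complex_norm_square[symmetric] mult.commute)
  have dd: "dderiv (\<lambda>s. cnj \<omega> * \<gamma> s) 1 s = cnj \<omega> * dderiv \<gamma> 1 s" if "s \<in> K" for s
    using dderiv_unique[OF has_vector_derivative_mult_right[OF smooth_on_has_vector_derivative[OF D(4) that], unfolded has_vector_derivative_def], of "cnj \<omega>" 1]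
    by simp
  show ?thesis
    unfolding sphere_piece_def
  proof (intro conjI ballI allI impI)
    show "smooth_on K (\<lambda>s. cnj \<omega> * \<gamma> s)"
      by (rule smooth_on_bounded_linear[OF D(2) bounded_linear_mult_right D(4)])
    show "cnj \<omega> * \<gamma> s \<noteq> 0" "dderiv (\<lambda>s. cnj \<omega> * \<gamma> s) 1 s \<noteq> 0" if "s \<in> K" for s
      using D(5,6)[OF that] \<omega>0 by (simp_all add: dd[OF that])
    show "openin (top_of_set (sphere 0 1)) ((*v) R ` S)"
      by (rule orthogonal_image_sphere[OF R D(7)])
    show "openin (top_of_set M) (piece_image U2 c (\<lambda>s. cnj \<omega> * \<gamma> s) K' S')"
      if K': "open K'" "K' \<subseteq> K" and S': "openin (top_of_set (sphere 0 1)) S'" "S' \<subseteq> (*v) R ` S" for K' S'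
    proof -
      have inv: "transpose R *v (R *v x) = x" "R *v (transpose R *v x) = x" for x
        by (simp_all only: matrix_vector_mul_assoc R matrix_vector_mul_lid)
      let ?T = "(*v) (transpose R) ` S'"
      have "openin (top_of_set (sphere 0 1)) ?T"
        by (rule orthogonal_image_sphere[OF _ _ S'(1)]) (simp_all add: R)
      moreover have "?T \<subseteq> S"
      proof
        fix x assume "x \<in> ?T"
        then obtain y where "y \<in> S" "x = transpose R *v (R *v y)" using S'(2) by blast
        then show "x \<in> S" by (simp only: inv)
      qed
      ultimately have "openin (top_of_set M) (piece_image U1 c \<gamma> K' ?T)"
        by (rule D(8)[OF K'])
      moreover have "(*v) R ` ?T = S'"
        unfolding image_image inv by simp
      ultimately show ?thesis
        using piece_image_rotate[OF U, of c \<gamma> K' ?T] by simp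
    qed
    show "\<exists>s\<in>J. Im (dderiv (\<lambda>s. cnj \<omega> * \<gamma> s) 1 s * cnj (cnj \<omega> * \<gamma> s)) \<noteq> 0" if J: "open J" "J \<subseteq> K" "J \<noteq> {}" for J
    proof -
      obtain s where s: "s \<in> J" "Im (dderiv \<gamma> 1 s * cnj (\<gamma> s)) \<noteq> 0" using D(9)[OF J] by blast
      then have "s \<in> K" using J by blast
      have "dderiv (\<lambda>s. cnj \<omega> * \<gamma> s) 1 s * cnj (cnj \<omega> * \<gamma> s) = (cnj \<omega> * \<omega>) * (dderiv \<gamma> 1 s * cnj (\<gamma> s))"
        unfolding dd[OF \<open>s \<in> K\<close>] by (simp add: mult_ac)
      also have "\<dots> = dderiv \<gamma> 1 s * cnj (\<gamma> s)" unfolding \<omega>\<omega> by simp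
      finally have e: "dderiv (\<lambda>s. cnj \<omega> * \<gamma> s) 1 s * cnj (cnj \<omega> * \<gamma> s) = dderiv \<gamma> 1 s * cnj (\<gamma> s)" .
      show ?thesis by (rule bexI[of _ s], unfold e) (fact s)+
    qed
  qed (fact D(2) D(3) U2)+
qed

text \<open>A quadric containing a piece of the sphere contains all of it, so even and odd parts in \<open>x\<close> separate.\<close>

lemma quadric_on_sphere_split:
  fixes D :: "complex^'n^'n" and d :: "complex^'n"
  assumes n: "CARD('n) \<ge> 2" and D: "unitary_matrix D" and g: "g \<noteq> 0"
    and S: "openin (top_of_set (sphere 0 1)) S" "x0 \<in> S"
    and zero: "\<And>x i j. x \<in> S \<Longrightarrow> Im ((g *s (D *v real_vec x) + d) $ i * cnj ((g *s (D *v real_vec x) + d) $ j)) = 0"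
    and x: "x \<in> sphere 0 1"
  shows "Im ((D *v real_vec x) $ i * cnj ((D *v real_vec x) $ j)) = 0"
    and "Im (g * (D *v real_vec x) $ i * cnj (d $ j) + d $ i * cnj (g * (D *v real_vec x) $ j)) = 0"
proof -
  define L where "L i x = (D *v real_vec x) $ i" for i x
  have L: "L i (x + y) = L i x + L i y" "L i (t *\<^sub>R x) = of_real t * L i x" for i x y t
    by (simp_all add: L_def real_vec_linear matrix_vector_right_distrib)
      (simp add: matrix_vector_mult_def sum_distrib_left scaleR_conv_of_real[where 'a=complex] mult_ac)
  have Lneg: "L i (- x) = - L i x" for i x using L(2)[of i "-1" x] by simp
  let ?B = "\<lambda>i j x x'. Im ((g * L i x) * cnj (g * L j x'))"
  let ?l = "\<lambda>i j x. Im ((g * L i x) * cnj (d $ j) + d $ i * cnj (g * L j x))"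
  have all: "?B i j x x + ?l i j x + Im (d $ i * cnj (d $ j)) = 0" if x: "x \<in> sphere 0 1" for i j x
  proof (rule quadratic_vanishing_on_sphere[where B = "?B i j" and l = "?l i j", OF n _ _ S _ x])
    show "bilinear (?B i j)"
      unfolding bilinear_def
      by (auto intro!: linearI simp: L algebra_simps simp del: times_complex.sel)
        (simp_all add: algebra_simps)
    show "linear (?l i j)"
      by (rule linearI) (simp_all add: L algebra_simps)
    show "?B i j x x + ?l i j x + Im (d $ i * cnj (d $ j)) = 0" if "x \<in> S" for x
    proof -
      have "(g *s (D *v real_vec x) + d) $ i * cnj ((g *s (D *v real_vec x) + d) $ j) = (g * L i x) * cnj (g * L j x) + ((g * L i x) * cnj (d $ j) + d $ i * cnj (g * L j x)) + d $ i * cnj (d $ j)"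
        unfolding L_def by (simp add: algebra_simps)
      then have "Im ((g * L i x) * cnj (g * L j x) + ((g * L i x) * cnj (d $ j) + d $ i * cnj (g * L j x)) + d $ i * cnj (d $ j)) = 0"
        using zero[OF that, of i j] by (simp only:)
      then show ?thesis by (simp only: plus_complex.sel)
    qed
  qed
  have l0: "?l i j x = 0" and B: "?B i j x x + Im (d $ i * cnj (d $ j)) = 0" if x: "x \<in> sphere 0 1" for i j x
  proof -
    have "- x \<in> sphere 0 1" using x by simp
    from all[OF this, of i j] all[OF x, of i j]
    show "?l i j x = 0" "?B i j x x + Im (d $ i * cnj (d $ j)) = 0"
      unfolding Lneg by simp_all
  qed
  have B': "(cmod g)\<^sup>2 * Im (L i x * cnj (L j x)) = - Im (d $ i * cnj (d $ j))" if x: "x \<in> sphere 0 1" for i j x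
  proof -
    have "(g * L i x) * cnj (g * L j x) = of_real ((cmod g)\<^sup>2) * (L i x * cnj (L j x))"
      unfolding complex_norm_square by (simp add: mult_ac)
    also have "Im \<dots> = (cmod g)\<^sup>2 * Im (L i x * cnj (L j x))"
      by (simp only: times_complex.sel Re_complex_of_real Im_complex_of_real mult_zero_left add_0_right)
    finally show ?thesis using B[OF x, of i j] by linarith
  qed
  have Lax: "L i (axis l 1) = D $ i $ l" for i l
  proof -
    have "L i (axis l 1) = (\<Sum>m\<in>UNIV. of_real (axis l 1 $ m) * D $ i $ m)"
      by (simp add: L_def matrix_vector_mult_def real_vec_def mult.commute)
    then show ?thesis unfolding sum_axis .
  qed
  \<comment> \<open>Summing the even part over the standard basis gives the Hermitian product of two
    rows of \<open>D\<close>, which is real by unitarity; the constant term therefore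
    vanishes.\<close>
  have d0: "Im (d $ i * cnj (d $ j)) = 0" for i j
  proof -
    have "(\<Sum>l\<in>UNIV. (cmod g)\<^sup>2 * Im (L i (axis l 1) * cnj (L j (axis l 1)))) = (\<Sum>l\<in>(UNIV::'n set). - Im (d $ i * cnj (d $ j)))"
      by (intro sum.cong refl B') simp
    moreover have "(\<Sum>l\<in>UNIV. (cmod g)\<^sup>2 * Im (L i (axis l 1) * cnj (L j (axis l 1)))) = (cmod g)\<^sup>2 * Im (\<Sum>l\<in>UNIV. D $ i $ l * cnj (D $ j $ l))"
      unfolding Lax by (simp only: sum_distrib_left Im_sum)
    moreover have "Im (\<Sum>l\<in>UNIV. D $ i $ l * cnj (D $ j $ l)) = 0"
      unfolding unitary_rows[OF D] by simp
    ultimately have "real CARD('n) * Im (d $ i * cnj (d $ j)) = 0"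
      by (simp only: sum_constant mult_zero_right)
    then show ?thesis by simp
  qed
  show "Im ((D *v real_vec x) $ i * cnj ((D *v real_vec x) $ j)) = 0"
    using B'[OF x, of i j] g unfolding d0 L_def by simp
  show "Im (g * (D *v real_vec x) $ i * cnj (d $ j) + d $ i * cnj (g * (D *v real_vec x) $ j)) = 0"
    using l0[OF x, of i j] unfolding L_def .
qed

text \<open>
  In the coordinates of \<open>U2\<close> and \<open>c2\<close>, points of the second piece have pairwise real quotients of
  components. Imposing this on the first piece yields \<open>U2\<^sup>* U1 = \<omega>\<^sup>-\<^sup>1 R\<close> with \<open>R\<close> real orthogonal,
  and \<open>c1 = c2\<close>.
\<close>

lemma sphere_piece_overlap:
  fixes M :: "(complex^'n) set"
  assumes n: "CARD('n) \<ge> 2" and cb1: "sphere_piece M U1 c1 K1 \<gamma>1 S1" and cb2: "sphere_piece M U2 c2 K2 \<gamma>2 S2"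
    and p: "p \<in> piece_image U1 c1 \<gamma>1 K1 S1" "p \<in> piece_image U2 c2 \<gamma>2 K2 S2"
  shows "\<exists>\<gamma> S. sphere_piece M U2 c2 K1 \<gamma> S \<and> piece_image U2 c2 \<gamma> K1 S = piece_image U1 c1 \<gamma>1 K1 S1"
proof -
  note D1 = sphere_pieceD[OF cb1] and D2 = sphere_pieceD[OF cb2]
  have N2: "openin (top_of_set M) (piece_image U2 c2 \<gamma>2 K2 S2)"
    by (rule D2(8)[OF D2(2) order_refl D2(7) order_refl])
  from sphere_piece_shrink[OF cb1 N2 p] obtain K' S' s0 x0 where K': "open K'" "K' \<subseteq> K1" "s0 \<in> K'"
    and S': "openin (top_of_set (sphere 0 1)) S'" "x0 \<in> S'"
    and sub: "piece_image U1 c1 \<gamma>1 K' S' \<subseteq> piece_image U2 c2 \<gamma>2 K2 S2"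
    by (elim exE conjE)
  define D where "D = adjoint_matrix U2 ** U1"
  define d where "d = adjoint_matrix U2 *v (c1 - c2)"
  have uD: "unitary_matrix D"
    unfolding D_def by (rule unitary_matrix_mult[OF unitary_adjoint_matrix[OF D2(1)] D1(1)])
  have inv: "adjoint_matrix U2 ** U2 = mat 1" "U2 ** adjoint_matrix U2 = mat 1"
    using D2(1) unfolding unitary_matrix_adjoint by auto
  have U1D: "U1 *v v = U2 *v (D *v v)" for v
    unfolding D_def matrix_vector_mul_assoc matrix_mul_assoc inv by simp
  have adjU: "adjoint_matrix U2 *v (U2 *v v) = v" "U2 *v (adjoint_matrix U2 *v v) = v" for v
    unfolding matrix_vector_mul_assoc inv by simp_all
  have zero: "Im ((\<gamma>1 s *s (D *v real_vec x) + d) $ i * cnj ((\<gamma>1 s *s (D *v real_vec x) + d) $ j)) = 0"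
    if "s \<in> K'" "x \<in> S'" for s x i j
  proof -
    have "uembed U1 (\<gamma>1 s) x + c1 \<in> piece_image U2 c2 \<gamma>2 K2 S2"
      using sub that unfolding piece_image_def by force
    then obtain g x' where e: "uembed U1 (\<gamma>1 s) x + c1 = uembed U2 g x' + c2"
      by (auto simp: piece_image_def)
    have "\<gamma>1 s *s (D *v real_vec x) + d = adjoint_matrix U2 *v (uembed U1 (\<gamma>1 s) x + c1 - c2)"
      by (simp add: d_def uembed_def U1D vector_scalar_commute[symmetric] adjU matrix_vector_right_distrib add_diff_eq[symmetric] del: add_diff_eq)
    also have "\<dots> = g *s real_vec x'"
      unfolding e by (simp add: uembed_def vector_scalar_commute[symmetric] adjU)
    finally show ?thesis
      by (simp add: real_vec_def)
  qed
  have g0: "\<gamma>1 s \<noteq> 0" if "s \<in> K'" for s using D1(5) K'(2) that by blast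
  note split = quadric_on_sphere_split[OF n uD g0 S' zero]
  have hom: "(D *v real_vec (t *\<^sub>R v)) $ i = of_real t * (D *v real_vec v) $ i" for t v i
    by (simp add: real_vec_linear matrix_vector_mult_def sum_distrib_left scaleR_conv_of_real[where 'a=complex] mult_ac)
  have quad: "Im ((D *v real_vec v) $ i * cnj ((D *v real_vec v) $ j)) = 0" for v i j
  proof (cases "v = 0")
    case False
    have "Im ((D *v real_vec (sgn v)) $ i * cnj ((D *v real_vec (sgn v)) $ j)) = 0"
      by (rule split(1)[OF K'(3) K'(3)]) (use False in \<open>simp_all add: norm_sgn\<close>)
    moreover have "(D *v real_vec v) $ i = of_real (norm v) * (D *v real_vec (sgn v)) $ i" for i
      using hom[of "norm v" "sgn v" i] False by (simp add: sgn_div_norm)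
    ultimately show ?thesis
      by (simp add: mult.assoc mult.left_commute)
  qed (simp add: real_vec_def matrix_vector_mult_def)
  have Dax: "(D *v real_vec (axis l 1)) $ i = D $ i $ l" for i l
  proof -
    have "(D *v real_vec (axis l 1)) $ i = (\<Sum>m\<in>UNIV. of_real (axis l 1 $ m) * D $ i $ m)"
      by (simp add: matrix_vector_mult_def real_vec_def mult.commute)
    then show ?thesis unfolding sum_axis .
  qed
  have im: "Im (D $ i $ l * cnj (D $ j $ m) + D $ i $ m * cnj (D $ j $ l)) = 0" for i j l m
  proof -
    have "(D $ i $ l + D $ i $ m) * cnj (D $ j $ l + D $ j $ m) = D $ i $ l * cnj (D $ j $ l) + D $ i $ m * cnj (D $ j $ m)
       + (D $ i $ l * cnj (D $ j $ m) + D $ i $ m * cnj (D $ j $ l))"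
      by (simp add: algebra_simps)
    moreover have "Im ((D $ i $ l + D $ i $ m) * cnj (D $ j $ l + D $ j $ m)) = 0"
      using quad[of "axis l 1 + axis m 1" i j] by (simp only: real_vec_linear matrix_vector_right_distrib vector_add_component Dax)
    ultimately show ?thesis
      using quad[of "axis l 1" i j] quad[of "axis m 1" i j] unfolding Dax by (simp only: plus_complex.sel)
  qed
  from unitary_phase_real[OF uD im] obtain \<omega> where \<omega>: "cmod \<omega> = 1" and real: "\<And>i l. Im (\<omega> * D $ i $ l) = 0"
    by blast
  have \<omega>\<omega>: "\<omega> * cnj \<omega> = 1" "cnj \<omega> * \<omega> = 1" and \<omega>0: "\<omega> \<noteq> 0"
    using \<omega> by (auto simp: complex_norm_square[symmetric] mult.commute)
  define R :: "real^'n^'n" where "R = (\<chi> i l. Re (\<omega> * D $ i $ l))"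
  have RD: "of_real (R $ i $ l) = \<omega> * D $ i $ l" for i l
    using real[of i l] unfolding complex_eq_iff R_def by simp
  have R: "transpose R ** R = mat 1" "R ** transpose R = mat 1"
  proof -
    have "complex_of_real (\<Sum>i\<in>UNIV. R $ i $ j * R $ i $ k) = (cnj \<omega> * \<omega>) * (\<Sum>i\<in>UNIV. cnj (D $ i $ j) * D $ i $ k)" for j k
    proof -
      have "complex_of_real (\<Sum>i\<in>UNIV. R $ i $ j * R $ i $ k) = (\<Sum>i\<in>UNIV. cnj (of_real (R $ i $ j)) * of_real (R $ i $ k))"
        by simp
      then show ?thesis unfolding RD sum_distrib_left by (simp add: mult_ac)
    qed
    then have "complex_of_real (\<Sum>i\<in>UNIV. R $ i $ j * R $ i $ k) = complex_of_real (if j = k then 1 else 0)" for j k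
      unfolding \<omega>\<omega> unitary_columns[OF uD] by simp
    then have "(\<Sum>i\<in>UNIV. R $ i $ j * R $ i $ k) = (if j = k then 1 else 0)" for j k
      unfolding of_real_eq_iff .
    then show "transpose R ** R = mat 1"
      by (simp add: vec_eq_iff matrix_matrix_mult_def transpose_def mat_def)
    then show "R ** transpose R = mat 1"
      by (simp add: matrix_left_right_inverse)
  qed
  have DR: "D *v real_vec x = cnj \<omega> *s real_vec (R *v x)" for x
  proof -
    have "cnj \<omega> * of_real (R $ i $ l) = D $ i $ l" for i l
      unfolding RD mult.assoc[symmetric] \<omega>\<omega> by simp
    then show ?thesis
      by (simp add: vec_eq_iff matrix_vector_mult_def real_vec_def sum_distrib_left mult.assoc[symmetric])
  qed
  have "d $ j = 0" for j
  proof (rule ccontr)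
    assume dj: "d $ j \<noteq> 0"
    have "\<exists>i. i \<noteq> j"
    proof (rule ccontr)
      assume "\<nexists>i. i \<noteq> j"
      then have "(UNIV :: 'n set) = {j}" by auto
      then have "CARD('n) = card {j}" by (rule arg_cong)
      then show False using n by simp
    qed
    then obtain i where i: "i \<noteq> j" ..
    \<comment> \<open>At this point the odd part of the condition involves a single component of
      \<open>d\<close>: \<open>\<gamma>1\<close> times a fixed nonzero number would be real
      throughout \<open>K'\<close>, against the turning of the piece.\<close>
    define x where "x = transpose R *v axis i 1"
    have Rx: "R *v x = axis i 1"
      unfolding x_def by (simp only: matrix_vector_mul_assoc R matrix_vector_mul_lid)
    have "orthogonal_matrix (transpose R)"
      by (simp add: orthogonal_matrix_def R)
    then have "norm x = norm (axis i 1 :: real^'n)"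
      unfolding x_def using orthogonal_transformation_matrix[of "(*v) (transpose R)"]
      by (simp add: orthogonal_transformation del: transpose_matrix_vector)
    then have x: "x \<in> sphere 0 1" by simp
    have "Im (\<gamma>1 s * (cnj \<omega> * cnj (d $ j))) = 0" if s: "s \<in> K'" for s
    proof -
      have "Im (\<gamma>1 s * (D *v real_vec x) $ i * cnj (d $ j) + d $ i * cnj (\<gamma>1 s * (D *v real_vec x) $ j)) = 0"
        by (rule split(2)[OF s s]) (use x in simp_all)
      moreover have "(D *v real_vec x) $ i = cnj \<omega>" "(D *v real_vec x) $ j = 0"
        unfolding DR Rx using i by (simp_all add: real_vec_def axis_def)
      ultimately show ?thesis by (simp only: complex_cnj_zero mult_zero_right add_0_right mult.assoc)
    qed
    then show False
      using sphere_piece_turning[OF cb1 K'(1,2), of "cnj \<omega> * cnj (d $ j)"] dj \<omega>0 K'(3) by auto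
  qed
  then have "d = 0" by (simp add: vec_eq_iff)
  then have "c1 - c2 = 0"
    using adjU(2)[of "c1 - c2"] unfolding d_def by simp
  then have c: "c1 = c2" by simp
  have U: "U1 *v real_vec x = U2 *v (cnj \<omega> *s real_vec (R *v x))" for x
    unfolding U1D DR ..
  show ?thesis
    using sphere_piece_rotate[OF cb1 D2(1) R \<omega> U] piece_image_rotate[OF U, of c1 \<gamma>1 K1 S1] unfolding c by blast
qed

subsection \<open>Components\<close>

text \<open>Images of coordinate balls are connected, so a component contains one around each of its
  points.\<close>

lemma component_openin:
  fixes M :: "(complex^'n) set"
  assumes M: "submanifold M" and C: "C \<in> components M"
  shows "openin (top_of_set M) C"
proof (subst openin_subopen, intro ballI)
  fix p assume p: "p \<in> C"
  then have pM: "p \<in> M" using in_components_subset[OF C] by blast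
  then obtain D X where X: "local_parametrization M D X" "p \<in> X ` D"
    using M unfolding submanifold_def by blast
  note D = local_parametrizationD[OF X(1)]
  obtain u where u: "u \<in> D" "X u = p" using X(2) by blast
  obtain e where e: "e > 0" "ball u e \<subseteq> D" using D(1) u(1) openE by blast
  have "openin (top_of_set M) (X ` ball u e)"
    by (rule local_parametrization_open_image[OF X(1) open_ball e(2)])
  moreover have pX: "p \<in> X ` ball u e" using u e(1) by force
  moreover have "X ` ball u e \<subseteq> C"
  proof (rule components_maximal[OF C])
    show "connected (X ` ball u e)"
      by (rule connected_continuous_image[OF continuous_on_subset[OF smooth_on_continuous_on[OF D(2)] e(2)] connected_ball])
    show "X ` ball u e \<subseteq> M" using D(5) e(2) by blast
    show "C \<inter> X ` ball u e \<noteq> {}" using p pX by blast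
  qed
  ultimately show "\<exists>T. openin (top_of_set M) T \<and> p \<in> T \<and> T \<subseteq> C" by blast
qed

section \<open>Overlapping open parts of affine Lagrangian planes\<close>

lemma affine_plane_subset:
  assumes P: "affine_lagrangian_plane P" and P': "affine_lagrangian_plane P'"
    and T: "openin (top_of_set P) T" "x \<in> T" "T \<subseteq> P'"
  shows "P \<subseteq> P'"
proof
  fix z assume z: "z \<in> P"
  have xP: "x \<in> P" using T openin_imp_subset by blast
  obtain L a where L: "subspace L" "P = (\<lambda>v. a + v) ` L"
    using P unfolding affine_lagrangian_plane_def by blast
  obtain L' a' where L': "subspace L'" "P' = (\<lambda>v. a' + v) ` L'"
    using P' unfolding affine_lagrangian_plane_def by blast
  obtain B where B: "open B" "T = P \<inter> B" using T(1) unfolding openin_open by blast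
  have cont: "continuous_on UNIV (\<lambda>t. x + t *\<^sub>R (z - x))" by (intro continuous_intros)
  have "open ((\<lambda>t. x + t *\<^sub>R (z - x)) -` B)"
    by (intro open_vimage B(1) cont)
  moreover have "0 \<in> (\<lambda>t. x + t *\<^sub>R (z - x)) -` B" using T(2) B(2) by simp
  ultimately obtain e where e: "e > 0" "ball 0 e \<subseteq> (\<lambda>t. x + t *\<^sub>R (z - x)) -` B" using openE by blast
  \<comment> \<open>A short nonzero multiple of \<open>z - x\<close> stays in the common open part,
    and the direction space of \<open>P'\<close> allows it to be rescaled to full length.\<close>
  define t where "t = e / 2"
  have t: "t \<noteq> 0" "t \<in> ball 0 e" using e(1) by (auto simp: t_def)
  obtain vx vz where v: "vx \<in> L" "x = a + vx" "vz \<in> L" "z = a + vz"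
    using xP z unfolding L(2) by blast
  have "x + t *\<^sub>R (z - x) = a + (vx + t *\<^sub>R (vz - vx))" unfolding v by simp
  moreover have "vx + t *\<^sub>R (vz - vx) \<in> L"
    by (intro subspace_add[OF L(1)] subspace_scale[OF L(1)] subspace_diff[OF L(1)] v)
  ultimately have "x + t *\<^sub>R (z - x) \<in> P" unfolding L(2) by blast
  then have "x + t *\<^sub>R (z - x) \<in> P'" using e(2) t(2) B(2) T(3) by blast
  moreover have "x \<in> P'" using T by blast
  ultimately obtain w w' where w: "w \<in> L'" "x = a' + w" "w' \<in> L'" "x + t *\<^sub>R (z - x) = a' + w'"
    unfolding L'(2) by blast
  have "t *\<^sub>R (z - x) = w' - w" using w(2,4) by (simp add: algebra_simps)
  then have "z - x = (1 / t) *\<^sub>R (w' - w)" using t(1) by (metis divide_self_if one_add_one scaleR_one scaleR_scaleR times_divide_eq_left mult_1)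
  then have "z = a' + (w + (1 / t) *\<^sub>R (w' - w))" using w(2) by (simp add: algebra_simps)
  moreover have "w + (1 / t) *\<^sub>R (w' - w) \<in> L'"
    by (intro subspace_add[OF L'(1)] subspace_scale[OF L'(1)] subspace_diff[OF L'(1)] w)
  ultimately show "z \<in> P'" unfolding L'(2) by blast
qed

lemma flat_piece_Int:
  assumes "flat_piece M P N" and N': "openin (top_of_set M) N'"
  shows "openin (top_of_set P) (N \<inter> N')"
proof -
  have N: "openin (top_of_set M) N" "openin (top_of_set P) N" using assms(1) by (auto simp: flat_piece_def)
  have "openin (top_of_set N) (N \<inter> N')"
    by (rule openin_subset_trans[OF openin_Int[OF N(1) N'] _ openin_imp_subset[OF N(1)]]) simp
  then show ?thesis using N(2) by (rule openin_trans)
qed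

lemma flat_pieces_same_plane:
  assumes "flat_piece M P N" "flat_piece M P' N'" "x \<in> N" "x \<in> N'"
  shows "P = P'"
proof -
  have a: "openin (top_of_set M) N" "openin (top_of_set M) N'" "affine_lagrangian_plane P" "affine_lagrangian_plane P'"
    "N \<subseteq> P" "N' \<subseteq> P'"
    using assms(1,2) unfolding flat_piece_def by (auto dest: openin_imp_subset)
  show ?thesis
  proof
    show "P \<subseteq> P'"
      by (rule affine_plane_subset[OF a(3,4) flat_piece_Int[OF assms(1) a(2)], of x]) (use assms a in auto)
    show "P' \<subseteq> P"
      by (rule affine_plane_subset[OF a(4,3) flat_piece_Int[OF assms(2) a(1)], of x]) (use assms a in auto)
  qed
qed

section \<open>Centered families as local embeddings\<close>

lemma centered_family_uembed: "centered_family \<gamma> = (\<lambda>(s, x). uembed (mat 1) (\<gamma> s) x)"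
  by (simp add: centered_family_def uembed_def fun_eq_iff)

lemma unitary_mat_1: "unitary_matrix (mat 1)"
  by (simp add: unitary_matrix_def vec_eq_iff matrix_matrix_mult_def mat_def transpose_def
      if_distrib[where f=cnj] if_distrib[where f="\<lambda>x. _ * x"] if_distrib[where f="\<lambda>x. x * _"] cong: if_cong)

text \<open>The images of the sphere direction and of the parameter direction are orthogonal, so the
  squared length of their sum splits into two nonnegative terms.\<close>

lemma immersion_centered_family:
  fixes \<gamma> :: "real \<Rightarrow> complex"
  assumes K: "smooth_on K \<gamma>" and nz: "\<And>s. s \<in> K \<Longrightarrow> \<gamma> s \<noteq> 0" "\<And>s. s \<in> K \<Longrightarrow> dderiv \<gamma> 1 s \<noteq> 0"
  shows "immersion_on_cylinder K (centered_family \<gamma> :: real \<times> (real^'n) \<Rightarrow> complex^'n)"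
  unfolding immersion_on_cylinder_def
proof (intro ballI)
  fix s and x :: "real^'n" assume s: "s \<in> K" and x: "x \<in> sphere 0 1"
  let ?u = "uembed (mat 1 :: complex^'n^'n)"
  interpret u: bounded_bilinear ?u by (rule bounded_bilinear_uembed[OF unitary_mat_1])
  let ?g = "dderiv \<gamma> 1 s"
  have d: "(\<gamma> has_derivative (\<lambda>t. t *\<^sub>R ?g)) (at s)"
    using smooth_on_has_vector_derivative[OF K s] by (simp add: has_vector_derivative_def)
  have d1: "((\<lambda>z. \<gamma> (fst z)) has_derivative (\<lambda>h. fst h *\<^sub>R ?g)) (at (s, x))"
    by (rule has_derivative_compose[OF has_derivative_fst[OF has_derivative_ident], of \<gamma> "\<lambda>t. t *\<^sub>R ?g", simplified]) (simp add: d)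
  have "((\<lambda>z. ?u (\<gamma> (fst z)) (snd z)) has_derivative (\<lambda>h. ?u (\<gamma> s) (snd h) + ?u (fst h *\<^sub>R ?g) x)) (at (s, x))"
    using u.FDERIV[OF d1 has_derivative_snd[OF has_derivative_ident]] by simp
  then have fd: "frechet_derivative (centered_family \<gamma>) (at (s, x)) = (\<lambda>h. ?u (\<gamma> s) (snd h) + ?u (fst h *\<^sub>R ?g) x)"
    unfolding centered_family_uembed case_prod_beta by (rule frechet_derivative_at[symmetric])
  show "inj_on (frechet_derivative (centered_family \<gamma> :: real \<times> (real^'n) \<Rightarrow> complex^'n) (at (s, x))) {(t, v). x \<bullet> v = 0}"
  proof (rule inj_onI)
    fix h h' :: "real \<times> (real^'n)"
    assume h: "h \<in> {(t, v). x \<bullet> v = 0}" "h' \<in> {(t, v). x \<bullet> v = 0}"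
      and eq: "frechet_derivative (centered_family \<gamma> :: real \<times> (real^'n) \<Rightarrow> complex^'n) (at (s, x)) h = frechet_derivative (centered_family \<gamma>) (at (s, x)) h'"
    define v t where "v = snd h - snd h'" and "t = fst h - fst h'"
    have xv: "x \<bullet> v = 0" using h by (auto simp: v_def inner_diff_right)
    have 0: "?u (\<gamma> s) v + ?u (t *\<^sub>R ?g) x = 0"
      using eq unfolding fd v_def t_def by (simp add: u.diff_right u.diff_left scaleR_left_diff_distrib algebra_simps)
    have "0 = (?u (\<gamma> s) v + ?u (t *\<^sub>R ?g) x) \<bullet> (?u (\<gamma> s) v + ?u (t *\<^sub>R ?g) x)"
      unfolding 0 by simp
    also have "\<dots> = (\<gamma> s \<bullet> \<gamma> s) * (v \<bullet> v) + t\<^sup>2 * (?g \<bullet> ?g)"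
      using x xv by (simp add: inner_add_left inner_add_right inner_uembed[OF unitary_mat_1] inner_commute norm_eq_1 power2_eq_square)
    finally have "(\<gamma> s \<bullet> \<gamma> s) * (v \<bullet> v) + t\<^sup>2 * (?g \<bullet> ?g) = 0" by simp
    moreover have "\<gamma> s \<bullet> \<gamma> s > 0" "?g \<bullet> ?g > 0" using nz[OF s] by simp_all
    ultimately have "v = 0" "t = 0"
      by (simp_all add: add_nonneg_eq_0_iff zero_le_mult_iff)
    then show "h = h'" by (simp add: v_def t_def prod_eq_iff)
  qed
qed

text \<open>Two points can collide through \<open>\<gamma> t = - \<gamma> s\<close> at antipodal
  points of the sphere, or through a self-intersection of \<open>\<gamma>\<close>. The first is
  excluded by keeping \<open>\<gamma>\<close> in the half plane around \<open>\<gamma> s0\<close>,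
  the second by monotonicity of the component of \<open>\<gamma>\<close> along its velocity at
  \<open>s0\<close>.\<close>

lemma centered_family_injective_near:
  fixes \<gamma> :: "real \<Rightarrow> complex"
  assumes K: "open K" "smooth_on K \<gamma>" "s0 \<in> K" and nz: "\<gamma> s0 \<noteq> 0" "dderiv \<gamma> 1 s0 \<noteq> 0"
  obtains \<epsilon> where "\<epsilon> > 0" "cball s0 \<epsilon> \<subseteq> K"
    "inj_on (centered_family \<gamma> :: real \<times> (real^'n) \<Rightarrow> complex^'n) (cball s0 \<epsilon> \<times> sphere 0 1)"
proof -
  let ?g = "dderiv \<gamma> 1"
  have c: "continuous_on K \<gamma>" "continuous_on K ?g"
    using smooth_on_continuous_on[OF K(2)] smooth_on_continuous_on[OF smooth_on_dderiv[OF K(2)]] by auto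
  have "open (K \<inter> (\<lambda>s. \<gamma> s \<bullet> \<gamma> s0) -` {0<..})" "open (K \<inter> (\<lambda>s. ?g s \<bullet> ?g s0) -` {0<..})"
    by (intro continuous_open_preimage K(1) open_greaterThan continuous_intros c)+
  then have "open ((K \<inter> (\<lambda>s. \<gamma> s \<bullet> \<gamma> s0) -` {0<..}) \<inter> (K \<inter> (\<lambda>s. ?g s \<bullet> ?g s0) -` {0<..}))"
    by (rule open_Int)
  moreover have "s0 \<in> (K \<inter> (\<lambda>s. \<gamma> s \<bullet> \<gamma> s0) -` {0<..}) \<inter> (K \<inter> (\<lambda>s. ?g s \<bullet> ?g s0) -` {0<..})"
    using K(3) nz by simp
  ultimately obtain \<epsilon> where \<epsilon>: "\<epsilon> > 0"
    "cball s0 \<epsilon> \<subseteq> (K \<inter> (\<lambda>s. \<gamma> s \<bullet> \<gamma> s0) -` {0<..}) \<inter> (K \<inter> (\<lambda>s. ?g s \<bullet> ?g s0) -` {0<..})"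
    using open_contains_cball by (metis (no_types, lifting))
  have K': "cball s0 \<epsilon> \<subseteq> K" using \<epsilon>(2) by blast
  have pos: "\<gamma> s \<bullet> \<gamma> s0 > 0" "?g s \<bullet> ?g s0 > 0" if "s \<in> cball s0 \<epsilon>" for s
    using \<epsilon>(2) that by auto
  have lt: "\<gamma> s \<bullet> ?g s0 < \<gamma> t \<bullet> ?g s0" if st: "s \<in> cball s0 \<epsilon>" "t \<in> cball s0 \<epsilon>" "s < t" for s t
  proof (rule DERIV_pos_imp_increasing[OF st(3)])
    fix z assume "s \<le> z" "z \<le> t"
    then have z: "z \<in> cball s0 \<epsilon>" using st by (auto simp: dist_real_def abs_le_iff)
    have "((\<lambda>s. \<gamma> s \<bullet> ?g s0) has_real_derivative (?g z \<bullet> ?g s0)) (at z)"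
      unfolding has_real_derivative_iff_has_vector_derivative
      by (rule bounded_linear.has_vector_derivative[OF bounded_linear_inner_left smooth_on_has_vector_derivative[OF K(2)]])
        (use K' z in blast)
    then show "\<exists>y. ((\<lambda>s. \<gamma> s \<bullet> ?g s0) has_real_derivative y) (at z) \<and> y > 0"
      using pos(2)[OF z] by blast
  qed
  have inj\<gamma>: "s = t" if "s \<in> cball s0 \<epsilon>" "t \<in> cball s0 \<epsilon>" "\<gamma> s = \<gamma> t" for s t
    using lt[of s t] lt[of t s] that by (cases s t rule: linorder_cases) auto
  show thesis
  proof (rule that[OF \<epsilon>(1) K'], rule inj_onI)
    fix z z' :: "real \<times> (real^'n)"
    assume zz: "z \<in> cball s0 \<epsilon> \<times> sphere 0 1" "z' \<in> cball s0 \<epsilon> \<times> sphere 0 1"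
      and eq: "(centered_family \<gamma> z :: complex^'n) = centered_family \<gamma> z'"
    obtain s x t y where z: "z = (s, x)" "z' = (t, y)" by fastforce
    have s: "s \<in> cball s0 \<epsilon>" "t \<in> cball s0 \<epsilon>" and x: "x \<bullet> x = 1" "y \<bullet> y = 1"
      using zz unfolding z by (auto simp: norm_eq_1)
    have e: "\<gamma> s * of_real (x $ i) = \<gamma> t * of_real (y $ i)" for i
      using eq unfolding z centered_family_def by (simp add: vec_eq_iff real_vec_def)
    let ?a = "\<gamma> s \<bullet> \<gamma> s0" and ?b = "\<gamma> t \<bullet> \<gamma> s0"
    have ei: "?a * x $ i = ?b * y $ i" for i
    proof -
      have "(x $ i *\<^sub>R \<gamma> s) \<bullet> \<gamma> s0 = (y $ i *\<^sub>R \<gamma> t) \<bullet> \<gamma> s0"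
        using e[of i] by (simp add: scaleR_conv_of_real[where 'a=complex] mult.commute)
      then show ?thesis by (simp add: mult.commute)
    qed
    then have ev: "?a *\<^sub>R x = ?b *\<^sub>R y" by (simp add: vec_eq_iff)
    have "norm (?a *\<^sub>R x) = norm (?b *\<^sub>R y)" using ev by simp
    then have ab: "?a = ?b" using pos(1)[OF s(1)] pos(1)[OF s(2)] x by (simp add: norm_eq_1[THEN iffD2])
    then have xy: "x = y" using ev pos(1)[OF s(2)] by simp
    obtain i where i: "x $ i \<noteq> 0" using x(1) by (metis inner_zero_left vec_eq_iff zero_index zero_neq_one)
    then have "\<gamma> s = \<gamma> t" using e[of i] xy by simp
    then show "z = z'" using inj\<gamma>[OF s] xy z by simp
  qed
qed

text \<open>Injectivity on the compact closed cylinder makes the family a homeomorphism onto its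
  image; openness survives the restriction to the open parameter interval.\<close>

lemma centered_family_open_map:
  fixes \<gamma> :: "real \<Rightarrow> complex"
  assumes \<gamma>: "continuous_on (cball s0 \<epsilon>) \<gamma>"
    and inj: "inj_on (centered_family \<gamma> :: real \<times> (real^'n) \<Rightarrow> complex^'n) (cball s0 \<epsilon> \<times> sphere 0 1)"
    and S: "openin (top_of_set (sphere 0 1)) S"
  shows "openin (top_of_set ((centered_family \<gamma> :: real \<times> (real^'n) \<Rightarrow> complex^'n) ` (ball s0 \<epsilon> \<times> sphere 0 1)))
    (centered_family \<gamma> ` (ball s0 \<epsilon> \<times> S))"
proof -
  let ?\<Phi> = "centered_family \<gamma> :: real \<times> (real^'n) \<Rightarrow> complex^'n"
  let ?A = "cball s0 \<epsilon> \<times> (sphere 0 1 :: (real^'n) set)"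
  have "continuous_on ?A (\<lambda>z. \<gamma> (fst z))"
    by (rule continuous_on_compose2[OF \<gamma> continuous_on_fst]) (auto intro: continuous_on_id)
  then have "continuous_on ?A (\<lambda>z. uembed (mat 1 :: complex^'n^'n) (\<gamma> (fst z)) (snd z))"
    by (intro bounded_bilinear.continuous_on[OF bounded_bilinear_uembed[OF unitary_mat_1]])
      (auto intro: continuous_on_snd continuous_on_id)
  then have cont: "continuous_on ?A ?\<Phi>" by (simp add: centered_family_uembed case_prod_beta)
  have "compact ?A" by (intro compact_Times compact_cball compact_sphere)
  then obtain g where g: "homeomorphism ?A (?\<Phi> ` ?A) ?\<Phi> g"
    using homeomorphism_compact[OF _ cont refl inj] by blast
  have "openin (top_of_set ?A) (ball s0 \<epsilon> \<times> S)"
    by (rule openin_Times[OF open_subset[OF ball_subset_cball open_ball] S])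
  then have "openin (top_of_set (?\<Phi> ` ?A)) (?\<Phi> ` (ball s0 \<epsilon> \<times> S))"
    by (rule homeomorphism_imp_open_map[OF g])
  then show ?thesis
  proof (rule openin_subset_trans)
    show "?\<Phi> ` (ball s0 \<epsilon> \<times> S) \<subseteq> ?\<Phi> ` (ball s0 \<epsilon> \<times> sphere 0 1)"
      by (intro image_mono Sigma_mono order_refl openin_imp_subset[OF S])
    show "?\<Phi> ` (ball s0 \<epsilon> \<times> sphere 0 1) \<subseteq> ?\<Phi> ` ?A"
      by (intro image_mono Sigma_mono order_refl ball_subset_cball)
  qed
qed

text \<open>A centered submanifold has to be open in the family over the whole sphere, whereas a
  piece is open in \<open>M\<close>. On a short parameter interval the piece is open in both, so the
  two sets coincide inside a common neighbourhood.\<close>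

lemma sphere_piece_locally_centered:
  fixes M C :: "(complex^'n) set"
  assumes C: "openin (top_of_set M) C" and U: "unitary_matrix U"
    and box: "\<And>p. p \<in> C \<Longrightarrow> \<exists>K \<gamma> S. sphere_piece M U c K \<gamma> S \<and> p \<in> piece_image U c \<gamma> K S"
  shows "centered C"
proof -
  let ?U = "adjoint_matrix U"
  define T where "T z = ?U *v z + - (?U *v c)" for z
  define T' where "T' z = U *v z + c" for z
  have inv: "?U *v (U *v v) = v" "U *v (?U *v v) = v" for v
    using U unfolding matrix_vector_mul_assoc unitary_matrix_adjoint by simp_all
  have TT: "T (T' z) = z" "T' (T z) = z" for z
    by (simp_all add: T_def T'_def inv matrix_vector_right_distrib matrix_vector_mult_diff_distrib)
  have linv: "linear ((*v) A)" for A :: "complex^'n^'n"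
    by (rule linearI, rule matrix_vector_right_distrib)
      (simp add: vec_eq_iff matrix_vector_mult_def scaleR_sum_right)
  have contT: "continuous_on X T" "continuous_on X T'" for X
    unfolding T_def T'_def using linear_continuous_on[OF linv[unfolded linear_conv_bounded_linear]]
    by (intro continuous_on_add continuous_on_const; blast)+
  have hom: "homeomorphism M (T ` M) T T'"
    by (rule homeomorphismI) (auto simp: contT TT)
  have Tu: "T (uembed U g x + c) = g *s real_vec x" for g x
    by (simp add: T_def uembed_def matrix_vector_right_distrib vector_scalar_commute[symmetric] inv)
  have "locally_centered_at_origin (T ` C)"
    unfolding locally_centered_at_origin_def
  proof
    fix q assume "q \<in> T ` C"
    then obtain p where p: "p \<in> C" "q = T p" by blast
    obtain K \<gamma> S where cb: "sphere_piece M U c K \<gamma> S" and pb: "p \<in> piece_image U c \<gamma> K S" using box[OF p(1)] by blast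
    note D = sphere_pieceD[OF cb]
    obtain s0 x0 where s0: "s0 \<in> K" "x0 \<in> S" "p = uembed U (\<gamma> s0) x0 + c"
      using pb by (auto simp: piece_image_def)
    let ?\<Phi> = "centered_family \<gamma> :: real \<times> (real^'n) \<Rightarrow> complex^'n"
    obtain \<epsilon> where \<epsilon>: "\<epsilon> > 0" "cball s0 \<epsilon> \<subseteq> K" "inj_on ?\<Phi> (cball s0 \<epsilon> \<times> sphere 0 1)"
      by (rule centered_family_injective_near[OF D(2,4) s0(1) D(5)[OF s0(1)] D(6)[OF s0(1)]])
    let ?K = "ball s0 \<epsilon>"
    have KK: "?K \<subseteq> K" using \<epsilon>(2) ball_subset_cball by blast
    let ?N = "?\<Phi> ` (?K \<times> S)" and ?E = "?\<Phi> ` (?K \<times> sphere 0 1)"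
    have N_eq: "?N = T ` piece_image U c \<gamma> ?K S"
      unfolding piece_image_def image_image case_prod_beta Tu centered_family_def ..
    have "openin (top_of_set (T ` M)) ?N"
      unfolding N_eq by (rule homeomorphism_imp_open_map[OF hom D(8)[OF open_ball KK D(7) order_refl]])
    then obtain W2 where W2: "open W2" "?N = T ` M \<inter> W2" unfolding openin_open by blast
    have "openin (top_of_set ?E) ?N"
      by (rule centered_family_open_map[OF continuous_on_subset[OF smooth_on_continuous_on[OF D(4)] \<epsilon>(2)] \<epsilon>(3) D(7)])
    then obtain W1 where W1: "open W1" "?N = ?E \<inter> W1" unfolding openin_open by blast
    have "openin (top_of_set (T ` M)) (T ` C)"
      by (rule homeomorphism_imp_open_map[OF hom C])
    then obtain W3 where W3: "open W3" "T ` C = T ` M \<inter> W3" unfolding openin_open by blast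
    define W where "W = W1 \<inter> W2 \<inter> W3"
    have W: "open W" unfolding W_def by (intro open_Int W1 W2 W3)
    have EW: "T ` C \<inter> W = ?E \<inter> W"
    proof -
      have "T ` C \<inter> W = (T ` M \<inter> W2) \<inter> W" unfolding W3(2) W_def by blast
      also have "\<dots> = (?E \<inter> W1) \<inter> W" unfolding W2(2)[symmetric] W1(2)[symmetric] ..
      finally show ?thesis unfolding W_def by blast
    qed
    have "q = ?\<Phi> (s0, x0)" unfolding p(2) s0(3) Tu by (simp add: centered_family_def)
    moreover have "(s0, x0) \<in> ?K \<times> S" using s0(2) \<epsilon>(1) by simp
    ultimately have qN: "q \<in> ?N" by (rule image_eqI)
    have "q \<in> W1" by (rule IntD2[OF qN[unfolded W1(2)]])
    moreover have "q \<in> W2" by (rule IntD2[OF qN[unfolded W2(2)]])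
    moreover have "q \<in> W3" using \<open>q \<in> T ` C\<close> unfolding W3(2) by (rule IntD2)
    ultimately have "q \<in> W" unfolding W_def by blast
    moreover have "openin (top_of_set ?E) (T ` C \<inter> W)"
      unfolding EW by (rule openin_open_Int[OF W])
    moreover have "smooth_on ?K \<gamma>" by (rule smooth_on_subset[OF D(4) KK])
    moreover have "immersion_on_cylinder ?K ?\<Phi>"
      by (rule immersion_centered_family[OF smooth_on_subset[OF D(4) KK]]) (use D(5,6) KK in blast)+
    moreover have "is_interval ?K" by (simp add: is_interval_ball_real)
    moreover have "\<forall>s\<in>?K. \<gamma> s \<noteq> 0" using D(5) KK by blast
    ultimately show "\<exists>I \<gamma> W. open I \<and> is_interval I \<and> smooth_on I \<gamma> \<and> (\<forall>s\<in>I. \<gamma> s \<noteq> 0) \<and>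
        immersion_on_cylinder I (centered_family \<gamma> :: real \<times> (real^'n) \<Rightarrow> complex^'n) \<and>
        open W \<and> q \<in> W \<and> openin (top_of_set (centered_family \<gamma> ` (I \<times> sphere 0 1))) (T ` C \<inter> W)"
      by (intro exI[of _ ?K] exI[of _ \<gamma>] exI[of _ W] conjI open_ball W)
  qed
  then show ?thesis
    unfolding centered_def T_def using unitary_adjoint_matrix[OF U] by blast
qed

theorem theorem3:
  fixes M :: "(complex^'n) set"
  assumes "CARD('n) \<ge> 3"
    and "lagrangian M"
    and "hamiltonian_stationary M"
    and "foliated_by_round_spheres M"
  shows "\<forall>C\<in>components M. centered C"
proof
  fix C assume C: "C \<in> components M"
  have n2: "CARD('n) \<ge> 2" using assms(1) by simp
  have CM: "C \<subseteq> M" and conn: "connected C" and ne: "C \<noteq> {}"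
    using C in_components_subset in_components_connected in_components_nonempty by blast+
  have op: "openin (top_of_set M) C"
    using assms(2) component_openin[OF _ C] unfolding lagrangian_def by blast
  have opC: "openin (top_of_set C) (N \<inter> C)" if "openin (top_of_set M) N" for N
    by (rule openin_subset_trans[OF openin_Int[OF that op] _ CM]) simp
  have sphere_piece_openin: "openin (top_of_set M) (piece_image U c \<gamma> K S)" if "sphere_piece M U c K \<gamma> S" for U c K \<gamma> S
    by (rule sphere_pieceD(8)[OF that sphere_pieceD(2)[OF that] order_refl sphere_pieceD(7)[OF that] order_refl])
  have alt: "(\<exists>U c K \<gamma> S. sphere_piece M U c K \<gamma> S \<and> p \<in> piece_image U c \<gamma> K S) \<or> (\<exists>P N. flat_piece M P N \<and> p \<in> N)"
    if "p \<in> C" for p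
    using box_alternative[OF assms] that CM by blast
  define boxed where "boxed U c p \<longleftrightarrow> (\<exists>K \<gamma> S. sphere_piece M U c K \<gamma> S \<and> p \<in> piece_image U c \<gamma> K S)" for U c p
  define flat where "flat P p \<longleftrightarrow> (\<exists>N. flat_piece M P N \<and> p \<in> N)" for P p
  have boxedI: "boxed U c p" if "sphere_piece M U c K \<gamma> S" "p \<in> piece_image U c \<gamma> K S" for U c K \<gamma> S p
    unfolding boxed_def by (intro exI conjI, rule that(1), rule that(2))
  have alt': "(\<exists>U c. boxed U c p) \<or> (\<exists>P. flat P p)" if "p \<in> C" for p
    using alt[OF that] unfolding boxed_def flat_def by blast
  show "centered C"
  proof (cases "\<exists>U c. \<exists>p\<in>C. boxed U c p")
    case True
    then obtain U c p where p: "p \<in> C" "boxed U c p" by blast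
    \<comment> \<open>On an overlap the neighbouring piece takes over \<open>U\<close> and
      \<open>c\<close>. Around a flat point nothing is \<open>boxed\<close>, so there the
      implication is vacuous.\<close>
    have step: "\<exists>T. openin (top_of_set C) T \<and> a \<in> T \<and> (\<forall>x\<in>T. \<forall>y\<in>T. boxed U c x \<longrightarrow> boxed U c y)"
      if a: "a \<in> C" for a
      using alt[OF a]
    proof
      assume "\<exists>U c K \<gamma> S. sphere_piece M U c K \<gamma> S \<and> a \<in> piece_image U c \<gamma> K S"
      then obtain U1 c1 K1 \<gamma>1 S1 where cb1: "sphere_piece M U1 c1 K1 \<gamma>1 S1" and a1: "a \<in> piece_image U1 c1 \<gamma>1 K1 S1"
        by (elim exE conjE)
      have "boxed U c y" if x: "x \<in> piece_image U1 c1 \<gamma>1 K1 S1 \<inter> C" and y: "y \<in> piece_image U1 c1 \<gamma>1 K1 S1 \<inter> C" and bx: "boxed U c x" for x y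
      proof -
        from bx obtain K \<gamma> S where cb: "sphere_piece M U c K \<gamma> S" and xb: "x \<in> piece_image U c \<gamma> K S"
          unfolding boxed_def by (elim exE conjE)
        from sphere_piece_overlap[OF n2 cb1 cb IntD1[OF x] xb] obtain \<gamma>2 S2
          where "sphere_piece M U c K1 \<gamma>2 S2" "piece_image U c \<gamma>2 K1 S2 = piece_image U1 c1 \<gamma>1 K1 S1"
          by (elim exE conjE)
        then show ?thesis using IntD1[OF y] boxedI by metis
      qed
      then show ?thesis
        by (intro exI[of _ "piece_image U1 c1 \<gamma>1 K1 S1 \<inter> C"] conjI opC sphere_piece_openin[OF cb1] IntI a1 a) blast
    next
      assume "\<exists>P N. flat_piece M P N \<and> a \<in> N"
      then obtain P N where N: "flat_piece M P N" "a \<in> N" by blast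
      have "\<not> boxed U c x" if "x \<in> N" for x
      proof
        assume "boxed U c x"
        then obtain K \<gamma> S where cb: "sphere_piece M U c K \<gamma> S" and xb: "x \<in> piece_image U c \<gamma> K S"
          unfolding boxed_def by (elim exE conjE)
        then show False using sphere_piece_flat_disjoint[OF n2 cb N(1)] that by blast
      qed
      moreover have "openin (top_of_set M) N" using N(1) unfolding flat_piece_def by blast
      ultimately show ?thesis
        by (intro exI[of _ "N \<inter> C"] conjI opC IntI a N(2)) blast+
    qed
    have all: "boxed U c q" if "q \<in> C" for q
      by (rule connected_induction_simple[OF conn p(1) that p(2) step])
    have "unitary_matrix U"
      using p(2) sphere_pieceD(1) unfolding boxed_def by (elim exE conjE) (rule sphere_pieceD(1))
    then show ?thesis
      by (rule sphere_piece_locally_centered[OF op]) (use all in \<open>simp add: boxed_def\<close>)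
  next
    case False
    \<comment> \<open>No point of \<open>C\<close> lies in a sphere piece, so the flat alternative
      holds throughout and only the uniqueness of the plane is propagated.\<close>
    then have fl: "\<exists>P. flat P p" if "p \<in> C" for p
      using alt'[OF that] that by blast
    obtain p where p: "p \<in> C" using ne by blast
    then obtain P where P: "flat P p" using fl by blast
    have step: "\<exists>T. openin (top_of_set C) T \<and> a \<in> T \<and> (\<forall>x\<in>T. \<forall>y\<in>T. flat P x \<longrightarrow> flat P y)" if a: "a \<in> C" for a
    proof -
      obtain P' N where N: "flat_piece M P' N" "a \<in> N" using fl[OF a] unfolding flat_def by blast
      have "flat P y" if "x \<in> N" "y \<in> N" "flat P x" for x y
        using that flat_pieces_same_plane[OF N(1)] N(1) unfolding flat_def by metis
      moreover have "openin (top_of_set M) N" using N(1) unfolding flat_piece_def by blast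
      ultimately show ?thesis
        by (intro exI[of _ "N \<inter> C"] conjI opC IntI a N(2)) blast+
    qed
    have all: "flat P q" if "q \<in> C" for q
      by (rule connected_induction_simple[OF conn p that P step])
    have "openin (top_of_set P) C"
    proof (subst openin_subopen, intro ballI)
      fix q assume q: "q \<in> C"
      then obtain N where N: "flat_piece M P N" "q \<in> N" using all unfolding flat_def by blast
      show "\<exists>T. openin (top_of_set P) T \<and> q \<in> T \<and> T \<subseteq> C"
        using flat_piece_Int[OF N(1) op] N(2) q by blast
    qed
    moreover have "affine_lagrangian_plane P"
      using P unfolding flat_def flat_piece_def by blast
    ultimately show ?thesis unfolding centered_def by blast
  qed
qed

end
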